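(* Let $(X,d,m,\mathcal{E},\mathcal{F})$ be an MMD space that satisfies the heat kernel estimate $\operatorname{HKE}(\Psi)$ for some scale function $\Psi$, and let $m$ be a doubling measure. Let $U$ be a uniform domain in $(X,d)$, let $V=(U^c)^\circ$, and let $E_Q$ be the Whitney extension map described in the context. Then: (a) There exist $c_0\in(0,1)$ and $K_0,C_1\in(1,\infty)$ such that for any $\xi\in\partial U$ and $0<r<c_0\operatorname{diam}(U)$, $$\inf_{\alpha\in\mathbb{R}}\int_{B(\xi,r)}|E_Qf-\alpha|^2\,dm\le C_1\Psi(r)\int_{B(\xi,K_0r)\cap U}d\Gamma_U(f,f)\quad\text{for any } f\in\mathcal{F}(U).$$ (b) For any $f\in L^2(U)$ we have $E_Q(f)\in\mathcal{F}_{\mathrm{loc}}(V)$. There exist $c_1\in(0,1)$ and $C_1,C_2,K_1\in(1,\infty)$ such that for all $f\in\mathcal{F}(U)$, $\xi\in\partial U$, $0<r<c_1\operatorname{diam}(U)$, $$\Gamma(E_Q(f),E_Q(f))(B_V(\xi,r))\le C_1\Gamma_U(f,f)(B_U(\xi,K_1r)),$$ and $$\Gamma(E_Q(f),E_Q(f))(V)\le C_2\left(\mathcal{E}_U(f,f)+\frac1{\Psi(\operatorname{diam}(U))}\int_Uf^2\,dm\right),$$ where by convention $\frac1{\Psi(\operatorname{diam}(U))}=0$ if $\operatorname{diam}(U)=\infty$. (c) There exists $C_3\in(1,\infty)$ such that for any $f\in\mathcal{F}(U)$ we have $E_Q(f)\in\mathcal{F}$ and $$\mathcal{E}(E_Q(f),E_Q(f))\le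 C_3\left(\mathcal{E}_U(f,f)+\frac1{\Psi(\operatorname{diam}(U))}\int_Uf^2\,dm\right).$$ (d) For all $f\in\mathcal{F}(U)$, $\Gamma(E_Q(f),E_Q(f))(\partial U)=0$. (e) There exist $C_4,K_2\in(1,\infty)$ and $c_2\in(0,1)$ such that for all $f\in\mathcal{F}(U)$, $x\in\overline U$ and $0<r<c_2\operatorname{diam}(U)$, $$\Gamma(E_Q(f),E_Q(f))(B(x,r))\le C_4\Gamma_U(f,f)(B_U(x,K_2r)).$$
   Context: A metric measure space $(X,d,m)$ is a metric space in which every open ball $B(x,r)$ ($x\in X$, $r>0$) is relatively compact, together with a Radon measure $m$ of full support. An MMD space $(X,d,m,\mathcal{E},\mathcal{F})$ is a metric measure space with a strongly local regular symmetric Dirichlet form on $L^2(X,m)$ (strongly local: $\mathcal{E}(f,g)=0$ whenever $f,g\in\mathcal{F}$ have compact $m$-supports and $\operatorname{supp}_m[f-a\mathbf 1_X]\cap\operatorname{supp}_m[g]=\emptyset$ for some $a\in\mathbb{R}$). Notation: $B_W(x,r)=W\cap B(x,r)$ for $W\subset X$; balls are understood with their given center and radius, $\lambda B$ denotes the ball with the same center and $\lambda$ times the radius ($\lambda B_W(x,r)=B_W(x,\lambda r)$), $r(B)$ is the radius of $B$; $\fint_S f\,dm=m(S)^{-1}\int_Sf\,dm$. Doubling: there is $D_0\ge1$ with $m(B(x,2r))\le D_0m(B(x,r))$ for all $x\in X,r>0$. Energy measure: for $f\in\mathcal{F}\cap L^\infty$, $\Gamma(f,f)$ is the unique Borel measure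 with $\int g\,d\Gamma(f,f)=\mathcal{E}(f,fg)-\frac12\mathcal{E}(f^2,g)$ for all $g\in\mathcal{F}\cap C_c(X)$; for $f\in\mathcal{F}$, $\Gamma(f,f)(A)=\lim_n\Gamma(f_n,f_n)(A)$, $f_n=(-n)\vee(f\wedge n)$. For open $W\subset X$, $\mathcal{F}_{\mathrm{loc}}(W)$ is the set of $m$-classes of Borel $f:W\to\mathbb{R}$ such that for each relatively compact open subset $O$ of $W$ there is $f^\#\in\mathcal{F}$ with $f=f^\#$ $m$-a.e. on $O$; its energy measure $\Gamma_W(f,f)$ is the unique Borel measure on $W$ with $\Gamma_W(f,f)(A)=\Gamma(f^\#,f^\#)(A)$ for relatively compact Borel $A\subset W$ and such $O\supset A$, $f^\#$. In (b), $\Gamma(E_Q(f),E_Q(f))$ denotes the energy measure on $V$ of $E_Q(f)\in\mathcal{F}_{\mathrm{loc}}(V)$. $\mathcal{F}(U)=\{f\in\mathcal{F}_{\mathrm{loc}}(U):\int_Uf^2dm+\Gamma_U(f,f)(U)<\infty\}$, $\mathcal{E}_U(f,f)=\Gamma_U(f,f)(U)$. Uniform domain: $\delta_W(z)=\inf\{d(z,y):y\in X\setminus W\}$ for open $W\subsetneq X$. For $A\ge1$, a connected non-empty proper open $U\subsetneq X$ is $A$-uniform if all $x,y\in U$ can be joined by a curve $\gamma$ in $U$ with $\operatorname{diam}(\gamma)\le A\,d(x,y)$ and $\delta_U(z)\ge A^{-1}\min(d(x,z),d(y,z))$ for all $z\in\gamma$. Uniform: $A$-uniform for some $A\ge1$;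 fix such an $A$ for $U$. Scale function: continuous increasing bijection $\Psi:(0,\infty)\to(0,\infty)$ with $C^{-1}(R/r)^{\beta_1}\le\Psi(R)/\Psi(r)\le C(R/r)^{\beta_2}$ for $0<r\le R$, some $1<\beta_1<\beta_2$, $C>1$. $\Phi(s)=\sup_{r>0}(s/r-1/\Psi(r))$. $\operatorname{HKE}(\Psi)$: there are positive constants $C_1,c_1,c_2,c_3,\delta$ and a heat kernel $p_t$ (non-negative Borel integral kernel of the semigroup $P_t$ of $(\mathcal{E},\mathcal{F})$) such that for all $t>0$, $p_t(x,y)\le\frac{C_1}{m(B(x,\Psi^{-1}(t)))}\exp(-c_1t\Phi(c_2d(x,y)/t))$ for $m$-a.e. $x,y$, and $p_t(x,y)\ge\frac{c_3}{m(B(x,\Psi^{-1}(t)))}$ for $m$-a.e. $x,y$ with $d(x,y)\le\delta\Psi^{-1}(t)$. $\operatorname{PI}(\Psi)$ (a known consequence of doubling and $\operatorname{HKE}(\Psi)$): there are $C_P,A_P\ge1$ with $\int_{B(x,r)}(f-f_{B(x,r)})^2dm\le C_P\Psi(r)\int_{B(x,A_Pr)}d\Gamma(f,f)$ for all $x\in X$, $r>0$, $f\in\mathcal{F}_{\mathrm{loc}}(B(x,A_Pr))$, where $f_{B}=\fint_Bf\,dm$. An $\epsilon$-Whitney cover ($0<\epsilon<1/2$) of open $W\subsetneq X$ is a collection of pairwise disjoint balls $B_W(x_i,r_i)$, $x_i\in W$, $r_i=\frac{\epsilon}{1+\epsilon}\delta_W(x_i)$, with $\bigcup_iB_W(x_i,2(1+\epsilon)r_i)=W$.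 The map $E_Q$: Let $\epsilon>0$ with $27A_P\epsilon<1$, where $A_P$ is a constant for which $\operatorname{PI}(\Psi)$ holds. Let $\mathfrak{R},\mathfrak{S}$ be $\epsilon$-Whitney covers of $U$ and of $V=(U^c)^\circ=(\overline U)^c$, and $\widetilde{\mathfrak S}=\{B_V(y,s)\in\mathfrak{S}:s<\frac{\epsilon}{6A(1+\epsilon)}\operatorname{diam}(U)\}$. Let $Q:\widetilde{\mathfrak S}\to\mathfrak{R}$ be a map such that: (1) if $Q(B_V(y,s))=B_U(x,r)$ then $\frac{1+\epsilon}{1+4\epsilon}s<r<\frac{1+\epsilon}{1-2\epsilon}s$ and $d(x,y)\le(2+\frac{3A}2)\frac{1+\epsilon}{\epsilon}s$; (2) $\sup_{B\in\mathfrak R}\#Q^{-1}(B)<\infty$; (3) there is $N_0$ such that if $B_V(y_i,s_i)\in\widetilde{\mathfrak S}$ ($i=1,2$) satisfy $B_V(y_1,6s_1)\cap B_V(y_2,6s_2)\ne\emptyset$, then the radii $r_i$ of $Q(B_V(y_i,s_i))$ satisfy $\frac{(1-2\epsilon)(1-5\epsilon)}{(1+4\epsilon)(1+7\epsilon)}r_2\le r_1\le\frac{(1+4\epsilon)(1+7\epsilon)}{(1-2\epsilon)(1-5\epsilon)}r_2$ and there is a chain of at most $N_0$ distinct balls of $\mathfrak R$ from $Q(B_V(y_1,s_1))$ to $Q(B_V(y_2,s_2))$ such that consecutive balls $D,D'$ satisfy $3D\cap3D'\ne\emptyset$. Let $\{\psi_B:B\in\mathfrak S\}\subset C_c(X)\cap\mathcal{F}$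 be a partition of unity with $0\le\psi_B\le1$, $\sum_B\psi_B=\mathbf 1_V$, and, for some constants $c,C>0$ and each $B=B_V(y,s)\in\mathfrak{S}$: $\psi_B\ge c$ on $B_V(y,3s)$, $\psi_B=0$ off $B_V(y,6s)$, and $\mathcal{E}(\psi_B,\psi_B)\le C\,m(B(y,s))/\Psi(s)$. For $f\in L^2(U,m)$ define $E_Q(f)(x)=f(x)$ for $x\in U$ and $E_Q(f)(x)=\sum_{B\in\widetilde{\mathfrak S}}\psi_B(x)\fint_{3Q(B)}f\,dm$ for $x\notin U$ (the sum is $0$ if $V=\emptyset$). *)

theory Defs
  imports "HOL-Analysis.Analysis"
begin

text \<open>
  The space $X$ is the type \<open>'a::metric_space\<close>. Elements of $L^2(X,m)$ and of the form domain are
  represented by Borel functions on \<open>'a\<close>; the form domain is required to be closed under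
  $m$-a.e. equality and the form to be invariant under it. A function on an open set $W$ is
  represented by a total function of which only the values on $W$ matter; a measure on $W$ is a
  measure whose \<open>space\<close> is $W$.
\<close>

section \<open>Metric measure spaces\<close>

definition radon_measure :: "'a::metric_space measure \<Rightarrow> bool" where
  "radon_measure m \<longleftrightarrow>
     sets m = sets borel \<and>
     (\<forall>K. compact K \<longrightarrow> emeasure m K < \<infinity>) \<and>
     (\<forall>B\<in>sets borel. emeasure m B = (SUP K\<in>{K. compact K \<and> K \<subseteq> B}. emeasure m K))"

definition metric_measure_space :: "'a::metric_space measure \<Rightarrow> bool" where
  "metric_measure_space m \<longleftrightarrow>
     (\<forall>(x::'a) r. r > 0 \<longrightarrow> compact (closure (ball x r))) \<and>
     radon_measure m \<and>
     (\<forall>O'. open O' \<and> O' \<noteq> {} \<longrightarrow> emeasure m O' > 0)"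

definition doubling_measure :: "'a::metric_space measure \<Rightarrow> bool" where
  "doubling_measure m \<longleftrightarrow>
     (\<exists>D\<ge>1. \<forall>x r. r > 0 \<longrightarrow> emeasure m (ball x (2 * r)) \<le> ennreal D * emeasure m (ball x r))"

definition set_average :: "'a measure \<Rightarrow> 'a set \<Rightarrow> ('a \<Rightarrow> real) \<Rightarrow> real" where
  "set_average m S f = (LINT x:S|m. f x) / measure m S"

section \<open>Dirichlet forms\<close>

definition L2_on :: "'a::metric_space measure \<Rightarrow> 'a set \<Rightarrow> ('a \<Rightarrow> real) set" where
  "L2_on m W = {f \<in> borel_measurable (restrict_space borel W).
                  (\<integral>\<^sup>+x\<in>W. ennreal ((f x)\<^sup>2) \<partial>m) < \<infinity>}"

definition L2_normsq :: "'a measure \<Rightarrow> ('a \<Rightarrow> real) \<Rightarrow> real" where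
  "L2_normsq m f = (\<integral>x. (f x)\<^sup>2 \<partial>m)"

definition ess_bounded :: "'a measure \<Rightarrow> ('a \<Rightarrow> real) \<Rightarrow> bool" where
  "ess_bounded m f \<longleftrightarrow> (\<exists>C. AE x in m. \<bar>f x\<bar> \<le> C)"

definition Cc :: "('a::topological_space \<Rightarrow> real) set" where
  "Cc = {f. continuous_on UNIV f \<and> compact (closure {x. f x \<noteq> 0})}"

definition msupp :: "'a::topological_space measure \<Rightarrow> ('a \<Rightarrow> real) \<Rightarrow> 'a set" where
  "msupp m f = \<Inter>{C. closed C \<and> (AE x in m. x \<notin> C \<longrightarrow> f x = 0)}"

definition E1 :: "'a measure \<Rightarrow> (('a \<Rightarrow> real) \<Rightarrow> ('a \<Rightarrow> real) \<Rightarrow> real) \<Rightarrow> ('a \<Rightarrow> real) \<Rightarrow> real" where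
  "E1 m \<E> f = \<E> f f + L2_normsq m f"

definition symmetric_form ::
  "'a::metric_space measure \<Rightarrow> (('a \<Rightarrow> real) \<Rightarrow> ('a \<Rightarrow> real) \<Rightarrow> real) \<Rightarrow> ('a \<Rightarrow> real) set \<Rightarrow> bool" where
  "symmetric_form m \<E> \<F> \<longleftrightarrow>
     \<F> \<subseteq> L2_on m UNIV \<and>
     (\<lambda>_. 0) \<in> \<F> \<and>
     (\<forall>f\<in>\<F>. \<forall>g\<in>\<F>. (\<lambda>x. f x + g x) \<in> \<F>) \<and>
     (\<forall>f\<in>\<F>. \<forall>a. (\<lambda>x. a * f x) \<in> \<F>) \<and>
     (\<forall>f\<in>\<F>. \<forall>g\<in>borel_measurable borel. (AE x in m. f x = g x) \<longrightarrow>
         g \<in> \<F> \<and> (\<forall>h\<in>\<F>. \<E> f h = \<E> g h)) \<and>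
     (\<forall>f\<in>L2_on m UNIV. \<forall>e>0. \<exists>g\<in>\<F>. L2_normsq m (\<lambda>x. f x - g x) < e) \<and>
     (\<forall>f\<in>\<F>. \<forall>g\<in>\<F>. \<forall>h\<in>\<F>. \<E> (\<lambda>x. f x + g x) h = \<E> f h + \<E> g h) \<and>
     (\<forall>f\<in>\<F>. \<forall>h\<in>\<F>. \<forall>a. \<E> (\<lambda>x. a * f x) h = a * \<E> f h) \<and>
     (\<forall>f\<in>\<F>. \<forall>g\<in>\<F>. \<E> f g = \<E> g f) \<and>
     (\<forall>f\<in>\<F>. \<E> f f \<ge> 0)"

definition closed_form ::
  "'a::metric_space measure \<Rightarrow> (('a \<Rightarrow> real) \<Rightarrow> ('a \<Rightarrow> real) \<Rightarrow> real) \<Rightarrow> ('a \<Rightarrow> real) set \<Rightarrow> bool" where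
  "closed_form m \<E> \<F> \<longleftrightarrow>
     (\<forall>u::nat \<Rightarrow> 'a \<Rightarrow> real.
        (\<forall>n. u n \<in> \<F>) \<and>
        (\<forall>e>0. \<exists>N. \<forall>i\<ge>N. \<forall>j\<ge>N. E1 m \<E> (\<lambda>x. u i x - u j x) < e) \<longrightarrow>
        (\<exists>f\<in>\<F>. (\<lambda>n. E1 m \<E> (\<lambda>x. u n x - f x)) \<longlonglongrightarrow> 0))"

definition markovian_form ::
  "(('a \<Rightarrow> real) \<Rightarrow> ('a \<Rightarrow> real) \<Rightarrow> real) \<Rightarrow> ('a \<Rightarrow> real) set \<Rightarrow> bool" where
  "markovian_form \<E> \<F> \<longleftrightarrow>
     (\<forall>f\<in>\<F>. (\<lambda>x. max 0 (min (f x) 1)) \<in> \<F> \<and>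
        \<E> (\<lambda>x. max 0 (min (f x) 1)) (\<lambda>x. max 0 (min (f x) 1)) \<le> \<E> f f)"

definition dirichlet_form ::
  "'a::metric_space measure \<Rightarrow> (('a \<Rightarrow> real) \<Rightarrow> ('a \<Rightarrow> real) \<Rightarrow> real) \<Rightarrow> ('a \<Rightarrow> real) set \<Rightarrow> bool" where
  "dirichlet_form m \<E> \<F> \<longleftrightarrow>
     symmetric_form m \<E> \<F> \<and> closed_form m \<E> \<F> \<and> markovian_form \<E> \<F>"

definition regular_form ::
  "'a::metric_space measure \<Rightarrow> (('a \<Rightarrow> real) \<Rightarrow> ('a \<Rightarrow> real) \<Rightarrow> real) \<Rightarrow> ('a \<Rightarrow> real) set \<Rightarrow> bool" where
  "regular_form m \<E> \<F> \<longleftrightarrow>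
     (\<forall>f\<in>\<F>. \<forall>e>0. \<exists>g\<in>\<F> \<inter> Cc. E1 m \<E> (\<lambda>x. f x - g x) < e) \<and>
     (\<forall>f\<in>Cc. \<forall>e>0. \<exists>g\<in>\<F> \<inter> Cc. \<forall>x. \<bar>f x - g x\<bar> < e)"

definition strongly_local_form ::
  "'a::metric_space measure \<Rightarrow> (('a \<Rightarrow> real) \<Rightarrow> ('a \<Rightarrow> real) \<Rightarrow> real) \<Rightarrow> ('a \<Rightarrow> real) set \<Rightarrow> bool" where
  "strongly_local_form m \<E> \<F> \<longleftrightarrow>
     (\<forall>f\<in>\<F>. \<forall>g\<in>\<F>. compact (msupp m f) \<and> compact (msupp m g) \<and>
        (\<exists>a::real. msupp m (\<lambda>x. f x - a) \<inter> msupp m g = {}) \<longrightarrow> \<E> f g = 0)"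

definition MMD_space ::
  "'a::metric_space measure \<Rightarrow> (('a \<Rightarrow> real) \<Rightarrow> ('a \<Rightarrow> real) \<Rightarrow> real) \<Rightarrow> ('a \<Rightarrow> real) set \<Rightarrow> bool" where
  "MMD_space m \<E> \<F> \<longleftrightarrow>
     metric_measure_space m \<and> dirichlet_form m \<E> \<F> \<and> regular_form m \<E> \<F> \<and>
     strongly_local_form m \<E> \<F>"

section \<open>Energy measures and local domains\<close>

text \<open>
  The integrability requirement makes the measure finite on compact sets, since by regularity
  every compact set carries a function in $\mathcal{F} \cap C_c(X)$ that is at least 1 on it; hence
  the defining property has at most one solution.
\<close>

definition energy_measure_bdd ::
  "(('a::metric_space \<Rightarrow> real) \<Rightarrow> ('a \<Rightarrow> real) \<Rightarrow> real) \<Rightarrow> ('a \<Rightarrow> real) set \<Rightarrow>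
   ('a \<Rightarrow> real) \<Rightarrow> 'a measure" where
  "energy_measure_bdd \<E> \<F> f =
     (THE \<mu>. sets \<mu> = sets borel \<and>
        (\<forall>g\<in>\<F> \<inter> Cc. integrable \<mu> g \<and>
           (\<integral>x. g x \<partial>\<mu>) = \<E> f (\<lambda>x. f x * g x) - 1/2 * \<E> (\<lambda>x. (f x)\<^sup>2) g))"

definition energy_measure ::
  "'a::metric_space measure \<Rightarrow> (('a \<Rightarrow> real) \<Rightarrow> ('a \<Rightarrow> real) \<Rightarrow> real) \<Rightarrow> ('a \<Rightarrow> real) set \<Rightarrow>
   ('a \<Rightarrow> real) \<Rightarrow> 'a measure" where
  "energy_measure m \<E> \<F> f =
     (if ess_bounded m f then energy_measure_bdd \<E> \<F> f
      else (THE \<mu>. sets \<mu> = sets borel \<and>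
             (\<forall>A\<in>sets borel.
                (\<lambda>n::nat. emeasure (energy_measure_bdd \<E> \<F> (\<lambda>x. max (- real n) (min (f x) (real n)))) A)
                  \<longlonglongrightarrow> emeasure \<mu> A)))"

text \<open>Relative compactness in $W$: the closure in $W$ is compact.\<close>

definition rel_compact_in :: "'a::topological_space set \<Rightarrow> 'a set \<Rightarrow> bool" where
  "rel_compact_in W S \<longleftrightarrow> compact (closure S) \<and> closure S \<subseteq> W"

definition F_loc ::
  "'a::metric_space measure \<Rightarrow> ('a \<Rightarrow> real) set \<Rightarrow> 'a set \<Rightarrow> ('a \<Rightarrow> real) set" where
  "F_loc m \<F> W = {f \<in> borel_measurable (restrict_space borel W).
     \<forall>O'. open O' \<and> rel_compact_in W O' \<longrightarrow>
       (\<exists>f'\<in>\<F>. AE x in m. x \<in> O' \<longrightarrow> f x = f' x)}"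

definition local_energy_measure ::
  "'a::metric_space measure \<Rightarrow> (('a \<Rightarrow> real) \<Rightarrow> ('a \<Rightarrow> real) \<Rightarrow> real) \<Rightarrow> ('a \<Rightarrow> real) set \<Rightarrow>
   'a set \<Rightarrow> ('a \<Rightarrow> real) \<Rightarrow> 'a measure" where
  "local_energy_measure m \<E> \<F> W f =
     (THE \<mu>. sets \<mu> = sets (restrict_space borel W) \<and>
        (\<forall>A O' f'. A \<in> sets borel \<and> rel_compact_in W A \<and> A \<subseteq> O' \<and>
           open O' \<and> rel_compact_in W O' \<and> f' \<in> \<F> \<and> (AE x in m. x \<in> O' \<longrightarrow> f x = f' x) \<longrightarrow>
           emeasure \<mu> A = emeasure (energy_measure m \<E> \<F> f') A))"

definition F_refl ::
  "'a::metric_space measure \<Rightarrow> (('a \<Rightarrow> real) \<Rightarrow> ('a \<Rightarrow> real) \<Rightarrow> real) \<Rightarrow> ('a \<Rightarrow> real) set \<Rightarrow>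
   'a set \<Rightarrow> ('a \<Rightarrow> real) set" where
  "F_refl m \<E> \<F> U = {f \<in> F_loc m \<F> U.
     (\<integral>\<^sup>+x\<in>U. ennreal ((f x)\<^sup>2) \<partial>m) + emeasure (local_energy_measure m \<E> \<F> U f) U < \<infinity>}"

definition E_refl ::
  "'a::metric_space measure \<Rightarrow> (('a \<Rightarrow> real) \<Rightarrow> ('a \<Rightarrow> real) \<Rightarrow> real) \<Rightarrow> ('a \<Rightarrow> real) set \<Rightarrow>
   'a set \<Rightarrow> ('a \<Rightarrow> real) \<Rightarrow> ennreal" where
  "E_refl m \<E> \<F> U f = emeasure (local_energy_measure m \<E> \<F> U f) U"

section \<open>Heat kernel estimates and Poincare inequality\<close>

definition scale_function :: "(real \<Rightarrow> real) \<Rightarrow> bool" where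
  "scale_function \<Psi> \<longleftrightarrow>
     continuous_on {0<..} \<Psi> \<and> strict_mono_on {0<..} \<Psi> \<and> bij_betw \<Psi> {0<..} {0<..} \<and>
     (\<exists>C \<beta>1 \<beta>2. C > 1 \<and> 1 < \<beta>1 \<and> \<beta>1 < \<beta>2 \<and>
        (\<forall>r R. 0 < r \<and> r \<le> R \<longrightarrow>
           inverse C * (R / r) powr \<beta>1 \<le> \<Psi> R / \<Psi> r \<and> \<Psi> R / \<Psi> r \<le> C * (R / r) powr \<beta>2))"

definition scale_inv :: "(real \<Rightarrow> real) \<Rightarrow> real \<Rightarrow> real" where
  "scale_inv \<Psi> = the_inv_into {0<..} \<Psi>"

definition scale_conj :: "(real \<Rightarrow> real) \<Rightarrow> real \<Rightarrow> real" where
  "scale_conj \<Psi> s = (SUP r\<in>{0<..}. s / r - 1 / \<Psi> r)"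

definition L2_semigroup ::
  "'a::metric_space measure \<Rightarrow> (real \<Rightarrow> ('a \<Rightarrow> real) \<Rightarrow> 'a \<Rightarrow> real) \<Rightarrow> bool" where
  "L2_semigroup m P \<longleftrightarrow>
     (\<forall>t>0. \<forall>f\<in>L2_on m UNIV. P t f \<in> L2_on m UNIV \<and> L2_normsq m (P t f) \<le> L2_normsq m f) \<and>
     (\<forall>t>0. \<forall>f\<in>L2_on m UNIV. \<forall>g\<in>L2_on m UNIV. \<forall>a b.
        AE x in m. P t (\<lambda>y. a * f y + b * g y) x = a * P t f x + b * P t g x) \<and>
     (\<forall>t>0. \<forall>f\<in>L2_on m UNIV. \<forall>g\<in>L2_on m UNIV.
        (\<integral>x. P t f x * g x \<partial>m) = (\<integral>x. f x * P t g x \<partial>m)) \<and>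
     (\<forall>s>0. \<forall>t>0. \<forall>f\<in>L2_on m UNIV. AE x in m. P (s + t) f x = P s (P t f) x) \<and>
     (\<forall>f\<in>L2_on m UNIV. ((\<lambda>t. L2_normsq m (\<lambda>x. P t f x - f x)) \<longlongrightarrow> 0) (at_right 0))"

text \<open>
  The semigroup of a form is the one whose infinitesimal generator is the operator $L$ with
  $\mathcal{E}(f,g) = -\langle Lf, g\rangle$ for $g \in \mathcal{F}$; both operators are given by
  their graphs.
\<close>

definition semigroup_generator ::
  "'a::metric_space measure \<Rightarrow> (real \<Rightarrow> ('a \<Rightarrow> real) \<Rightarrow> 'a \<Rightarrow> real) \<Rightarrow>
   ('a \<Rightarrow> real) \<Rightarrow> ('a \<Rightarrow> real) \<Rightarrow> bool" where
  "semigroup_generator m P f h \<longleftrightarrow>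
     f \<in> L2_on m UNIV \<and> h \<in> L2_on m UNIV \<and>
     ((\<lambda>t. L2_normsq m (\<lambda>x. (P t f x - f x) / t - h x)) \<longlongrightarrow> 0) (at_right 0)"

definition form_generator ::
  "'a::metric_space measure \<Rightarrow> (('a \<Rightarrow> real) \<Rightarrow> ('a \<Rightarrow> real) \<Rightarrow> real) \<Rightarrow> ('a \<Rightarrow> real) set \<Rightarrow>
   ('a \<Rightarrow> real) \<Rightarrow> ('a \<Rightarrow> real) \<Rightarrow> bool" where
  "form_generator m \<E> \<F> f h \<longleftrightarrow>
     f \<in> \<F> \<and> h \<in> L2_on m UNIV \<and> (\<forall>g\<in>\<F>. \<E> f g = - (\<integral>x. h x * g x \<partial>m))"

definition form_semigroup ::
  "'a::metric_space measure \<Rightarrow> (('a \<Rightarrow> real) \<Rightarrow> ('a \<Rightarrow> real) \<Rightarrow> real) \<Rightarrow> ('a \<Rightarrow> real) set \<Rightarrow>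
   (real \<Rightarrow> ('a \<Rightarrow> real) \<Rightarrow> 'a \<Rightarrow> real) \<Rightarrow> bool" where
  "form_semigroup m \<E> \<F> P \<longleftrightarrow>
     L2_semigroup m P \<and> (\<forall>f h. semigroup_generator m P f h \<longleftrightarrow> form_generator m \<E> \<F> f h)"

definition heat_kernel ::
  "'a::metric_space measure \<Rightarrow> (('a \<Rightarrow> real) \<Rightarrow> ('a \<Rightarrow> real) \<Rightarrow> real) \<Rightarrow> ('a \<Rightarrow> real) set \<Rightarrow>
   (real \<Rightarrow> 'a \<Rightarrow> 'a \<Rightarrow> real) \<Rightarrow> bool" where
  "heat_kernel m \<E> \<F> p \<longleftrightarrow>
     (\<forall>t>0. case_prod (p t) \<in> borel_measurable (borel \<Otimes>\<^sub>M borel) \<and> (\<forall>x y. 0 \<le> p t x y)) \<and>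
     (\<exists>P. form_semigroup m \<E> \<F> P \<and>
        (\<forall>t>0. \<forall>f\<in>L2_on m UNIV. AE x in m.
           integrable m (\<lambda>y. p t x y * f y) \<and> P t f x = (\<integral>y. p t x y * f y \<partial>m)))"

definition HKE ::
  "'a::metric_space measure \<Rightarrow> (('a \<Rightarrow> real) \<Rightarrow> ('a \<Rightarrow> real) \<Rightarrow> real) \<Rightarrow> ('a \<Rightarrow> real) set \<Rightarrow>
   (real \<Rightarrow> real) \<Rightarrow> bool" where
  "HKE m \<E> \<F> \<Psi> \<longleftrightarrow>
     (\<exists>C1 c1 c2 c3 \<delta> p. C1 > 0 \<and> c1 > 0 \<and> c2 > 0 \<and> c3 > 0 \<and> \<delta> > 0 \<and>
        heat_kernel m \<E> \<F> p \<and>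
        (\<forall>t>0.
           (AE x in m. AE y in m.
              p t x y \<le> C1 / measure m (ball x (scale_inv \<Psi> t)) *
                          exp (- c1 * t * scale_conj \<Psi> (c2 * dist x y / t))) \<and>
           (AE x in m. AE y in m. dist x y \<le> \<delta> * scale_inv \<Psi> t \<longrightarrow>
              p t x y \<ge> c3 / measure m (ball x (scale_inv \<Psi> t)))))"

definition poincare ::
  "'a::metric_space measure \<Rightarrow> (('a \<Rightarrow> real) \<Rightarrow> ('a \<Rightarrow> real) \<Rightarrow> real) \<Rightarrow> ('a \<Rightarrow> real) set \<Rightarrow>
   (real \<Rightarrow> real) \<Rightarrow> real \<Rightarrow> real \<Rightarrow> bool" where
  "poincare m \<E> \<F> \<Psi> C\<^sub>P A\<^sub>P \<longleftrightarrow> C\<^sub>P \<ge> 1 \<and> A\<^sub>P \<ge> 1 \<and>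
     (\<forall>x r f. r > 0 \<and> f \<in> F_loc m \<F> (ball x (A\<^sub>P * r)) \<longrightarrow>
        (\<integral>\<^sup>+y\<in>ball x r. ennreal ((f y - set_average m (ball x r) f)\<^sup>2) \<partial>m)
          \<le> ennreal (C\<^sub>P * \<Psi> r) *
             emeasure (local_energy_measure m \<E> \<F> (ball x (A\<^sub>P * r)) f) (ball x (A\<^sub>P * r)))"

section \<open>Uniform domains and Whitney covers\<close>

text \<open>The library's \<open>diameter\<close> is only meaningful for bounded sets.\<close>

definition ediam :: "'a::metric_space set \<Rightarrow> ereal" where
  "ediam S = (SUP (x, y)\<in>S \<times> S. ereal (dist x y))"

definition uniform_domain :: "real \<Rightarrow> 'a::metric_space set \<Rightarrow> bool" where
  "uniform_domain A U \<longleftrightarrow>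
     A \<ge> 1 \<and> connected U \<and> U \<noteq> {} \<and> open U \<and> U \<noteq> UNIV \<and>
     (\<forall>x\<in>U. \<forall>y\<in>U. \<exists>\<gamma>. path \<gamma> \<and> pathstart \<gamma> = x \<and> pathfinish \<gamma> = y \<and> path_image \<gamma> \<subseteq> U \<and>
        diameter (path_image \<gamma>) \<le> A * dist x y \<and>
        (\<forall>z\<in>path_image \<gamma>. infdist z (- U) \<ge> inverse A * min (dist x z) (dist y z)))"

text \<open>
  Balls with a specified centre and radius are pairs; \<open>rball W \<lambda> B\<close> is the set $\lambda B_W(x,r)$
  for \<open>B = (x, r)\<close>.
\<close>

definition rball :: "'a::metric_space set \<Rightarrow> real \<Rightarrow> 'a \<times> real \<Rightarrow> 'a set" where
  "rball W l B = W \<inter> ball (fst B) (l * snd B)"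

definition whitney_cover :: "real \<Rightarrow> 'a::metric_space set \<Rightarrow> ('a \<times> real) set \<Rightarrow> bool" where
  "whitney_cover \<epsilon> W \<RR> \<longleftrightarrow>
     0 < \<epsilon> \<and> \<epsilon> < 1/2 \<and> open W \<and> W \<noteq> UNIV \<and>
     (\<forall>(x, r)\<in>\<RR>. x \<in> W \<and> r = \<epsilon> / (1 + \<epsilon>) * infdist x (- W)) \<and>
     pairwise (\<lambda>B B'. rball W 1 B \<inter> rball W 1 B' = {}) \<RR> \<and>
     (\<Union>B\<in>\<RR>. rball W (2 * (1 + \<epsilon>)) B) = W"

definition small_balls ::
  "real \<Rightarrow> real \<Rightarrow> 'a::metric_space set \<Rightarrow> ('a \<times> real) set \<Rightarrow> ('a \<times> real) set" where
  "small_balls \<epsilon> A U \<SS> =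
     {B \<in> \<SS>. ereal (snd B) < ereal (\<epsilon> / (6 * A * (1 + \<epsilon>))) * ediam U}"

definition ball_chain ::
  "'a::metric_space set \<Rightarrow> ('a \<times> real) set \<Rightarrow> nat \<Rightarrow> 'a \<times> real \<Rightarrow> 'a \<times> real \<Rightarrow> bool" where
  "ball_chain U \<RR> N B B' \<longleftrightarrow>
     (\<exists>Ds. Ds \<noteq> [] \<and> set Ds \<subseteq> \<RR> \<and> distinct Ds \<and> length Ds \<le> N \<and> hd Ds = B \<and> last Ds = B' \<and>
        (\<forall>i. Suc i < length Ds \<longrightarrow> rball U 3 (Ds ! i) \<inter> rball U 3 (Ds ! Suc i) \<noteq> {}))"

definition whitney_reflection ::
  "real \<Rightarrow> real \<Rightarrow> 'a::metric_space set \<Rightarrow> ('a \<times> real) set \<Rightarrow> ('a \<times> real) set \<Rightarrow>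
   ('a \<times> real \<Rightarrow> 'a \<times> real) \<Rightarrow> bool" where
  "whitney_reflection \<epsilon> A U \<RR> \<SS> Q \<longleftrightarrow>
     (\<forall>B\<in>small_balls \<epsilon> A U \<SS>. Q B \<in> \<RR>) \<and>
     (\<forall>(y, s)\<in>small_balls \<epsilon> A U \<SS>. \<forall>x r. Q (y, s) = (x, r) \<longrightarrow>
        (1 + \<epsilon>) / (1 + 4 * \<epsilon>) * s < r \<and> r < (1 + \<epsilon>) / (1 - 2 * \<epsilon>) * s \<and>
        dist x y \<le> (2 + 3 * A / 2) * ((1 + \<epsilon>) / \<epsilon>) * s) \<and>
     (\<exists>N::nat. \<forall>D\<in>\<RR>. finite {B \<in> small_balls \<epsilon> A U \<SS>. Q B = D} \<and>
        card {B \<in> small_balls \<epsilon> A U \<SS>. Q B = D} \<le> N) \<and>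
     (\<exists>N0::nat. \<forall>B1\<in>small_balls \<epsilon> A U \<SS>. \<forall>B2\<in>small_balls \<epsilon> A U \<SS>.
        rball (interior (- U)) 6 B1 \<inter> rball (interior (- U)) 6 B2 \<noteq> {} \<longrightarrow>
        ((1 - 2 * \<epsilon>) * (1 - 5 * \<epsilon>)) / ((1 + 4 * \<epsilon>) * (1 + 7 * \<epsilon>)) * snd (Q B2) \<le> snd (Q B1) \<and>
        snd (Q B1) \<le> ((1 + 4 * \<epsilon>) * (1 + 7 * \<epsilon>)) / ((1 - 2 * \<epsilon>) * (1 - 5 * \<epsilon>)) * snd (Q B2) \<and>
        ball_chain U \<RR> N0 (Q B1) (Q B2))"

definition whitney_partition ::
  "'a::metric_space measure \<Rightarrow> (('a \<Rightarrow> real) \<Rightarrow> ('a \<Rightarrow> real) \<Rightarrow> real) \<Rightarrow> ('a \<Rightarrow> real) set \<Rightarrow>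
   (real \<Rightarrow> real) \<Rightarrow> 'a set \<Rightarrow> ('a \<times> real) set \<Rightarrow> ('a \<times> real \<Rightarrow> 'a \<Rightarrow> real) \<Rightarrow> bool" where
  "whitney_partition m \<E> \<F> \<Psi> V \<SS> \<psi> \<longleftrightarrow>
     (\<forall>B\<in>\<SS>. \<psi> B \<in> Cc \<inter> \<F> \<and> (\<forall>x. 0 \<le> \<psi> B x \<and> \<psi> B x \<le> 1)) \<and>
     (\<forall>x. ((\<lambda>B. \<psi> B x) has_sum (indicator V x)) \<SS>) \<and>
     (\<exists>c>0. \<exists>C>0. \<forall>B\<in>\<SS>.
        (\<forall>x\<in>rball V 3 B. \<psi> B x \<ge> c) \<and>
        (\<forall>x. x \<notin> rball V 6 B \<longrightarrow> \<psi> B x = 0) \<and>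
        \<E> (\<psi> B) (\<psi> B) \<le> C * measure m (ball (fst B) (snd B)) / \<Psi> (snd B))"

definition whitney_extension ::
  "'a::metric_space measure \<Rightarrow> real \<Rightarrow> real \<Rightarrow> 'a set \<Rightarrow> ('a \<times> real) set \<Rightarrow>
   ('a \<times> real \<Rightarrow> 'a \<times> real) \<Rightarrow> ('a \<times> real \<Rightarrow> 'a \<Rightarrow> real) \<Rightarrow> ('a \<Rightarrow> real) \<Rightarrow> 'a \<Rightarrow> real" where
  "whitney_extension m \<epsilon> A U \<SS> Q \<psi> f x =
     (if x \<in> U then f x
      else (\<Sum>\<^sub>\<infinity>B\<in>small_balls \<epsilon> A U \<SS>. \<psi> B x * set_average m (rball U 3 (Q B)) f))"

definition inv_scale_diam :: "(real \<Rightarrow> real) \<Rightarrow> 'a::metric_space set \<Rightarrow> real" where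
  "inv_scale_diam \<Psi> U = (if ediam U = \<infinity> then 0 else 1 / \<Psi> (real_of_ereal (ediam U)))"

end

(* The energy measure of f is the Riesz measure of h |-> E(f,fh) - E(f^2,h)/2, whose positivity
 comes from the resolvent. Clipping the heat flow of an indicator and using HKE gives cutoff
 functions of energy at most C m(B)/Psi(r). Mollifying with partitions of unity made of them
 shows: if the L^2 oscillation of g in L^2 on every small ball of radius r is at most Psi(r) nu(ball)
 for a finite measure nu, then g is in F and nu dominates its energy near every open set.
 Let b(x) be the averages of f over Whitney balls of U. Two of them of comparable size are compared
 along a uniform curve by PI. Since Psi(r)/r almost increases, telescoping b along climbs away from the
 boundary and Cauchy-Schwarz with weights dist(x, boundary) give (a). Near a Whitney ball of V
 the extension is a finite combination of the psi_B with such averages as coefficients,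
 which gives (b). For (c)-(e) the criterion applies with nu = Gamma_U(f) + Gamma_V(EQ f): a ball
 whose A_P-multiple is neither in U nor in V lies in a comparable ball centred on the
 boundary, where (a) applies; and nu does not charge the boundary. *)
theory Submission
 imports Defs
begin

text \<open>Three obstacles shape the proof. Elements of the domain are functions, not classes, and
  weak compactness is replaced by resolvents: \<open>E (R lam f) w\<close> is an L^2 pairing, so
  bounded energies together with L^2 convergence give membership in the domain and weak convergence.
  Dividing by a sum of cutoff functions is not an operation that a Dirichlet form controls, so
  partitions of unity are made of differences of truncated partial sums. Balls are not known to be
  connected, so a ball that meets both U and its complement may miss the frontier; but if its
  \<open>AP\<close>-dilate missed it too, the indicator of U would have zero energy there, against
  PI. The same fact shows that U is not a single point. The frontier is m-null because corkscrew
  balls make it porous, so L^2 oscillations of the extension split into a part in U and a part in V.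
  The smallness of 27*AP*eps keeps the dilated Poincare balls of Whitney size well inside U. All
  constants are built from doubling factors \<open>DD K\<close> and scale factors
  \<open>PK K\<close>; none depends on f, on the location or on the radius.\<close>

abbreviation lims (infix "~~>" 60) where "X ~~> L == X \<longlonglongrightarrow> L"

section \<open>Positive semidefinite forms\<close>

lemma quad_cs:
 fixes a b c :: real
 assumes "!!s. 0 <= a + 2* s*b + s^2*c" "0 <= c"
 shows "b^2 <= a*c"
proof (cases "c = 0")
 case True
 have "b = 0"
 proof (rule ccontr)
  assume "b ~= 0"
  \<comment> \<open>At this \<open>s\<close> the polynomial takes the value -1.\<close>
  thus False using assms(1)[of "-(a+1)/(2*b)"] True by (simp add: field_simps)
 qed
 thus ?thesis using True by simp
next
 case False
 hence c: "c > 0" using assms(2) by simp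
 have "0 <= a + 2*(-b/c)*b + (-b/c)^2*c" by (rule assms)
 also have "... = a - b^2/c" using c by (simp add: field_simps power2_eq_square)
 finally show ?thesis using c by (simp add: field_simps)
qed

lemma le_sqrt_self:
 fixes x M :: real assumes "0 <= x" "0 <= M" "x <= sqrt M * sqrt x" shows "x <= M"
proof (cases "x = 0")
 case False
 have "x^2 <= (sqrt M * sqrt x)^2" by (rule power_mono) (use assms in auto)
 hence "x * x <= M * x" using assms by (simp add: power_mult_distrib) (simp add: power2_eq_square)
 thus ?thesis using False assms(1) by simp
qed (use assms in simp)

text \<open>This algebra serves four forms: the L^2 product, the form E, the bracket
  \<open>Ib h\<close> with a fixed weight, and the product of f minus its heat flow with g. Only
  semidefiniteness is asked, because functions that agree almost everywhere stay distinct.\<close>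

locale psd =
 fixes S :: "('a => real) set" and B :: "('a => real) => ('a => real) => real"
 assumes add: "f : S ==> g : S ==> (%x. f x + g x) : S"
  and scale: "f : S ==> (%x. c * f x) : S"
  and B_add: "f : S ==> g : S ==> h : S ==> B (%x. f x + g x) h = B f h + B g h"
  and B_scale: "f : S ==> h : S ==> B (%x. c * f x) h = c * B f h"
  and B_sym: "f : S ==> g : S ==> B f g = B g f"
  and B_nonneg: "f : S ==> 0 <= B f f"
begin

lemma uminus: "f : S ==> (%x. - f x) : S"
 using scale[of f "-1"] by simp

lemma diff: "f : S ==> g : S ==> (%x. f x - g x) : S"
 using add[OF _ uminus, of f g] by simp

lemma B_uminus: "f : S ==> h : S ==> B (%x. - f x) h = - B f h"
 using B_scale[of f h "-1"] by simp

lemma B_diff: "f : S ==> g : S ==> h : S ==> B (%x. f x - g x) h = B f h - B g h"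
 using B_add[of f "%x. - g x" h] by (simp add: uminus B_uminus)

lemma B_add_right: "f : S ==> g : S ==> h : S ==> B h (%x. f x + g x) = B h f + B h g"
 by (simp add: B_sym[of h] add B_add)

lemma B_scale_right: "f : S ==> h : S ==> B h (%x. c * f x) = c * B h f"
 by (simp add: B_sym[of h] scale B_scale)

lemma B_diff_right: "f : S ==> g : S ==> h : S ==> B h (%x. f x - g x) = B h f - B h g"
 by (simp add: B_sym[of h] diff B_diff)

lemmas B_simps = add scale diff B_add B_scale B_diff B_add_right B_scale_right B_diff_right

lemma B_exp: "f : S ==> g : S ==>
  B (%x. f x + c * g x) (%x. f x + c * g x) = B f f + 2*c * B f g + c^2 * B g g"
 by (simp add: B_simps B_sym[of g f] power2_eq_square algebra_simps)

lemma B_exp_diff: "f : S ==> g : S ==>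
  B (%x. f x - g x) (%x. f x - g x) = B f f - 2 * B f g + B g g"
 using B_exp[of f g "-1"] by simp

lemma B_diff_swap: "f : S ==> g : S ==>
  B (%x. f x - g x) (%x. f x - g x) = B (%x. g x - f x) (%x. g x - f x)"
 by (simp add: B_exp_diff B_sym)

lemma par: "f : S ==> g : S ==> B f f + B g g =
  2 * B (%x. (f x + g x)/2) (%x. (f x + g x)/2) + 1/2 * B (%x. f x - g x) (%x. f x - g x)"
 using B_scale[OF add scale[OF add], of f g f g "1/2" "1/2"]
  B_scale_right[OF add add, of f g f g "1/2"] B_exp[of f g 1] B_exp_diff[of f g]
 by (simp add: add_divide_distrib[symmetric] mult.commute[of _ "1/2::real"] scale add) argo

lemma CS: assumes "f : S" "g : S" shows "(B f g)^2 <= B f f * B g g"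
proof (rule quad_cs)
 fix s show "0 <= B f f + 2* s * B f g + s^2 * B g g"
  unfolding B_exp[OF assms, symmetric] by (intro B_nonneg add scale assms)
qed (rule B_nonneg[OF assms(2)])

lemma CS_abs: "f : S ==> g : S ==> abs (B f g) <= sqrt (B f f) * sqrt (B g g)"
 by (metis CS real_sqrt_abs real_sqrt_le_mono real_sqrt_mult)

lemma tri_add: assumes "f : S" "g : S"
 shows "sqrt (B (%x. f x + g x) (%x. f x + g x)) <= sqrt (B f f) + sqrt (B g g)"
proof (rule real_le_lsqrt)
 have "B (%x. f x + g x) (%x. f x + g x) = B f f + 2 * B f g + B g g"
  using B_exp[OF assms, of 1] by simp
 also have "... <= (sqrt (B f f) + sqrt (B g g))^2"
  using CS_abs[OF assms] B_nonneg assms by (simp add: power2_sum algebra_simps)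
 finally show "B (%x. f x + g x) (%x. f x + g x) <= (sqrt (B f f) + sqrt (B g g))^2" .
qed (use B_nonneg assms in auto)

lemma tri_diff: assumes "f : S" "g : S"
 shows "sqrt (B (%x. f x - g x) (%x. f x - g x)) <= sqrt (B f f) + sqrt (B g g)"
 using tri_add[OF assms(1) uminus[OF assms(2)]] B_uminus[OF assms(2) uminus[OF assms(2)]]
  B_scale_right[OF assms(2) assms(2), of "-1"] by simp

lemma tri_abs: assumes "f : S" "g : S"
 shows "abs (sqrt (B f f) - sqrt (B g g)) <= sqrt (B (%x. f x - g x) (%x. f x - g x))"
 using tri_add[OF diff[OF assms] assms(2)] tri_add[OF diff[OF assms(2,1)] assms(1)]
  B_diff_swap[OF assms] by simp

lemma add_le: assumes "f : S" "g : S"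
 shows "B (%x. f x + g x) (%x. f x + g x) <= 2 * B f f + 2 * B g g"
 using B_exp[OF assms, of 1] B_exp_diff[OF assms] B_nonneg[OF diff[OF assms]] by simp

lemma zero: "f : S ==> (%_. 0) : S" using scale[of f 0] by simp

lemma sum: "finite I ==> S ~= {} ==> (!!i. i : I ==> f i : S) ==> (%x. SUM i:I. f i x) : S"
proof (induction rule: finite_induct)
 case empty thus ?case using zero by auto
next
 case (insert i I) thus ?case using add[of "f i" "%x. SUM i:I. f i x"] by simp
qed

lemma tri_sum: assumes "finite I" "S ~= {}" "!!i. i : I ==> f i : S"
 shows "sqrt (B (%x. SUM i:I. f i x) (%x. SUM i:I. f i x)) <= (SUM i:I. sqrt (B (f i) (f i)))"
 using assms(1,3)
proof (induction rule: finite_induct)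
 case empty obtain g where "g : S" using assms(2) by auto
 thus ?case using B_scale[OF _ zero, of g g 0] by (simp)
next
 case (insert i I) thus ?case
  using tri_add[of "f i" "%x. SUM i:I. f i x"] sum[of I f] assms(2) by simp
qed

lemma lim1: assumes "!!n. u n : S" "v : S" "w : S"
  "(%n. B (%x. u n x - v x) (%x. u n x - v x)) ~~> 0"
 shows "(%n. B (u n) w) ~~> B v w"
proof -
 have "(%n. sqrt (B (%x. u n x - v x) (%x. u n x - v x)) * sqrt (B w w)) ~~> sqrt 0 * sqrt (B w w)"
  by (intro tendsto_intros assms)
 hence "(%n. B (u n) w - B v w) ~~> 0"
  using CS_abs[OF diff[OF assms(1) assms(2)] assms(3)] B_diff[OF assms(1-3)]
  by (auto elim!: Lim_null_comparison[OF always_eventually, rotated])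
 thus ?thesis by (simp add: LIM_zero_iff)
qed

lemma lim2: assumes "!!n. u n : S" "v : S"
  "(%n. B (%x. u n x - v x) (%x. u n x - v x)) ~~> 0"
 shows "(%n. B (u n) (u n)) ~~> B v v"
proof -
 have "(%n. sqrt (B (%x. u n x - v x) (%x. u n x - v x))) ~~> sqrt 0"
  by (intro tendsto_intros assms)
 hence "(%n. sqrt (B (u n) (u n)) - sqrt (B v v)) ~~> 0"
  using tri_abs[OF assms(1,2)]
  by (auto elim!: Lim_null_comparison[OF always_eventually, rotated])
 hence "(%n. sqrt (B (u n) (u n))) ~~> sqrt (B v v)" by (simp add: LIM_zero_iff)
 from tendsto_power[OF this, of 2] show ?thesis using B_nonneg assms by simp
qed

end

section \<open>The form domain\<close>

locale mmd =
 fixes m :: "'a::metric_space measure" and E :: "('a => real) => ('a => real) => real"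
  and F :: "('a => real) set"
 assumes MMD: "MMD_space m E F"
begin

abbreviation "L2 == L2_on m UNIV"
definition ip :: "('a => real) => ('a => real) => real" where "ip f g = (\<integral>x. f x * g x \<partial>m)"

lemma sets_m[simp, measurable_cong]: "sets m = sets borel"
 using MMD by (simp add: MMD_space_def metric_measure_space_def radon_measure_def)

lemma borel_m[simp]: "borel_measurable m = borel_measurable borel"
 by (rule measurable_cong_sets) simp_all

lemma space_m[simp]: "space m = UNIV"
 using sets_eq_imp_space_eq[OF sets_m] by simp

lemma L2_iff: "f : L2 \<longleftrightarrow> f : borel_measurable borel & integrable m (%x. (f x)^2)"
proof -
 have "integrable m (%x. (f x)^2) \<longleftrightarrow> (\<integral>\<^sup>+x. ennreal ((f x)^2) \<partial>m) < \<infinity>" if "f : borel_measurable borel"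
  using that by (subst integrable_iff_bounded) (auto)
 thus ?thesis by (auto simp: L2_on_def)
qed

lemma L2_meas: "f : L2 ==> f : borel_measurable borel" by (simp add: L2_iff)

lemma L2_int: assumes "f : L2" "g : L2" shows "integrable m (%x. f x * g x)"
proof (rule Bochner_Integration.integrable_bound)
 show "integrable m (%x. (f x)^2 + (g x)^2)" using assms by (auto simp: L2_iff)
 show "(%x. f x * g x) : borel_measurable m" using assms by (auto simp: L2_iff)
 have "abs (a * b) <= a^2 + b^2" for a b :: real
  using sum_squares_bound[of "abs a" "abs b"] mult_nonneg_nonneg[of "abs a" "abs b"]
  unfolding abs_mult power2_abs by linarith
 thus "AE x in m. norm (f x * g x) <= norm ((f x)^2 + (g x)^2)" by auto
qed

lemma L2_add: assumes "f : L2" "g : L2" shows "(%x. f x + g x) : L2"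
 using L2_int[OF assms] assms by (auto simp: L2_iff power2_sum mult.assoc)

lemma L2_scale: "f : L2 ==> (%x. c * f x) : L2"
 by (auto simp: L2_iff power_mult_distrib)

abbreviation En where "En h == E h h"
abbreviation Ns where "Ns h == ip h h"
abbreviation sqi where "sqi S h == (\<integral>\<^sup>+x\<in>S. ennreal ((h x)^2) \<partial>m)"

sublocale ip: psd L2 ip
proof
 fix f g h c
 show "f : L2 ==> g : L2 ==> h : L2 ==> ip (%x. f x + g x) h = ip f h + ip g h"
  by (simp add: ip_def distrib_right L2_int)
 show "f : L2 ==> h : L2 ==> ip (%x. c * f x) h = c * ip f h"
  by (simp add: ip_def mult.assoc)
 show "ip f g = ip g f" by (simp add: ip_def mult.commute)
 show "0 <= ip f f" by (simp add: ip_def)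
qed (auto intro: L2_add L2_scale)

lemma nsq: "L2_normsq m f = ip f f" by (simp add: L2_normsq_def ip_def power2_eq_square)

lemma F_facts: "symmetric_form m E F" "closed_form m E F" "markovian_form E F" "regular_form m E F"
 "strongly_local_form m E F" "metric_measure_space m"
 using MMD by (auto simp: MMD_space_def dirichlet_form_def)

lemma F_L2: "f : F ==> f : L2" using F_facts(1) by (auto simp: symmetric_form_def)
lemma F_meas: "f : F ==> f : borel_measurable borel" by (intro L2_meas F_L2)
lemma F0: "(%_. 0) : F" using F_facts(1) by (auto simp: symmetric_form_def)
lemma F_ne: "F ~= {}" using F0 by auto
lemma F_AE: "f : F ==> g : borel_measurable borel ==> AE x in m. f x = g x ==> g : F"
 using F_facts(1) by (auto simp: symmetric_form_def)
lemma E_AE: "f : F ==> g : borel_measurable borel ==> AE x in m. f x = g x ==> h : F ==> E f h = E g h"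
 using F_facts(1) unfolding symmetric_form_def by blast
sublocale EE: psd F E
 using F_facts(1) unfolding symmetric_form_def by unfold_locales blast+

lemma E_AE2: "f : F ==> g : borel_measurable borel ==> AE x in m. f x = g x ==> E f f = E g g"
 using E_AE[of f g f] E_AE[of f g g] F_AE[of f g] EE.B_sym[of g f] by simp

lemma ip_AE: assumes "AE x in m. f x = g x" and [measurable]: "f : borel_measurable borel"
  "g : borel_measurable borel" "h : borel_measurable borel"
 shows "ip f h = ip g h"
 unfolding ip_def
proof (intro integral_cong_AE)
 show "AE x in m. f x * h x = g x * h x" using assms(1) by auto
qed measurable

lemma ip_zero_AE: assumes "f : L2" "ip f f = 0" shows "AE x in m. f x = 0"
proof -
 have "AE x in m. f x * f x = 0"
  using assms integral_nonneg_eq_0_iff_AE[OF L2_int[OF assms(1,1)]] by (auto simp: ip_def)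
 thus ?thesis by simp
qed

lemma E1_lim:
 assumes "!!n. u n : F" "w : F" "(%n. E1 m E (%x. u n x - w x)) ~~> 0"
 shows "(%n. Ns (%x. u n x - w x)) ~~> 0"
  "(%n. En (%x. u n x - w x)) ~~> 0"
proof -
 have d: "(%x. u n x - w x) : F" for n by (rule EE.diff[OF assms(1,2)])
 have p: "0 <= Ns (%x. u n x - w x)" "0 <= En (%x. u n x - w x)" for n
  using ip.B_nonneg[OF F_L2[OF d]] EE.B_nonneg[OF d] by auto
 show "(%n. Ns (%x. u n x - w x)) ~~> 0"
  by (rule Lim_null_comparison[OF always_eventually assms(3)]) (use p in "auto simp: E1_def nsq")
 show "(%n. En (%x. u n x - w x)) ~~> 0"
  by (rule Lim_null_comparison[OF always_eventually assms(3)]) (use p in "auto simp: E1_def nsq")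
qed

text \<open>Closedness yields some limit in the E1 norm; L^2 convergence forces it to agree almost
  everywhere with \<open>u0\<close>, and both the domain and the form ignore null sets.\<close>

lemma E_closed:
 assumes un: "!!n. u n : F" and u: "u0 : L2"
  and lim: "(%n. Ns (%x. u n x - u0 x)) ~~> 0"
  and cau: "!!e. e > 0 ==> EX N. ALL i>=N. ALL j>=N. En (%x. u i x - u j x) < e"
 shows "u0 : F" "(%n. En (%x. u n x - u0 x)) ~~> 0"
proof -
 have L: "u n : L2" for n by (intro F_L2 un)
 have "EX N. ALL i>=N. ALL j>=N. E1 m E (%x. u i x - u j x) < e" if e: "e > 0" for e
 proof -
  obtain N1 where N1: "!!i j. i >= N1 ==> j >= N1 ==> En (%x. u i x - u j x) < e/2"
   using cau[of "e/2"] e by auto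
  obtain N2 where N2: "!!n. n >= N2 ==> Ns (%x. u n x - u0 x) < e/8"
   using order_tendstoD(2)[OF lim, of "e/8"] e by (auto simp: eventually_sequentially)
  have "E1 m E (%x. u i x - u j x) < e" if "i >= max N1 N2" "j >= max N1 N2" for i j
  proof -
   have "Ns (%x. u i x - u j x) <= 2 * Ns (%x. u i x - u0 x)
     + 2 * Ns (%x. u0 x - u j x)"
    using ip.add_le[OF ip.diff[OF L u] ip.diff[OF u L], of i j] by simp
   also have "... < e/2" using N2[of i] N2[of j] that ip.B_diff_swap[OF u L] by simp
   finally show ?thesis using N1[of i j] that by (simp add: E1_def nsq)
  qed
  thus ?thesis by (intro exI[of _ "max N1 N2"]) blast
 qed
 then obtain w where w: "w : F" "(%n. E1 m E (%x. u n x - w x)) ~~> 0"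
  using F_facts(2)[unfolded closed_form_def, rule_format, of u] un by blast
 have wl: "(%n. Ns (%x. u n x - w x)) ~~> 0"
  by (rule E1_lim(1)[OF un w])
 have we: "(%n. En (%x. u n x - w x)) ~~> 0"
  by (rule E1_lim(2)[OF un w])
 let ?d = "%x. w x - u0 x"
 have wL: "w : L2" and d: "?d : L2" using w(1) F_L2 u ip.diff by auto
 have "ip ?d ?d <= 2 * Ns (%x. u n x - w x) + 2 * Ns (%x. u n x - u0 x)" for n
  using ip.add_le[OF ip.diff[OF wL L] ip.diff[OF L u], of n n] ip.B_diff_swap[OF wL L, of n] by simp
 moreover have "(%n. 2 * Ns (%x. u n x - w x) + 2 * Ns (%x. u n x - u0 x)) ~~> 2*0+2*0"
  by (intro tendsto_intros wl lim)
 ultimately have "ip ?d ?d <= 0" using LIMSEQ_le_const by fastforce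
 hence "AE x in m. ?d x = 0" using ip_zero_AE[OF d] ip.B_nonneg[OF d] by simp
 hence ae: "AE x in m. w x = u0 x" by simp
 show u0: "u0 : F" using F_AE[OF w(1) L2_meas[OF u] ae] .
 have "En (%x. u n x - w x) = En (%x. u n x - u0 x)" for n
  by (rule E_AE2[OF EE.diff[OF un w(1)] L2_meas[OF ip.diff[OF L u]]]) (use ae in auto)
 with we show "(%n. En (%x. u n x - u0 x)) ~~> 0" by simp
qed

section \<open>Resolvents\<close>

text \<open>The weak form of v = lam (lam - L)^{-1} f for the generator L. With this normalisation
  the resolvents tend to the identity as lam grows.\<close>

definition "is_res lam f v \<longleftrightarrow> v : F & (ALL w:F. E v w = lam * ip (%x. f x - v x) w)"

text \<open>The solution minimises E v v + lam |v - f|^2 over F. By the parallelogram law a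
  minimising sequence is Cauchy for E1, closedness gives its limit, and the equation is the first
  variation, taken along the sequence with errors 1/(n+1) that vanish in the limit.\<close>

lemma res_ex: assumes f: "f : L2" and lam: "lam > 0" shows "EX v. is_res lam f v"
proof -
 define J where "J v = E v v + lam * Ns (%x. v x - f x)" for v
 have Jpos: "0 <= J v" if "v : F" for v
  unfolding J_def using lam that f by (intro add_nonneg_nonneg EE.B_nonneg mult_nonneg_nonneg ip.B_nonneg ip.diff F_L2[OF that]) auto
 define d where "d = Inf (J ` F)"
 have bdd: "bdd_below (J ` F)" using Jpos by (intro bdd_belowI2[where m=0]) auto
 have dle: "d <= J v" if "v : F" for v unfolding d_def using bdd that by (intro cInf_lower) auto
 have "EX v:F. J v < d + 1/(real n+1)" for n
  using cInf_lessD[of "J ` F" "d + 1/(real n+1)"] F_ne by (auto simp: d_def)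
 then obtain v where v: "!!n. v n : F" "!!n. J (v n) < d + 1/(real n+1)" by metis
 have vL: "v n : L2" for n using v F_L2 by auto
 have vdL: "(%x. v n x - f x) : L2" for n using vL f ip.diff by auto
 have C: "En (%x. v i x - v j x) + lam * Ns (%x. v i x - v j x)
   <= 2*(1/(real i+1) + 1/(real j+1))" for i j
 proof -
  let ?h = "%x. (v i x + v j x)/2"
  have h: "?h : F" using EE.scale[OF EE.add[OF v(1)[of i] v(1)[of j]], of "1/2"] by simp
  have "(%x. (v i x - f x + (v j x - f x))/2) = (%x. ?h x - f x)" by (auto simp: field_simps)
  hence "J (v i) + J (v j) = 2 * J ?h + 1/2 * (En (%x. v i x - v j x) + lam * Ns (%x. v i x - v j x))"
   unfolding J_def using EE.par[OF v(1)[of i] v(1)[of j]] arg_cong[OF ip.par[OF vdL[of i] vdL[of j]], of "%t. lam * t"]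
   by (simp add: algebra_simps)
  thus ?thesis using dle[OF h] v(2)[of i] v(2)[of j] by argo
 qed
 have "EX N. ALL i>=N. ALL j>=N. E1 m E (%x. v i x - v j x) < e" if e: "e > 0" for e
 proof -
  define l where "l = min 1 lam"
  have l: "l > 0" "l <= 1" "l <= lam" using lam by (auto simp: l_def)
  obtain N where N: "1/(real N+1) < e*l/4" using e l nat_approx_posE[of "e*l/4"] by (auto simp: field_simps)
  have "E1 m E (%x. v i x - v j x) < e" if "i >= N" "j >= N" for i j
  proof -
   have "1/(real i+1) <= 1/(real N+1)" "1/(real j+1) <= 1/(real N+1)" using that by (auto simp: frac_le)
   hence "2*(1/(real i+1) + 1/(real j+1)) < e*l" using N by simp
   moreover have "l * E1 m E (%x. v i x - v j x) <= En (%x. v i x - v j x) + lam * Ns (%x. v i x - v j x)"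
    unfolding E1_def nsq distrib_left using l
    by (intro add_mono mult_right_mono mult_left_le_one_le) (auto intro!: EE.B_nonneg ip.B_nonneg EE.diff ip.diff vL v)
   ultimately have "l * E1 m E (%x. v i x - v j x) < l * e" using C[of i j] by (simp add: mult.commute)
   thus ?thesis using l by simp
  qed
  thus ?thesis by blast
 qed
 then obtain w where w: "w : F" "(%n. E1 m E (%x. v n x - w x)) ~~> 0"
  using F_facts(2)[unfolded closed_form_def, rule_format, of v] v(1) by blast
 have wl: "(%n. Ns (%x. v n x - w x)) ~~> 0"
  by (rule E1_lim(1)[OF v(1) w])
 have we: "(%n. En (%x. v n x - w x)) ~~> 0"
  by (rule E1_lim(2)[OF v(1) w])
 have "E w g = lam * ip (%x. f x - w x) g" if g: "g : F" for g
 proof -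
  have gL: "g : L2" and wL: "w : L2" using g w F_L2 by auto
  define q where "q = E g g + lam * ip g g"
  define p where "p n = E (v n) g + lam * ip (%x. v n x - f x) g" for n
  define p0 where "p0 = E w g + lam * (ip w g - ip f g)"
  have pl: "p ~~> p0" unfolding p_def p0_def ip.B_diff[OF vL f gL]
   by (intro tendsto_intros EE.lim1 ip.lim1 v w g we wl vL wL gL)
  have "0 <= 0 + 2* s*p0 + s^2*q" for s
  proof -
   have "- (1/(real n+1)) <= 2* s*p n + s^2*q" for n
   proof -
    have vs: "(%x. v n x + s * g x) : F" using v g EE.add EE.scale by auto
    have "(%x. v n x + s * g x - f x) = (%x. (v n x - f x) + s * g x)" by (auto simp: algebra_simps)
    hence "J (%x. v n x + s * g x) = J (v n) + 2* s*p n + s^2*q"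
     unfolding J_def p_def q_def using EE.B_exp[OF v(1) g, of n s] ip.B_exp[OF vdL gL, of n s]
     by (simp add: algebra_simps)
    thus ?thesis using dle[OF vs] v(2)[of n] by simp
   qed
   moreover have "(%n. 2* s*p n + s^2*q) ~~> 2* s*p0 + s^2*q" by (intro tendsto_intros pl)
   moreover have "(%n. - (1/(real n+1))) ~~> - 0" using LIMSEQ_inverse_real_of_nat
    by (intro tendsto_minus) (simp add: inverse_eq_divide add.commute)
   ultimately show ?thesis using LIMSEQ_le[of "%n. - (1/(real n+1))" "-0"] by auto
  qed
  moreover have "0 <= q" unfolding q_def using lam by (intro add_nonneg_nonneg mult_nonneg_nonneg EE.B_nonneg ip.B_nonneg g gL) auto
  ultimately have "p0^2 <= 0 * q" by (rule quad_cs)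
  thus ?thesis by (simp add: p0_def ip.B_diff[OF f wL gL] algebra_simps)
 qed
 thus ?thesis using w(1) by (auto simp: is_res_def)
qed

definition "R lam f = (SOME v. is_res lam f v)"

context
 fixes lam :: real and f assumes f: "f : L2" and lam: "lam > 0"
begin

lemma R_F: "R lam f : F" and E_R: "w : F ==> E (R lam f) w = lam * ip (%x. f x - R lam f x) w"
 using someI_ex[OF res_ex[OF f lam]] by (auto simp: R_def is_res_def)

lemma R_L2: "R lam f : L2" by (intro F_L2 R_F)

text \<open>Both bounds come from expanding around the pairing of f - R f with R f, which equals the
  energy of R f divided by lam and so is nonnegative.\<close>

lemma E_R_self: "En (R lam f) <= lam * ip (%x. f x - R lam f x) f"
  "Ns (%x. f x - R lam f x) <= ip (%x. f x - R lam f x) f"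
proof -
 note d = ip.diff[OF f R_L2]
 have a: "En (R lam f) = lam * ip (%x. f x - R lam f x) (R lam f)" by (rule E_R[OF R_F])
 have b: "Ns (%x. f x - R lam f x) = ip (%x. f x - R lam f x) f - ip (%x. f x - R lam f x) (R lam f)"
  using ip.B_diff_right[OF f R_L2 d] .
 have c: "0 <= ip (%x. f x - R lam f x) (R lam f)"
  using EE.B_nonneg[OF R_F] lam unfolding a by (simp add: zero_le_mult_iff)
 show "Ns (%x. f x - R lam f x) <= ip (%x. f x - R lam f x) f" using b c by simp
 show "En (R lam f) <= lam * ip (%x. f x - R lam f x) f"
  unfolding a using b ip.B_nonneg[OF d] lam by simp
qed
end

text \<open>A converse to Cauchy-Schwarz. In \<open>H\<close> the function v lies in the domain of
  the generator and h = -Lv, so \<open>ip h u\<close> is what E v u would be if u were in F. Taking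
  v to be a resolvent of u bounds the resolvent energies by M; these increase, hence the resolvents
  converge in energy to u.\<close>

lemma form_domain_criterion:
 assumes u: "u : L2" and M: "0 <= M"
  and H: "!!v h. v : F ==> h : L2 ==> (!!w. w : F ==> E v w = ip h w) ==> abs (ip h u) <= sqrt M * sqrt (E v v)"
 shows "u : F" "E u u <= M" "(%n. En (%x. R (real (Suc n)) u x - u x)) ~~> 0"
  "(%n. Ns (%x. R (real (Suc n)) u x - u x)) ~~> 0"
proof -
 define l where "l n = real (Suc n)" for n
 define T where "T n = R (l n) u" for n
 have l: "l n > 0" for n by (simp add: l_def)
 have TF: "T n : F" and TL: "T n : L2" for n using R_F[OF u l] R_L2[OF u l] by (auto simp: T_def)
 have ET: "w : F ==> E (T n) w = l n * ip (%x. u x - T n x) w" for n w unfolding T_def by (rule E_R[OF u l])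
 note d = ip.diff[OF u TL]
 have bd: "En (T n) <= M & Ns (%x. T n x - u x) <= M / l n" for n
 proof -
  have *: "l n * ip (%x. u x - T n x) u <= sqrt M * sqrt (En (T n))"
   using H[OF TF ip.scale[OF d], of n "l n" n] ET by (simp add: ip.B_simps d u F_L2)
  hence "En (T n) <= sqrt M * sqrt (En (T n))"
   using E_R_self(1)[OF u l] unfolding T_def[symmetric] by (meson order_trans)
  hence 1: "sqrt (En (T n)) <= sqrt M"
   using le_sqrt_self[OF EE.B_nonneg[OF TF, of n] M] by simp
  have "l n * ip (%x. u x - T n x) u <= sqrt M * sqrt M"
   using * mult_left_mono[OF 1, of "sqrt M"] M by simp
  hence "l n * Ns (%x. u x - T n x) <= M"
   using E_R_self(2)[OF u l, of n] mult_left_mono[OF E_R_self(2)[OF u l, of n] less_imp_le[OF l[of n]]] M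
   unfolding T_def[symmetric] by simp
  thus ?thesis using 1 l[of n] ip.B_diff_swap[OF u TL] by (simp add: field_simps)
 qed
 have TL2: "(%n. Ns (%x. T n x - u x)) ~~> 0"
 proof (rule tendsto_sandwich[OF _ _ tendsto_const])
  show "(%n. M / l n) ~~> 0" unfolding l_def
   using LIMSEQ_Suc[OF lim_const_over_n[of M]] by simp
 qed (use bd in "auto intro!: always_eventually ip.B_nonneg ip.diff TL u")
 \<comment> \<open>Energies of resolvents increase with the parameter, and their increments dominate
   the energies of the differences; boundedness therefore gives the Cauchy property.\<close>
 have inc: "En (%x. T j x - T i x) <= En (T j) - En (T i)" if ij: "i <= j" for i j
 proof -
  let ?d = "%x. T j x - T i x"
  have dF: "?d : F" and dL: "?d : L2" by (auto intro!: EE.diff ip.diff TF TL)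
  have 1: "E (T i) ?d = l i * ip (%x. u x - T i x) ?d" "E (T j) ?d = l j * ip (%x. u x - T j x) ?d" using ET dF by auto
  have 2: "ip (%x. u x - T i x) ?d = ip (%x. u x - T j x) ?d + ip ?d ?d"
   using ip.B_add[OF d dL dL, of j] by simp
  have 3: "E ?d ?d = E (T j) ?d - E (T i) ?d" using EE.B_diff[OF TF TF dF] .
  \<comment> \<open>A negative value would force the energy of \<open>?d\<close> to vanish, hence by
    Cauchy-Schwarz \<open>E (T i) ?d = 0\<close>, although this is \<open>l i\<close> times the
    negative number.\<close>
  have "0 <= ip (%x. u x - T i x) ?d"
  proof (rule ccontr)
   assume n: "~ 0 <= ip (%x. u x - T i x) ?d"
   have "E ?d ?d = (l j - l i) * ip (%x. u x - T i x) ?d - l j * ip ?d ?d"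
    using 1 2 3 by (simp add: algebra_simps)
   moreover have "0 <= ip ?d ?d" by (rule ip.B_nonneg[OF dL])
   ultimately have "E ?d ?d <= (l j - l i) * ip (%x. u x - T i x) ?d" using l[of j] by simp
   also have "... <= 0" using n ij by (simp add: l_def mult_nonneg_nonpos)
   finally have z: "E ?d ?d = 0" using EE.B_nonneg[OF dF] by simp
   have "(E (T i) ?d)^2 <= 0" using EE.CS[OF TF dF, of i] z by simp
   thus False using 1 n l[of i] by simp
  qed
  hence "0 <= l i * ip (%x. u x - T i x) ?d" using l[of i] by (intro mult_nonneg_nonneg) auto
  hence "En (T i) <= E (T i) (T j)"
   using 1(1) EE.B_diff_right[OF TF[of j] TF[of i] TF[of i]] by linarith
  thus ?thesis using EE.B_exp_diff[OF TF TF, of j i] EE.B_sym[OF TF TF, of i j] by simp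
 qed
 have "incseq (%n. En (T n))"
  using order_trans[OF EE.B_nonneg[OF EE.diff[OF TF TF]] inc] by (intro monoI) simp
 hence "convergent (%n. En (T n))" using bd
  by (intro Bseq_mono_convergent BseqI'[of _ M]) (auto dest: monoD simp: EE.B_nonneg TF)
 hence "Cauchy (%n. En (T n))" by (rule convergent_Cauchy)
 hence cau: "EX N. ALL i>=N. ALL j>=N. En (%x. T i x - T j x) < e" if e: "e > 0" for e
 proof -
  obtain N where N: "!!i j. i >= N ==> j >= N ==> abs (En (T i) - En (T j)) < e"
   using \<open>Cauchy _\<close> e unfolding Cauchy_def dist_real_def by blast
  have "En (%x. T i x - T j x) < e" if "i >= N" "j >= N" for i j
   using inc[of i j] inc[of j i] N[OF that] EE.B_diff_swap[OF TF TF, of i j] by (cases "i <= j") auto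
  thus ?thesis by blast
 qed
 show uF: "u : F" and El: "(%n. En (%x. R (real (Suc n)) u x - u x)) ~~> 0"
  using E_closed[OF TF u TL2 cau] by (auto simp: T_def l_def)
 show "(%n. Ns (%x. R (real (Suc n)) u x - u x)) ~~> 0"
  using TL2 by (simp add: T_def l_def)
 have "(%n. En (T n)) ~~> E u u" using EE.lim2[OF TF uF] El by (simp add: T_def l_def)
 thus "E u u <= M" using bd by (intro LIMSEQ_le_const2[of _ "E u u" M]) auto
qed

lemma R_tendsto: assumes u: "u : F"
 shows "(%n. En (%x. R (real (Suc n)) u x - u x)) ~~> 0"
  "(%n. Ns (%x. R (real (Suc n)) u x - u x)) ~~> 0"
proof -
 have "abs (ip h u) <= sqrt (E u u) * sqrt (E v v)" if "v : F" "!!w. w : F ==> E v w = ip h w" for v h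
  using EE.CS_abs[OF that(1) u] that(2)[OF u] by (simp add: mult.commute)
 note * = form_domain_criterion(3,4)[OF F_L2[OF u] EE.B_nonneg[OF u] this]
 show "(%n. En (%x. R (real (Suc n)) u x - u x)) ~~> 0"
  "(%n. Ns (%x. R (real (Suc n)) u x - u x)) ~~> 0"
  by (rule *; assumption)+
qed

text \<open>Lower semicontinuity and weak convergence without weak compactness: the limit passes
  through the L^2 pairing in \<open>form_domain_criterion\<close>, and an arbitrary test function g
  is replaced by a resolvent of g, against which E is again an L^2 pairing.\<close>

lemma E_limit:
 assumes un: "!!n. u n : F" and u: "u0 : L2"
  and lim: "(%n. Ns (%x. u n x - u0 x)) ~~> 0"
  and bd: "!!n. En (u n) <= M"
 shows "u0 : F" "E u0 u0 <= M" "g : F ==> (%n. E (u n) g) ~~> E u0 g"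
proof -
 have M: "0 <= M" using bd[of 0] EE.B_nonneg[OF un[of 0]] by simp
 have L: "u n : L2" for n by (intro F_L2 un)
 have H: "abs (ip h u0) <= sqrt M * sqrt (E v v)" if "v : F" "h : L2" "!!w. w : F ==> E v w = ip h w" for v h
 proof (rule LIMSEQ_le_const2)
  show "(%n. abs (ip (u n) h)) ~~> abs (ip h u0)"
   using ip.lim1[OF L u that(2) lim] ip.B_sym[OF u that(2)] by (simp add: tendsto_rabs)
  have "abs (ip (u n) h) <= sqrt M * sqrt (E v v)" for n
  proof -
   have "abs (ip (u n) h) = abs (E v (u n))" using that(3)[OF un] ip.B_sym[OF L that(2)] by simp
   also have "... <= sqrt (E v v) * sqrt (En (u n))" by (rule EE.CS_abs[OF that(1) un])
   also have "... <= sqrt (E v v) * sqrt M" using bd EE.B_nonneg[OF that(1)] by (intro mult_left_mono) auto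
   finally show ?thesis by (simp add: mult.commute)
  qed
  thus "EX N. ALL n>=N. abs (ip (u n) h) <= sqrt M * sqrt (E v v)" by blast
 qed
 show u0: "u0 : F" and E0: "E u0 u0 <= M" using form_domain_criterion(1,2)[OF u M H] by blast+
 assume g: "g : F"
 show "(%n. E (u n) g) ~~> E u0 g"
 proof (rule LIMSEQ_I)
  fix e :: real assume e: "e > 0"
  \<comment> \<open>With this choice the two errors from replacing g by its resolvent add up to at
    most e/2.\<close>
  define c where "c = 4 * (sqrt M + 1)"
  have c: "c > 0" using M by (simp add: c_def add_nonneg_pos)
  obtain k where k: "En (%x. R (real (Suc k)) g x - g x) < (e/c)^2"
   using order_tendstoD(2)[OF R_tendsto(1)[OF g], of "(e/c)^2"] e c by (auto simp: eventually_sequentially)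
  define v where "v = R (real (Suc k)) g"
  define h where "h = (%x. real (Suc k) * (g x - v x))"
  have v: "v : F" unfolding v_def by (rule R_F[OF F_L2[OF g]]) simp
  have h: "h : L2" unfolding h_def by (intro ip.scale ip.diff F_L2 g v)
  have vh: "E v w = ip h w" if "w : F" for w
   using E_R[OF F_L2[OF g], of "real (Suc k)" w] that ip.B_scale[OF ip.diff[OF F_L2[OF g] F_L2[OF v]] F_L2[OF that], of "real (Suc k)"]
   by (simp add: v_def h_def)
  have sm: "sqrt (En (%x. v x - g x)) < e/c"
   using k e c unfolding v_def[symmetric] by (intro real_less_lsqrt) auto
  have "(%n. ip (u n) h) ~~> ip u0 h" by (rule ip.lim1[OF L u h lim])
  then obtain N where N: "!!n. n >= N ==> abs (ip (u n) h - ip u0 h) < e/2"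
   using e LIMSEQ_D[of _ _ "e/2"] by fastforce
  have "norm (E (u n) g - E u0 g) < e" if "n >= N" for n
  proof -
   have A: "abs (E w (%x. v x - g x)) <= sqrt M * (e/c)" if w: "w : F" "E w w <= M" for w
    using EE.CS_abs[OF w(1) EE.diff[OF v g]] mult_mono[of "sqrt (E w w)" "sqrt M" "sqrt (En (%x. v x - g x))" "e/c"] w sm M EE.B_nonneg[OF EE.diff[OF v g]]
    by simp
   have "E (u n) g - E u0 g = (E (u n) v - E u0 v) - E (u n) (%x. v x - g x) + E u0 (%x. v x - g x)"
    using EE.B_diff_right[OF v g] un u0 by simp
   moreover have "E (u n) v - E u0 v = ip (u n) h - ip u0 h"
    using vh[OF un, of n] vh[OF u0] EE.B_sym[OF v un, of n] EE.B_sym[OF v u0] ip.B_sym[OF h L, of n] ip.B_sym[OF h u] by simp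
   moreover have "2 * (sqrt M * (e/c)) <= e/2" using M e c by (simp add: c_def field_simps)
   ultimately show ?thesis using N[OF that] A[OF un bd, of n] A[OF u0 E0] unfolding real_norm_def by argo
  qed
  thus "EX no. ALL n>=no. norm (E (u n) g - E u0 g) < e" by blast
 qed
qed

text \<open>In a Hilbert space, weak convergence with norms not exceeding the norm of the limit is
  strong convergence.\<close>

lemma E_limit_strong:
 assumes "!!n. u n : F" "u0 : F" "(%n. Ns (%x. u n x - u0 x)) ~~> 0"
  "!!n. En (u n) <= E u0 u0"
 shows "(%n. En (%x. u n x - u0 x)) ~~> 0"
proof (rule tendsto_sandwich[OF _ _ tendsto_const])
 have "(%n. 2 * E u0 u0 - 2 * E (u n) u0) ~~> 2 * E u0 u0 - 2 * E u0 u0"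
  by (intro tendsto_intros E_limit(3)[OF assms(1) F_L2[OF assms(2)] assms(3,4)] assms(2))
 thus "(%n. 2 * E u0 u0 - 2 * E (u n) u0) ~~> 0" by simp
qed (use EE.B_exp_diff[OF assms(1,2)] assms(4) in "auto intro!: always_eventually EE.B_nonneg EE.diff assms simp: algebra_simps")

end

section \<open>Contractions and products\<close>

text \<open>The sum is a Riemann sum of step h for the integral of 2 (t - s)^+ over s > 0, which is
  t^2. It writes a square as a combination of cut-offs (t - kh)^+, to which the Markov property
  applies; p_k^2 - p_{k+1}^2 telescopes.\<close>

lemma riemann_square:
 fixes t h :: real assumes "0 <= t" "t <= n * h" "h > 0"
 shows "abs ((\<Sum>k<n. 2 * h * max 0 (t - real k * h)) - t^2) <= 2 * h * t"
proof -
 define p where "p k = max 0 (t - real k * h)" for k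
 have st: "abs (2 * h * p k - ((p k)^2 - (p (Suc k))^2)) <= 2 * h * (p k - p (Suc k))" for k
 proof -
  consider "t <= real k * h" | "real k * h < t" "t < real k * h + h" | "real k * h + h <= t" by linarith
  thus ?thesis
  proof cases
   case 1 hence "p k = 0" "p (Suc k) = 0" using assms by (auto simp: p_def algebra_simps)
   thus ?thesis by simp
  next
   case 2 hence p: "0 < p k" "p k < h" "p (Suc k) = 0" by (auto simp: p_def algebra_simps)
   have "p k * p k <= p k * h" using p by (intro mult_left_mono) auto
   thus ?thesis using p by (simp add: power2_eq_square abs_le_iff mult.commute)
  next
   case 3 hence pk: "p k = p (Suc k) + h" using assms by (auto simp: p_def algebra_simps)
   have "2 * h * p k - ((p k)^2 - (p (Suc k))^2) = h^2" unfolding pk by (simp add: power2_eq_square algebra_simps)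
   thus ?thesis unfolding pk by (simp add: power2_eq_square)
  qed
 qed
 have "abs ((\<Sum>k<n. 2 * h * p k) - (\<Sum>k<n. (p k)^2 - (p (Suc k))^2)) <= (\<Sum>k<n. 2 * h * (p k - p (Suc k)))"
  unfolding sum_subtractf[symmetric] using st by (intro order_trans[OF sum_abs] sum_mono)
 also have "... = 2 * h * (p 0 - p n)" by (simp add: sum_distrib_left[symmetric] sum_lessThan_telescope')
 also have "... <= 2 * h * t" using assms by (intro mult_left_mono) (auto simp: p_def)
 finally have 1: "abs ((\<Sum>k<n. 2 * h * p k) - (\<Sum>k<n. (p k)^2 - (p (Suc k))^2)) <= 2 * h * t" .
 have "(\<Sum>k<n. (p k)^2 - (p (Suc k))^2) = t^2"
  unfolding sum_lessThan_telescope'[of "%k. (p k)^2" n] using assms by (simp add: p_def)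
 thus ?thesis using 1 by (simp add: p_def)
qed

lemma (in psd) B_uminus2: "f : S ==> B (%x. - f x) (%x. - f x) = B f f"
 using B_uminus[of f "%x. - f x"] B_scale_right[of f f "-1"] by (simp add: uminus)

context mmd begin

lemma L2_bound: assumes "f : L2" and [measurable]: "g : borel_measurable borel" and "!!x. abs (g x) <= abs (f x)"
 shows "g : L2"
proof -
 have "integrable m (%x. (g x)^2)"
  by (rule Bochner_Integration.integrable_bound[where f = "%x. (f x)^2"]) (use assms in "auto simp: L2_iff abs_le_square_iff[symmetric]")
 thus ?thesis by (simp add: L2_iff)
qed

lemma ip_dct: assumes u[measurable]: "!!n. u n : borel_measurable borel" and [measurable]: "v : borel_measurable borel"
  and w: "w : L2" and b: "!!n x. abs (u n x - v x) <= abs (w x)" and l: "!!x. (%n. u n x) ~~> v x"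
 shows "(%n. Ns (%x. u n x - v x)) ~~> 0"
proof -
 have [measurable]: "w : borel_measurable borel" using w by (rule L2_meas)
 have "(%n. \<integral>x. (u n x - v x)^2 \<partial>m) ~~> (\<integral>x. 0 \<partial>m)"
 proof (rule integral_dominated_convergence[where w = "%x. (w x)^2"])
  show "AE x in m. (%n. (u n x - v x)^2) ~~> 0"
   using tendsto_power[OF LIM_zero[OF l], where n = 2] by simp
  show "AE x in m. norm ((u n x - v x)^2) <= (w x)^2" for n
   using b[of n] by (simp add: abs_le_square_iff[symmetric])
 qed (use w in "auto simp: L2_iff")
 thus ?thesis by (simp add: ip_def power2_eq_square)
qed

lemma clip: assumes "f : F" "0 <= c"
 shows "(%x. max 0 (min (f x) c)) : F" "En (%x. max 0 (min (f x) c)) <= E f f"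
proof -
 define g where "g x = max 0 (min (1/c * f x) 1)" for x
 have *: "(%x. max 0 (min (f x) c)) = (%x. c * g x)"
  using assms(2) by (auto simp: g_def fun_eq_iff max_def min_def field_simps)
 have a: "(%x. 1/c * f x) : F" by (rule EE.scale[OF assms(1)])
 have g: "g : F" "E g g <= En (%x. 1/c * f x)"
  using F_facts(3) a unfolding markovian_form_def g_def by auto
 show "(%x. max 0 (min (f x) c)) : F" unfolding * by (rule EE.scale[OF g(1)])
 have "En (%x. 1/c * f x) = 1/c^2 * E f f"
  unfolding EE.B_scale[OF assms(1) a] EE.B_scale_right[OF assms(1,1)] by (simp add: power2_eq_square)
 hence "c^2 * E g g <= c^2 * (1/c^2 * E f f)"
  using g(2) by (intro mult_left_mono) auto
 also have "... <= E f f" using EE.B_nonneg[OF assms(1)] by simp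
 finally show "En (%x. max 0 (min (f x) c)) <= E f f"
  unfolding * using g(1) by (simp add: EE.B_simps power2_eq_square)
qed

text \<open>The positive part is an L^2 limit of clips of energy at most \<open>E f f\<close>. The
  clips of f are also the clips of its positive part, so their energies do not exceed that of the
  limit, and convergence is strong.\<close>

lemma F_pos: assumes f: "f : F"
 shows "(%x. max 0 (f x)) : F" "En (%x. max 0 (f x)) <= E f f"
  "(%n. En (%x. max 0 (min (f x) (real n)) - max 0 (f x))) ~~> 0"
proof -
 note [measurable] = F_meas[OF f]
 have lim: "(%n. Ns (%x. max 0 (min (f x) (real n)) - max 0 (f x))) ~~> 0"
 proof (rule ip_dct[where w = f])
  show "(%n. max 0 (min (f x) (real n))) ~~> max 0 (f x)" for x
  proof (rule tendsto_eventually)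
   obtain N where "f x <= real N" using real_arch_simple by blast
   thus "\<forall>\<^sub>F n in sequentially. max 0 (min (f x) (real n)) = max 0 (f x)"
    by (auto simp: eventually_sequentially intro!: exI[of _ N])
  qed
 qed (use F_L2[OF f] in auto)
 have L: "(%x. max 0 (f x)) : L2" by (rule L2_bound[OF F_L2[OF f]]) auto
 note * = E_limit[OF clip(1)[OF f] L lim clip(2)[OF f]]
 show F: "(%x. max 0 (f x)) : F" "En (%x. max 0 (f x)) <= E f f" using *(1,2) by auto
 have eq: "max 0 (min (max 0 (f x)) (real n)) = max 0 (min (f x) (real n))" for x n by auto
 show "(%n. En (%x. max 0 (min (f x) (real n)) - max 0 (f x))) ~~> 0"
 proof (rule E_limit_strong[OF clip(1)[OF f] F(1) lim])
  show "En (%x. max 0 (min (f x) (real n))) <= En (%x. max 0 (f x))" for n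
   using clip(2)[OF F(1), of "real n"] unfolding eq by simp
 qed simp
qed

definition "trunc n f = (%x. max (- real n) (min (f x) (real n)))"

lemma trunc: assumes f: "f : F"
 shows "trunc n f : F" "(%n. En (%x. trunc n f x - f x)) ~~> 0"
proof -
 define a where "a n x = max 0 (min (f x) (real n)) - max 0 (f x)" for n :: nat and x
 define b where "b n x = max 0 (min (- f x) (real n)) - max 0 (- f x)" for n :: nat and x
 note g = EE.uminus[OF f]
 have t: "trunc n f = (%x. max 0 (min (f x) (real n)) - max 0 (min (- f x) (real n)))" for n
  by (auto simp: trunc_def fun_eq_iff)
 have d: "(%x. trunc n f x - f x) = (%x. a n x - b n x)" for n by (auto simp: t a_def b_def fun_eq_iff)
 show "trunc n f : F" unfolding t by (intro EE.diff clip f g) auto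
 have ab: "a n : F" "b n : F" for n unfolding a_def b_def by (intro EE.diff clip F_pos f g; simp)+
 have l: "(%n. En (a n)) ~~> 0" "(%n. En (b n)) ~~> 0"
  using F_pos(3)[OF f] F_pos(3)[OF g] unfolding a_def b_def by auto
 have "(%n. 2 * En (a n) + 2 * En (b n)) ~~> 2 * 0 + 2 * 0" by (intro tendsto_intros l)
 hence l2: "(%n. 2 * En (a n) + 2 * En (b n)) ~~> 0" by simp
 have "En (%x. a n x - b n x) <= 2 * En (a n) + 2 * En (b n)" for n
  using EE.add_le[OF ab(1) EE.uminus[OF ab(2)], of n n] EE.B_uminus2[OF ab(2), of n] by simp
 thus "(%n. En (%x. trunc n f x - f x)) ~~> 0"
  unfolding d using EE.B_nonneg[OF EE.diff[OF ab]] by (intro Lim_null_comparison[OF always_eventually l2]) auto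
qed

lemma band: assumes "f : F" "0 <= a" "0 <= b"
 shows "(%x. max 0 (min (f x - a) b)) : F" "En (%x. max 0 (min (f x - a) b)) <= 4 * E f f"
proof -
 define p where "p x = max 0 (min (f x) (a + b))" for x
 define q where "q x = max 0 (min (f x) a)" for x
 have *: "(%x. max 0 (min (f x - a) b)) = (%x. p x - q x)" using assms by (auto simp: p_def q_def fun_eq_iff)
 have pq: "p : F" "q : F" "E p p <= E f f" "E q q <= E f f" using clip[OF assms(1)] assms(2,3) unfolding p_def q_def by auto
 show "(%x. max 0 (min (f x - a) b)) : F" unfolding * by (intro EE.diff pq)
 have "sqrt (En (%x. p x - q x)) <= 2 * sqrt (E f f)"
  using EE.tri_diff[OF pq(1,2)] real_sqrt_le_mono[OF pq(3)] real_sqrt_le_mono[OF pq(4)] by linarith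
 hence "sqrt (En (%x. p x - q x)) <= sqrt (4 * E f f)" by (simp add: real_sqrt_mult)
 thus "En (%x. max 0 (min (f x - a) b)) <= 4 * E f f" unfolding * by simp
qed

lemma F_excess: assumes "f : F" "0 <= a"
 shows "(%x. max 0 (f x - a)) : F" "sqrt (En (%x. max 0 (f x - a))) <= 2 * sqrt (E f f)"
proof -
 define q where "q x = max 0 (min (f x) a)" for x
 have *: "(%x. max 0 (f x - a)) = (%x. max 0 (f x) - q x)" using assms by (auto simp: q_def fun_eq_iff)
 have pq: "q : F" "E q q <= E f f" using clip[OF assms] unfolding q_def by auto
 show "(%x. max 0 (f x - a)) : F" unfolding * by (intro EE.diff pq F_pos assms)
 show "sqrt (En (%x. max 0 (f x - a))) <= 2 * sqrt (E f f)" unfolding *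
  using EE.tri_diff[OF F_pos(1)[OF assms(1)] pq(1)] real_sqrt_le_mono[OF pq(2)] real_sqrt_le_mono[OF F_pos(2)[OF assms(1)]] by linarith
qed

text \<open>The approximants from \<open>riemann_square\<close> have n+1 terms of root energy at
  most 4 h times the root energy of f, and (n+1) h = M. The bound is thus uniform in n and survives
  the L^2 limit.\<close>

lemma F_square_pos: assumes f: "f : F" and b: "!!x. 0 <= f x" "!!x. f x <= M" and M: "M > 0"
 shows "(%x. (f x)^2) : F" "En (%x. (f x)^2) <= 16 * M^2 * E f f"
proof -
 note [measurable] = F_meas[OF f]
 define h where "h n = M / real (Suc n)" for n
 have h: "h n > 0" "real (Suc n) * h n = M" for n using M by (auto simp: h_def)
 have h0: "h ~~> 0" unfolding h_def using LIMSEQ_Suc[OF lim_const_over_n[of M]] by simp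
 define u where "u n x = (\<Sum>k<Suc n. 2 * h n * max 0 (f x - real k * h n))" for n x
 have uk: "(%x. 2 * h n * max 0 (f x - real k * h n)) : F" for n k
  using h(1)[of n] by (intro EE.scale F_excess f) auto
 have uF: "u n : F" for n unfolding u_def by (rule EE.sum) (use F_ne uk in auto)
 note [measurable] = F_meas[OF uF]
 have e: "abs (u n x - (f x)^2) <= 2 * h n * f x" for n x
  unfolding u_def using riemann_square[of "f x" "Suc n" "h n"] h b by simp
 have hM: "h n <= M" for n using M by (simp add: h_def field_simps)
 have fL: "(%x. (f x)^2) : L2" using b M
  by (intro L2_bound[OF L2_scale[OF F_L2[OF f], of M]]) (auto simp: power2_eq_square abs_mult intro!: mult_right_mono)
 have lim: "(%n. Ns (%x. u n x - (f x)^2)) ~~> 0"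
 proof (rule ip_dct[where w = "%x. 2 * M * f x"])
  show "(%x. 2 * M * f x) : L2" by (intro L2_scale F_L2 f)
  fix n x
  have "2 * h n * f x <= 2 * M * f x" using hM b by (intro mult_right_mono) auto
  thus "abs (u n x - (f x)^2) <= abs (2 * M * f x)" using e[of n x] by simp
  have "(%n. 2 * h n * f x) ~~> 2 * 0 * f x" by (intro tendsto_intros h0)
  hence "(%n. 2 * h n * f x) ~~> 0" by simp
  from Lim_null_comparison[OF always_eventually this, of "%n. u n x - (f x)^2"] e
  show "(%n. u n x) ~~> (f x)^2" by (auto intro: LIM_zero_cancel)
 qed auto
 have Eu: "En (u n) <= 16 * M^2 * E f f" for n
 proof -
  have "sqrt (En (u n)) <= (\<Sum>k<Suc n. sqrt (En (%x. 2 * h n * max 0 (f x - real k * h n))))"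
   unfolding u_def by (rule EE.tri_sum) (use F_ne uk in auto)
  also have "... <= (\<Sum>k<Suc n. 4 * h n * sqrt (E f f))"
  proof (rule sum_mono)
   fix k
   have x: "(%x. max 0 (f x - real k * h n)) : F" using h(1)[of n] by (intro F_excess f) auto
   have "sqrt (En (%x. 2 * h n * max 0 (f x - real k * h n)))
    = 2 * h n * sqrt (En (%x. max 0 (f x - real k * h n)))"
    using EE.B_scale[OF x EE.scale[OF x], of "2 * h n" "2 * h n"] EE.B_scale_right[OF x x] h(1)[of n]
    by (simp add: real_sqrt_mult mult.assoc[symmetric])
   also have "... <= 2 * h n * (2 * sqrt (E f f))"
    using F_excess(2)[OF f, of "real k * h n"] h(1)[of n] by (intro mult_left_mono) auto
   finally show "sqrt (En (%x. 2 * h n * max 0 (f x - real k * h n))) <= 4 * h n * sqrt (E f f)" by simp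
  qed
  also have "... = 4 * (real (Suc n) * h n) * sqrt (E f f)" by simp
  also have "... = sqrt (16 * M^2 * E f f)" unfolding h(2) using M by (simp add: real_sqrt_mult)
  finally show ?thesis by simp
 qed
 show "(%x. (f x)^2) : F" "En (%x. (f x)^2) <= 16 * M^2 * E f f"
  by (rule E_limit(1,2)[OF uF fL lim Eu])+
qed

lemma F_square: assumes f: "f : F" and b: "!!x. abs (f x) <= M" and M: "M > 0"
 shows "(%x. (f x)^2) : F" "En (%x. (f x)^2) <= 64 * M^2 * E f f"
proof -
 define p where "p x = max 0 (f x)" for x
 define q where "q x = max 0 (- f x)" for x
 have pq: "p : F" "q : F" "E p p <= E f f" "E q q <= E f f"
  using F_pos(1,2)[OF f] F_pos(1,2)[OF EE.uminus[OF f]] EE.B_uminus2[OF f]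
  unfolding p_def q_def by auto
 have B: "0 <= p x" "p x <= M" "0 <= q x" "q x <= M" for x using b[of x] by (auto simp: p_def q_def)
 note P = F_square_pos[OF pq(1) B(1,2) M] and Q = F_square_pos[OF pq(2) B(3,4) M]
 have eq: "(%x. (f x)^2) = (%x. (p x)^2 + (q x)^2)" by (auto simp: p_def q_def fun_eq_iff max_def)
 show "(%x. (f x)^2) : F" unfolding eq by (intro EE.add P Q)
 have "16 * M^2 * E p p <= 16 * M^2 * E f f" "16 * M^2 * E q q <= 16 * M^2 * E f f" using pq by (auto intro!: mult_left_mono)
 thus "En (%x. (f x)^2) <= 64 * M^2 * E f f" unfolding eq using EE.add_le[OF P(1) Q(1)] P(2) Q(2) by simp
qed

text \<open>Polarisation: f g is a quarter of the difference of the squares of f + g and f - g. Only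
  the form of the bound matters later, not its size.\<close>

lemma F_prod0: assumes f: "f : F" "!!x. abs (f x) <= M" and g: "g : F" "!!x. abs (g x) <= M" and M: "M > 0"
 shows "(%x. f x * g x) : F" "En (%x. f x * g x) <= 64 * M^2 * (E f f + E g g)"
proof -
 have b: "abs (f x + g x) <= 2 * M" "abs (f x - g x) <= 2 * M" for x using f(2)[of x] g(2)[of x] by linarith+
 note P = F_square[OF EE.add[OF f(1) g(1)] b(1)] and Q = F_square[OF EE.diff[OF f(1) g(1)] b(2)]
 define p where "p x = (f x + g x)^2" for x
 define q where "q x = (f x - g x)^2" for x
 have P: "p : F" "E p p <= 256 * M^2 * En (%x. f x + g x)" and
  Q: "q : F" "E q q <= 256 * M^2 * En (%x. f x - g x)" using P Q M by (auto simp: p_def[abs_def] q_def[abs_def] power_mult_distrib)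
 have eq: "(%x. f x * g x) = (%x. 1/4 * (p x - q x))" by (auto simp: p_def q_def fun_eq_iff power2_eq_square field_simps)
 show "(%x. f x * g x) : F" unfolding eq by (intro EE.scale EE.diff P Q)
 have "En (%x. f x * g x) = 1/16 * En (%x. p x - q x)"
  unfolding eq using EE.B_scale[OF EE.diff[OF P(1) Q(1)] EE.scale[OF EE.diff[OF P(1) Q(1)]], of "1/4" "1/4"]
  EE.B_scale_right[OF EE.diff[OF P(1) Q(1)] EE.diff[OF P(1) Q(1)], of "1/4"] by simp
 also have "... <= 1/8 * (E p p + E q q)"
  using EE.B_exp_diff[OF P(1) Q(1)] EE.B_exp[OF P(1) Q(1), of 1] EE.B_nonneg[OF EE.add[OF P(1) Q(1)]] by simp
 also have "... <= 1/8 * (256 * M^2 * (En (%x. f x + g x) + En (%x. f x - g x)))"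
  using P Q by (simp add: distrib_left)
 also have "... = 64 * M^2 * (E f f + E g g)" using EE.B_exp[OF f(1) g(1), of 1] EE.B_exp_diff[OF f(1) g(1)] by simp
 finally show "En (%x. f x * g x) <= 64 * M^2 * (E f f + E g g)" .
qed

lemma F_prod: assumes f: "f : F" "AE x in m. abs (f x) <= M" and g: "g : F" "AE x in m. abs (g x) <= M"
 shows "(%x. f x * g x) : F" "En (%x. f x * g x) <= 64 * (abs M + 1)^2 * (E f f + E g g)"
proof -
 note [measurable] = F_meas[OF f(1)] F_meas[OF g(1)]
 let ?M = "abs M + 1"
 define f' where "f' x = max (-?M) (min (f x) ?M)" for x
 define g' where "g' x = max (-?M) (min (g x) ?M)" for x
 have [measurable]: "f' : borel_measurable borel" "g' : borel_measurable borel" unfolding f'_def g'_def by measurable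
 have ae: "AE x in m. f x = f' x" "AE x in m. g x = g' x" using f(2) g(2) by (eventually_elim, auto simp: f'_def g'_def)+
 have F': "f' : F" "g' : F" "E f' f' = E f f" "E g' g' = E g g"
  using F_AE[OF f(1) _ ae(1)] F_AE[OF g(1) _ ae(2)] E_AE2[OF f(1) _ ae(1)] E_AE2[OF g(1) _ ae(2)] by auto
 have b: "abs (f' x) <= ?M" "abs (g' x) <= ?M" for x by (auto simp: f'_def g'_def)
 have ae2: "AE x in m. f' x * g' x = f x * g x" using ae by eventually_elim simp
 note P = F_prod0[OF F'(1) b(1) F'(2) b(2)]
 show "(%x. f x * g x) : F" by (rule F_AE[OF P(1) _ ae2]) auto
 show "En (%x. f x * g x) <= 64 * ?M^2 * (E f f + E g g)"
  using E_AE2[OF P(1) _ ae2] P(2) F' by auto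
qed

section \<open>The bracket approximating the energy measure\<close>

lemma R_self: "f : L2 ==> lam > 0 ==> is_res lam f (R lam f)"
 by (simp add: is_res_def R_F E_R)

lemma is_res_unique: assumes "is_res lam f v" "is_res lam f w" "f : L2" "lam > 0"
 shows "AE x in m. v x = w x"
proof -
 have F: "v : F" "w : F" using assms by (auto simp: is_res_def)
 note L = F_L2[OF F(1)] F_L2[OF F(2)] and d = EE.diff[OF F]
 let ?d = "%x. v x - w x"
 have "E ?d ?d = lam * ip (%x. f x - v x) ?d - lam * ip (%x. f x - w x) ?d"
  using EE.B_diff[OF F d] assms(1,2) d by (simp add: is_res_def)
 also have "... = lam * (ip (%x. f x - v x) ?d - ip (%x. f x - w x) ?d)" by (simp add: right_diff_distrib)
 also have "ip (%x. f x - v x) ?d - ip (%x. f x - w x) ?d = - ip ?d ?d"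
  using ip.B_diff[OF assms(3) L(1) ip.diff[OF L]] ip.B_diff[OF assms(3) L(2) ip.diff[OF L]]
   ip.B_diff[OF L ip.diff[OF L]] by linarith
 finally have "lam * Ns (%x. v x - w x) <= 0" using EE.B_nonneg[OF d] by simp
 hence "Ns (%x. v x - w x) = 0"
  using assms(4) ip.B_nonneg[OF ip.diff[OF L]] by (simp add: mult_le_0_iff)
 from ip_zero_AE[OF ip.diff[OF L] this] show ?thesis by simp
qed

context
 fixes lam :: real assumes lam: "lam > 0"
begin

lemma R_lin: assumes "f : L2" "g : L2" shows "AE x in m. R lam (%x. f x + c * g x) x = R lam f x + c * R lam g x"
proof -
 have "is_res lam (%x. f x + c * g x) (%x. R lam f x + c * R lam g x)"
  unfolding is_res_def
 proof (intro conjI ballI)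
  show "(%x. R lam f x + c * R lam g x) : F" by (intro EE.add EE.scale R_F assms lam)
  fix w assume w: "w : F"
  have "ip (%x. f x + c * g x - (R lam f x + c * R lam g x)) w = ip (%x. (f x - R lam f x) + c * (g x - R lam g x)) w"
   by (simp add: algebra_simps)
  thus "E (%x. R lam f x + c * R lam g x) w = lam * ip (%x. f x + c * g x - (R lam f x + c * R lam g x)) w"
   using w assms lam by (simp add: EE.B_simps R_F E_R ip.B_simps F_L2 R_L2 algebra_simps)
 qed
 note L = ip.add[OF assms(1) ip.scale[OF assms(2), of c]]
 show ?thesis by (rule is_res_unique[OF R_self[OF L lam] \<open>is_res lam _ _\<close> L lam])
qed

lemma R_sym: assumes "f : L2" "g : L2" shows "ip (R lam f) g = ip f (R lam g)"
proof -
 have "lam * ip (%x. f x - R lam f x) (R lam g) = lam * ip (%x. g x - R lam g x) (R lam f)"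
  using E_R[OF assms(1) lam R_F[OF assms(2) lam]] E_R[OF assms(2) lam R_F[OF assms(1) lam]] EE.B_sym[OF R_F[OF assms(1) lam] R_F[OF assms(2) lam]] by linarith
 hence "ip f (R lam g) - ip (R lam f) (R lam g) = ip g (R lam f) - ip (R lam g) (R lam f)"
  using lam assms by (simp add: ip.B_diff R_L2)
 thus ?thesis using ip.B_sym[OF R_L2[OF assms(1) lam] R_L2[OF assms(2) lam]] ip.B_sym[OF assms(2) R_L2[OF assms(1) lam]] by simp
qed

text \<open>The minimiser of E v v + lam |v - f|^2 is unique: a competitor that increases neither
  the energy nor the pointwise distance to f must coincide with it. Clipping the resolvent gives
  such competitors.\<close>

lemma R_cut: assumes f: "f : L2" and w: "w : F" "E w w <= En (R lam f)"
  "AE x in m. abs (w x - f x) <= abs (R lam f x - f x)"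
 shows "AE x in m. w x = R lam f x"
proof -
 let ?v = "R lam f"
 note v = R_F[OF f lam] and L = R_L2[OF f lam] F_L2[OF w(1)]
 let ?d = "%x. w x - ?v x"
 have d: "?d : F" "?d : L2" using v w L by (auto intro: EE.diff ip.diff)
 have 1: "E w w = E ?v ?v + 2 * E ?v ?d + E ?d ?d" using EE.B_exp[OF v d(1), of 1] by simp
 have 2: "Ns (%x. w x - f x) = Ns (%x. ?v x - f x) + 2 * ip (%x. ?v x - f x) ?d + ip ?d ?d"
  using ip.B_exp[OF ip.diff[OF L(1) f] d(2), of 1] by simp
 have 3: "E ?v ?d = lam * ip (%x. f x - ?v x) ?d" by (rule E_R[OF f lam d(1)])
 have 4: "ip (%x. ?v x - f x) ?d = - ip (%x. f x - ?v x) ?d"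
  using ip.B_uminus[OF ip.diff[OF L(1) f] d(2)] by simp
 have "Ns (%x. w x - f x) <= Ns (%x. ?v x - f x)"
  unfolding ip_def
 proof (rule integral_mono_AE)
  show "AE x in m. (w x - f x) * (w x - f x) <= (?v x - f x) * (?v x - f x)"
   using w(3) by eventually_elim (simp add: abs_le_square_iff power2_eq_square)
 qed (intro L2_int ip.diff L f)+
 hence "lam * (2 * ip (%x. ?v x - f x) ?d + ip ?d ?d) <= 0" using 2 lam by (simp add: mult_nonneg_nonpos)
 hence "lam * ip ?d ?d <= 0" using 1 3 4 w(2) EE.B_nonneg[OF d(1)] by (simp add: algebra_simps)
 hence "ip ?d ?d = 0" using lam ip.B_nonneg[OF d(2)] by (simp add: mult_le_0_iff)
 from ip_zero_AE[OF d(2) this] show ?thesis by simp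
qed

lemma R_nonneg: assumes "f : L2" "AE x in m. 0 <= f x" shows "AE x in m. 0 <= R lam f x"
proof -
 have "AE x in m. max 0 (R lam f x) = R lam f x"
  by (rule R_cut[OF assms(1)]) (use F_pos[OF R_F[OF assms(1) lam]] assms(2) in "auto elim!: eventually_mono")
 thus ?thesis by (auto elim!: eventually_mono)
qed

text \<open>Clipping to the interval from 0 to a is admissible only for data f >= 0, so it is
  applied to the positive part; the resolvent of the negative part is nonnegative and is
  subtracted.\<close>

lemma R_le: assumes f: "f : L2" "AE x in m. f x <= a" and a: "0 <= a" shows "AE x in m. R lam f x <= a"
proof -
 note [measurable] = L2_meas[OF f(1)]
 define p where "p x = max 0 (f x)" for x
 define q where "q x = max 0 (- f x)" for x
 have L: "p : L2" "q : L2" unfolding p_def q_def by (rule L2_bound[OF f(1)]; auto)+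
 have eq: "f = (%x. p x + (-1) * q x)" by (auto simp: p_def q_def)
 have 1: "AE x in m. R lam f x = R lam p x + (-1) * R lam q x" by (subst (1) eq) (rule R_lin[OF L])
 have 2: "AE x in m. 0 <= R lam q x" by (rule R_nonneg[OF L(2)]) (simp add: q_def)
 have "AE x in m. max 0 (min (R lam p x) a) = R lam p x"
 proof (rule R_cut[OF L(1)])
  show "AE x in m. abs (max 0 (min (R lam p x) a) - p x) <= abs (R lam p x - p x)"
   using f(2) by eventually_elim (use a in "auto simp: p_def")
 qed (use clip[OF R_F[OF L(1) lam] a] in auto)
 with 1 2 show ?thesis by eventually_elim (use a in "auto simp: min_def max_def split: if_splits")
qed

text \<open>Formally this is the resolvent of (f - c)^2 at c = f(x). Constants need not lie in L^2,
  so for fixed c the inequality 2cf - f^2 <= c^2 is fed into \<open>R_le\<close>. Countably many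
  rational c leave one null set, and continuity in c allows c = f(x).\<close>

lemma R_bracket_nonneg: assumes f: "f : L2" "(%x. (f x)^2) : L2"
 shows "AE x in m. 0 <= (f x)^2 - 2 * f x * R lam f x + R lam (%x. (f x)^2) x"
proof -
 have "AE x in m. ALL c:\<rat>. 0 <= R lam (%x. (f x)^2) x - 2 * c * R lam f x + c^2"
 proof (subst AE_ball_countable)
  show "ALL c:\<rat>. AE x in m. 0 <= R lam (%x. (f x)^2) x - 2 * c * R lam f x + c^2"
  proof
   fix c :: real
   have g: "(%x. (-1) * (f x)^2 + (2*c) * f x) : L2" by (intro ip.add ip.scale f)
   have "0 <= (f x - c)^2" for x by simp
   hence "(-1) * (f x)^2 + (2*c) * f x <= c^2" for x by (simp add: power2_eq_square algebra_simps)
   hence 1: "AE x in m. R lam (%x. (-1) * (f x)^2 + (2*c) * f x) x <= c^2" by (intro R_le[OF g]) auto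
   have 2: "AE x in m. R lam (%x. (-1) * (f x)^2 + (2*c) * f x) x = R lam (%x. (-1) * (f x)^2) x + 2*c * R lam f x"
    by (rule R_lin[OF ip.scale[OF f(2)] f(1)])
   have 3: "AE x in m. R lam (%x. (-1) * (f x)^2) x = - R lam (%x. (f x)^2) x"
    using R_lin[OF ip.zero[OF f(1)] f(2), of "-1"] R_lin[OF ip.zero[OF f(1)] ip.zero[OF f(1)], of 1] by eventually_elim simp
   from 1 2 3 show "AE x in m. 0 <= R lam (%x. (f x)^2) x - 2 * c * R lam f x + c^2" by eventually_elim simp
  qed
 qed (simp add: countable_rat)
 thus ?thesis
 proof eventually_elim
  fix x assume a: "ALL c:\<rat>. 0 <= R lam (%x. (f x)^2) x - 2 * c * R lam f x + c^2"
  let ?P = "%c. 0 <= R lam (%x. (f x)^2) x - 2 * c * R lam f x + c^2"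
  have "closed {c. ?P c}" by (intro closed_Collect_le continuous_intros)
  moreover have "\<rat> <= {c. ?P c}" using a by auto
  ultimately have "closure \<rat> <= {c. ?P c}" by (intro closure_minimal)
  hence "?P (f x)" using Rats_closure_real by auto
  thus "0 <= (f x)^2 - 2 * f x * R lam f x + R lam (%x. (f x)^2) x" by simp
 qed
qed

text \<open>As the bracket is nonnegative and h <= 1, its full integral bounds the left side. By
  symmetry and the sub-Markov property the integral of \<open>R lam s\<close> is at most that of s,
  which leaves twice the pairing of f - R f with f.\<close>

lemma R_bracket_le: assumes f: "f : L2" "(%x. (f x)^2) : L2" and h: "h : L2" "AE x in m. 0 <= h x & h x <= 1"
 shows "ip h (%x. (f x)^2 - 2 * f x * R lam f x + R lam (%x. (f x)^2) x) <= 2 * ip (%x. f x - R lam f x) f"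
proof -
 fix o' :: 'a
 define s where "s x = (f x)^2" for x
 define X where "X x = s x - 2 * f x * R lam f x + R lam s x" for x
 have s: "s : L2" using f(2) by (simp add: s_def[abs_def])
 note [measurable] = L2_meas[OF f(1)] L2_meas[OF s] L2_meas[OF R_L2[OF f(1) lam]] L2_meas[OF R_L2[OF s lam]] L2_meas[OF h(1)]
 have Xp: "AE x in m. 0 <= X x" using R_bracket_nonneg[OF f] unfolding X_def s_def .
 \<comment> \<open>Indicators of growing balls stand in for the constant 1, which may fail to be in
   L^2, so that the symmetry of R can be used.\<close>
 define k :: "nat => 'a => real" where "k n = indicator (ball o' (real n))" for n
 have [measurable]: "k n : borel_measurable borel" for n unfolding k_def by (rule borel_measurable_indicator) simp
 have fin: "emeasure m (ball o' (real n)) < \<infinity>" for n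
 proof (cases "n = 0")
  case False
  have "compact (closure (ball o' (real n)))" using F_facts(6) False by (auto simp: metric_measure_space_def)
  hence "emeasure m (closure (ball o' (real n))) < \<infinity>" using F_facts(6) by (auto simp: metric_measure_space_def radon_measure_def)
  thus ?thesis using emeasure_mono[of "ball o' (real n)" "closure (ball o' (real n))" m] closure_subset by (auto intro: le_less_trans)
 qed simp
 have kL: "k n : L2" for n unfolding L2_iff k_def
  using fin[of n] by (auto simp: power2_eq_square indicator_inter_arith[symmetric] intro!: integrable_real_indicator borel_measurable_indicator)
 have k1: "\<forall>\<^sub>F n in sequentially. k n x = 1" for x
 proof -
  obtain N where "dist o' x < real N" using reals_Archimedean2 by blast
  thus ?thesis by (auto simp: eventually_sequentially k_def intro!: exI[of _ N])
 qed
 have kb: "0 <= k n x" "k n x <= 1" for n x by (auto simp: k_def indicator_def)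
 have kg: "integrable m (%x. k n x * g x)" "(%n. \<integral>x. k n x * g x \<partial>m) ~~> (\<integral>x. g x \<partial>m)"
  if g: "integrable m g" for n g
 proof -
  have [measurable]: "g : borel_measurable borel" using g by auto
  have b: "AE x in m. norm (k n x * g x) <= norm (g x)" for n using kb by (auto simp: abs_mult mult_left_le_one_le)
  show "integrable m (%x. k n x * g x)" by (rule Bochner_Integration.integrable_bound[OF g _ b]) measurable
  show "(%n. \<integral>x. k n x * g x \<partial>m) ~~> (\<integral>x. g x \<partial>m)"
  proof (rule integral_dominated_convergence[where w = "%x. norm (g x)"])
   show "AE x in m. (%n. k n x * g x) ~~> g x"
    using k1 by (auto intro!: AE_I2 tendsto_eventually elim!: eventually_mono)
  qed (use g b in auto)
 qed
 have i1: "integrable m s" using f(1) by (simp add: L2_iff s_def[abs_def])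
 have i2: "integrable m (%x. f x * R lam f x)" by (intro L2_int f R_L2 lam)
 have i3: "integrable m (%x. g x * R lam s x)" "integrable m (%x. g x * s x)" if "g : L2" for g by (intro L2_int that R_L2 s lam)+
 have ii: "integrable m (%x. g x * X x)" if g: "g : L2" "!!x. abs (g x) <= 1 | g = h" for g
 proof -
  have [measurable]: "g : borel_measurable borel" using g by (rule_tac L2_meas)
  have gb: "AE x in m. abs (g x) <= 1" 
  proof (cases "g = h")
   case True show ?thesis using h(2) unfolding True by eventually_elim auto
  qed (use g(2) in auto)
  have "integrable m (%x. g x * (f x * R lam f x))"
   by (rule Bochner_Integration.integrable_bound[OF i2]) (use gb in "auto simp: abs_mult mult_left_le_one_le elim!: eventually_mono")
  hence "integrable m (%x. g x * s x - 2 * (g x * (f x * R lam f x)) + g x * R lam s x)"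
   using i3[OF g(1)] by auto
  thus ?thesis by (simp add: X_def algebra_simps)
 qed
 have a1: "(%n. \<integral>x. k n x * (h x * X x) \<partial>m) ~~> ip h X" unfolding ip_def by (rule kg(2)[OF ii[OF h(1)]]) simp
 define b where "b n = (\<integral>x. k n x * s x \<partial>m) - 2 * (\<integral>x. k n x * (f x * R lam f x) \<partial>m) + (\<integral>x. s x \<partial>m)" for n
 have a2: "b ~~> (\<integral>x. s x \<partial>m) - 2 * (\<integral>x. f x * R lam f x \<partial>m) + (\<integral>x. s x \<partial>m)"
  unfolding b_def by (intro tendsto_intros kg i1 i2)
 have a3: "(\<integral>x. k n x * (h x * X x) \<partial>m) <= b n" for n
 proof -
  have kX: "integrable m (%x. k n x * X x)" by (rule ii[OF kL]) (use kb in "auto simp: k_def")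
  have "(\<integral>x. k n x * (h x * X x) \<partial>m) <= (\<integral>x. k n x * X x \<partial>m)"
  proof (rule integral_mono_AE)
   show "integrable m (%x. k n x * (h x * X x))" by (rule kg(1)[OF ii[OF h(1)]]) simp
   show "AE x in m. k n x * (h x * X x) <= k n x * X x"
    using Xp h(2) by eventually_elim (use kb in "auto intro!: mult_left_mono mult_left_le_one_le")
  qed (rule kX)
  also have "... = (\<integral>x. k n x * s x - 2 * (k n x * (f x * R lam f x)) + k n x * R lam s x \<partial>m)"
   by (simp add: X_def algebra_simps)
  also have "... = (\<integral>x. k n x * s x \<partial>m) - 2 * (\<integral>x. k n x * (f x * R lam f x) \<partial>m) + (\<integral>x. k n x * R lam s x \<partial>m)"
   using i3[OF kL, of n] kg(1)[OF i2, of n] by simp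
  also have "(\<integral>x. k n x * R lam s x \<partial>m) = (\<integral>x. R lam (k n) x * s x \<partial>m)"
   using R_sym[OF kL s] by (simp add: ip_def)
  also have "... <= (\<integral>x. s x \<partial>m)"
  proof (rule integral_mono_AE)
   show "integrable m (%x. R lam (k n) x * s x)" by (intro L2_int R_L2 kL s lam)
   have "AE x in m. R lam (k n) x <= 1" by (rule R_le[OF kL]) (use kb in auto)
   thus "AE x in m. R lam (k n) x * s x <= s x"
    by eventually_elim (simp add: s_def mult_right_mono[where b = "1::real", simplified])
  qed (rule i1)
  finally show ?thesis by (simp add: b_def)
 qed
 have "ip h X <= (\<integral>x. s x \<partial>m) - 2 * (\<integral>x. f x * R lam f x \<partial>m) + (\<integral>x. s x \<partial>m)"
  by (rule LIMSEQ_le[OF a1 a2]) (use a3 in auto)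
 also have "... = 2 * ip (%x. f x - R lam f x) f"
  using ip.B_diff[OF f(1) R_L2[OF f(1) lam] f(1)] by (simp add: ip_def s_def power2_eq_square mult.commute)
 finally show ?thesis unfolding X_def[abs_def] s_def .
qed

end

section \<open>Bounded functions of the domain and the polarised bracket\<close>

abbreviation "FB == {f : F. ess_bounded m f}"

lemma FB_prod: "f : FB ==> g : FB ==> (%x. f x * g x) : FB"
proof -
 assume f: "f : FB" and g: "g : FB"
 obtain a b where a: "AE x in m. abs (f x) <= a" and b: "AE x in m. abs (g x) <= b" using f g by (auto simp: ess_bounded_def)
 have "AE x in m. abs (f x) <= max a b" "AE x in m. abs (g x) <= max a b" using a b by (eventually_elim, auto)+
 hence F: "(%x. f x * g x) : F" using f g by (auto intro!: F_prod(1))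
 have "AE x in m. abs (f x * g x) <= max 0 a * max 0 b" using a b by eventually_elim (auto simp: abs_mult intro!: mult_mono)
 with F show ?thesis by (auto simp: ess_bounded_def)
qed

lemma FB_square: "f : FB ==> (%x. (f x)^2) : FB" using FB_prod[of f f] by (simp add: power2_eq_square)

lemma FB_add: "f : FB ==> g : FB ==> (%x. f x + g x) : FB"
proof -
 assume f: "f : FB" and g: "g : FB"
 obtain a b where a: "AE x in m. abs (f x) <= a" and b: "AE x in m. abs (g x) <= b" using f g by (auto simp: ess_bounded_def)
 hence "AE x in m. abs (f x + g x) <= a + b" by eventually_elim linarith
 with f g show ?thesis by (auto simp: ess_bounded_def EE.add)
qed

lemma FB_scale: "f : FB ==> (%x. c * f x) : FB"
proof -
 assume f: "f : FB"
 obtain a where a: "AE x in m. abs (f x) <= a" using f by (auto simp: ess_bounded_def)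
 hence "AE x in m. abs (c * f x) <= abs c * a" by eventually_elim (simp add: abs_mult mult_left_mono)
 with f show ?thesis by (auto simp: ess_bounded_def EE.scale)
qed

text \<open>The integral of h against the mutual energy measure of f and g, before any measure
  exists. The weight comes first so that \<open>Ib h\<close> is itself a semidefinite form.\<close>

definition Ib :: "('a => real) => ('a => real) => ('a => real) => real" where
 "Ib h f g = 1/2 * (E f (%x. g x * h x) + E g (%x. f x * h x) - E (%x. f x * g x) h)"

lemma Ib_self: "Ib h f f = E f (%x. f x * h x) - 1/2 * E (%x. (f x)^2) h"
 by (simp add: Ib_def power2_eq_square)

text \<open>With f and f^2 replaced by their resolvents, both terms of the bracket become L^2
  pairings and combine to the integrand of \<open>R_bracket_nonneg\<close>; sign and upper bound of
  \<open>Ib\<close> are read off from there.\<close>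

lemma Ib_limit: assumes f: "f : FB" and h: "h : FB"
 shows "(%n. real (Suc n) / 2 * ip h (%x. (f x)^2 - 2 * f x * R (real (Suc n)) f x + R (real (Suc n)) (%x. (f x)^2) x)) ~~> Ib h f f"
proof -
 define l where "l n = real (Suc n)" for n
 have l: "l n > 0" for n by (simp add: l_def)
 define s where "s x = (f x)^2" for x
 have F: "f : F" "h : F" "s : F" "(%x. f x * h x) : F" using FB_prod[OF f h] FB_square[OF f] f h by (auto simp: s_def[abs_def])
 note L = F_L2[OF F(1)] F_L2[OF F(2)] F_L2[OF F(3)] F_L2[OF F(4)]
 have 1: "(%n. E (R (l n) f) (%x. f x * h x) - 1/2 * E (R (l n) s) h) ~~> E f (%x. f x * h x) - 1/2 * E s h"
  unfolding l_def by (intro tendsto_intros EE.lim1 R_F L F R_tendsto) auto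
 have 2: "E (R (l n) f) (%x. f x * h x) - 1/2 * E (R (l n) s) h
  = l n / 2 * ip h (%x. s x - 2 * f x * R (l n) f x + R (l n) s x)" for n
 proof -
  have i: "integrable m (%x. f x * (f x * h x))" "integrable m (%x. R (l n) f x * (f x * h x))"
   "integrable m (%x. s x * h x)" "integrable m (%x. R (l n) s x * h x)" by (intro L2_int L R_L2 l)+
  have "ip (%x. f x - R (l n) f x) (%x. f x * h x) - 1/2 * ip (%x. s x - R (l n) s x) h
   = 1/2 * ip h (%x. s x - 2 * f x * R (l n) f x + R (l n) s x)"
  proof -
   have "ip h (%x. s x - 2 * f x * R (l n) f x + R (l n) s x) =
    (\<integral>x. 2 * (f x * (f x * h x)) - 2 * (R (l n) f x * (f x * h x)) - s x * h x + R (l n) s x * h x \<partial>m)"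
    unfolding ip_def by (intro Bochner_Integration.integral_cong) (auto simp: s_def power2_eq_square algebra_simps)
   also have "... = 2 * (\<integral>x. f x * (f x * h x) \<partial>m) - 2 * (\<integral>x. R (l n) f x * (f x * h x) \<partial>m) - (\<integral>x. s x * h x \<partial>m) + (\<integral>x. R (l n) s x * h x \<partial>m)"
    using i by simp
   finally show ?thesis using ip.B_diff[OF L(1) R_L2[OF L(1) l] L(4), of n] ip.B_diff[OF L(3) R_L2[OF L(3) l] L(2), of n]
    unfolding ip_def by argo
  qed
  thus ?thesis using E_R[OF L(1) l F(4), of n] E_R[OF L(3) l F(2), of n] by (simp add: algebra_simps)
 qed
 show ?thesis using 1[unfolded 2] unfolding Ib_self l_def s_def .
qed

lemma Ib_nonneg: assumes f: "f : FB" and h: "h : FB" "AE x in m. 0 <= h x" shows "0 <= Ib h f f"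
proof (rule LIMSEQ_le_const[OF Ib_limit[OF f h(1)]])
 have L: "f : L2" "(%x. (f x)^2) : L2" using f FB_square[OF f] by (auto intro: F_L2)
 have "0 <= real (Suc n) / 2 * ip h (%x. (f x)^2 - 2 * f x * R (real (Suc n)) f x + R (real (Suc n)) (%x. (f x)^2) x)" for n
 proof -
  have "AE x in m. 0 <= h x * ((f x)^2 - 2 * f x * R (real (Suc n)) f x + R (real (Suc n)) (%x. (f x)^2) x)"
   using R_bracket_nonneg[of "real (Suc n)", OF _ L] h(2) by (auto elim!: eventually_elim2)
  thus ?thesis unfolding ip_def by (intro mult_nonneg_nonneg integral_nonneg_AE) auto
 qed
 thus "EX N. ALL n>=N. 0 <= real (Suc n) / 2 * ip h (%x. (f x)^2 - 2 * f x * R (real (Suc n)) f x + R (real (Suc n)) (%x. (f x)^2) x)" by blast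
qed

lemma Ib_le: assumes f: "f : FB" and h: "h : FB" "AE x in m. 0 <= h x & h x <= 1" shows "Ib h f f <= E f f"
proof (rule LIMSEQ_le[OF Ib_limit[OF f h(1)]])
 have fF: "f : F" and L: "f : L2" "(%x. (f x)^2) : L2" "h : L2" using f FB_square[OF f] h by (auto intro: F_L2)
 show "(%n. E (R (real (Suc n)) f) f) ~~> E f f" using fF L by (intro EE.lim1 R_F R_tendsto) auto
 have "real (Suc n) / 2 * ip h (%x. (f x)^2 - 2 * f x * R (real (Suc n)) f x + R (real (Suc n)) (%x. (f x)^2) x) <= E (R (real (Suc n)) f) f" for n
  using mult_left_mono[OF R_bracket_le[of "real (Suc n)", OF _ L h(2)], of "real (Suc n) / 2"] E_R[OF L(1) _ fF, of "real (Suc n)"] by simp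
 thus "EX N. ALL n>=N. real (Suc n) / 2 * ip h (%x. (f x)^2 - 2 * f x * R (real (Suc n)) f x + R (real (Suc n)) (%x. (f x)^2) x) <= E (R (real (Suc n)) f) f" by blast
qed

lemma Ib_psd: assumes h: "h : FB" "AE x in m. 0 <= h x" shows "psd FB (Ib h)"
proof
 fix f g k c
 show "f : FB ==> g : FB ==> (%x. f x + g x) : FB" by (rule FB_add)
 show "f : FB ==> (%x. c * f x) : FB" by (rule FB_scale)
 show "0 <= Ib h f f" if "f : FB" by (rule Ib_nonneg[OF that h])
 show "Ib h f g = Ib h g f" unfolding Ib_def by (simp add: mult.commute add.commute)
 have fh: "p : FB ==> p : F" for p by simp
 show "Ib h (%x. f x + g x) k = Ib h f k + Ib h g k" if a: "f : FB" "g : FB" "k : FB"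
  using fh[OF a(1)] fh[OF a(2)] fh[OF a(3)] fh[OF h(1)] fh[OF FB_prod[OF a(1) h(1)]] fh[OF FB_prod[OF a(2) h(1)]] fh[OF FB_prod[OF a(3) h(1)]]
   fh[OF FB_prod[OF a(1,3)]] fh[OF FB_prod[OF a(2,3)]]
  unfolding Ib_def by (simp add: distrib_right EE.B_simps algebra_simps)
 show "Ib h (%x. c * f x) k = c * Ib h f k" if a: "f : FB" "k : FB"
  using fh[OF a(1)] fh[OF a(2)] fh[OF h(1)] fh[OF FB_prod[OF a(1) h(1)]] fh[OF FB_prod[OF a(2) h(1)]]
   fh[OF FB_prod[OF a(1,2)]]
  unfolding Ib_def by (simp add: mult.assoc EE.B_simps algebra_simps)
qed

end

section \<open>Riesz representation on the core\<close>

context mmd begin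

abbreviation "C0 == F Int Cc"

lemma compact_if_bounded: assumes "closed S" "bounded (S::'a set)" shows "compact S"
proof -
 obtain x r where "S <= ball x r" using assms(2) bounded_subset_ballD by blast
 hence *: "S <= ball x (max 1 r)" by auto
 have "compact (closure (ball x (max 1 r)))" using F_facts(6) by (auto simp: metric_measure_space_def)
 hence "compact (S Int closure (ball x (max 1 r)))" using assms(1) by (simp add: closed_Int_compact)
 moreover have "S Int closure (ball x (max 1 r)) = S" using * closure_subset by blast
 ultimately show ?thesis by simp
qed

lemma Cc_iff: "f : Cc \<longleftrightarrow> continuous_on UNIV f & (EX K. compact K & (ALL x. x ~: K --> f x = (0::real)))"
 for f :: "'a => real"
proof (intro iffI conjI; (elim conjE exE)?)
 assume "f : Cc" thus "continuous_on UNIV f" "EX K. compact K & (ALL x. x ~: K --> f x = 0)"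
  using closure_subset[of "{x. f x ~= 0}"] by (auto simp: Cc_def)
next
 fix K assume "continuous_on UNIV f" and K: "compact K" "ALL x. x ~: K --> f x = 0"
 moreover have "closure {x. f x ~= 0} <= K" using K by (intro closure_minimal compact_imp_closed) auto
 hence "compact (closure {x. f x ~= 0})" using K(1) by (metis closed_closure compact_Int_closed inf.absorb_iff2)
 ultimately show "f : Cc" by (simp add: Cc_def)
qed

lemma Cc_bound: fixes f :: "'a => real" assumes "f : Cc" obtains M where "M > 0" "!!x. abs (f x) <= M"
proof -
 obtain K where f: "continuous_on UNIV f" "compact K" "!!x. x ~: K ==> f x = 0" using assms by (auto simp: Cc_iff)
 have "bounded (f ` K)" using f by (intro compact_imp_bounded compact_continuous_image) (auto intro: continuous_on_subset)
 then obtain M where "ALL x:K. abs (f x) <= M" by (auto simp: bounded_iff)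
 hence "abs (f x) <= max 1 M" for x using f(3)[of x] by (cases "x : K") auto
 thus ?thesis by (intro that[of "max 1 M"]) auto
qed

lemma C0_FB: "f : C0 ==> f : FB"
 using Cc_bound[of f] by (auto simp: ess_bounded_def) (metis AE_I2)

lemma Cc_add: "f : Cc ==> g : Cc ==> (%x. f x + g x :: real) : Cc" for f g :: "'a => real"
proof -
 assume "f : Cc" "g : Cc"
 then obtain K L where "continuous_on UNIV f" "continuous_on UNIV g" "compact K" "compact L"
  "ALL x. x ~: K --> f x = 0" "ALL x. x ~: L --> g x = 0" unfolding Cc_iff by blast
 thus ?thesis unfolding Cc_iff by (intro conjI continuous_intros exI[of _ "K Un L"]) auto
qed

lemma Cc_comp: fixes f :: "'a => real" assumes "f : Cc" "continuous_on UNIV p" "p 0 = 0" shows "(%x. p (f x) :: real) : Cc"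
 using assms unfolding Cc_iff by (auto intro!: continuous_on_compose2[OF assms(2)])

lemma C0_add: "f : C0 ==> g : C0 ==> (%x. f x + g x) : C0" by (auto intro: Cc_add EE.add)
lemma C0_scale: "f : C0 ==> (%x. c * f x) : C0" by (auto intro: EE.scale Cc_comp[where p = "%x. c * x"] continuous_intros)
lemma C0_diff: "f : C0 ==> g : C0 ==> (%x. f x - g x) : C0" using C0_add[OF _ C0_scale[of g "-1"], of f] by simp
lemma C0_0: "(%_. 0) : C0" by (auto simp: Cc_iff F0)

lemma C0_prod: assumes "f : C0" "g : C0" shows "(%x. f x * g x) : C0"
proof -
 have "(%x. f x * g x) : FB" using assms C0_FB by (intro FB_prod) auto
 moreover obtain K where "continuous_on UNIV f" "continuous_on UNIV g" "compact K" "ALL x. x ~: K --> f x = 0"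
  using assms by (auto simp: Cc_iff)
 hence "(%x. f x * g x) : Cc" unfolding Cc_iff by (intro conjI continuous_intros exI[of _ K]) auto
 ultimately show ?thesis by auto
qed

lemma C0_band: assumes "f : C0" "0 <= a" "0 <= b" shows "(%x. max 0 (min (f x - a) b)) : C0"
 using band(1)[of f a b] assms by (auto intro!: Cc_comp[where p = "%t. max 0 (min (t - a) b)"] continuous_intros)

text \<open>Test functions below the indicator of U. The support condition asks for a compact subset
  of U, so that functions living in different open sets can be pasted.\<close>

definition T where "T U = {h : C0. (ALL x. 0 <= h x & h x <= 1) & (EX K. compact K & K <= U & (ALL x. x ~: K --> h x = 0))}"

lemma TD: "h : T U ==> h : C0" "h : T U ==> 0 <= h x" "h : T U ==> h x <= 1" by (auto simp: T_def)
lemma T_zero: "h : T U ==> x ~: U ==> h x = 0" by (auto simp: T_def)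
lemma T0: "(%_. 0) : T U" using C0_0 by (auto simp: T_def)
lemma T_mono: "U <= V ==> h : T U ==> h : T V" unfolding T_def by blast

text \<open>Regularity of the form only gives uniform approximation of a plateau function from F and
  Cc. Cutting off the bottom and the top quarter of the approximant makes it exactly 0 and exactly 1
  where required, and cutting stays in F.\<close>

lemma urysohn: assumes K: "compact K" and U: "open U" and KU: "K <= (U::'a set)"
 obtains h G where "h : T U" "open G" "K <= G" "!!x. x : G ==> h x = 1"
proof (cases "K = {}")
 case True thus ?thesis using that[OF T0, of "{}"] by auto
next
 case False
 obtain e where e: "e > 0" "(UN x:K. cball x e) <= U" using compact_subset_open_imp_cball_epsilon_subset[OF K U KU] by blast
 define d where "d = e / 3"
 have d: "d > 0" using e by (simp add: d_def)
 have near: "EX k:K. dist x k <= infdist x K + d" for x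
 proof -
  have "Inf (dist x ` K) < infdist x K + d" using d False by (simp add: infdist_def)
  thus ?thesis using cInf_lessD[of "dist x ` K"] False by force
 qed
 define K' where "K' = {x. infdist x K <= 2 * d}"
 have clo: "closed K'" unfolding K'_def by (intro closed_Collect_le continuous_intros)
 have "bounded K'"
 proof -
  obtain x0 r where r: "K <= ball x0 r" using compact_imp_bounded[OF K] bounded_subset_ballD by blast
  have "dist x0 x <= r + 3 * d" if x: "x : K'" for x
  proof -
   obtain k where "k : K" "dist x k <= infdist x K + d" using near by blast
   thus ?thesis using r x dist_triangle[of x0 x k] by (auto simp: K'_def dist_commute subset_iff)
  qed
  thus ?thesis unfolding bounded_def by blast
 qed
 hence K': "compact K'" by (rule compact_if_bounded[OF clo])
 have K'U: "K' <= U"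
 proof
  fix x assume x: "x : K'"
  obtain k where "k : K" "dist x k <= infdist x K + d" using near by blast
  hence "x : cball k e" using x by (auto simp: K'_def d_def dist_commute)
  thus "x : U" using e \<open>k : K\<close> by blast
 qed
 define \<phi> where "\<phi> x = max 0 (min 1 (2 - infdist x K / d))" for x
 have "\<phi> : Cc" unfolding Cc_iff \<phi>_def
  using K' d by (intro conjI continuous_intros exI[of _ K']) (auto simp: K'_def field_simps)
 then obtain g where g: "g : C0" "!!x. abs (\<phi> x - g x) < 1/4"
  using F_facts(4) unfolding regular_form_def by (metis zero_less_divide_1_iff zero_less_numeral)
 \<comment> \<open>Where the plateau is 1 the approximant exceeds 3/4, where it is 0 the approximant
   is below 1/4.\<close>
 define h where "h x = 2 * max 0 (min (g x - 1/4) (1/2))" for x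
 have h0: "h x = 0" if "x ~: K'" for x
 proof -
  have "\<phi> x = 0" using that d by (auto simp: \<phi>_def K'_def field_simps)
  thus ?thesis using g(2)[of x] by (auto simp: h_def)
 qed
 have hC: "h : C0" unfolding h_def by (rule C0_scale[OF C0_band[OF g(1)]]) auto
 have "h x <= 1" "0 <= h x" for x by (auto simp: h_def max_def min_def)
 hence "h : T U" using hC h0 K' K'U unfolding T_def by blast
 moreover have "open {x. infdist x K < d}" by (intro open_Collect_less continuous_intros)
 moreover have "K <= {x. infdist x K < d}" using d by auto
 moreover have "h x = 1" if "x : {x. infdist x K < d}" for x
 proof -
  have "\<phi> x = 1" using that d infdist_nonneg[of x K] by (auto simp: \<phi>_def field_simps)
  thus ?thesis using g(2)[of x] by (auto simp: h_def max_def min_def)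
 qed
 ultimately show ?thesis by (rule that)
qed

lemma open_exhaust: assumes "open (U::'a set)"
 obtains K where "!!n::nat. compact (K n)" "!!n. K n <= interior (K (Suc n))" "(\<Union>n. interior (K n)) = U" "!!n. K n <= U"
proof (cases "U = {}")
 case True thus ?thesis using that[of "%_. {}"] by auto
next
 case False
 then obtain o' where o': "o' : U" by auto
 \<comment> \<open>The distance to the empty set is 0 by convention, so the whole space gets its own
   value.\<close>
 define s where "s x = (if U = UNIV then 1 else infdist x (- U))" for x
 have sc: "continuous_on UNIV s" unfolding s_def by (cases "U = UNIV") (auto intro!: continuous_intros)
 have sp: "0 < s x \<longleftrightarrow> x : U" for x
 proof (cases "U = UNIV")
  case False
  hence "x : - U \<longleftrightarrow> infdist x (-U) = 0" using assms by (intro in_closed_iff_infdist_zero) auto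
  thus ?thesis using False infdist_nonneg[of x "-U"] by (auto simp: s_def)
 qed (simp add: s_def)
 define K where "K n = {x. dist o' x <= real n & 1 / (real n + 1) <= s x}" for n
 define G where "G n = {x. dist o' x < real (Suc n) & 1 / (real (Suc n) + 1) < s x}" for n
 have KC: "K n = {x. dist o' x <= real n} Int {x. 1 / (real n + 1) <= s x}" for n by (auto simp: K_def)
 have "closed (K n)" for n unfolding KC by (intro closed_Int closed_Collect_le continuous_intros sc)
 moreover have "bounded (K n)" for n by (rule bounded_subset[of "cball o' (real n)"]) (auto simp: K_def)
 ultimately have K: "compact (K n)" for n by (rule compact_if_bounded)
 have GC: "G n = {x. dist o' x < real (Suc n)} Int {x. 1 / (real (Suc n) + 1) < s x}" for n by (auto simp: G_def)
 have Go: "open (G n)" for n unfolding GC by (intro open_Int open_Collect_less continuous_intros sc)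
 have GK: "G n <= K (Suc n)" for n by (auto simp: G_def K_def)
 have KG: "K n <= G n" for n
 proof
  fix x assume x: "x : K n"
  have "1 / (real (Suc n) + 1) < 1 / (real n + 1)" by (simp add: field_simps)
  thus "x : G n" using x by (auto simp: K_def G_def intro: less_le_trans)
 qed
 have Gi: "G n <= interior (K (Suc n))" for n using Go GK by (simp add: interior_maximal)
 have KU: "K n <= U" for n
 proof
  fix x assume "x : K n"
  hence "1 / (real n + 1) <= s x" by (simp add: K_def)
  moreover have "0 < 1 / (real n + 1)" by simp
  ultimately show "x : U" using sp[of x] by linarith
 qed
 have "U <= (\<Union>n. interior (K n))"
 proof
  fix x assume "x : U"
  hence "s x > 0" using sp by simp
  then obtain n where n: "1 / (real n + 1) < s x" using nat_approx_posE[of "s x"] by (auto simp: add.commute)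
  obtain k where k: "dist o' x <= real k" using real_arch_simple by blast
  have "1 / (real (max n k) + 1) <= 1 / (real n + 1)" by (simp add: frac_le)
  hence "x : K (max n k)" using n k by (auto simp: K_def)
  hence "x : interior (K (Suc (max n k)))" using KG Gi by blast
  thus "x : (\<Union>n. interior (K n))" by blast
 qed
 moreover have "(\<Union>n. interior (K n)) <= U" using KU interior_subset by blast
 ultimately show ?thesis using K KG Gi KU by (intro that[of K]) blast+
qed

text \<open>Functionals are given only on the intersection of F and Cc, not on all of Cc. The bound
  M makes the resulting measure finite.\<close>

definition posfun :: "(('a => real) => real) => real => bool" where
 "posfun I M \<longleftrightarrow> (ALL f:C0. ALL g:C0. I (%x. f x + g x) = I f + I g) & (ALL f:C0. ALL c. I (%x. c * f x) = c * I f)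
  & (ALL f:C0. (ALL x. 0 <= f x) --> 0 <= I f) & (ALL f:C0. (ALL x. 0 <= f x & f x <= 1) --> I f <= M)"

text \<open>The content on open sets, the outer measure and the measure of the Riesz-Markov
  construction; \<open>urysohn\<close> ensures that test functions from F are plentiful
  enough.\<close>

definition "lamI I U = (SUP h\<in>T U. ennreal (I h))"
definition "muI I A = (INF U\<in>{U. open U & A <= U}. lamI I U)"
definition "rz I = measure_of (UNIV::'a set) (sets borel) (muI I)"

context
 fixes I M assumes I: "posfun I M"
begin

lemma I_add: "f : C0 ==> g : C0 ==> I (%x. f x + g x) = I f + I g"
 and I_scale: "f : C0 ==> I (%x. c * f x) = c * I f"
 and I_nonneg: "f : C0 ==> (!!x. 0 <= f x) ==> 0 <= I f"
 and I_le_M: "f : C0 ==> (!!x. 0 <= f x) ==> (!!x. f x <= 1) ==> I f <= M"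
 using I by (auto simp: posfun_def)

lemma I_diff: "f : C0 ==> g : C0 ==> I (%x. f x - g x) = I f - I g"
 using I_add[OF _ C0_scale[of g "-1"], of f] I_scale[of g "-1"] by simp

lemma I_mono: "f : C0 ==> g : C0 ==> (!!x. f x <= g x) ==> I f <= I g"
 using I_nonneg[OF C0_diff[of g f]] I_diff[of g f] by simp

lemma I_T: "h : T U ==> 0 <= I h" "h : T U ==> I h <= M"
 by (auto intro!: I_nonneg I_le_M simp: T_def)

lemma lamI_upper: "h : T U ==> ennreal (I h) <= lamI I U" unfolding lamI_def by (rule SUP_upper)

lemma lamI_mono: "U <= V ==> lamI I U <= lamI I V"
 unfolding lamI_def by (intro SUP_subset_mono) (use T_mono in auto)

text \<open>A test function h splits as h c + h (1 - c), where c is a test function of U that is 1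
  near the part of the support outside V. Both pieces stay in F because F and Cc intersect in an
  algebra.\<close>

lemma lamI_Un: assumes U: "open U" and V: "open V" shows "lamI I (U Un V) <= lamI I U + lamI I V"
 unfolding lamI_def[of I "U Un V"]
proof (rule SUP_least)
 fix h assume h: "h : T (U Un V)"
 then obtain K where K: "compact K" "K <= U Un V" "!!x. x ~: K ==> h x = 0" by (auto simp: T_def)
 have "compact (K - V)" using K(1) V by (rule compact_diff)
 then obtain c G where c: "c : T U" "open G" "K - V <= G" "!!x. x : G ==> c x = 1"
  using urysohn[of "K - V" U] U K(2) by blast
 obtain L where L: "compact L" "L <= U" "!!x. x ~: L ==> c x = 0" using c(1) by (auto simp: T_def)
 note hC = TD(1)[OF h] and cC = TD(1)[OF c(1)] and hb = TD(2,3)[OF h] and cb = TD(2,3)[OF c(1)]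
 note P = C0_prod[OF hC cC]
 have a: "(%x. h x * c x) : T U" unfolding T_def using P L hb cb by (auto simp: mult_le_one intro!: exI[of _ L])
 have bC: "(%x. h x - h x * c x) : C0" by (rule C0_diff[OF hC P])
 have "0 <= h x - h x * c x" for x using mult_left_mono[OF cb(2)[of x] hb(1)[of x]] by simp
 moreover have "h x - h x * c x <= 1" for x using mult_nonneg_nonneg[OF hb(1)[of x] cb(1)[of x]] hb(2)[of x] by simp
 moreover have "compact (K - G)" using K(1) c(2) by (rule compact_diff)
 ultimately have b: "(%x. h x - h x * c x) : T V" unfolding T_def using bC K(3) c(3,4) by (auto intro!: exI[of _ "K - G"])
 have "I h = I (%x. h x * c x) + I (%x. h x - h x * c x)" using I_diff[OF hC P] by simp
 hence "ennreal (I h) = ennreal (I (%x. h x * c x)) + ennreal (I (%x. h x - h x * c x))"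
  using I_T(1)[OF a] I_T(1)[OF b] by simp
 also have "... <= lamI I U + lamI I V" by (intro add_mono lamI_upper a b)
 finally show "ennreal (I h) <= lamI I U + lamI I V" .
qed

lemma I_0: "I (%_. 0) = 0" using I_scale[OF C0_0, of 0] by simp

lemma T_empty: "h : T {} ==> h = (%_. 0)" by (auto simp: T_def)

lemma lamI_empty: "lamI I {} = 0"
proof -
 have "T {} = {%_. 0}" using T_empty T0 by auto
 thus ?thesis by (simp add: lamI_def I_0)
qed

lemma lamI_UN: assumes U: "!!i::nat. open (U i)" shows "lamI I (\<Union>i. U i) <= (\<Sum>i. lamI I (U i))"
 unfolding lamI_def[of I "\<Union>i. U i"]
proof (rule SUP_least)
 fix h assume h: "h : T (\<Union>i. U i)"
 then obtain K where K: "compact K" "K <= (\<Union>i. U i)" "!!x. x ~: K ==> h x = 0" by (auto simp: T_def)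
 obtain C where C: "finite C" "K <= (UN i:C. U i)" using compactE_image[OF K(1), of UNIV U] U K(2) by auto
 have hT: "h : T (UN i:C. U i)" using h K C unfolding T_def by blast
 have "lamI I (UN i:C. U i) <= (SUM i:C. lamI I (U i))" using C(1)
 proof (induction)
  case (insert i C)
  have "lamI I (UN i:insert i C. U i) <= lamI I (U i) + lamI I (UN i:C. U i)"
   using lamI_Un[of "U i" "UN i:C. U i"] U by auto
  thus ?case using insert add_left_mono[OF insert.IH, of "lamI I (U i)"] by (auto intro: order_trans)
 qed (simp add: lamI_empty)
 also have "... <= (\<Sum>i. lamI I (U i))" by (rule sum_le_suminf) (use C in auto)
 finally show "ennreal (I h) <= (\<Sum>i. lamI I (U i))" using lamI_upper[OF hT] by (rule order_trans[rotated])
qed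

lemma muI_le: "open U ==> A <= U ==> muI I A <= lamI I U" unfolding muI_def by (rule INF_lower) auto

lemma muI_open: "open U ==> muI I U = lamI I U"
 unfolding muI_def by (intro antisym INF_greatest INF_lower lamI_mono) auto

lemma muI_mono: "A <= B ==> muI I A <= muI I B"
 unfolding muI_def by (intro INF_superset_mono) auto

lemma lamI_le_M: "lamI I U <= ennreal M"
 unfolding lamI_def by (intro SUP_least ennreal_leI I_T)

lemma muI_le_M: "muI I A <= ennreal M" using muI_le[of UNIV A] lamI_le_M[of UNIV] by (auto intro: order_trans)

lemma muI_approx: assumes "e > (0::real)" obtains U where "open U" "A <= U" "lamI I U <= muI I A + ennreal e"
proof -
 have "muI I A ~= \<infinity>" using muI_le_M[of A] by (metis ennreal_less_top infinity_ennreal_def linorder_not_less top.not_eq_extremum)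
 from INF_approx_ennreal[OF assms muI_def this] show ?thesis using that by (auto intro: less_imp_le)
qed

lemma muI_UN: "muI I (\<Union>i::nat. A i) <= (\<Sum>i. muI I (A i))"
proof (rule ennreal_le_epsilon)
 fix e :: real assume e: "0 < e"
 have "EX U. open U & A i <= U & lamI I U <= muI I (A i) + ennreal (e * (1/2)^Suc i)" for i
  using muI_approx[of "e * (1/2)^Suc i" "A i"] e by (metis half_gt_zero_iff mult_pos_pos zero_less_numeral zero_less_power zero_less_divide_1_iff)
 then obtain U where U: "!!i. open (U i)" "!!i. A i <= U i" "!!i. lamI I (U i) <= muI I (A i) + ennreal (e * (1/2)^Suc i)" by metis
 have "muI I (\<Union>i. A i) <= lamI I (\<Union>i. U i)" using U by (intro muI_le) auto
 also have "... <= (\<Sum>i. lamI I (U i))" by (rule lamI_UN[OF U(1)])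
 also have "... <= (\<Sum>i. muI I (A i) + ennreal (e * (1/2)^Suc i))" using U(3) by (intro suminf_le) auto
 also have "... = (\<Sum>i. muI I (A i)) + (\<Sum>i. ennreal e * ennreal ((1/2)^Suc i))"
  using e by (subst suminf_add[symmetric]) (auto simp del: ennreal_suminf_cmult simp add: ennreal_mult[symmetric])
 also have "... = (\<Sum>i. muI I (A i)) + ennreal e"
  unfolding ennreal_suminf_cmult by (subst suminf_ennreal_eq[OF zero_le_power power_half_series]) auto
 finally show "muI I (\<Union>i. A i) <= (\<Sum>i. muI I (A i)) + ennreal e" .
qed

lemma muI_empty: "muI I {} = 0" using muI_open[of "{}"] lamI_empty by simp

lemma muI_Un: "muI I (A Un B) <= muI I A + muI I B"
proof -
 have "muI I (\<Union>i. binaryset A B i) <= (\<Sum>i. muI I (binaryset A B i))" by (rule muI_UN)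
 also have "... = muI I A + muI I B" by (rule suminf_binaryset_eq[where f = "muI I", OF muI_empty])
 finally show ?thesis by (simp add: UN_binaryset_eq)
qed

text \<open>Caratheodory's condition for the open set U, tested on an open set G. A nearly optimal h
  for G Int U has compact support K, and a nearly optimal g is taken in G - K; the supports are
  disjoint, so h + g <= 1 is admissible for G.\<close>

lemma lamI_split: assumes G: "open G" and U: "open U" shows "muI I (G Int U) + muI I (G - U) <= lamI I G"
proof (rule ennreal_le_epsilon)
 fix e :: real assume e: "0 < e"
 have fin: "lamI I W ~= \<infinity>" for W using lamI_le_M[of W] by (metis ennreal_less_top infinity_ennreal_def linorder_not_less top.not_eq_extremum)
 have ne: "T W ~= {}" for W using T0 by blast
 obtain h where h: "h : T (G Int U)" "lamI I (G Int U) < ennreal (I h) + ennreal (e/2)"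
  using SUP_approx_ennreal[OF _ ne lamI_def fin, of "e/2" "G Int U"] e by auto
 then obtain K where K: "compact K" "K <= G Int U" "!!x. x ~: K ==> h x = 0" by (auto simp: T_def)
 have o: "open (G - K)" using G K compact_imp_closed by auto
 obtain g where g: "g : T (G - K)" "lamI I (G - K) < ennreal (I g) + ennreal (e/2)"
  using SUP_approx_ennreal[OF _ ne lamI_def fin, of "e/2" "G - K"] e by auto
 then obtain L where L: "compact L" "L <= G - K" "!!x. x ~: L ==> g x = 0" by (auto simp: T_def)
 have "h x + g x <= 1" for x using TD(3)[OF h(1), of x] TD(3)[OF g(1), of x] K(3)[of x] subsetD[OF L(2), of x] L(3)[of x] by (cases "x : K"; cases "x : L") auto
 moreover have "0 <= h x + g x" for x using TD(2)[OF h(1), of x] TD(2)[OF g(1), of x] by simp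
 moreover have "EX k. compact k & k <= G & (ALL x. x ~: k --> h x + g x = 0)"
  using K L by (intro exI[of _ "K Un L"]) auto
 ultimately have hg: "(%x. h x + g x) : T G" unfolding T_def using C0_add[OF TD(1)[OF h(1)] TD(1)[OF g(1)]] by simp
 have "muI I (G Int U) + muI I (G - U) <= lamI I (G Int U) + lamI I (G - K)"
  using K(2) o G U by (intro add_mono muI_le) auto
 also have "... <= (ennreal (I h) + ennreal (e/2)) + (ennreal (I g) + ennreal (e/2))" using h g by (intro add_mono) auto
 also have "... = (ennreal (I h) + ennreal (I g)) + (ennreal (e/2) + ennreal (e/2))" by (simp add: ac_simps)
 also have "... = ennreal (I (%x. h x + g x)) + ennreal e"
  using I_T(1)[OF h(1)] I_T(1)[OF g(1)] e I_add[OF TD(1)[OF h(1)] TD(1)[OF g(1)]] by (simp flip: ennreal_plus)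
 also have "... <= lamI I G + ennreal e" by (intro add_right_mono lamI_upper hg)
 finally show "muI I (G Int U) + muI I (G - U) <= lamI I G + ennreal e" .
qed

lemma muI_measure: "measure_space UNIV (sets borel) (muI I)"
proof -
 interpret S: sigma_algebra "UNIV::'a set" "Pow UNIV" by (rule sigma_algebra_Pow)
 have "outer_measure_space (Pow UNIV) (muI I)"
  unfolding outer_measure_space_def positive_def increasing_def countably_subadditive_def
  using muI_empty muI_mono muI_UN by auto
 from S.caratheodory_lemma[OF this]
 have ms: "measure_space UNIV (lambda_system UNIV (Pow UNIV) (muI I)) (muI I)" .
 have "U : lambda_system UNIV (Pow UNIV) (muI I)" if U: "open U" for U :: "'a set"
  unfolding S.lambda_system_eq
 proof (rule CollectI, intro conjI ballI antisym)
  fix A :: "'a set"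
  show "muI I (A Int U) + muI I (A - U) <= muI I A"
   unfolding muI_def[of I A]
  proof (rule INF_greatest, safe)
   fix G assume G: "open G" "A <= G"
   have "muI I (A Int U) + muI I (A - U) <= muI I (G Int U) + muI I (G - U)" using G by (intro add_mono muI_mono) auto
   also have "... <= lamI I G" by (rule lamI_split[OF G(1) U])
   finally show "muI I (A Int U) + muI I (A - U) <= lamI I G" .
  qed
  show "muI I A <= muI I (A Int U) + muI I (A - U)"
   using muI_Un[of "A Int U" "A - U"] by (simp add: Int_Diff_Un)
 qed auto
 moreover have sig: "sigma_algebra UNIV (lambda_system UNIV (Pow UNIV) (muI I))" using ms by (simp add: measure_space_def)
 ultimately have "sets borel <= lambda_system UNIV (Pow UNIV) (muI I)"
  unfolding sets_borel by (intro sigma_algebra.sigma_sets_subset) auto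
 hence "countably_additive (sets borel) (muI I)" using ms unfolding measure_space_def countably_additive_def by blast
 thus ?thesis using ms sets.sigma_algebra_axioms[of "borel::'a measure"] by (auto simp: measure_space_def positive_def)
qed

lemma sets_rz[simp]: "sets (rz I) = sets borel" unfolding rz_def by (metis sets.sets_measure_of_eq space_borel)
lemma space_rz[simp]: "space (rz I) = UNIV" using sets_eq_imp_space_eq[OF sets_rz] by simp

lemma emeasure_rz: "A : sets borel ==> emeasure (rz I) A = muI I A"
 unfolding rz_def using muI_measure by (intro emeasure_measure_of_sigma) (auto simp: measure_space_def)

lemma rz_open: "open U ==> emeasure (rz I) U = lamI I U" by (simp add: emeasure_rz muI_open)

lemma rz_finite: "emeasure (rz I) A <= ennreal M" 
 using emeasure_rz[of A] muI_le_M[of A] emeasure_notin_sets[of A "rz I"] by (cases "A : sets borel") auto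

lemma rz_lt: "emeasure (rz I) A < \<infinity>" using le_less_trans[OF rz_finite] by simp

lemma C0_int: assumes h: "h : C0" and N: "sets N = sets (borel::'a measure)" "emeasure N UNIV < \<infinity>" shows "integrable N h"
proof -
 obtain B where B: "!!x. abs (h x) <= B" using Cc_bound[of h] h by auto
 have "finite_measure N" using N sets_eq_imp_space_eq[OF N(1)] by (intro finite_measureI) auto
 moreover have "h : borel_measurable N" using F_meas[of h] h measurable_cong_sets[OF N(1) refl] by auto
 ultimately show ?thesis using B by (intro finite_measure.integrable_const_bound[of N h B]) auto
qed

lemma rz_integral_T: assumes h: "h : T UNIV" shows "(\<integral>x. h x \<partial>(rz I)) = I h"
proof -
 interpret N: finite_measure "rz I" using rz_lt[of UNIV] by (intro finite_measureI) auto
 have M0: "0 <= M" using I_T[OF T0] by (meson order_trans)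
 have hC: "h : C0" by (rule TD(1)[OF h])
 note [measurable] = F_meas[of h]
 have hm[measurable]: "h : borel_measurable borel" using hC by simp
 have key: "abs (I h - (\<integral>x. h x \<partial>(rz I))) * real n <= 2 * M" if n: "n > 0" for n :: nat
 proof -
  define a where "a k = measure (rz I) {x. real k / n < h x}" for k
  \<comment> \<open>Level masses shifted by one: the support of slice k is the closed level set k,
    which lies in the open level set k-1. The lowest slice has no such set and is bounded by
    M.\<close>
  define b where "b k = (case k of 0 => M | Suc j => a j)" for k
  define g where "g k x = real n * max 0 (min (h x - real k / n) (1 / n))" for k x
  have gC: "g k : C0" for k unfolding g_def by (rule C0_scale[OF C0_band[OF hC]]) auto
  have g01: "0 <= g k x" "g k x <= 1" for k x
   using n mult_left_mono[of "max 0 (min (h x - real k / n) (1 / n))" "1 / n" "real n"] by (auto simp: g_def)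
  have g0: "g k x = 0" if "h x <= real k / n" for k x using that by (simp add: g_def)
  have g1: "g k x = 1" if "real (Suc k) / n <= h x" for k x using that n by (auto simp: g_def field_simps)
  have op: "open {x. c < h x}" for c using hC by (intro open_Collect_less) (auto simp: Cc_iff)
  have aS: "{x. real k / n < h x} : sets (rz I)" for k using borel_open[OF op] by simp
  have aM: "a k <= M" for k using N.emeasure_eq_measure[of "{x. real k / n < h x}"] rz_finite[of "{x. real k / n < h x}"] M0
   by (simp add: a_def)
  have al: "ennreal (a k) = lamI I {x. real k / n < h x}" for k unfolding a_def
   using N.emeasure_eq_measure rz_open[OF op, of "real k / n"] by metis
  have dec: "a (Suc k) <= a k" for k unfolding a_def using aS
   by (intro N.finite_measure_mono) (auto intro: le_less_trans[rotated] simp: frac_le divide_right_mono)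
  obtain K where K: "compact K" "!!x. x ~: K ==> h x = 0" using h by (auto simp: T_def)
  have U: "I (g k) <= b k" for k
  proof (cases k)
   case 0 thus ?thesis using I_le_M[OF gC g01] by (simp add: b_def)
  next
   case (Suc j)
   have cl: "closed {x. real k / n <= h x}" using hC by (intro closed_Collect_le) (auto simp: Cc_iff)
   have "{x. real k / n <= h x} <= K" using K(2) n Suc by (force simp: field_simps)
   hence "{x. real k / n <= h x} = K Int {x. real k / n <= h x}" by blast
   hence "compact {x. real k / n <= h x}" using K(1) cl by (metis compact_Int_closed)
   moreover have "{x. real k / n <= h x} <= {x. real j / n < h x}" using n Suc
    less_le_trans[OF divide_strict_right_mono[of "real j" "real k" "real n"]] by auto
   ultimately have "g k : T {x. real j / n < h x}" unfolding T_def using gC g01 g0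
    by (auto intro!: exI[of _ "{x. real k / n <= h x}"]) (meson linear)
   from lamI_upper[OF this] show ?thesis unfolding al[symmetric] by (simp add: b_def Suc a_def)
  qed
  have L: "a (Suc k) <= I (g k)" for k
  proof -
   have "lamI I {x. real (Suc k) / n < h x} <= ennreal (I (g k))" unfolding lamI_def
   proof (intro SUP_least ennreal_leI I_mono)
    fix t x assume t: "t : T {x. real (Suc k) / n < h x}"
    show "t x <= g k x" using g1[of k x] g01[of k x] T_zero[OF t, of x] TD(3)[OF t, of x]
     by (cases "real (Suc k) / n < h x") auto
    show "t : C0" by (rule TD(1)[OF t])
   qed (rule gC)
   thus ?thesis unfolding al[symmetric] using I_nonneg[OF gC g01(1)] by simp
  qed
  have gi: "integrable (rz I) (g k)" for k by (rule C0_int[OF gC]) (simp_all add: rz_lt del: infinity_ennreal_def)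
  have ai: "a k = (\<integral>x. indicator {x. real k / n < h x} x \<partial>(rz I))" for k unfolding a_def using aS by simp
  have ii: "integrable (rz I) (indicat_real {x. real k / n < h x})" for k
   using aS by (intro integrable_real_indicator) (use rz_lt in auto)
  have L2: "a (Suc k) <= (\<integral>x. g k x \<partial>(rz I))" for k unfolding ai
   using g1[of k] g01[of k] by (intro integral_mono gi ii) (auto simp: indicator_def)
  have U2: "(\<integral>x. g k x \<partial>(rz I)) <= b k" for k
  proof (cases k)
   case 0
   have "(\<integral>x. g k x \<partial>(rz I)) <= (\<integral>x. 1 \<partial>(rz I))" using g01 by (intro integral_mono gi) auto
   also have "... = measure (rz I) UNIV" by simp
   also have "... <= M" using N.emeasure_eq_measure[of UNIV] rz_finite[of UNIV] M0 by simp
   finally show ?thesis using 0 by (simp add: b_def)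
  next
   case (Suc j)
   have "real j / n < real k / n" using Suc n by (simp add: divide_strict_right_mono)
   hence "g k x <= indicator {x. real j / n < h x} x" for x using g0[of x k] g01[of k x] by (auto simp: indicator_def)
   hence "(\<integral>x. g k x \<partial>(rz I)) <= (\<integral>x. indicator {x. real j / n < h x} x \<partial>(rz I))" by (intro integral_mono gi ii) auto
   thus ?thesis using Suc ai by (simp add: b_def)
  qed
  have hs: "real n * h x = (\<Sum>k<n. g k x)" for x
  proof -
   have st: "g k x = real n * (min (h x) (real (Suc k) / n) - min (h x) (real k / n))" for k
   proof -
    have e: "real (Suc k) / n = real k / n + 1 / n" by (simp add: add_divide_distrib)
    have "0 < 1 / real n" using n by simp
    moreover have "max 0 (min (t - c) d) = min t (c + d) - min t c" if "0 < d" for t c d :: real using that by auto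
    ultimately show ?thesis unfolding g_def e by metis
   qed
   have "(\<Sum>k<n. g k x) = real n * (\<Sum>k<n. min (h x) (real (Suc k) / n) - min (h x) (real k / n))"
    unfolding st sum_distrib_left ..
   also have "(\<Sum>k<n. min (h x) (real (Suc k) / n) - min (h x) (real k / n)) = h x"
    unfolding sum_lessThan_telescope[of "%k. min (h x) (real k / n)"] using n TD(2,3)[OF h, of x] by simp
   finally show ?thesis by simp
  qed
  have Is: "I (%x. \<Sum>k<j. g k x) = (\<Sum>k<j. I (g k)) & (%x. \<Sum>k<j. g k x) : C0" for j
   by (induction j) (use I_0 C0_0 I_add gC C0_add in auto)
  have "real n * I h = (\<Sum>k<n. I (g k))" using I_scale[OF hC, of "real n"] Is[of n] hs by simp
  moreover have "real n * (\<integral>x. h x \<partial>(rz I)) = (\<Sum>k<n. \<integral>x. g k x \<partial>(rz I))"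
  proof -
   have "real n * (\<integral>x. h x \<partial>(rz I)) = (\<integral>x. real n * h x \<partial>(rz I))" by simp
   also have "... = (\<integral>x. (\<Sum>k<n. g k x) \<partial>(rz I))" by (simp only: hs)
   also have "... = (\<Sum>k<n. \<integral>x. g k x \<partial>(rz I))" by (rule Bochner_Integration.integral_sum) (rule gi)
   finally show ?thesis .
  qed
  ultimately have "(I h - (\<integral>x. h x \<partial>(rz I))) * real n = (\<Sum>k<n. I (g k) - (\<integral>x. g k x \<partial>(rz I)))"
   unfolding sum_subtractf left_diff_distrib by (simp only: mult.commute)
  hence "abs (I h - (\<integral>x. h x \<partial>(rz I))) * real n = abs (\<Sum>k<n. I (g k) - (\<integral>x. g k x \<partial>(rz I)))"
   by (metis abs_mult abs_of_nat)
  also have "... <= (\<Sum>k<n. abs (I (g k) - (\<integral>x. g k x \<partial>(rz I))))" by (rule sum_abs)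
  also have "... <= (\<Sum>k<n. (b k - b (Suc k)) + (b (Suc k) - b (Suc (Suc k))))"
  proof (rule sum_mono)
   fix k show "abs (I (g k) - (\<integral>x. g k x \<partial>(rz I))) <= (b k - b (Suc k)) + (b (Suc k) - b (Suc (Suc k)))"
    using U[of k] L[of k] U2[of k] L2[of k] by (simp add: b_def[of "Suc (Suc k)"] abs_le_iff)
  qed
  also have "... = (b 0 - b n) + (b (Suc 0) - b (Suc n))"
   unfolding sum.distrib sum_lessThan_telescope'[of b] sum_lessThan_telescope'[of "%k. b (Suc k)"] by simp
  also have "... <= 2 * M"
  proof -
   have bp: "0 <= b k" for k using M0 by (cases k) (auto simp: b_def a_def)
   have "b 0 = M" "b (Suc 0) <= M" using aM[of 0] by (auto simp: b_def)
   thus ?thesis using bp[of n] bp[of "Suc n"] by linarith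
  qed
  finally show ?thesis .
 qed
 show ?thesis
 proof (rule ccontr)
  assume "(\<integral>x. h x \<partial>(rz I)) ~= I h"
  hence p: "abs (I h - (\<integral>x. h x \<partial>(rz I))) > 0" by simp
  obtain n :: nat where n: "2 * M + 1 < real n * abs (I h - (\<integral>x. h x \<partial>(rz I)))" using ex_less_of_nat_mult[OF p] by blast
  hence "n > 0" using M0 by (cases n) auto
  from key[OF this] n show False by (simp add: mult.commute)
 qed
qed

lemma rz_integral: assumes h: "h : C0" shows "integrable (rz I) h" "(\<integral>x. h x \<partial>(rz I)) = I h"
proof -
 have i: "integrable (rz I) g" if "g : C0" for g by (rule C0_int[OF that]) (simp_all add: rz_lt del: infinity_ennreal_def)
 show "integrable (rz I) h" by (rule i[OF h])
 obtain B where B: "B > 0" "!!x. abs (h x) <= B" using Cc_bound[of h] h by auto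
 define p where "p x = 1/B * max 0 (min (h x - 0) B)" for x
 define q where "q x = 1/B * max 0 (min ((-1) * h x - 0) B)" for x
 have pqC: "p : C0" "q : C0" unfolding p_def q_def by (intro C0_scale C0_band h; use B in simp)+
 have "0 <= p x" "p x <= 1" "0 <= q x" "q x <= 1" for x using B(1) by (auto simp: p_def q_def)
 hence pq: "p : T UNIV" "q : T UNIV" using pqC unfolding T_def by (auto simp: Cc_iff)
 have hpq: "h = (%x. B * (p x - q x))"
 proof
  fix x show "h x = B * (p x - q x)" using B(1) B(2)[of x] by (auto simp: p_def q_def min_def max_def)
 qed
 have "(\<integral>x. h x \<partial>(rz I)) = B * ((\<integral>x. p x \<partial>(rz I)) - (\<integral>x. q x \<partial>(rz I)))"
  unfolding hpq using i[OF pqC(1)] i[OF pqC(2)] by simp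
 also have "... = I h" unfolding rz_integral_T[OF pq(1)] rz_integral_T[OF pq(2)]
  unfolding hpq using I_scale[OF C0_diff[OF pqC]] I_diff[OF pqC] by simp
 finally show "(\<integral>x. h x \<partial>(rz I)) = I h" .
qed

text \<open>On open sets any representing measure equals the supremum over test functions, by
  exhaustion with compact sets, and open sets generate. Finiteness of N follows from its value on
  the whole space.\<close>

lemma rz_unique: assumes N: "sets N = sets borel" and r: "!!h. h : C0 ==> integrable N h & (\<integral>x. h x \<partial>N) = I h"
 shows "N = rz I"
proof (rule measure_eqI_generator_eq[where E = "{U. open U}" and \<Omega> = UNIV and A = "%_. UNIV"])
 have nn: "(\<integral>\<^sup>+x. ennreal (h x) \<partial>N) = ennreal (I h)" if h: "h : T U" for h U
  using nn_integral_eq_integral[of N h] r[OF TD(1)[OF h]] TD(2)[OF h] by simp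
 have op: "emeasure N U = lamI I U" if U: "open U" for U
 proof (rule antisym)
  obtain K where K: "!!n::nat. compact (K n)" "!!n. K n <= interior (K (Suc n))" "(\<Union>n. interior (K n)) = U" "!!n. K n <= U"
   using open_exhaust[OF U] by blast
  have inc: "incseq (%n. interior (K n))" using K(2) interior_subset by (intro incseq_SucI) blast
  have rg: "range (%n. interior (K n)) <= sets N" unfolding N by (intro image_subsetI borel_open open_interior)
  have "emeasure N U = (SUP n. emeasure N (interior (K n)))"
   unfolding SUP_emeasure_incseq[OF rg inc] K(3) ..
  also have "... <= lamI I U"
  proof (rule SUP_least)
   fix n
   obtain h G where h: "h : T U" "open G" "K n <= G" "!!x. x : G ==> h x = 1" using urysohn[OF K(1) U K(4), of n] by blast
   have "emeasure N (interior (K n)) = (\<integral>\<^sup>+x. indicator (interior (K n)) x \<partial>N)"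
    by (rule nn_integral_indicator[symmetric]) (unfold N, intro borel_open open_interior)
   also have "... <= (\<integral>\<^sup>+x. ennreal (h x) \<partial>N)"
    using h interior_subset[of "K n"] by (intro nn_integral_mono) (auto simp: indicator_def)
   also have "... <= lamI I U" unfolding nn[OF h(1)] by (rule lamI_upper[OF h(1)])
   finally show "emeasure N (interior (K n)) <= lamI I U" .
  qed
  finally show "emeasure N U <= lamI I U" .
  show "lamI I U <= emeasure N U" unfolding lamI_def
  proof (rule SUP_least)
   fix h assume h: "h : T U"
   have "ennreal (I h) = (\<integral>\<^sup>+x. ennreal (h x) \<partial>N)" using nn[OF h] by simp
   also have "... <= (\<integral>\<^sup>+x. indicator U x \<partial>N)"
    using T_zero[OF h] TD(3)[OF h] by (intro nn_integral_mono) (auto simp: indicator_def)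
   also have "... = emeasure N U" by (rule nn_integral_indicator) (unfold N, intro borel_open U)
   finally show "ennreal (I h) <= emeasure N U" .
  qed
 qed
 show "emeasure N X = emeasure (rz I) X" if "X : {U. open U}" for X using that op rz_open by simp
 show "emeasure N UNIV ~= \<infinity>" using op[of UNIV] lamI_le_M[of UNIV] by (auto simp: top_unique)
qed (auto simp: Int_stable_def N sets_borel)

end

end

section \<open>Energy measures\<close>

context mmd begin

lemma Ib_lin: assumes "w : FB" "h : FB" "k : FB"
 shows "Ib (%x. h x + c * k x) w w = Ib h w w + c * Ib k w w"
proof -
 have F: "w : F" "h : F" "k : F" "(%x. w x * h x) : F" "(%x. w x * k x) : F" "(%x. (w x)^2) : F"
  using assms FB_prod[OF assms(1,2)] FB_prod[OF assms(1,3)] FB_square[OF assms(1)] by auto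
 have "(%x. w x * (h x + c * k x)) = (%x. w x * h x + c * (w x * k x))" by (auto simp: algebra_simps)
 thus ?thesis unfolding Ib_self using F by (simp add: EE.B_simps algebra_simps)
qed

lemma C0_decomp: assumes h: "h : C0"
 obtains B p q where "B > 0" "p : T UNIV" "q : T UNIV" "h = (%x. B * (p x - q x))"
proof -
 obtain B where B: "B > 0" "!!x. abs (h x) <= B" using Cc_bound[of h] h by auto
 define p where "p x = 1/B * max 0 (min (h x - 0) B)" for x
 define q where "q x = 1/B * max 0 (min ((-1) * h x - 0) B)" for x
 have pqC: "p : C0" "q : C0" unfolding p_def q_def by (intro C0_scale C0_band h; use B in simp)+
 have "0 <= p x" "p x <= 1" "0 <= q x" "q x <= 1" for x using B(1) by (auto simp: p_def q_def)
 hence pq: "p : T UNIV" "q : T UNIV" using pqC unfolding T_def by (auto simp: Cc_iff)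
 have "h = (%x. B * (p x - q x))"
 proof
  fix x show "h x = B * (p x - q x)" using B(1) B(2)[of x] by (auto simp: p_def q_def min_def max_def)
 qed
 thus ?thesis using that B(1) pq by blast
qed

lemma trunc_FB: "f : F ==> trunc n f : FB"
 using trunc(1)[of f n] by (auto simp: ess_bounded_def trunc_def intro!: exI[of _ "real n"] AE_I2)

text \<open>The integral of h against the energy measure of f, for unbounded f as well; for bounded
  f it is the bracket itself.\<close>

definition "GI f h = lim (%n. Ib h (trunc n f) (trunc n f))"

lemma T_FB: "h : T U ==> h : FB" by (rule C0_FB[OF TD(1)])

lemma Ib_sqrt_diff: assumes "h : T U" "f : FB" "g : FB"
 shows "abs (sqrt (Ib h f f) - sqrt (Ib h g g)) <= sqrt (En (%x. f x - g x))"
proof -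
 interpret h: psd FB "Ib h" by (rule Ib_psd[OF T_FB[OF assms(1)]]) (use TD[OF assms(1)] in auto)
 show ?thesis
  by (rule order_trans[OF h.tri_abs[OF assms(2,3)] real_sqrt_le_mono[OF Ib_le[OF h.diff[OF assms(2,3)] T_FB[OF assms(1)]]]])
   (use TD[OF assms(1)] in auto)
qed

text \<open>For 0 <= h <= 1 the root of \<open>Ib h\<close> is 1-Lipschitz for the root energy, so
  it converges along every bounded sequence that tends to f in energy, always to the same
  value.\<close>

lemma Ib_conv: assumes f: "f : F" and w: "!!n. w n : FB" "(%n. En (%x. w n x - f x)) ~~> 0"
  and w': "!!n. w' n : FB" "(%n. En (%x. w' n x - f x)) ~~> 0" and h: "h : T U"
 shows "convergent (%n. Ib h (w n) (w n))" "(%n. Ib h (w n) (w n)) ~~> L ==> (%n. Ib h (w' n) (w' n)) ~~> L"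
proof -
 have F: "w n : F" "w' n : F" for n using w w' by auto
 define e where "e w n = sqrt (En (%x. w n x - f x))" for w :: "nat => 'a => real" and n
 have el: "e w ~~> 0" "e w' ~~> 0" using tendsto_real_sqrt[OF w(2)] tendsto_real_sqrt[OF w'(2)] by (auto simp: e_def[abs_def])
 have tr: "sqrt (En (%x. a x - b x)) <= sqrt (En (%x. a x - f x)) + sqrt (En (%x. b x - f x))"
  if "a : F" "b : F" for a b using EE.tri_diff[OF EE.diff[OF that(1) f] EE.diff[OF that(2) f]] by simp
 have nn: "0 <= Ib h g g" if "g : FB" for g by (rule Ib_nonneg[OF that T_FB[OF h]]) (use TD[OF h] in auto)
 have "Cauchy (%n. sqrt (Ib h (w n) (w n)))"
 proof (rule metric_CauchyI)
  fix r :: real assume "0 < r"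
  then obtain N where N: "!!n. n >= N ==> e w n < r/2" using order_tendstoD(2)[OF el(1), of "r/2"] by (auto simp: eventually_sequentially)
  have "dist (sqrt (Ib h (w i) (w i))) (sqrt (Ib h (w j) (w j))) < r" if "i >= N" "j >= N" for i j
   using Ib_sqrt_diff[OF h w(1)[of i] w(1)[of j]] tr[OF F(1)[of i] F(1)[of j]] N[OF that(1)] N[OF that(2)]
   by (simp add: dist_real_def e_def)
  thus "EX M. ALL m>=M. ALL n>=M. dist (sqrt (Ib h (w m) (w m))) (sqrt (Ib h (w n) (w n))) < r" by blast
 qed
 then obtain l where "(%n. sqrt (Ib h (w n) (w n))) ~~> l" using Cauchy_convergent convergent_def by blast
 from tendsto_power[OF this, of 2] show "convergent (%n. Ib h (w n) (w n))" using nn[OF w(1)] by (auto simp: convergent_def)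
 assume L: "(%n. Ib h (w n) (w n)) ~~> L"
 have "(%n. sqrt (Ib h (w' n) (w' n)) - sqrt (Ib h (w n) (w n))) ~~> 0"
 proof (rule Lim_null_comparison[OF always_eventually])
  show "(%n. e w' n + e w n) ~~> 0" using tendsto_add[OF el(2,1)] by simp
  show "ALL n. norm (sqrt (Ib h (w' n) (w' n)) - sqrt (Ib h (w n) (w n))) <= e w' n + e w n"
   using order_trans[OF Ib_sqrt_diff[OF h w'(1) w(1)] tr[OF F(2,1)]] by (auto simp: e_def)
 qed
 from tendsto_add[OF this tendsto_real_sqrt[OF L]] have "(%n. sqrt (Ib h (w' n) (w' n))) ~~> sqrt L" by simp
 from tendsto_power[OF this, of 2] show "(%n. Ib h (w' n) (w' n)) ~~> L"
  using nn[OF w'(1)] LIMSEQ_le_const[OF L] nn[OF w(1)] by auto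
qed

lemma GI_lim: assumes f: "f : F" and w: "!!n. w n : FB" "(%n. En (%x. w n x - f x)) ~~> 0" and h: "h : C0"
 shows "(%n. Ib h (w n) (w n)) ~~> GI f h"
proof -
 let ?t = "%n. trunc n f"
 note t = trunc_FB[OF f] trunc(2)[OF f]
 \<comment> \<open>The Lipschitz estimate needs weights between 0 and 1, so a signed h is written
   through two such weights.\<close>
 obtain B p q where d: "B > 0" "p : T UNIV" "q : T UNIV" "h = (%x. B * (p x - q x))" by (rule C0_decomp[OF h])
 have e: "h = (%x. (%x. B * p x) x + (- B) * q x)" unfolding d(4) by (auto simp: algebra_simps)
 have e2: "(%x. B * p x) = (%x. (%x. 0) x + B * p x)" by simp
 have Z: "(%_. 0) : FB" by (rule T_FB[OF T0])
 have "Ib (%_. 0) v v = 0" if "v : FB" for v using Ib_lin[OF that Z Z, of 1] by simp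
 hence x: "Ib h v v = B * Ib p v v - B * Ib q v v" if "v : FB" for v
  unfolding e using Ib_lin[OF that FB_scale[OF T_FB[OF d(2)]] T_FB[OF d(3)], of B "-B"] Ib_lin[OF that Z T_FB[OF d(2)], of B] that by simp
 obtain a b where ab: "(%n. Ib p (?t n) (?t n)) ~~> a" "(%n. Ib q (?t n) (?t n)) ~~> b"
  using Ib_conv(1)[OF f t t d(2)] Ib_conv(1)[OF f t t d(3)] by (auto simp: convergent_def)
 have 1: "(%n. Ib h (?t n) (?t n)) ~~> B * a - B * b" unfolding x[OF t(1)] by (intro tendsto_intros ab)
 have 2: "(%n. Ib h (w n) (w n)) ~~> B * a - B * b" unfolding x[OF w(1)]
  by (intro tendsto_intros Ib_conv(2)[OF f t w d(2) ab(1)] Ib_conv(2)[OF f t w d(3) ab(2)])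
 show ?thesis using 2 limI[OF 1] by (simp add: GI_def)
qed

lemma GI_FB: assumes "f : FB" "h : C0" shows "GI f h = E f (%x. f x * h x) - 1/2 * E (%x. (f x)^2) h"
proof -
 have z: "En (%_. 0) = 0" using EE.B_scale[OF F0 F0, of 0] by simp
 have "(%n. Ib h f f) ~~> GI f h" by (rule GI_lim) (use assms z in auto)
 thus ?thesis using LIMSEQ_unique tendsto_const Ib_self by metis
qed

lemma GI_posfun: assumes f: "f : F" shows "posfun (GI f) (E f f)"
 unfolding posfun_def
proof (intro conjI ballI allI impI)
 note l = GI_lim[OF f trunc_FB[OF f] trunc(2)[OF f]] and t = trunc_FB[OF f]
 fix g h assume g: "g : C0" and h: "h : C0"
 have "(%n. Ib (%x. g x + h x) (trunc n f) (trunc n f)) ~~> GI f g + GI f h"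
  using tendsto_add[OF l[OF g] l[OF h]] Ib_lin[OF t C0_FB[OF g] C0_FB[OF h], where c = 1] by simp
 thus "GI f (%x. g x + h x) = GI f g + GI f h" using LIMSEQ_unique[OF l[OF C0_add[OF g h]]] by simp
next
 note l = GI_lim[OF f trunc_FB[OF f] trunc(2)[OF f]] and t = trunc_FB[OF f]
 fix h and c :: real assume h: "h : C0"
 have Z: "(%_. 0) : FB" by (rule T_FB[OF T0])
 have "Ib (%_. 0) v v = 0" if "v : FB" for v using Ib_lin[OF that Z Z, of 1] by simp
 hence "(%n. Ib (%x. c * h x) (trunc n f) (trunc n f)) ~~> c * GI f h"
  using tendsto_mult[OF tendsto_const l[OF h], of c] Ib_lin[OF t Z C0_FB[OF h], where c = c] t by simp
 thus "GI f (%x. c * h x) = c * GI f h" using LIMSEQ_unique[OF l[OF C0_scale[OF h]]] by simp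
next
 note l = GI_lim[OF f trunc_FB[OF f] trunc(2)[OF f]] and t = trunc_FB[OF f]
 fix h assume h: "h : C0" "ALL x. 0 <= h x"
 show "0 <= GI f h" by (rule LIMSEQ_le_const[OF l[OF h(1)]]) (use Ib_nonneg[OF t C0_FB[OF h(1)]] h(2) in auto)
next
 note l = GI_lim[OF f trunc_FB[OF f] trunc(2)[OF f]] and t = trunc_FB[OF f]
 fix h assume h: "h : C0" "ALL x. 0 <= h x & h x <= 1"
 show "GI f h <= E f f"
  by (rule LIMSEQ_le[OF l[OF h(1)] EE.lim2[OF trunc(1)[OF f] f trunc(2)[OF f]]]) (use Ib_le[OF t C0_FB[OF h(1)]] h(2) in auto)
qed

definition "G f = rz (GI f)"
abbreviation "gm f A == measure (G f) A"

context
 fixes f assumes f: "f : F"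
begin

lemma sets_G[simp]: "sets (G f) = sets borel" unfolding G_def by (rule sets_rz[OF GI_posfun[OF f]])
lemma G_le: "emeasure (G f) A <= ennreal (E f f)" unfolding G_def by (rule rz_finite[OF GI_posfun[OF f]])
lemma G_fin: "finite_measure (G f)" using le_less_trans[OF G_le ennreal_less_top] by (intro finite_measureI) (metis infinity_ennreal_def less_irrefl)
lemma emeasure_G: "emeasure (G f) A = ennreal (gm f A)" by (rule finite_measure.emeasure_eq_measure[OF G_fin])
lemma gm_le: "gm f A <= E f f" using G_le[of A] EE.B_nonneg[OF f] by (simp add: emeasure_G)
lemma gm_open: "open U ==> ennreal (gm f U) = lamI (GI f) U"
 using rz_open[OF GI_posfun[OF f], of U] emeasure_G[of U] by (simp add: G_def)
lemma GI_le: "open U ==> h : T U ==> GI f h <= gm f U"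
 using lamI_upper[OF GI_posfun[OF f], of h U] I_T(1)[OF GI_posfun[OF f]] by (simp add: gm_open[symmetric])
lemma gm_open_le: "open U ==> 0 <= c ==> (!!h. h : T U ==> GI f h <= c) ==> gm f U <= c"
 using SUP_least[of "T U" "%h. ennreal (GI f h)" "ennreal c"] gm_open[of U]
 by (simp add: lamI_def) (metis ennreal_le_iff)
lemma gm_mono: "A <= B ==> B : sets borel ==> gm f A <= gm f B"
 by (rule finite_measure.finite_measure_mono[OF G_fin]) simp_all
lemma gm_outer: assumes "A : sets borel" "e > 0" obtains U where "open U" "A <= U" "gm f U <= gm f A + e"
proof -
 obtain U where U: "open U" "A <= U" "lamI (GI f) U <= muI (GI f) A + ennreal e" by (rule muI_approx[OF GI_posfun[OF f] assms(2)])
 have "muI (GI f) A = ennreal (gm f A)" using emeasure_rz[OF GI_posfun[OF f] assms(1)] emeasure_G by (simp add: G_def)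
 hence "gm f U <= gm f A + e" using U(3) assms(2) by (simp add: gm_open[OF U(1), symmetric] flip: ennreal_plus)
 with U show ?thesis using that by blast
qed
end

text \<open>For open sets the inequality comes from the semidefinite form \<open>Ib h\<close>, test
  function by test function. Borel sets follow by outer regularity; the neighbourhoods that suit f
  and g are intersected.\<close>

lemma gm_tri: assumes f: "f : F" and g: "g : F" and A: "A : sets borel"
 shows "sqrt (gm (%x. f x + g x) A) <= sqrt (gm f A) + sqrt (gm g A)"
proof -
 let ?s = "%x. f x + g x"
 note s = EE.add[OF f g]
 have op: "gm ?s U <= (sqrt (gm f U) + sqrt (gm g U))^2" if U: "open U" for U
 proof (rule gm_open_le[OF s U])
  fix h assume h: "h : T U"
  let ?w = "%n x. trunc n f x + trunc n g x"
  note hC = TD(1)[OF h] and t = trunc_FB[OF f] trunc_FB[OF g]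
  have w: "?w n : FB" for n by (rule FB_add[OF t])
  have tF: "(%x. trunc n f x - f x) : F" "(%x. trunc n g x - g x) : F" for n by (intro EE.diff trunc f g)+
  have "(%n. En (%x. ?w n x - ?s x)) ~~> 0"
  proof (rule Lim_null_comparison[OF always_eventually])
   show "(%n. 2 * En (%x. trunc n f x - f x) + 2 * En (%x. trunc n g x - g x)) ~~> 0"
    using tendsto_add[OF tendsto_mult_left[OF trunc(2)[OF f], of 2] tendsto_mult_left[OF trunc(2)[OF g], of 2]] by simp
   have eq: "(%x. ?w n x - ?s x) = (%x. (trunc n f x - f x) + (trunc n g x - g x))" for n by auto
   show "ALL n. norm (En (%x. ?w n x - ?s x)) <= 2 * En (%x. trunc n f x - f x) + 2 * En (%x. trunc n g x - g x)"
    unfolding eq using EE.add_le[OF tF] EE.B_nonneg[OF EE.add[OF tF]] by simp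
  qed
  note L = GI_lim[OF s w this hC]
  note Lf = GI_lim[OF f t(1) trunc(2)[OF f] hC] and Lg = GI_lim[OF g t(2) trunc(2)[OF g] hC]
  interpret h: psd FB "Ib h" by (rule Ib_psd[OF T_FB[OF h]]) (use TD[OF h] in auto)
  have "sqrt (GI ?s h) <= sqrt (GI f h) + sqrt (GI g h)"
   by (rule LIMSEQ_le[OF tendsto_real_sqrt[OF L] tendsto_add[OF tendsto_real_sqrt[OF Lf] tendsto_real_sqrt[OF Lg]]])
    (use h.tri_add[OF t] in auto)
  also have "... <= sqrt (gm f U) + sqrt (gm g U)" by (intro add_mono real_sqrt_le_mono GI_le f g U h)
  finally show "GI ?s h <= (sqrt (gm f U) + sqrt (gm g U))^2" by (rule sqrt_le_D)
 qed simp
 have "sqrt (gm ?s A) <= sqrt (gm f A + 1 / real (Suc n)) + sqrt (gm g A + 1 / real (Suc n))" for n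
 proof -
  define e where "e = 1 / real (Suc n)"
  have e: "e > 0" by (simp add: e_def)
  obtain U where U: "open U" "A <= U" "gm f U <= gm f A + e" by (rule gm_outer[OF f A e])
  obtain V where V: "open V" "A <= V" "gm g V <= gm g A + e" by (rule gm_outer[OF g A e])
  have o: "open (U Int V)" using U V by auto
  have "gm ?s A <= gm ?s (U Int V)" using U V o by (intro gm_mono s) auto
  hence "sqrt (gm ?s A) <= sqrt ((sqrt (gm f (U Int V)) + sqrt (gm g (U Int V)))^2)"
   using op[OF o] by (intro real_sqrt_le_mono) (rule order_trans)
  also have "... = sqrt (gm f (U Int V)) + sqrt (gm g (U Int V))" by simp
  also have "... <= sqrt (gm f A + e) + sqrt (gm g A + e)"
   using gm_mono[OF f, of "U Int V" U] gm_mono[OF g, of "U Int V" V] U V by (intro add_mono real_sqrt_le_mono) auto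
  finally show ?thesis by (simp add: e_def)
 qed
 moreover have l: "(%n. 1 / real (Suc n)) ~~> 0" using LIMSEQ_Suc[OF lim_const_over_n[of 1]] by simp
 have "(%n. sqrt (gm f A + 1 / real (Suc n)) + sqrt (gm g A + 1 / real (Suc n))) ~~> sqrt (gm f A + 0) + sqrt (gm g A + 0)"
  by (intro tendsto_intros l)
 ultimately show ?thesis by (intro LIMSEQ_le_const[of _ "sqrt (gm f A) + sqrt (gm g A)"]) auto
qed

lemma gm_diff: assumes "f : F" "g : F" "A : sets borel"
 shows "sqrt (gm f A) <= sqrt (gm g A) + sqrt (gm (%x. f x - g x) A)"
 using gm_tri[OF assms(2) EE.diff[OF assms(1,2)] assms(3)] by simp

lemma gm_diff_E: assumes "f : F" "g : F" "A : sets borel"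
 shows "abs (sqrt (gm f A) - sqrt (gm g A)) <= sqrt (En (%x. f x - g x))"
 using gm_diff[OF assms] gm_diff[OF assms(2,1,3)] gm_le[OF EE.diff[OF assms(1,2)], of A] gm_le[OF EE.diff[OF assms(2,1)], of A]
  EE.B_diff_swap[OF assms(1,2)] real_sqrt_le_mono by (smt (verit, best))

lemma gm_limit: assumes "!!n. u n : F" "f : F" "A : sets borel" "(%n. En (%x. u n x - f x)) ~~> 0"
 shows "(%n. gm (u n) A) ~~> gm f A"
proof -
 have "(%n. sqrt (gm (u n) A) - sqrt (gm f A)) ~~> 0"
  by (rule Lim_null_comparison[OF always_eventually tendsto_real_sqrt[OF assms(4), simplified]]) (use gm_diff_E[OF assms(1-3)] in auto)
 hence "(%n. sqrt (gm (u n) A)) ~~> sqrt (gm f A)" by (simp add: LIM_zero_iff)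
 from tendsto_power[OF this, of 2] show ?thesis by simp
qed

lemma gm_sum: assumes "finite Q" "!!q. q : Q ==> f q : F" "A : sets borel"
 shows "sqrt (gm (%x. SUM q:Q. f q x) A) <= (SUM q:Q. sqrt (gm (f q) A))"
 using assms(1,2)
proof (induction rule: finite_induct)
 case empty
 have z: "En (%_. 0) = 0" using EE.B_scale[OF F0 F0, of 0] by simp
 have "gm (%_. 0) A = 0" using gm_le[OF F0, of A] z measure_nonneg[of "G (%_. 0)" A] by linarith
 thus ?case by simp
next
 case (insert q Q)
 have "(%x. SUM q:Q. f q x) : F" by (rule EE.sum) (use insert F_ne in auto)
 thus ?case using gm_tri[of "f q" "%x. SUM q:Q. f q x" A] insert assms(3) by force
qed

lemma energy_bdd: assumes f: "f : FB" shows "energy_measure_bdd E F f = G f"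
proof -
 have fF: "f : F" using f by auto
 note P = GI_posfun[OF fF]
 show ?thesis unfolding energy_measure_bdd_def
 proof (rule the_equality)
  show "sets (G f) = sets borel & (ALL g:C0. integrable (G f) g & (\<integral>x. g x \<partial>(G f)) = E f (%x. f x * g x) - 1/2 * E (%x. (f x)^2) g)"
   using rz_integral[OF P] sets_rz[OF P] GI_FB[OF f] unfolding G_def by auto
  fix \<mu> assume "sets \<mu> = sets borel & (ALL g:C0. integrable \<mu> g & (\<integral>x. g x \<partial>\<mu>) = E f (%x. f x * g x) - 1/2 * E (%x. (f x)^2) g)"
  thus "\<mu> = G f" unfolding G_def using GI_FB[OF f] by (intro rz_unique[OF P]) auto
 qed
qed

lemma energy_measure_G: assumes f: "f : F" shows "energy_measure m E F f = G f"
proof (cases "ess_bounded m f")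
 case True thus ?thesis using energy_bdd[of f] f by (simp add: energy_measure_def)
next
 case False
 have t: "energy_measure_bdd E F (%x. max (- real n) (min (f x) (real n))) = G (trunc n f)" for n
  using energy_bdd[OF trunc_FB[OF f], of n] by (simp add: trunc_def)
 have l: "(%n. emeasure (G (trunc n f)) A) ~~> emeasure (G f) A" if "A : sets borel" for A
  unfolding emeasure_G[OF trunc(1)[OF f]] emeasure_G[OF f] by (intro tendsto_ennrealI gm_limit trunc f that)
 have "(THE \<mu>. sets \<mu> = sets borel & (ALL A:sets borel. (%n. emeasure (G (trunc n f)) A) ~~> emeasure \<mu> A)) = G f"
 proof (rule the_equality)
  show "sets (G f) = sets borel & (ALL A:sets borel. (%n. emeasure (G (trunc n f)) A) ~~> emeasure (G f) A)" using l f by simp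
  fix \<mu> assume a: "sets \<mu> = sets borel & (ALL A:sets borel. (%n. emeasure (G (trunc n f)) A) ~~> emeasure \<mu> A)"
  show "\<mu> = G f" by (rule measure_eqI) (use a f LIMSEQ_unique[OF l] in auto)
 qed
 thus ?thesis using False by (simp add: energy_measure_def t)
qed

section \<open>Strong locality\<close>

lemma msupp_sub: "closed C ==> (!!x. x ~: C ==> f x = 0) ==> msupp m f <= C" unfolding msupp_def by (intro Inter_lower) auto

lemma msupp_compact: assumes "compact K" "!!x. x ~: K ==> f x = 0" shows "compact (msupp m (f :: 'a => real))"
proof -
 have "closed (msupp m f)" unfolding msupp_def by (intro closed_Inter) auto
 moreover have "msupp m f <= K" using assms by (intro msupp_sub compact_imp_closed) auto
 ultimately show ?thesis using assms(1) by (metis compact_Int_closed inf.absorb_iff2)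
qed

lemma E_sl: assumes z: "z : F" "compact K'" "!!x. x ~: K' ==> z x = 0" and h: "h : F" "compact K" "!!x. x ~: K ==> h x = 0"
  and G: "open G'" "K <= G'" "!!x. x : G' ==> z x = c"
 shows "E z h = 0"
proof -
 have "msupp m (%x. z x - c) <= - G'" using G by (intro msupp_sub) auto
 moreover have "msupp m h <= K" using h by (intro msupp_sub compact_imp_closed) auto
 ultimately have "msupp m (%x. z x - c) Int msupp m h = {}" using G(2) by blast
 thus ?thesis using F_facts(5)[unfolded strongly_local_form_def, rule_format, OF z(1) h(1)]
   msupp_compact[of K' z, OF z(2)] z(3) msupp_compact[of K h, OF h(2)] h(3) by blast
qed

text \<open>Strong locality speaks of compactly supported functions that are constant near the
  support of h. The function v is only almost everywhere constant on O' and may lack compact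
  support, so it is approximated by elements of the core that are corrected near the support; a weak
  limit in energy suffices.\<close>

lemma E_local: assumes v: "v : FB" and O': "open O'" "AE x in m. x : O' --> v x = c" and h: "h : T O'"
 shows "E v h = 0"
proof -
 have vF: "v : F" using v by auto
 obtain K where K: "compact K" "K <= O'" "!!x. x ~: K ==> h x = 0" using h by (auto simp: T_def)
 obtain k G' where k: "k : T O'" "open G'" "K <= G'" "!!x. x : G' ==> k x = 1" using urysohn[OF K(1) O'(1) K(2)] by blast
 obtain M0 where "AE x in m. abs (v x) <= M0" using v by (auto simp: ess_bounded_def)
 moreover obtain M where "M0 <= real M" using real_arch_simple by blast
 ultimately have M: "AE x in m. abs (v x) <= real M" by (auto elim!: eventually_mono)
 have "EX g:C0. E1 m E (%x. v x - g x) < 1 / real (Suc n)" for n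
  using F_facts(4) vF unfolding regular_form_def by simp
 then obtain g where g: "!!n. g n : C0" "!!n. E1 m E (%x. v x - g n x) < 1 / real (Suc n)" by metis
 have gF: "g n : F" for n using g by auto
 define u where "u n = trunc M (g n)" for n
 have uC: "u n : C0" for n unfolding u_def using trunc(1)[OF gF[of n], of M] g(1)[of n]
  by (auto simp: trunc_def intro!: Cc_comp[where p = "%t. max (- real M) (min t (real M))"] continuous_intros)
 have uF: "u n : F" for n using uC by auto
 have ub: "abs (u n x) <= real M + abs c" for n x by (auto simp: u_def trunc_def)
 have kF: "k : F" and kC: "k : C0" using TD(1)[OF k(1)] by auto
 have kb: "abs (k x) <= 1" for x using TD(2,3)[OF k(1), of x] by auto
 \<comment> \<open>Equal to c where k = 1, that is near the support of h, and to \<open>u n\<close>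
   off O'. On O' the error against v is (1 - k) times that of \<open>u n\<close>, so the correction
   does not spoil L^2 convergence.\<close>
 define z where "z n x = u n x - u n x * k x + c * k x" for n x
 have zC: "z n : C0" for n unfolding z_def by (intro C0_add C0_diff C0_prod C0_scale uC kC)
 have zF: "z n : F" for n using zC by auto
 have z0: "E (z n) h = 0" for n
 proof -
  obtain L where "compact L" "!!x. x ~: L ==> z n x = 0" using zC[of n] by (auto simp: Cc_iff)
  thus ?thesis using E_sl[of "z n" L h K G' c] zF[of n] TD(1)[OF h] K k by (auto simp: z_def)
 qed
 have lim0: "(%n. 1 / real (Suc n)) ~~> 0" using LIMSEQ_Suc[OF lim_const_over_n[of 1]] by simp
 have vg: "Ns (%x. v x - g n x) <= 1 / real (Suc n)" "En (%x. v x - g n x) <= 1 / real (Suc n)" for n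
  using g(2)[of n] EE.B_nonneg[OF EE.diff[OF vF gF[of n]]] ip.B_nonneg[OF ip.diff[OF F_L2[OF vF] F_L2[OF gF[of n]]]]
  unfolding E1_def nsq by simp_all
 have zl: "(%n. Ns (%x. z n x - v x)) ~~> 0"
 proof (rule Lim_null_comparison[OF always_eventually lim0], intro allI)
  fix n
  have "Ns (%x. z n x - v x) <= Ns (%x. v x - g n x)"
   unfolding ip_def
  proof (rule integral_mono_AE)
   show "integrable m (%x. (z n x - v x) * (z n x - v x))" "integrable m (%x. (v x - g n x) * (v x - g n x))"
    by (intro L2_int ip.diff F_L2 zF vF gF)+
   show "AE x in m. (z n x - v x) * (z n x - v x) <= (v x - g n x) * (v x - g n x)"
    using M O'(2)
   proof eventually_elim
    fix x assume a: "abs (v x) <= real M" "x : O' --> v x = c"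
    have e: "z n x - v x = (1 - k x) * (u n x - v x)"
     using a(2) T_zero[OF k(1), of x] by (cases "x : O'") (auto simp: z_def algebra_simps)
    have "abs (u n x - v x) <= abs (v x - g n x)" using a(1) by (auto simp: u_def trunc_def)
    moreover have "abs (1 - k x) <= 1" using TD(2,3)[OF k(1), of x] by auto
    ultimately have "abs (z n x - v x) <= abs (v x - g n x)" unfolding e abs_mult using mult_mono[of "abs (1 - k x)" 1] by fastforce
    thus "(z n x - v x) * (z n x - v x) <= (v x - g n x) * (v x - g n x)" by (simp add: abs_le_square_iff power2_eq_square)
   qed
  qed
  thus "norm (Ns (%x. z n x - v x)) <= 1 / real (Suc n)"
   using vg[of n] ip.B_nonneg[OF ip.diff[OF F_L2[OF zF] F_L2[OF vF]], of n] by simp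
 qed
 obtain B where B: "!!n. En (z n) <= B"
 proof -
  let ?M = "real M + abs c + 1"
  define e where "e = 4 * (2 * E v v + 2)"
  have ge: "En (g n) <= 2 * E v v + 2" for n
  proof -
   have "En (g n) <= 2 * E v v + 2 * En (%x. v x - g n x)"
    using EE.add_le[OF vF EE.diff[OF gF vF], of n] EE.B_diff_swap[OF vF gF, of n] by simp
   moreover have "1 / real (Suc n) <= 1" by simp
   ultimately show ?thesis using vg(2)[of n] by linarith
  qed
  have ue: "En (u n) <= e" for n
  proof -
   have t: "u n = (%x. max 0 (min (g n x) (real M)) - max 0 (min (- g n x) (real M)))" by (auto simp: u_def trunc_def fun_eq_iff)
   note c1 = clip[OF gF[of n], of "real M"] and c2 = clip[OF EE.uminus[OF gF[of n]], of "real M"]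
   have "En (u n) <= 2 * En (%x. max 0 (min (g n x) (real M))) + 2 * En (%x. max 0 (min (- g n x) (real M)))"
    unfolding t using EE.add_le[OF c1(1) EE.uminus[OF c2(1)]] EE.B_uminus2[OF c2(1)] by simp
   also have "... <= 4 * En (g n)" using c1(2) c2(2) EE.B_uminus2[OF gF[of n]] by simp
   finally show ?thesis using ge[of n] by (simp add: e_def)
  qed
  have pF: "(%x. u n x * k x) : F" "En (%x. u n x * k x) <= 64 * ?M^2 * (En (u n) + E k k)" for n
  proof -
   have b: "abs (u n x) <= ?M" "abs (k x) <= ?M" for x using ub[of n x] kb[of x] by auto
   have "0 < ?M" by simp
   from F_prod0[OF uF b(1) kF b(2) this] show "(%x. u n x * k x) : F" "En (%x. u n x * k x) <= 64 * ?M^2 * (En (u n) + E k k)" .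
  qed
  have ck: "(%x. c * k x) : F" by (rule EE.scale[OF kF])
  have "En (z n) <= 2 * (2 * e + 2 * (64 * ?M^2 * (e + E k k))) + 2 * En (%x. c * k x)" for n
  proof -
   have "64 * ?M^2 * (En (u n) + E k k) <= 64 * ?M^2 * (e + E k k)" using ue[of n] by (intro mult_left_mono) auto
   hence "En (%x. u n x - u n x * k x) <= 2 * e + 2 * (64 * ?M^2 * (e + E k k))"
    using EE.add_le[OF uF EE.uminus[OF pF(1)], of n n] EE.B_uminus2[OF pF(1), of n] pF(2)[of n] ue[of n] by simp
   thus ?thesis using EE.add_le[OF EE.diff[OF uF pF(1)] ck, of n n] by (simp add: z_def[abs_def])
  qed
  thus ?thesis using that by blast
 qed
 have hF: "h : F" using TD(1)[OF h] by simp
 have "(%n. E (z n) h) ~~> E v h" by (rule E_limit(3)[OF zF F_L2[OF vF] zl B hF])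
 thus ?thesis unfolding z0 by (simp add: LIMSEQ_const_iff)
qed

text \<open>With v constant on O' and h supported there, v h is a multiple of h, and both terms of
  the bracket pair h with a function constant on O'.\<close>

lemma gm_const: assumes w: "w : F" and O': "open O'" "AE x in m. x : O' --> w x = c"
 shows "gm w O' = 0"
proof -
 have "GI w h = 0" if h: "h : T O'" for h
 proof -
  have "Ib h (trunc n w) (trunc n w) = 0" for n
  proof -
   define v where "v = trunc n w"
   define d where "d = max (- real n) (min c (real n))"
   have v: "v : FB" unfolding v_def by (rule trunc_FB[OF w])
   have vc: "AE x in m. x : O' --> v x = d" using O'(2) by (auto simp: v_def trunc_def d_def elim!: eventually_mono)
   hence sc: "AE x in m. x : O' --> (v x)^2 = d^2" by (auto elim!: eventually_mono)
   have hF: "h : F" and vF: "v : F" using TD(1)[OF h] v by auto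
   have "AE x in m. v x * h x = d * h x" using vc by eventually_elim (use T_zero[OF h] in auto)
   hence "E (%x. d * h x) v = E (%x. v x * h x) v"
    using E_AE[of "%x. v x * h x" "%x. d * h x" v] FB_prod[OF v T_FB[OF h]] F_meas[OF EE.scale[OF hF, of d]] vF by simp
   hence "E v (%x. v x * h x) = d * E v h" using EE.B_sym[OF vF, of "%x. v x * h x"] FB_prod[OF v T_FB[OF h]]
     EE.B_scale[OF hF vF, of d] EE.B_sym[OF vF hF] by simp
   thus ?thesis unfolding v_def[symmetric] Ib_self using E_local[OF v O'(1) vc h] E_local[OF FB_square[OF v] O'(1) sc h] by simp
  qed
  thus ?thesis using GI_lim[OF w trunc_FB[OF w] trunc(2)[OF w] TD(1)[OF h]] by (simp add: LIMSEQ_const_iff)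
 qed
 hence "gm w O' <= 0" by (intro gm_open_le[OF w O'(1)]) auto
 thus ?thesis using measure_nonneg[of "G w" O'] by linarith
qed

text \<open>The energy measure of f - g vanishes on O', and the triangle inequality for root energy
  measures does the rest.\<close>

lemma gm_local: assumes f: "f : F" and g: "g : F" and O': "open O'" "AE x in m. x : O' --> f x = g x + c"
  and A: "A : sets borel" "A <= O'"
 shows "gm f A = gm g A"
proof -
 have z: "gm w A = 0" if "w : F" "AE x in m. x : O' --> w x = d" for w d
  using gm_const[OF that(1) O'(1) that(2)] gm_mono[OF that(1) A(2)] O'(1) measure_nonneg[of "G w" A] by (metis borel_open antisym)
 have "AE x in m. x : O' --> f x - g x = c" "AE x in m. x : O' --> g x - f x = - c" using O'(2) by (auto elim!: eventually_mono)
 from z[OF EE.diff[OF f g] this(1)] z[OF EE.diff[OF g f] this(2)]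
 have "sqrt (gm f A) = sqrt (gm g A)" using gm_diff[OF f g A(1)] gm_diff[OF g f A(1)] by simp
 thus ?thesis by simp
qed

text \<open>With h = 1 near the support of u, the bracket reduces to \<open>E u u\<close>, because h
  is constant on the support of u^2 and locality kills the second term.\<close>

lemma E_le_gm: assumes u: "u : FB" "compact K" "!!x. x ~: K ==> u x = 0" shows "E u u <= gm u UNIV"
proof -
 obtain h G' where h: "h : T UNIV" "open G'" "K <= G'" "!!x. x : G' ==> h x = 1" using urysohn[OF u(2)] by blast
 obtain L where L: "compact L" "!!x. x ~: L ==> h x = 0" using h(1) by (auto simp: T_def)
 have uF: "u : F" "(%x. (u x)^2) : F" "h : F" using u(1) FB_square[OF u(1)] TD(1)[OF h(1)] by auto
 have "E h (%x. (u x)^2) = 0" by (rule E_sl[OF uF(3) L uF(2) u(2) _ h(2,3,4)]) (use u(3) in auto)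
 moreover have "(%x. u x * h x) = u" using h(3,4) u(3) by (force simp: fun_eq_iff)
 ultimately have "GI u h = E u u" using GI_FB[OF u(1) TD(1)[OF h(1)]] EE.B_sym[OF uF(2,3)] by simp
 thus ?thesis using GI_le[OF uF(1) open_UNIV h(1)] by simp
qed

end

section \<open>Local energy measures\<close>

context mmd begin

abbreviation "LE W f == emeasure (local_energy_measure m E F W f)"
abbreviation "FL W == F_loc m F W"

lemma rci: "compact (K::'a set) ==> K <= W ==> S <= K ==> rel_compact_in W S"
 unfolding rel_compact_in_def
 by (metis closed_closure closure_minimal compact_Int_closed compact_imp_closed inf.absorb_iff2 order_trans)

lemma FL_mono: assumes "f : FL W" "W' <= W" shows "f : FL W'"
proof -
 have "f : borel_measurable (restrict_space borel W')"
  using assms measurable_restrict_mono by (auto simp: F_loc_def)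
 moreover have "rel_compact_in W' O' ==> rel_compact_in W O'" for O' using assms(2) by (auto simp: rel_compact_in_def)
 ultimately show ?thesis using assms(1) unfolding F_loc_def by blast
qed

lemma F_FL: "f : F ==> f : FL W"
 using F_meas[of f] by (auto simp: F_loc_def intro: measurable_restrict_space1)

lemma FL_rep: assumes "f : FL W" "compact (K::'a set)" "K <= W"
 obtains f' where "f' : F" "AE x in m. x : interior K --> f x = f' x"
 using assms rci[of K W "interior K"] interior_subset[of K] unfolding F_loc_def by auto

text \<open>The predicate under the definite description in \<open>local_energy_measure\<close>,
  named so that existence and uniqueness can be argued about it.\<close>

definition "LEspec W f \<mu> \<longleftrightarrow> sets \<mu> = sets (restrict_space borel W) &
    (ALL A O' f'. A : sets borel & rel_compact_in W A & A <= O' &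
     open O' & rel_compact_in W O' & f' : F & (AE x in m. x : O' --> f x = f' x) -->
     emeasure \<mu> A = emeasure (energy_measure m E F f') A)"

text \<open>The measure is the increasing limit of the energy measures of representatives on an
  exhaustion; locality makes them agree on overlaps. The defining property fixes the value on every
  piece of the exhaustion, which gives uniqueness.\<close>

lemma LE_spec: assumes W: "open W" and f: "f : FL W"
 shows "LEspec W f (local_energy_measure m E F W f)"
proof -
 obtain K where K: "!!n::nat. compact (K n)" "!!n. K n <= interior (K (Suc n))" "(\<Union>n. interior (K n)) = W" "!!n. K n <= W"
  using open_exhaust[OF W] by blast
 define U where "U n = interior (K n)" for n
 have Uo: "open (U n)" and UW: "U n <= W" and rcU: "A <= U n ==> rel_compact_in W A" for n A
  using K(4)[of n] interior_subset[of "K n"] rci[OF K(1,4), of A n] by (auto simp: U_def)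
 have incU: "i <= j ==> U i <= U j" for i j
 proof -
  have "incseq U" unfolding U_def using K(2) interior_subset by (intro incseq_SucI) blast
  thus "i <= j ==> U i <= U j" by (simp add: incseq_def)
 qed
 have WU: "(\<Union>n. U n) = W" using K(3) by (simp add: U_def)
 have "EX f'. f' : F & (AE x in m. x : U n --> f x = f' x)" for n using FL_rep[OF f K(1,4)] unfolding U_def by metis
 then obtain fn where fn: "!!n. fn n : F" "!!n. AE x in m. x : U n --> f x = fn n x" by metis
 have loc: "gm (fn n) A = gm f' A" if "f' : F" "AE x in m. x : O' --> f x = f' x" "open O'" "A : sets borel" "A <= U n" "A <= O'" for n f' O' A
 proof (rule gm_local[OF fn(1) that(1) _ _ that(4), of "U n Int O'" n 0])
  show "AE x in m. x : U n Int O' --> fn n x = f' x + 0" using fn(2)[of n] that(2) by eventually_elim auto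
 qed (use Uo that in auto)
 have sR: "sets (restrict_space borel W) = {A. A : sets borel & A <= W}" using W by (auto simp: sets_restrict_space_iff)
 define \<mu>0 where "\<mu>0 A = (SUP n. emeasure (G (fn n)) (A Int U n))" for A
 have inc: "incseq (%n. emeasure (G (fn n)) (A Int U n))" if "A : sets borel" for A
 proof (rule incseq_SucI)
  fix n
  have "gm (fn n) (A Int U n) = gm (fn (Suc n)) (A Int U n)"
   using loc[OF fn(1) fn(2) Uo, of "A Int U n" n "Suc n"] that incU[of n "Suc n"] Uo[of n] by auto
  also have "... <= gm (fn (Suc n)) (A Int U (Suc n))" using that incU[of n "Suc n"] Uo by (intro gm_mono fn) auto
  finally show "emeasure (G (fn n)) (A Int U n) <= emeasure (G (fn (Suc n))) (A Int U (Suc n))"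
   unfolding emeasure_G[OF fn(1)] by (rule ennreal_leI)
 qed
 define \<mu> where "\<mu> = measure_of W (sets (restrict_space borel W)) \<mu>0"
 have ca: "countably_additive (sets (restrict_space borel W)) \<mu>0"
  unfolding countably_additive_def
 proof (intro allI impI)
  fix A :: "nat => 'a set" assume A: "range A <= sets (restrict_space borel W)" "disjoint_family A"
  have Ab: "A i : sets borel" for i using A(1) unfolding sR by auto
  have se: "(\<Sum>i. emeasure (G (fn n)) (A i Int U n)) = emeasure (G (fn n)) (\<Union>i. A i Int U n)" for n
  proof (rule suminf_emeasure)
   show "range (%i. A i Int U n) <= sets (G (fn n))" using Ab Uo by (auto simp: sets_G[OF fn(1)])
   show "disjoint_family (%i. A i Int U n)" using A(2) unfolding disjoint_family_on_def by blast
  qed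
  have "(\<Sum>i. \<mu>0 (A i)) = (SUP n. \<Sum>i. emeasure (G (fn n)) (A i Int U n))"
   unfolding \<mu>0_def by (rule ennreal_suminf_SUP_eq[OF inc[OF Ab]])
  also have "... = \<mu>0 (\<Union>i. A i)" unfolding se by (simp add: \<mu>0_def Int_UN_distrib2[symmetric])
  finally show "(\<Sum>i. \<mu>0 (A i)) = \<mu>0 (\<Union>i. A i)" .
 qed
 have spW: "space (restrict_space borel W) = W" by (simp add: space_restrict_space)
 have em: "emeasure \<mu> A = \<mu>0 A" if "A : sets borel" "A <= W" for A
  unfolding \<mu>_def using ca that sR sets.sigma_algebra_axioms[of "restrict_space borel W"]
  by (intro emeasure_measure_of_sigma) (auto simp: positive_def \<mu>0_def spW)
 have sets\<mu>: "sets \<mu> = sets (restrict_space borel W)" unfolding \<mu>_def using spW by (metis sets.sets_measure_of_eq)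
 have "LEspec W f \<mu>" unfolding LEspec_def
 proof (intro conjI allI impI sets\<mu>, elim conjE)
  fix A O' f' assume a: "A : sets borel" "rel_compact_in W A" "A <= O'" "open O'" "f' : F" "AE x in m. x : O' --> f x = f' x"
  have cA: "compact (closure A)" "closure A <= (\<Union>n. U n)" using a(2) WU by (auto simp: rel_compact_in_def)
  obtain C where C: "finite C" "closure A <= (UN n:C. U n)" 
   by (rule compactE_image[OF cA(1) Uo cA(2)])
  obtain N where N: "C <= {..N}" using C(1) finite_nat_iff_bounded_le by blast
  have AN: "A <= U N"
  proof
   fix x assume "x : A"
   then obtain n where "n : C" "x : U n" using C(2) closure_subset by blast
   thus "x : U N" using incU[of n N] N by blast
  qed
  have l: "emeasure (G (fn n)) (A Int U n) = emeasure (G f') (A Int U n)" for n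
   unfolding emeasure_G[OF fn(1)] emeasure_G[OF a(5)] using loc[OF a(5,6,4), of "A Int U n" n] a Uo[of n] by auto
  have "\<mu>0 A = emeasure (G f') A" unfolding \<mu>0_def l
  proof (rule antisym)
   show "(SUP n. emeasure (G f') (A Int U n)) <= emeasure (G f') A" using a by (intro SUP_least emeasure_mono) auto
   show "emeasure (G f') A <= (SUP n. emeasure (G f') (A Int U n))" using AN by (intro SUP_upper2[of N]) (auto simp: Int_absorb2)
  qed
  thus "emeasure \<mu> A = emeasure (energy_measure m E F f') A"
   using em[of A] AN UW[of N] a by (auto simp: energy_measure_G)
 qed
 moreover have "N = \<mu>" if N: "LEspec W f N" for N
 proof (rule measure_eqI)
  show "sets N = sets \<mu>" using N sets\<mu> by (simp add: LEspec_def)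
  fix A assume "A : sets N"
  hence A: "A : sets borel" "A <= W" using N sR by (auto simp: LEspec_def)
  have eq: "emeasure N (A Int U n) = emeasure (G (fn n)) (A Int U n)" for n
   using N[unfolded LEspec_def, THEN conjunct2, rule_format, of "A Int U n" "U n" "fn n"] fn[of n] A Uo[of n] rcU[of _ n]
   by (auto simp: energy_measure_G)
  have "(SUP n. emeasure N (A Int U n)) = emeasure N (\<Union>n. A Int U n)"
  proof (rule SUP_emeasure_incseq)
   have "sets N = {A. A : sets borel & A <= W}" using N sR by (simp add: LEspec_def)
   thus "range (%n. A Int U n) <= sets N" using A Uo by auto
   show "incseq (%n. A Int U n)" using incU by (fastforce simp: incseq_def)
  qed
  moreover have "(\<Union>n. A Int U n) = A" using A(2) WU by blast
  ultimately show "emeasure N A = emeasure \<mu> A" using em[OF A] by (simp add: \<mu>0_def eq)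
 qed
 ultimately have "(THE \<mu>. LEspec W f \<mu>) = \<mu>" by (intro the_equality)
 moreover have "local_energy_measure m E F W f = (THE \<mu>. LEspec W f \<mu>)"
  unfolding local_energy_measure_def LEspec_def ..
 ultimately show ?thesis using \<open>LEspec W f \<mu>\<close> by simp
qed

lemma sets_LE: "open W ==> f : FL W ==> sets (local_energy_measure m E F W f) = {A. A : sets borel & A <= W}"
 using LE_spec[of W f] by (auto simp: LEspec_def sets_restrict_space_iff)

lemma LE_mono: assumes "open W" "f : FL W" "A <= B" "B : sets borel" "B <= W" shows "LE W f A <= LE W f B"
 using assms by (intro emeasure_mono) (auto simp: sets_LE)

lemma LE_rep: assumes W: "open W" "f : FL W" and K: "compact K" "K <= W" and f': "f' : F" "AE x in m. x : interior K --> f x = f' x"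
  and A: "A : sets borel" "A <= interior K"
 shows "LE W f A = ennreal (gm f' A)"
 using LE_spec[OF W, unfolded LEspec_def, THEN conjunct2, rule_format, of A "interior K" f'] A f'
  rci[OF K, of A] rci[OF K, of "interior K"] interior_subset[of K]
 by (auto simp: energy_measure_G emeasure_G)

lemma exhaust_incr: assumes "open (W::'a set)"
 obtains K where "!!n::nat. compact (K n)" "!!n. K n <= W" "incseq (%n. interior (K n))" "(\<Union>n. interior (K n)) = W"
proof -
 obtain K where K: "!!n::nat. compact (K n)" "!!n. K n <= interior (K (Suc n))" "(\<Union>n. interior (K n)) = W" "!!n. K n <= W"
  using open_exhaust[OF assms] by blast
 have "incseq (%n. interior (K n))" using K(2) interior_subset by (intro incseq_SucI) blast
 with K show ?thesis using that by blast
qed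

lemma LE_SUP: assumes W: "open W" "f : FL W" and U: "incseq U" "!!n. open (U n)" "(\<Union>n. U n) = O'" "O' <= W"
  and A: "A : sets borel" "A <= O'"
 shows "LE W f A = (SUP n. LE W f (A Int U n))"
proof -
 have "(SUP n. LE W f (A Int U n)) = LE W f (\<Union>n. A Int U n)"
 proof (rule SUP_emeasure_incseq)
  show "range (%n. A Int U n) <= sets (local_energy_measure m E F W f)"
   unfolding sets_LE[OF W] using A(1,2) U(2,4) borel_open[OF U(2)] by auto
  show "incseq (%n. A Int U n)" using U(1) by (auto simp: incseq_def)
 qed
 moreover have "(\<Union>n. A Int U n) = A" using A(2) U(3) by blast
 ultimately show ?thesis by simp
qed

lemma LE_loc: assumes W: "open W" "f : FL W" and W': "open W'" "g : FL W'" and O': "open O'" "O' <= W" "O' <= W'"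
  and ae: "AE x in m. x : O' --> f x = g x + c" and A: "A : sets borel" "A <= O'"
 shows "LE W f A = LE W' g A"
proof -
 obtain K where K: "!!n::nat. compact (K n)" "!!n. K n <= O'" "incseq (%n. interior (K n))" "(\<Union>n. interior (K n)) = O'"
  by (rule exhaust_incr[OF O'(1)]) blast
 have "LE W f (A Int interior (K n)) = LE W' g (A Int interior (K n))" for n
 proof -
  have k: "K n <= W" "K n <= W'" using K(2) O' by blast+
  obtain f' where f': "f' : F" "AE x in m. x : interior (K n) --> f x = f' x" by (rule FL_rep[OF W(2) K(1) k(1)])
  obtain g' where g': "g' : F" "AE x in m. x : interior (K n) --> g x = g' x" by (rule FL_rep[OF W'(2) K(1) k(2)])
  have B: "A Int interior (K n) : sets borel" "A Int interior (K n) <= interior (K n)" using A by auto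
  have "AE x in m. x : interior (K n) --> f' x = g' x + c"
   using ae f'(2) g'(2) by eventually_elim (use subsetD[OF K(2) subsetD[OF interior_subset]] in auto)
  from gm_local[OF f'(1) g'(1) open_interior this B] show ?thesis
   unfolding LE_rep[OF W K(1) k(1) f' B] LE_rep[OF W' K(1) k(2) g' B] by simp
 qed
 thus ?thesis unfolding LE_SUP[OF W K(3) open_interior K(4) O'(2) A] LE_SUP[OF W' K(3) open_interior K(4) O'(3) A] by simp
qed

lemma LE_F: assumes W: "open W" and g: "g : F" and A: "A : sets borel" "A <= W" shows "LE W g A = ennreal (gm g A)"
proof -
 obtain K where K: "!!n::nat. compact (K n)" "!!n. K n <= W" "incseq (%n. interior (K n))" "(\<Union>n. interior (K n)) = W"
  by (rule exhaust_incr[OF W]) blast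
 have "LE W g (A Int interior (K n)) = emeasure (G g) (A Int interior (K n))" for n
  unfolding emeasure_G[OF g] by (rule LE_rep[OF W F_FL[OF g] K(1,2) g]) (use A in auto)
 hence "LE W g A = (SUP n. emeasure (G g) (A Int interior (K n)))"
  using LE_SUP[OF W F_FL[OF g] K(3) open_interior K(4) order_refl A] by simp
 also have "... = emeasure (G g) (\<Union>n. A Int interior (K n))"
 proof (rule SUP_emeasure_incseq)
  show "range (%n. A Int interior (K n)) <= sets (G g)" using A(1) by (auto simp: sets_G[OF g])
  show "incseq (%n. A Int interior (K n))" using K(3) by (auto simp: incseq_def)
 qed
 also have "(\<Union>n. A Int interior (K n)) = A" using A(2) K(4) by blast
 finally show ?thesis by (simp add: emeasure_G[OF g])
qed

lemma LE_loc_F: assumes W: "open W" "f : FL W" and g: "g : F" and O': "open O'" "O' <= W"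
  and ae: "AE x in m. x : O' --> f x = g x + c" and A: "A : sets borel" "A <= O'"
 shows "LE W f A = ennreal (gm g A)"
 using LE_loc[OF W O'(1) F_FL[OF g] O'(1,2) order_refl ae A] LE_F[OF O'(1) g A] by simp

lemma LE_restrict: assumes "open W" "f : FL W" "open W'" "W' <= W" "A : sets borel" "A <= W'"
 shows "LE W' f A = LE W f A"
 by (rule LE_loc[OF assms(3) FL_mono[OF assms(2,4)] assms(1,2,3) _ assms(4), of 0]) (use assms in auto)

end

section \<open>Cutoff functions from the heat kernel\<close>

lemma ex_pow2_gt: "EX k::nat. (s::real) < 2^k" by (rule real_arch_pow) simp

lemma pow2_bracket: assumes "(s::real) >= 1" obtains k :: nat where "s <= 2^k" "2^k <= 2 * s"
proof -
 define k where "k = (LEAST k. s <= (2::real)^k)"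
 obtain k0 :: nat where "s < 2^k0" using ex_pow2_gt by blast
 hence k: "s <= 2^k" unfolding k_def using LeastI[of "%k. s <= 2^k" k0] \<open>s < 2^k0\<close> by simp
 show ?thesis
 proof (cases k)
  case 0 thus ?thesis using assms k by (intro that[of 0]) auto
 next
  case (Suc j)
  hence "~ s <= 2^j" using not_less_Least[of j "%k. s <= (2::real)^k"] by (simp add: k_def)
  thus ?thesis using Suc k by (intro that[of k]) auto
 qed
qed

context mmd begin

section \<open>Volumes, doubling and the scale function\<close>

definition "vol x r = measure m (ball x r)"

lemma bounded_fin: assumes "bounded (A::'a set)" shows "emeasure m A < \<infinity>"
proof -
 have "compact (closure A)" using assms by (intro compact_if_bounded) auto
 hence "emeasure m (closure A) < \<infinity>" using F_facts(6) by (auto simp: metric_measure_space_def radon_measure_def)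
 moreover have "emeasure m A <= emeasure m (closure A)" by (intro emeasure_mono closure_subset) auto
 ultimately show ?thesis by (rule le_less_trans[rotated])
qed

lemma emeasure_bounded: "bounded (A::'a set) ==> emeasure m A = ennreal (measure m A)"
 using bounded_fin[of A] by (simp add: emeasure_eq_ennreal_measure less_top)

lemma measure_mono_b: "A <= B ==> A : sets borel ==> B : sets borel ==> bounded B ==> measure m A <= measure m B"
 using bounded_fin[of B] by (intro measure_mono_fmeasurable) (auto simp: fmeasurable_def)

lemma vol_pos: "r > 0 ==> vol x r > 0"
proof -
 assume r: "r > 0"
 hence "emeasure m (ball x r) > 0" using F_facts(6) by (auto simp: metric_measure_space_def)
 thus ?thesis using emeasure_bounded[of "ball x r"] by (simp add: vol_def)
qed

lemma vol_mono: "ball x r <= ball y s ==> vol x r <= vol y s" unfolding vol_def by (rule measure_mono_b) auto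

lemma vol_mono_dist: "dist x y + r <= s ==> vol x r <= vol y s"
proof (rule vol_mono, rule subsetI)
 fix z assume "dist x y + r <= s" "z : ball x r"
 thus "z : ball y s" using dist_triangle[of y z x] by (simp add: dist_commute)
qed

lemma indicator_L2: assumes "A : sets borel" "bounded (A::'a set)" shows "indicator A : L2"
proof -
 have "(%x. (indicator A x :: real)^2) = indicator A" by (auto simp: indicator_def)
 thus ?thesis using assms bounded_fin[OF assms(2)]
  by (auto simp: L2_iff intro!: integrable_real_indicator borel_measurable_indicator)
qed

end

locale hk = mmd m E F for m :: "'a::metric_space measure" and E F +
 fixes Ps :: "real => real"
 assumes scale: "scale_function Ps" and doubling: "doubling_measure m" and HKE: "HKE m E F Ps"
begin

lemma Psi_pos: "r > 0 ==> Ps r > 0" using scale by (auto simp: scale_function_def bij_betw_def)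
lemma Psi_mono: "0 < r ==> r <= s ==> Ps r <= Ps s"
 using scale by (auto simp: scale_function_def strict_mono_on_def le_less)
lemma scale_inv_Psi: "r > 0 ==> scale_inv Ps (Ps r) = r"
 using scale by (auto simp: scale_function_def scale_inv_def bij_betw_def intro!: the_inv_into_f_f)

lemma Psi_bounds: obtains C b1 b2 where "C > 1" "b1 > 1" "b2 > b1"
 "!!r R. 0 < r ==> r <= R ==> inverse C * (R / r) powr b1 <= Ps R / Ps r"
 "!!r R. 0 < r ==> r <= R ==> Ps R / Ps r <= C * (R / r) powr b2"
 using scale unfolding scale_function_def by blast

definition "D = (SOME D. D >= 1 & (ALL x r. r > 0 --> emeasure m (ball x (2 * r)) <= ennreal D * emeasure m (ball x r)))"

lemma D: "D >= 1" "r > 0 ==> vol x (2 * r) <= D * vol x r"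
proof -
 have *: "D >= 1 & (ALL x r. r > 0 --> emeasure m (ball x (2 * r)) <= ennreal D * emeasure m (ball x r))"
  using someI_ex[OF doubling[unfolded doubling_measure_def]] unfolding D_def .
 thus "D >= 1" by simp
 assume "r > 0"
 hence "ennreal (vol x (2 * r)) <= ennreal (D * vol x r)"
  using * by (simp add: vol_def emeasure_bounded[symmetric] ennreal_mult)
 thus "vol x (2 * r) <= D * vol x r" using * by (simp add: vol_def)
qed

lemma vol_pow: "r > 0 ==> vol x (2^k * r) <= D^k * vol x r"
proof (induction k)
 case (Suc k)
 have "vol x (2^Suc k * r) <= D * vol x (2^k * r)" using D(2)[of "2^k * r" x] Suc.prems by (simp add: mult.assoc)
 also have "... <= D * (D^k * vol x r)" using Suc D(1) by (intro mult_left_mono) auto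
 finally show ?case by (simp add: mult.assoc)
qed simp

text \<open>The doubling constant to the number of doublings that exceed the ratio K. Most of the
  geometric constants below are values of this function.\<close>

definition "DD K = D ^ (LEAST k. K <= (2::real)^k)"

lemma DD: "DD K >= 1" "r > 0 ==> dist x y + s <= K * r ==> vol x s <= DD K * vol y r"
proof -
 show "DD K >= 1" unfolding DD_def using D(1) by simp
 assume r: "r > 0" "dist x y + s <= K * r"
 define k where "k = (LEAST k. K <= (2::real)^k)"
 obtain k0 :: nat where "K < 2^k0" using ex_pow2_gt by blast
 hence k: "K <= 2^k" unfolding k_def using LeastI[of "%k. K <= 2^k" k0] \<open>K < 2^k0\<close> by simp
 have "dist x y + s <= 2^k * r" using r k mult_right_mono[OF k, of r] by linarith
 hence "vol x s <= vol y (2^k * r)" by (rule vol_mono_dist)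
 also have "... <= D^k * vol y r" by (rule vol_pow[OF r(1)])
 finally show "vol x s <= DD K * vol y r" by (simp add: DD_def k_def)
qed

text \<open>A supremum of reals dominates its members only if it is bounded above. It is, since
  beta1 > 1: in z = 1/r the expression is at most s z - k z^beta1 for z > 1, which is negative
  beyond \<open>Z\<close>.\<close>

lemma scale_conj_ge: assumes s: "s >= 0" and q: "q > 0" shows "s / q - 1 / Ps q <= scale_conj Ps s"
 unfolding scale_conj_def
proof (rule cSUP_upper)
 obtain C b1 b2 where C: "C > 1" "b1 > 1" and lo: "!!r R. 0 < r ==> r <= R ==> inverse C * (R / r) powr b1 <= Ps R / Ps r"
  by (rule Psi_bounds) blast
 define k where "k = inverse C / Ps 1"
 have k: "k > 0" using C Psi_pos[of 1] by (simp add: k_def)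
 define Z where "Z = (s / k) powr (1 / (b1 - 1))"
 show "bdd_above ((%r. s / r - 1 / Ps r) ` {0<..})"
 proof (rule bdd_aboveI2[of _ _ "s + s * Z"])
  fix r :: real assume "r : {0<..}"
  hence r: "r > 0" by simp
  have Z0: "s * Z >= 0" using s by (simp add: Z_def)
  have p: "1 / Ps r > 0" using Psi_pos[OF r] by simp
  show "s / r - 1 / Ps r <= s + s * Z"
  proof (cases "r >= 1")
   case True
   hence "s / r <= s" using s by (simp add: divide_le_eq mult_le_cancel_left1)
   thus ?thesis using p Z0 by linarith
  next
   case False
   define z where "z = 1 / r"
   have z: "z > 1" using False r by (simp add: z_def)
   have "inverse C * (1 / r) powr b1 <= Ps 1 / Ps r" using lo[of r 1] False r by simp
   hence "inverse C * (1 / r) powr b1 / Ps 1 <= Ps 1 / Ps r / Ps 1" using Psi_pos[of 1] by (intro divide_right_mono) auto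
   hence "k * z powr b1 <= 1 / Ps r" using Psi_pos[of 1] by (simp add: k_def z_def)
   moreover have "z powr b1 = z * z powr (b1 - 1)" using z by (simp add: powr_diff)
   ultimately have 1: "s / r - 1 / Ps r <= z * (s - k * z powr (b1 - 1))" by (simp add: z_def algebra_simps)
   show ?thesis
   proof (cases "z <= Z")
    case True
    have "z * (s - k * z powr (b1 - 1)) <= z * s" using z k by (intro mult_left_mono) auto
    also have "... <= s * Z" using True s by (simp add: mult.commute[of z s] mult_left_mono)
    finally show ?thesis using 1 s by linarith
   next
    case False
    have "s / k = Z powr (b1 - 1)"
     using C s k by (simp add: Z_def powr_powr)
    also have "... <= z powr (b1 - 1)" using False C by (intro powr_mono2) (auto simp: Z_def)
    finally have "s <= k * z powr (b1 - 1)" using k by (simp add: field_simps)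
    hence "z * (s - k * z powr (b1 - 1)) <= 0" using z by (simp add: mult_nonneg_nonpos)
    thus ?thesis using 1 s Z0 by linarith
   qed
  qed
 qed
qed (use q in auto)

section \<open>Energy of the heat flow\<close>

context
 fixes P assumes P: "form_semigroup m E F P"
begin

lemma P_L2: "t > 0 ==> f : L2 ==> P t f : L2" and P_contr: "t > 0 ==> f : L2 ==> Ns (P t f) <= ip f f"
 and P_lin: "t > 0 ==> f : L2 ==> g : L2 ==> AE x in m. P t (%y. a * f y + b * g y) x = a * P t f x + b * P t g x"
 and P_sym: "t > 0 ==> f : L2 ==> g : L2 ==> ip (P t f) g = ip f (P t g)"
 and P_add: "s > 0 ==> t > 0 ==> f : L2 ==> AE x in m. P (s + t) f x = P s (P t f) x"
 using P unfolding form_semigroup_def L2_semigroup_def nsq[symmetric] ip_def[symmetric] L2_normsq_def by (auto simp: ip_def)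

lemma P_ip: assumes "s > 0" "t > 0" "f : L2" shows "ip (P s f) (P t f) = ip (P (s + t) f) f"
proof -
 have "ip (P s f) (P t f) = ip (P s (P t f)) f"
  using P_sym[of s f "P t f"] ip.B_sym[of f "P s (P t f)"] assms P_L2 by simp
 also have "... = ip (P (s + t) f) f"
  using P_add[of s t f] assms P_L2 by (intro ip_AE) (auto intro!: L2_meas elim!: eventually_mono)
 finally show ?thesis .
qed

text \<open>Divided by t this is the usual approximation of E by the semigroup; positivity is the
  contraction property.\<close>

lemma P_psd: assumes t: "t > 0" shows "psd L2 (%f g. ip (%x. f x - P t f x) g)"
proof
 fix f g h c
 show "ip (%x. f x + g x - P t (%x. f x + g x) x) h = ip (%x. f x - P t f x) h + ip (%x. g x - P t g x) h"
  if a: "f : L2" "g : L2" "h : L2"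
 proof -
  have "ip (P t (%x. f x + g x)) h = ip (%x. P t f x + P t g x) h"
   using P_lin[OF t a(1,2), of 1 1] P_L2[OF t] a by (intro ip_AE) (auto intro!: L2_meas ip.add)
  thus ?thesis using a P_L2[OF t] by (simp add: ip.B_simps)
 qed
 show "ip (%x. c * f x - P t (%x. c * f x) x) h = c * ip (%x. f x - P t f x) h" if a: "f : L2" "h : L2"
 proof -
  have "ip (P t (%x. c * f x)) h = ip (%x. c * P t f x) h"
   using P_lin[OF t a(1,1), of c 0] P_L2[OF t] a by (intro ip_AE) (auto intro!: L2_meas ip.scale)
  thus ?thesis using a P_L2[OF t] by (simp add: ip.B_simps right_diff_distrib)
 qed
 show "ip (%x. f x - P t f x) g = ip (%x. g x - P t g x) f" if a: "f : L2" "g : L2"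
  using a P_L2[OF t] P_sym[OF t a] ip.B_sym[OF a] ip.B_sym[OF a(1) P_L2[OF t a(2)]] by (simp add: ip.B_simps)
 show "0 <= ip (%x. f x - P t f x) f" if a: "f : L2"
 proof -
  have "ip (P t f) f <= sqrt (Ns (P t f)) * sqrt (ip f f)" using ip.CS_abs[OF P_L2[OF t a] a] by simp
  also have "... <= sqrt (ip f f) * sqrt (ip f f)" using P_contr[OF t a] ip.B_nonneg[OF a] by (intro mult_right_mono) auto
  finally show ?thesis using a P_L2[OF t a] ip.B_nonneg[OF a] by (simp add: ip.B_simps)
 qed
qed (auto intro: ip.add ip.scale)

text \<open>A bound on the approximating forms of u along one sequence of times yields membership in
  F. For v in the generator domain the approximating forms of v against u converge to the pairing
  with h = -Lv, and Cauchy-Schwarz for each approximating form provides the hypothesis of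
  \<open>form_domain_criterion\<close>.\<close>

lemma semigroup_criterion:
 assumes u: "u : L2" and M: "M >= 0" and tn: "!!n. tn n > 0" "tn ~~> 0" and b: "!!n::nat. ip (%x. u x - P (tn n) u x) u <= tn n * M"
 shows "u : F" "E u u <= M"
proof -
 have "abs (ip h u) <= sqrt M * sqrt (E v v)" if v: "v : F" "h : L2" "!!w. w : F ==> E v w = ip h w" for v h
 proof -
  have vL: "v : L2" by (rule F_L2[OF v(1)])
  have h': "(%x. - h x) : L2" by (rule ip.uminus[OF v(2)])
  have "form_generator m E F v (%x. - h x)" using v h' ip.B_uminus[OF v(2)] F_L2 by (auto simp: form_generator_def ip_def)
  hence "semigroup_generator m P v (%x. - h x)" using P by (simp add: form_semigroup_def)
  hence gen: "((%t. Ns (%x. (P t v x - v x) / t - - h x)) \<longlongrightarrow> 0) (at_right 0)"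
   by (simp add: semigroup_generator_def nsq)
  have ft: "filterlim tn (at_right 0) sequentially"
   using tn by (intro tendsto_imp_filterlim_at_right) (auto intro: always_eventually)
  define q where "q n x = (P (tn n) v x - v x) / tn n" for n x
  have PL: "P (tn n) v : L2" for n by (rule P_L2[OF tn(1) vL])
  have qL: "q n : L2" for n unfolding q_def using ip.scale[OF ip.diff[OF PL vL], of "1 / tn n" n] by simp
  have "(%n. Ns (%x. q n x - - h x)) ~~> 0"
   using filterlim_compose[OF gen ft] unfolding q_def by simp
  note lim = ip.lim1[OF qL h' _ this]
  have qe: "ip (q n) w = - (ip (%x. v x - P (tn n) v x) w / tn n)" if w: "w : L2" for w n
   using ip.B_scale[OF ip.diff[OF PL vL] w, of "1 / tn n" n] ip.B_diff[OF PL vL w, of n] ip.B_diff[OF vL PL w, of n]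
   by (simp add: q_def[abs_def] diff_divide_distrib)
  have l1: "(%n. abs (ip (%x. v x - P (tn n) v x) u / tn n)) ~~> abs (ip h u)"
   using tendsto_rabs[OF lim[OF u]] ip.B_uminus[OF v(2) u] by (simp add: qe[OF u])
  have l2: "(%n. ip (%x. v x - P (tn n) v x) v / tn n) ~~> E v v"
   using tendsto_minus[OF lim[OF vL]] ip.B_uminus[OF v(2) vL] v(3)[OF v(1)] by (simp add: qe[OF vL])
  have "abs (ip (%x. v x - P (tn n) v x) u / tn n) <= sqrt M * sqrt (ip (%x. v x - P (tn n) v x) v / tn n)" for n
  proof -
   interpret p: psd L2 "%f g. ip (%x. f x - P (tn n) f x) g" by (rule P_psd[OF tn(1)])
   note t = tn(1)[of n]
   have "abs (ip (%x. v x - P (tn n) v x) u) <= sqrt (ip (%x. v x - P (tn n) v x) v) * sqrt (ip (%x. u x - P (tn n) u x) u)"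
    by (rule p.CS_abs[OF vL u])
   also have "... <= sqrt (ip (%x. v x - P (tn n) v x) v) * sqrt (tn n * M)"
    using b[of n] p.B_nonneg[OF vL] by (intro mult_left_mono) auto
   also have "... = tn n * (sqrt M * sqrt (ip (%x. v x - P (tn n) v x) v / tn n))"
   proof -
    define r where "r = sqrt (tn n)"
    have r: "r > 0" "tn n = r * r" using t by (auto simp: r_def)
    hence r2: "sqrt (r * r) = r" by simp
    show ?thesis unfolding r(2) real_sqrt_mult[of "r * r"] real_sqrt_divide r2 using r(1) by simp
   qed
   finally show ?thesis using t by (simp add: field_simps)
  qed
  thus ?thesis by (intro LIMSEQ_le[OF l1 tendsto_mult[OF tendsto_const tendsto_real_sqrt[OF l2]]]) auto
 qed
 thus "u : F" "E u u <= M" using form_domain_criterion(1,2)[OF u M] by blast+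
qed

text \<open>Convexity of the pairing of P_t f with f replaces the spectral theorem: the decrements
  over N steps of length t = 2s/N decrease, and their sum is at most |f|^2, so the last of them is
  at most |f|^2 / N.\<close>

lemma heat_energy: assumes f: "f : L2" and s: "s > 0"
 shows "P s f : F" "En (P s f) <= ip f f / (2 * s)"
proof -
 define u where "u = P s f"
 have uL: "u : L2" unfolding u_def by (rule P_L2[OF s f])
 define tn where "tn n = 2 * s / 2^n" for n :: nat
 have tn: "tn n > 0" for n using s by (simp add: tn_def)
 have tl: "tn ~~> 0" unfolding tn_def using tendsto_mult[OF tendsto_const LIMSEQ_inverse_realpow_zero[of 2], of "2 * s"]
  by (simp add: divide_inverse power_inverse)
 have "ip (%x. u x - P (tn n) u x) u <= tn n * (ip f f / (2 * s))" for n
 proof -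
  define t where "t = tn n"
  have t: "t > 0" using tn by (simp add: t_def)
  \<comment> \<open>The value at k = 0 is set by hand, since nothing is asked of the semigroup at
    time 0.\<close>
  define c where "c k = (if k = 0 then ip f f else ip (P (real k * t) f) f)" for k :: nat
  have cs: "c k = Ns (P (real k * t / 2) f)" if "k > 0" for k
   using P_ip[of "real k * t / 2" "real k * t / 2" f] that t f by (simp add: c_def mult.commute)
  have mid: "2 * c (Suc k) <= c k + c (Suc (Suc k))" for k
  proof (cases "k = 0")
   case True
   have L: "P t f : L2" by (rule P_L2[OF t f])
   have "c (Suc (Suc 0)) = Ns (P t f)" using cs[of 2] by (simp add: numeral_2_eq_2)
   thus ?thesis using True ip.B_exp_diff[OF L f] ip.B_nonneg[OF ip.diff[OF L f]] by (simp add: c_def)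
  next
   case False
   let ?a = "real k * t / 2" and ?b = "real (Suc (Suc k)) * t / 2"
   have p: "?a > 0" "?b > 0" using False t by auto
   have "?a + ?b = real (Suc k) * t" by (simp add: field_simps)
   hence "c (Suc k) = ip (P ?a f) (P ?b f)" using P_ip[OF p f] by (simp add: c_def)
   thus ?thesis using cs[of k] cs[of "Suc (Suc k)"] False
    ip.B_exp_diff[OF P_L2[OF p(1) f] P_L2[OF p(2) f]] ip.B_nonneg[OF ip.diff[OF P_L2[OF p(1) f] P_L2[OF p(2) f]]] by simp
  qed
  have dec: "c (k + j) - c (Suc (k + j)) <= c k - c (Suc k)" for k j
  proof (induction j)
   case (Suc j) thus ?case using mid[of "k + j"] by simp
  qed simp
  define N :: nat where "N = 2^n"
  have N: "N > 0" "real N * t = 2 * s" by (auto simp: N_def t_def tn_def)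
  have "real N * (c N - c (Suc N)) = (\<Sum>k<N. c N - c (Suc N))" by simp
  also have "... <= (\<Sum>k<N. c k - c (Suc k))" 
  proof (rule sum_mono)
   fix k assume "k : {..<N}" thus "c N - c (Suc N) <= c k - c (Suc k)" using dec[of k "N - k"] by simp
  qed
  also have "... <= c 0" using cs[OF N(1)] ip.B_nonneg[OF P_L2[of "real N * t / 2" f]] N t f s by (simp add: sum_lessThan_telescope')
  finally have 1: "real N * (c N - c (Suc N)) <= ip f f" by (simp add: c_def)
  have Pt: "ip (P t u) u = c (Suc N)"
  proof -
   have "ip (P t u) u = ip (P (t + s) f) u" unfolding u_def
    using P_add[OF t s f] P_L2[OF t P_L2[OF s f]] P_L2[of "t + s" f] P_L2[OF s f] f t s by (intro ip_AE) (auto intro!: L2_meas elim!: eventually_mono)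
   also have "... = ip (P (t + s + s) f) f" unfolding u_def using t s f by (intro P_ip) auto
   also have "t + s + s = real (Suc N) * t" using N by (simp add: algebra_simps)
   finally show ?thesis by (simp add: c_def)
  qed
  have "ip u u = c N" unfolding u_def using P_ip[OF s s f] N by (simp add: c_def)
  hence "ip (%x. u x - P t u x) u = c N - c (Suc N)"
   using ip.B_diff[OF uL P_L2[OF t uL] uL] Pt by simp
  moreover have "c N - c (Suc N) <= ip f f / real N" using 1 N(1) by (simp add: field_simps)
  moreover have "ip f f / real N = t * (ip f f / (2 * s))" unfolding N(2)[symmetric] using N(1) t by simp
  ultimately show ?thesis by (simp add: t_def)
 qed
 from semigroup_criterion[OF uL _ tn tl this] show "P s f : F" "En (P s f) <= ip f f / (2 * s)"
  using ip.B_nonneg[OF f] s by (auto simp: u_def)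
qed

end

text \<open>The heat flow of the indicator of the ball at a time comparable to Psi(r) is at least a
  on the ball by the lower estimate, and at most a/2 far away because exponential decay beats the
  polynomial volume growth. The band between a/2 and a, rescaled, is the cutoff.\<close>

lemma cutoff_ex: "EX L C. L >= 2 & C > 0 & (ALL x r. r > 0 --> (EX h:F. (ALL z. 0 <= h z & h z <= 1) &
  (ALL z:ball x r. h z = 1) & (ALL z. z ~: ball x (L * r) --> h z = 0) & E h h <= C * vol x r / Ps r))"
proof -
 from HKE[unfolded HKE_def] obtain C1 c1 c2 c3 \<delta>0 p where H: "C1 > 0 & c1 > 0 & c2 > 0 & c3 > 0 & \<delta>0 > 0 &
    heat_kernel m E F p &
    (ALL t>0.
     (AE x in m. AE y in m.
       p t x y <= C1 / measure m (ball x (scale_inv Ps t)) *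
             exp (- c1 * t * scale_conj Ps (c2 * dist x y / t))) &
     (AE x in m. AE y in m. dist x y <= \<delta>0 * scale_inv Ps t -->
       p t x y >= c3 / measure m (ball x (scale_inv Ps t))))"
  by (elim exE)
 hence k0: "C1 > 0" "c1 > 0" "c2 > 0" "c3 > 0" "\<delta>0 > 0" "heat_kernel m E F p" by simp_all
 have up: "AE x in m. AE y in m. p t x y <= C1 / measure m (ball x (scale_inv Ps t)) * exp (- c1 * t * scale_conj Ps (c2 * dist x y / t))"
  and lo0: "AE x in m. AE y in m. dist x y <= \<delta>0 * scale_inv Ps t --> p t x y >= c3 / measure m (ball x (scale_inv Ps t))"
  if "t > 0" for t using H that by simp_all
 obtain P where P: "form_semigroup m E F P"
  "!!t f. t > 0 ==> f : L2 ==> AE x in m. integrable m (%y. p t x y * f y) & P t f x = (\<integral>y. p t x y * f y \<partial>m)"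
  using k0(6) unfolding heat_kernel_def by blast
 define \<delta> where "\<delta> = min \<delta>0 1"
 have d: "\<delta> > 0" "\<delta> <= 1" using k0 by (auto simp: \<delta>_def)
 define K where "K = 1 + \<delta> / 2"
 have DK: "DD (1 + \<delta>) >= 1" by (rule DD(1))
 \<comment> \<open>The lower bound of the heat flow on the ball; the two doubling factors compare
   the ball of radius \<open>q1\<close> around a point of the ball with the ball itself.\<close>
 define a where "a = c3 / DD (2 / \<delta>) / DD (1 + \<delta>)"
 have a: "a > 0" using k0 DK DD(1)[of "2 / \<delta>"] by (simp add: a_def)
 \<comment> \<open>Volume growth is at most of degree q, since D^k <= (2^k)^q.\<close>
 obtain q :: nat where q: "D < 2^q" using ex_pow2_gt by blast
 define c where "c = c1 * c2 / 2"
 have c: "c > 0" using k0 by (simp add: c_def)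
 define B where "B = C1 * exp c1 * (4 / c)^q"
 have "((%z. z^q / exp z) \<longlongrightarrow> (0::real)) at_top" by (rule tendsto_power_div_exp_0)
 moreover have Bp: "B > 0" using k0 c by (simp add: B_def)
 ultimately have "\<forall>\<^sub>F z in at_top. z^q / exp z < a / 2 / B" using a by (intro order_tendstoD(2)) auto
 then obtain Z where Z: "!!z. z >= Z ==> z^q / exp z < a / 2 / B" by (auto simp: eventually_at_top_linorder)
 define s0 where "s0 = max (Z / c) 2"
 have tail: "C1 * exp c1 * (4 * s)^q * exp (- c * s) <= a / 2" if s: "s >= s0" for s
 proof -
  have "c * s >= Z" using s c by (simp add: s0_def field_simps)
  from Z[OF this] have "B * ((c * s)^q / exp (c * s)) <= a / 2" using Bp by (simp add: field_simps)
  moreover have "B * ((c * s)^q / exp (c * s)) = C1 * exp c1 * (4 * s)^q * exp (- c * s)"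
  proof -
   have e: "(4 / c)^q * (c * s)^q = (4 * s)^q" unfolding power_mult_distrib[symmetric] using c by simp
   have e2: "X / exp (c * s) = X * exp (- c * s)" for X by (simp add: exp_minus divide_inverse)
   show ?thesis unfolding B_def e[symmetric] e2 by (simp only: mult_ac)
  qed
  ultimately show ?thesis by linarith
 qed
 define L where "L = max 2 (2 * s0 / \<delta>)"
 have "EX h:F. (ALL z. 0 <= h z & h z <= 1) & (ALL z:ball x r. h z = 1) & (ALL z. z ~: ball x (L * r) --> h z = 0) & E h h <= 8 / a^2 * vol x r / Ps r"
  if r: "r > 0" for x r
 proof -
  \<comment> \<open>Any two points of the ball are then within reach of the near-diagonal lower
    bound at time Psi(q1).\<close>
  define q1 where "q1 = 2 * r / \<delta>"
  have q1: "q1 > 0" "r <= q1" "2 * r <= \<delta> * q1" using r d mult_left_le_one_le[of r \<delta>] by (auto simp: q1_def field_simps)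
  define t where "t = Ps q1"
  have t: "t > 0" "scale_inv Ps t = q1" using Psi_pos[OF q1(1)] scale_inv_Psi[OF q1(1)] by (auto simp: t_def)
  define f where "f = (indicator (ball x r) :: 'a => real)"
  have f: "f : L2" unfolding f_def by (rule indicator_L2) auto
  define u where "u = P t f"
  have u: "u : F" "E u u <= vol x r / (2 * t)"
  proof -
   have "ip f f = vol x r" by (simp add: ip_def f_def vol_def flip: indicator_inter_arith)
   thus "u : F" "E u u <= vol x r / (2 * t)" using heat_energy[OF P(1) f t(1)] by (auto simp: u_def)
  qed
  have fi: "integrable m f" using bounded_fin[of "ball x r"] by (auto simp: f_def intro!: integrable_real_indicator)
  have If: "(\<integral>y. k * f y \<partial>m) = k * vol x r" for k by (simp add: f_def vol_def)
  note If1 = If[of 1, simplified]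
  have low: "AE z in m. z : ball x r --> a <= u z"
   using P(2)[OF t(1) f] lo0[OF t(1)]
  proof eventually_elim
   fix z assume A: "integrable m (%y. p t z y * f y) & P t f z = (\<integral>y. p t z y * f y \<partial>m)"
    "AE y in m. dist z y <= \<delta>0 * scale_inv Ps t --> p t z y >= c3 / measure m (ball z (scale_inv Ps t))"
   show "z : ball x r --> a <= u z"
   proof
    assume z: "z : ball x r"
    have "(\<integral>y. c3 / vol z q1 * f y \<partial>m) <= (\<integral>y. p t z y * f y \<partial>m)"
    proof (rule integral_mono_AE)
     show "AE y in m. c3 / vol z q1 * f y <= p t z y * f y" using A(2)
     proof eventually_elim
      fix y assume A: "dist z y <= \<delta>0 * scale_inv Ps t --> p t z y >= c3 / measure m (ball z (scale_inv Ps t))"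
      have "dist z y <= \<delta>0 * q1" if "y : ball x r"
      proof -
       have "dist z y < 2 * r" using z that dist_triangle[of z y x] by (simp add: dist_commute)
       moreover have "\<delta> * q1 <= \<delta>0 * q1" using q1 by (simp add: \<delta>_def)
       ultimately show ?thesis using q1 by linarith
      qed
      thus "c3 / vol z q1 * f y <= p t z y * f y" using A t by (auto simp: f_def vol_def indicator_def)
     qed
    qed (use A fi in auto)
    hence 1: "c3 / vol z q1 * vol x r <= u z" using A(1) If1 by (simp add: u_def)
    have "vol x r > 0" "vol z q1 > 0" using vol_pos r q1 by auto
    have "vol z q1 <= DD (1 + \<delta>) * vol x q1" by (rule DD(2)) (use z q1 d r in "auto simp: q1_def field_simps dist_commute")
    also have "... <= DD (1 + \<delta>) * (DD (2 / \<delta>) * vol x r)" using DK r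
     by (intro mult_left_mono DD(2)) (auto simp: q1_def)
    finally have "a * vol z q1 <= c3 * vol x r" using k0(4) DD(1)[of "2/\<delta>"] DK
     by (simp add: a_def field_simps)
    thus "a <= u z" using 1 \<open>vol z q1 > 0\<close> by (simp add: field_simps)
     (metis less_le_trans mult.commute mult_le_cancel_right_pos order_trans)
   qed
  qed
  have upp: "AE z in m. z ~: ball x (L * r) --> u z <= a / 2"
   using P(2)[OF t(1) f] up[OF t(1)]
  proof eventually_elim
   fix z assume A: "integrable m (%y. p t z y * f y) & P t f z = (\<integral>y. p t z y * f y \<partial>m)"
    "AE y in m. p t z y <= C1 / measure m (ball z (scale_inv Ps t)) * exp (- c1 * t * scale_conj Ps (c2 * dist z y / t))"
   show "z ~: ball x (L * r) --> u z <= a / 2"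
   proof
    assume z: "z ~: ball x (L * r)"
    define s where "s = dist x z / q1"
    have dz: "dist x z >= 2 * r" "dist x z >= s0 * q1"
    proof -
     have "2 <= L" "2 * s0 / \<delta> <= L" by (auto simp: L_def)
     hence "2 * r <= L * r" "2 * s0 / \<delta> * r <= L * r" using r by (intro mult_right_mono; simp)+
     moreover have "s0 * q1 = 2 * s0 / \<delta> * r" by (simp add: q1_def)
     ultimately show "dist x z >= 2 * r" "dist x z >= s0 * q1" using z by auto
    qed
    hence s: "s >= s0" "s >= 1" "dist x z = s * q1" 
    proof -
     have "s0 >= 2" by (simp add: s0_def)
     moreover show "s >= s0" using dz(2) q1(1) by (simp add: s_def pos_le_divide_eq)
     ultimately show "s >= 1" by linarith
     show "dist x z = s * q1" using q1(1) by (simp add: s_def)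
    qed
    define M where "M = C1 / vol z q1 * (exp c1 * exp (- c * s))"
    have vz: "vol z q1 > 0" by (rule vol_pos[OF q1(1)])
    have "(\<integral>y. p t z y * f y \<partial>m) <= (\<integral>y. M * f y \<partial>m)"
    proof (rule integral_mono_AE)
     show "AE y in m. p t z y * f y <= M * f y" using A(2)
     proof eventually_elim
      fix y assume A: "p t z y <= C1 / measure m (ball z (scale_inv Ps t)) * exp (- c1 * t * scale_conj Ps (c2 * dist z y / t))"
      have "p t z y <= M" if y: "y : ball x r"
      proof -
       have "dist x z <= dist x y + dist z y" using dist_triangle2[of x z y] by simp
       hence "2 * dist z y >= s * q1" using y dz(1) s(3) by simp
       hence dzy: "s / 2 <= dist z y / q1" using q1(1) by (simp add: field_simps)
       \<comment> \<open>The radius \<open>q1\<close> is inserted into the supremum; t / Psi(q1) = 1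
         costs only the factor exp c1.\<close>
       have "c2 * dist z y / t / q1 - 1 / t <= scale_conj Ps (c2 * dist z y / t)"
        unfolding t_def using Psi_pos[OF q1(1)] k0 q1(1) by (intro scale_conj_ge) auto
       hence "t * (c2 * dist z y / t / q1 - 1 / t) <= t * scale_conj Ps (c2 * dist z y / t)" using t(1) by (intro mult_left_mono) auto
       hence "c2 * (dist z y / q1) - 1 <= t * scale_conj Ps (c2 * dist z y / t)" using t(1) by (simp add: right_diff_distrib)
       moreover have "c2 * (s / 2) <= c2 * (dist z y / q1)" using k0 dzy by (intro mult_left_mono) auto
       ultimately have "c2 * (s / 2) - 1 <= t * scale_conj Ps (c2 * dist z y / t)" by linarith
       hence "c1 * (c2 * (s / 2) - 1) <= c1 * (t * scale_conj Ps (c2 * dist z y / t))" using k0 by (intro mult_left_mono) auto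
       hence "- c1 * t * scale_conj Ps (c2 * dist z y / t) <= c1 + - c * s" by (simp add: c_def algebra_simps)
       hence "exp (- c1 * t * scale_conj Ps (c2 * dist z y / t)) <= exp c1 * exp (- c * s)" unfolding exp_add[symmetric] by simp
       hence "C1 / vol z q1 * exp (- c1 * t * scale_conj Ps (c2 * dist z y / t)) <= M"
        unfolding M_def using k0 vz by (intro mult_left_mono) auto
       thus ?thesis using A unfolding t(2) vol_def[symmetric] by linarith
      qed
      thus "p t z y * f y <= M * f y" by (auto simp: f_def indicator_def)
     qed
    qed (use A fi in auto)
    hence 1: "u z <= M * vol x r" using A(1) If1 by (simp add: u_def)
    obtain k :: nat where k: "2 * s <= 2^k" "2^k <= 2 * (2 * s)" using pow2_bracket[of "2 * s"] s by auto
    have "dist x z + r <= 2^k * q1" using k(1) dz(1) s(3) mult_right_mono[OF k(1), of q1] q1(1) r by linarith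
    hence "vol x r <= vol z (2^k * q1)" by (rule vol_mono_dist)
    also have "... <= D^k * vol z q1" by (rule vol_pow[OF q1(1)])
    also have "... <= (4 * s)^q * vol z q1"
    proof (rule mult_right_mono)
     have "D^k <= (2^q)^k" using q D(1) by (intro power_mono) auto
     also have "... = (2^k)^q" by (metis power_mult mult.commute)
     also have "... <= (4 * s)^q" using k by (intro power_mono) auto
     finally show "D^k <= (4 * s)^q" .
    qed (use vz in simp)
    finally have "M * vol x r <= M * ((4 * s)^q * vol z q1)" using k0 vz by (intro mult_left_mono) (auto simp: M_def)
    also have "... = C1 * exp c1 * (4 * s)^q * exp (- c * s)" using vz by (simp add: M_def)
    also have "... <= a / 2" by (rule tail[OF s(1)])
    finally show "u z <= a / 2" using 1 by simp
   qed
  qed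
  define g where "g z = 2 / a * max 0 (min (u z - a / 2) (a / 2))" for z
  define b where "b z = max 0 (min (u z - a / 2) (a / 2))" for z
  have b: "b : F" "E b b <= 4 * E u u" using band[OF u(1), of "a/2" "a/2"] a by (auto simp: b_def[abs_def])
  have gb: "g = (%z. 2 / a * b z)" by (simp add: g_def b_def fun_eq_iff)
  have gF: "g : F" unfolding gb by (rule EE.scale[OF b(1)])
  have gE: "E g g = 4 / a^2 * E b b" unfolding gb EE.B_scale[OF b(1) EE.scale[OF b(1)]] EE.B_scale_right[OF b(1,1)]
   by (simp add: power2_eq_square)
  \<comment> \<open>The heat kernel bounds hold almost everywhere; changing g on a null set makes
    the plateau and the support exact.\<close>
  define h where "h z = (if z : ball x r then 1 else if z ~: ball x (L * r) then 0 else g z)" for z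
  have [measurable]: "g : borel_measurable borel" by (rule F_meas[OF gF])
  have S: "{z : space borel. z : ball x r} : sets borel" "{z : space borel. z ~: ball x (L * r)} : sets borel"
  proof -
   have "{z : space borel. z : ball x r} = ball x r" "{z : space borel. z ~: ball x (L * r)} = - ball x (L * r)" by auto
   thus "{z : space borel. z : ball x r} : sets borel" "{z : space borel. z ~: ball x (L * r)} : sets borel"
    by (simp_all only: borel_open borel_comp open_ball)
  qed
  have hm: "h : borel_measurable borel" unfolding h_def[abs_def] by (intro measurable_If S) auto
  have gh: "AE z in m. g z = h z" using low upp by eventually_elim (use a in "auto simp: g_def h_def")
  have hF: "h : F" by (rule F_AE[OF gF hm gh])
  have hE: "E h h = E g g" using E_AE2[OF gF hm gh] by simp
  have "t >= Ps r" unfolding t_def by (rule Psi_mono[OF r q1(2)])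
  hence "vol x r / (2 * t) <= vol x r / (2 * Ps r)" using Psi_pos[OF r] vol_pos[OF r, of x] by (intro divide_left_mono) auto
  hence "E b b <= 4 * (vol x r / (2 * Ps r))" using u(2) b(2) by linarith
  hence "4 / a^2 * E b b <= 4 / a^2 * (4 * (vol x r / (2 * Ps r)))" by (intro mult_left_mono) auto
  hence "E h h <= 8 / a^2 * vol x r / Ps r" unfolding hE gE by simp
  moreover have "0 <= g z" "g z <= 1" for z
  proof -
   have "0 <= b z" "b z <= a / 2" using a by (auto simp: b_def max_def min_def)
   thus "0 <= g z" "g z <= 1" using a mult_left_mono[of "b z" "a / 2" "2 / a"] by (auto simp: gb)
  qed
  moreover have "L >= 2" by (simp add: L_def)
  hence "r <= L * r" using r by (simp add: mult_le_cancel_right1)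
  ultimately show ?thesis using hF by (intro bexI[of _ h]) (auto simp: h_def)
 qed
 moreover have "L >= 2" "8 / a^2 > 0" using a by (auto simp: L_def)
 ultimately show ?thesis by blast
qed

end

section \<open>Averages and overlaps\<close>

lemma nn_integral_UN_le:
 assumes "finite I" "!!i. i : I ==> A i : sets M" "f : borel_measurable M" "B : sets M" "B <= (UN i:I. A i)"
 shows "(\<integral>\<^sup>+x\<in>B. f x \<partial>M) <= (SUM i:I. \<integral>\<^sup>+x\<in>A i. f x \<partial>M)"
proof -
 have "(\<integral>\<^sup>+x\<in>B. f x \<partial>M) <= (\<integral>\<^sup>+x. (SUM i:I. f x * indicator (A i) x) \<partial>M)"
 proof (rule nn_integral_mono)
  fix x
  show "f x * indicator B x <= (SUM i:I. f x * indicator (A i) x)"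
  proof (cases "x : B")
   case True
   then obtain i where i: "i : I" "x : A i" using assms(5) by blast
   have "f x * indicator (A i) x <= (SUM i:I. f x * indicator (A i) x)" using i assms(1) by (intro member_le_sum) auto
   thus ?thesis using True i by simp
  qed simp
 qed
 also have "... = (SUM i:I. \<integral>\<^sup>+x\<in>A i. f x \<partial>M)"
 proof (rule nn_integral_sum)
  fix i assume "i : I"
  hence [measurable]: "A i : sets M" using assms(2) by simp
  have [measurable]: "f : borel_measurable M" by fact
  show "(%x. f x * indicator (A i) x) : borel_measurable M" by measurable
 qed
 finally show ?thesis .
qed

lemma nn_integral_overlap:
 assumes I: "finite I" and A: "!!i. i : I ==> A i : sets M" "!!i. i : I ==> A i <= B" and f: "f : borel_measurable M" and B: "B : sets M"
  and c: "!!x. x : B ==> real (card {i:I. x : A i}) <= c"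
 shows "(SUM i:I. \<integral>\<^sup>+x\<in>A i. f x \<partial>M) <= ennreal c * (\<integral>\<^sup>+x\<in>B. f x \<partial>M)"
proof -
 note [measurable] = f
 have m: "(%x. f x * indicator (A i) x) : borel_measurable M" if "i : I" for i
 proof -
  have [measurable]: "A i : sets M" using A that by simp
  show ?thesis by measurable
 qed
 have "(SUM i:I. \<integral>\<^sup>+x\<in>A i. f x \<partial>M) = (\<integral>\<^sup>+x. (SUM i:I. f x * indicator (A i) x) \<partial>M)"
  using m by (simp add: nn_integral_sum)
 also have "... <= (\<integral>\<^sup>+x. ennreal c * (f x * indicator B x) \<partial>M)"
 proof (rule nn_integral_mono)
  fix x
  show "(SUM i:I. f x * indicator (A i) x) <= ennreal c * (f x * indicator B x)"
  proof (cases "x : B")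
   case True
   have 1: "(SUM i:I. f x * indicator (A i) x) = f x * (SUM i:I. indicator (A i) x)" by (simp add: sum_distrib_left)
   have 2: "(SUM i:I. indicator (A i) x :: ennreal) = of_nat (card {i:I. x : A i})"
    using I by (simp add: indicator_def of_bool_def sum.If_cases Int_def)
   have "(of_nat (card {i:I. x : A i}) :: ennreal) <= ennreal c"
    using c[OF True] by (metis ennreal_leI ennreal_of_nat_eq_real_of_nat)
   from mult_left_mono[OF this, of "f x"] show ?thesis unfolding 1 2 using True by (simp add: mult.commute)
  next
   case False
   hence "indicator (A i) x = (0::ennreal)" if "i : I" for i using A(2)[OF that] by (auto simp: indicator_def)
   thus ?thesis by simp
  qed
 qed
 also have "... = ennreal c * (\<integral>\<^sup>+x\<in>B. f x \<partial>M)"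
 proof (rule nn_integral_cmult)
  have [measurable]: "B : sets M" by fact
  show "(%x. f x * indicator B x) : borel_measurable M" by measurable
 qed
 finally show ?thesis .
qed

lemma emeasure_overlap:
 assumes "finite I" "!!i. i : I ==> A i : sets M" "!!i. i : I ==> A i <= B" "B : sets M"
  and "!!x. x : B ==> real (card {i:I. x : A i}) <= c"
 shows "(SUM i:I. emeasure M (A i)) <= ennreal c * emeasure M B"
 using nn_integral_overlap[of I A M B "%_. 1" c] assms by simp

context mmd begin

lemma ip_nn: "f : L2 ==> (\<integral>\<^sup>+x. ennreal ((f x)^2) \<partial>m) = ennreal (ip f f)"
 unfolding ip_def power2_eq_square by (rule nn_integral_eq_integral[OF L2_int]) auto

text \<open>Cauchy-Schwarz against the indicator of S. When the right side is finite, g is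
  integrable on S, so the average is a genuine one.\<close>

lemma average_bound:
 assumes S: "S : sets borel" "bounded S" "measure m S > 0" and g: "set_borel_measurable borel S g"
 shows "ennreal (measure m S * (set_average m S g - a)^2) <= (sqi S (%x. g x - a))" (is "_ <= ?N")
proof (cases "?N = \<infinity>")
 case False
 define s where "s = measure m S"
 define f where "f x = indicator S x * (g x - a)" for x
 have fin: "emeasure m S < \<infinity>" by (rule bounded_fin[OF S(2)])
 have gm0: "(%x. indicator S x * g x) : borel_measurable borel" using g by (simp add: set_borel_measurable_def)
 have [measurable]: "S : sets borel" by fact
 have "f = (%x. indicator S x * g x - a * indicator S x)" by (auto simp: f_def algebra_simps)
 hence fm[measurable]: "f : borel_measurable borel" using gm0 by (simp) measurable
 have N: "?N = (\<integral>\<^sup>+x. ennreal ((f x)^2) \<partial>m)" by (intro nn_integral_cong) (auto simp: f_def indicator_def)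
 have fL: "f : L2" using False fm unfolding N L2_on_def by (auto simp: less_top)
 have iL: "indicator S : L2" by (rule indicator_L2[OF S(1,2)])
 have fi: "integrable m f" 
 proof -
  have "(%x. indicator S x * f x) = f" by (auto simp: f_def indicator_def)
  thus ?thesis using L2_int[OF iL fL] by simp
 qed
 have ii: "integrable m (indicat_real S)" using fin by (intro integrable_real_indicator) auto
 have "(\<integral>x. f x \<partial>m) = s * (set_average m S g - a)"
 proof -
  have "integrable m (%x. indicator S x * g x)"
   using Bochner_Integration.integrable_add[OF fi integrable_mult_right[OF ii, of a]] by (simp add: f_def algebra_simps)
  hence "(\<integral>x. indicator S x * g x - a * indicator S x \<partial>m) = (\<integral>x. indicator S x * g x \<partial>m) - a * s"
   using ii by (simp add: s_def)
  thus ?thesis using S(3) by (simp add: f_def set_average_def set_lebesgue_integral_def s_def algebra_simps)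
 qed
 moreover have "ip (indicator S) f = (\<integral>x. f x \<partial>m)"
  unfolding ip_def by (intro Bochner_Integration.integral_cong) (auto simp: f_def indicator_def)
 moreover have "Ns (indicator S) = s" by (simp add: ip_def s_def indicator_inter_arith[symmetric])
 ultimately have "(s * (set_average m S g - a))^2 <= s * ip f f" using ip.CS[OF iL fL] by simp
 hence "s * (s * (set_average m S g - a)^2) <= s * ip f f" by (simp add: power2_eq_square mult_ac)
 hence "s * (set_average m S g - a)^2 <= ip f f" using S(3) by (simp add: s_def)
 moreover have "?N = ennreal (ip f f)" unfolding N by (rule ip_nn[OF fL])
 ultimately show ?thesis by (simp add: s_def ennreal_leI)
qed simp

lemma average_bound_real:
 assumes "S : sets borel" "bounded S" "measure m S > 0" "set_borel_measurable borel S g"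
  "sqi S (%x. g x - a) <= ennreal c" "0 <= c"
 shows "(set_average m S g - a)^2 <= c / measure m S"
proof -
 have "measure m S * (set_average m S g - a)^2 <= c"
  using order_trans[OF average_bound[OF assms(1-4)] assms(5)] assms(6) by (simp add: ennreal_le_iff)
 thus ?thesis using assms(3) by (simp add: field_simps)
qed

lemma borel_set_meas: assumes [measurable]: "g : borel_measurable borel" "S : sets borel"
 shows "set_borel_measurable borel S (g :: 'a => real)"
 unfolding set_borel_measurable_def by measurable

lemma half_balls: assumes "rh <= dist p q" shows "ball p (rh/2) Int ball q (rh/2) = ({} :: 'a set)"
proof (rule ccontr)
 assume "~ ?thesis"
 then obtain x where "dist p x < rh/2" "dist q x < rh/2" by auto
 thus False using assms dist_triangle2[of p q x] by simp
qed

end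

context hk begin

text \<open>Packing: disjoint balls of radius sg whose centres are within R' of z have comparable
  volumes and all lie in one ball of radius R' + sg.\<close>

lemma count:
 fixes c :: "'b => 'a"
 assumes sg: "sg > 0" and dis: "!!p q. p : Q ==> q : Q ==> p ~= q ==> ball (c p) sg Int ball (c q) sg = {}"
  and near: "!!p. p : Q ==> dist z (c p) <= R'" and K: "2 * R' + sg <= K * sg"
 shows "finite Q" "real (card Q) <= DD K"
proof -
 have fin: "real (card Q') <= DD K" if Q': "finite Q'" "Q' <= Q" for Q'
 proof (cases "Q' = {}")
  case False
  hence R0: "R' >= 0" using near Q' by (metis all_not_in_conv subsetD zero_le_dist order_trans)
  define v where "v = vol z (R' + sg)"
  have v: "v > 0" unfolding v_def using R0 sg by (intro vol_pos) auto
  have b: "v / DD K <= vol (c p) sg" if "p : Q'" for p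
  proof -
   have "v <= DD K * vol (c p) sg" unfolding v_def by (rule DD(2)[OF sg]) (use near[of p] that Q' K in auto)
   thus ?thesis using DD(1)[of K] by (simp add: field_simps)
  qed
  have "real (card Q') * (v / DD K) = (SUM p:Q'. v / DD K)" by simp
  also have "... <= (SUM p:Q'. measure m (ball (c p) sg))" using b by (intro sum_mono) (simp add: vol_def)
  also have "... = measure m (UN p:Q'. ball (c p) sg)"
  proof (rule measure_finite_Union[symmetric])
   show "disjoint_family_on (%p. ball (c p) sg) Q'" using dis Q'(2) by (auto simp: disjoint_family_on_def)
   show "emeasure m (ball (c p) sg) ~= \<infinity>" for p using bounded_fin[of "ball (c p) sg"] by auto
  qed (use Q' in auto)
  also have "... <= v" unfolding v_def vol_def
  proof (rule measure_mono_b)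
   show "(UN p:Q'. ball (c p) sg) <= ball z (R' + sg)"
   proof
    fix y assume "y : (UN p:Q'. ball (c p) sg)"
    then obtain p where "p : Q'" "dist (c p) y < sg" by auto
    thus "y : ball z (R' + sg)" using near[of p] Q'(2) dist_triangle[of z y "c p"] by auto
   qed
  qed (use Q' in auto)
  finally show ?thesis using v DD(1)[of K] by (simp add: field_simps)
 qed (use DD(1)[of K] in auto)
 show "finite Q"
 proof (rule ccontr)
  assume "infinite Q"
  obtain n :: nat where n: "DD K < real n" using reals_Archimedean2 by blast
  obtain Q' where "finite Q'" "card Q' = n" "Q' <= Q" using infinite_arbitrarily_large[OF \<open>infinite Q\<close>] by blast
  thus False using fin[of Q'] n by simp
 qed
 thus "real (card Q) <= DD K" using fin by simp
qed

text \<open>A separated set of maximal cardinality; doubling bounds the cardinalities, and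
  maximality gives the covering.\<close>

lemma net: fixes S :: "'a set" assumes S: "bounded S" and rh: "rh > 0"
 obtains N where "finite N" "N <= S" "!!p q. p : N ==> q : N ==> p ~= q ==> rh <= dist p q" "S <= (UN p:N. ball p rh)"
proof -
 define sep where "sep N \<longleftrightarrow> N <= S & (ALL p:N. ALL q:N. p ~= q --> rh <= dist p q)" for N
 obtain z e where e: "!!y. y : S ==> dist z y <= e" using S by (auto simp: bounded_def)
 define K where "K = (2 * e + rh/2) / (rh/2)"
 have c: "finite N" "real (card N) <= DD K" if N: "sep N" for N
 proof -
  have d: "ball p (rh/2) Int ball q (rh/2) = {}" if "p : N" "q : N" "p ~= q" for p q
   by (rule half_balls) (use N that in "auto simp: sep_def")
  have k: "2 * e + rh/2 <= K * (rh/2)" using rh by (simp add: K_def)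
  have n: "dist z p <= e" if "p : N" for p using e N that by (auto simp: sep_def)
  show "finite N" "real (card N) <= DD K" using count[where c = "%p. p", OF _ d n k] rh by auto
 qed
 have "sep {}" by (simp add: sep_def)
 moreover have "card N < nat \<lceil>DD K\<rceil> + 1" if "sep N" for N using c(2)[OF that] by linarith
 ultimately obtain N where N: "sep N" "!!N'. sep N' ==> card N' <= card N"
  using ex_has_greatest_nat[of sep "{}" card "nat \<lceil>DD K\<rceil> + 1"] by blast
 have "S <= (UN p:N. ball p rh)"
 proof (rule ccontr)
  assume "~ S <= (UN p:N. ball p rh)"
  then obtain y where y: "y : S" "!!p. p : N ==> rh <= dist p y" by (force simp: not_less)
  have "sep (insert y N)" using N(1) y by (auto simp: sep_def dist_commute)
  moreover have "y ~: N" using y(2)[of y] rh by auto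
  ultimately show False using N(2)[of "insert y N"] c(1)[OF N(1)] by simp
 qed
 thus ?thesis using that[of N] N(1) c(1) by (auto simp: sep_def)
qed

section \<open>An energy criterion by mollification\<close>

text \<open>One pair of cutoff constants is fixed once, so that everything built on it is a constant
  of the locale.\<close>

definition "cutLC = (SOME q. fst q >= 2 & snd q > 0 & (ALL x r. r > 0 --> (EX h:F. (ALL z. 0 <= h z & h z <= 1) &
  (ALL z:ball x r. h z = 1) & (ALL z. z ~: ball x (fst q * r) --> h z = 0) & E h h <= snd q * vol x r / Ps r)))"
definition "cL = fst cutLC"
definition "cC = snd cutLC"

lemma cut: "cL >= 2" "cC > 0" "r > 0 ==> (EX h:F. (ALL z. 0 <= h z & h z <= 1) &
  (ALL z:ball x r. h z = 1) & (ALL z. z ~: ball x (cL * r) --> h z = 0) & E h h <= cC * vol x r / Ps r)"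
proof -
 obtain L C where "L >= 2 & C > 0 & (ALL x r. r > 0 --> (EX h:F. (ALL z. 0 <= h z & h z <= 1) &
  (ALL z:ball x r. h z = 1) & (ALL z. z ~: ball x (L * r) --> h z = 0) & E h h <= C * vol x r / Ps r))" using cutoff_ex by blast
 hence "EX q. fst q >= 2 & snd q > 0 & (ALL x r. r > 0 --> (EX h:F. (ALL z. 0 <= h z & h z <= 1) &
  (ALL z:ball x r. h z = 1) & (ALL z. z ~: ball x (fst q * r) --> h z = 0) & E h h <= snd q * vol x r / Ps r))"
  by (intro exI[of _ "(L, C)"]) simp
 from someI_ex[OF this, folded cutLC_def] show "cL >= 2" "cC > 0" "r > 0 ==> (EX h:F. (ALL z. 0 <= h z & h z <= 1) &
  (ALL z:ball x r. h z = 1) & (ALL z. z ~: ball x (cL * r) --> h z = 0) & E h h <= cC * vol x r / Ps r)"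
  unfolding cL_def cC_def by blast+
qed

text \<open>\<open>cM\<close> is the multiple of the mesh on which oscillation must be known: it
  covers every mesh ball whose centre is within 2 cL of a given net point. \<open>cQ\<close> bounds
  the number of those net points and the ratios of their volumes, and \<open>cX\<close> the energy
  of a partition function.\<close>

definition "cM = 2 * cL + 2"
definition "cQ = DD (8 * cL + 1)"
definition "cX = 4 * cQ^2 * (cC * cQ)"

lemma cQ: "cQ >= 1" and cX: "cX >= 0" using DD(1) cut(2)
 by (auto simp: cQ_def cX_def intro!: mult_nonneg_nonneg order_trans[OF zero_le_one DD(1)])

text \<open>Quotients by the sum of the cutoffs are avoided. The p-th function is the increment of
  the truncated partial sums min 1 S_i, so the functions add up to min 1 of the full sum, and their
  energy is controlled by contractions alone.\<close>

lemma partition: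
 assumes rh: "rh > 0" and N: "finite N" "!!p q. p : N ==> q : N ==> p ~= q ==> rh <= dist p q"
 obtains et where "!!p. p : N ==> et p : F" "!!p z. p : N ==> 0 <= et p z & et p z <= 1"
  "!!p z. p : N ==> z ~: ball p (cL * rh) ==> et p z = 0"
  "!!z. z : (UN p:N. ball p rh) ==> (SUM p:N. et p z) = 1" "!!z. (SUM p:N. et p z) <= 1"
  "!!p. p : N ==> En (et p) <= cX * vol p rh / Ps rh"
  "!!z R'. R' <= 2 * cL * rh ==> real (card {p:N. dist z p <= R'}) <= cQ"
proof -
 note L = cut(1)
 have Lr: "cL * rh > 0" using L rh by simp
 have dis: "ball p (rh/2) Int ball q (rh/2) = {}" if "p : N" "q : N" "p ~= q" for p q
  by (rule half_balls[OF N(2)[OF that]])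
 have cnt: "real (card {p:N. dist z p <= R'}) <= cQ" if "R' <= 2 * cL * rh" for z R'
  unfolding cQ_def by (rule count(2)[where sg = "rh/2" and c = "%p. p" and z = z and R' = R'])
   (use that rh dis in "auto simp: algebra_simps")
 have "ALL p. EX h. h : F & (ALL z. 0 <= h z & h z <= 1) & (ALL z:ball p rh. h z = 1) & (ALL z. z ~: ball p (cL * rh) --> h z = 0) & E h h <= cC * vol p rh / Ps rh"
  using cut(3)[OF rh] by blast
 then obtain \<phi> where \<phi>: "!!p. \<phi> p : F" "!!p z. 0 <= \<phi> p z" "!!p z. \<phi> p z <= 1" "!!p z. z : ball p rh ==> \<phi> p z = 1"
  "!!p z. z ~: ball p (cL * rh) ==> \<phi> p z = 0" "!!p. En (\<phi> p) <= cC * vol p rh / Ps rh" by metis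
 obtain e where e: "bij_betw e {0..<card N} N" using ex_bij_betw_nat_finite[OF N(1)] by blast
 define n where "n = card N"
 define ix where "ix = the_inv_into {0..<n} e"
 have e': "bij_betw e {0..<n} N" using e by (simp add: n_def)
 have ix: "ix (e i) = i" if "i < n" for i using e' that by (auto simp: ix_def bij_betw_def the_inv_into_f_f)
 have eN: "e i : N" if "i < n" for i using e' that by (auto simp: bij_betw_def)
 have N_e: "EX i<n. p = e i" if "p : N" for p using e' that by (force simp: bij_betw_def)
 define S where "S i z = (\<Sum>j<i. \<phi> (e j) z)" for i z
 define et where "et p z = min 1 (S (Suc (ix p)) z) - min 1 (S (ix p) z)" for p z
 have Sd: "S (Suc i) z = S i z + \<phi> (e i) z" for i z by (simp add: S_def)
 have S0: "0 <= S i z" for i z unfolding S_def by (intro sum_nonneg \<phi>)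
 have ete: "et (e i) z = min 1 (S (Suc i) z) - min 1 (S i z)" if "i < n" for i z using ix[OF that] by (simp add: et_def)
 have b: "0 <= et p z & et p z <= 1" if pN: "p : N" for p z
 proof -
  obtain i where i: "i < n" "p = e i" using N_e[OF pN] by blast
  show ?thesis using \<phi>(2)[of p z] S0[of i z] \<phi>(3)[of p z] unfolding i(2) ete[OF i(1)] Sd by auto
 qed
 have zero: "et p z = 0" if pN: "p : N" "z ~: ball p (cL * rh)" for p z
 proof -
  obtain i where i: "i < n" "p = e i" using N_e[OF pN(1)] by blast
  show ?thesis using \<phi>(5)[OF pN(2)] unfolding i(2) ete[OF i(1)] Sd by auto
 qed
 have sum: "(SUM p:N. et p z) = min 1 (S n z)" for z
 proof -
  have "(SUM p:N. et p z) = (SUM i:{0..<n}. et (e i) z)" using sum.reindex_bij_betw[OF e', of "%p. et p z"] by simp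
  also have "... = (\<Sum>i<n. min 1 (S (Suc i) z) - min 1 (S i z))" by (intro sum.cong) (auto simp: ete)
  also have "... = min 1 (S n z)" unfolding sum_lessThan_telescope[of "%i. min 1 (S i z)"] by (simp add: S_def)
  finally show ?thesis .
 qed
 have one: "(SUM p:N. et p z) = 1" if z: "z : (UN p:N. ball p rh)" for z
 proof -
  obtain p where p: "p : N" "z : ball p rh" using z by blast
  obtain i where i: "i < n" "p = e i" using N_e[OF p(1)] by blast
  have "\<phi> (e i) z <= S n z" unfolding S_def using i \<phi> by (intro member_le_sum[of i "{..<n}" "%j. \<phi> (e j) z"]) auto
  thus ?thesis using \<phi>(4)[OF p(2)] i(2) unfolding sum by auto
 qed
 have en: "et p : F & En (et p) <= cX * vol p rh / Ps rh" if pN: "p : N" for p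
 proof -
  obtain i where i: "i < n" "p = e i" using N_e[OF pN] by blast
  \<comment> \<open>Only cutoffs centred this close can meet the support of the p-th function, so
    the long partial sums may be replaced by sums of at most cQ terms before energies are
    estimated.\<close>
  define J where "J = {q:N. dist p q <= 2 * cL * rh}"
  define J' where "J' = {q:J. ix q < i}"
  have J: "finite J" "finite J'" "J' <= J" "real (card J) <= cQ" using N(1) cnt[of "2 * cL * rh" p] by (auto simp: J_def J'_def)
  define t where "t z = (SUM q:J'. \<phi> q z)" for z
  define t' where "t' z = (SUM q:insert p J'. \<phi> q z)" for z
  have pJ: "p ~: J'" using ix[OF i(1)] i by (auto simp: J'_def)
  have t't: "t' z = t z + \<phi> p z" for z using pJ J by (simp add: t_def t'_def)
  have t0: "0 <= t z" "0 <= t' z" for z by (auto simp: t_def t'_def intro!: sum_nonneg \<phi>)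
  define v where "v = sqrt (cC * cQ * vol p rh / Ps rh)"
  have sq: "sqrt (En (\<phi> q)) <= v" if "dist p q <= 2 * cL * rh" for q
  proof -
   have "vol q rh <= cQ * vol p rh" unfolding cQ_def
    by (rule DD(2)[OF rh]) (use that Lr in "auto simp: dist_commute distrib_right")
   hence "cC * vol q rh / Ps rh <= cC * (cQ * vol p rh) / Ps rh" using cut(2) Psi_pos[OF rh]
    by (intro divide_right_mono mult_left_mono) auto
   thus ?thesis unfolding v_def using \<phi>(6)[of q] by (intro real_sqrt_le_mono) (simp add: mult.assoc)
  qed
  have v0: "v >= 0" using cut(2) cQ vol_pos[OF rh, of p] Psi_pos[OF rh] by (auto simp: v_def)
  have tF: "t : F" "t' : F" unfolding t_def[abs_def] t'_def[abs_def] using J \<phi>(1) F_ne by (auto intro!: EE.sum)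
  have "J' <= J" "insert p J' <= J" using pN L rh by (auto simp: J_def J'_def)
  hence "sqrt (E t t) <= (SUM q:J. v)" "sqrt (E t' t') <= (SUM q:J. v)"
  proof -
   have "sqrt (En (%z. SUM q:H. \<phi> q z)) <= (SUM q:J. v)" if "H <= J" for H
   proof -
    have "sqrt (En (%z. SUM q:H. \<phi> q z)) <= (SUM q:H. sqrt (En (\<phi> q)))"
     by (rule EE.tri_sum) (use that J(1) finite_subset F_ne \<phi> in auto)
    also have "... <= (SUM q:H. v)" using that by (intro sum_mono sq) (auto simp: J_def)
    also have "... <= (SUM q:J. v)" using that J(1) v0 by (intro sum_mono2) auto
    finally show ?thesis .
   qed
   from this[of J'] this[of "insert p J'"] show "sqrt (E t t) <= (SUM q:J. v)" "sqrt (E t' t') <= (SUM q:J. v)"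
    using \<open>J' <= J\<close> \<open>insert p J' <= J\<close> by (auto simp: t_def[abs_def] t'_def[abs_def])
  qed
  moreover have "(SUM q:J. v) <= cQ * v" using J(4) v0 by (simp add: mult_right_mono)
  ultimately have st: "sqrt (E t t) <= cQ * v" "sqrt (E t' t') <= cQ * v" by linarith+
  \<comment> \<open>On the ball around p the partial sums agree with the local sums t and t'; off it
    the p-th cutoff vanishes and both sides are 0.\<close>
  have eq: "et p = (%z. max 0 (min (t' z) 1) - max 0 (min (t z) 1))"
  proof
   fix z
   show "et p z = max 0 (min (t' z) 1) - max 0 (min (t z) 1)"
   proof (cases "z : ball p (cL * rh)")
    case True
    have "S i z = (SUM q:e ` {..<i}. \<phi> q z)" unfolding S_def
     using e' i(1) by (subst sum.reindex) (auto simp: bij_betw_def intro: inj_on_subset)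
    also have "... = t z" unfolding t_def
    proof (rule sum.mono_neutral_right)
     show "J' <= e ` {..<i}"
     proof
      fix q assume "q : J'"
      then obtain j where "j < n" "q = e j" "ix q < i" using N_e by (auto simp: J'_def J_def)
      thus "q : e ` {..<i}" using ix by auto
     qed
     show "ALL q:e ` {..<i} - J'. \<phi> q z = 0"
     proof
      fix q assume q: "q : e ` {..<i} - J'"
      then obtain j where j: "j < i" "q = e j" by auto
      hence "q ~: J" using q i(1) ix[of j] by (auto simp: J'_def)
      hence "2 * cL * rh < dist p q" using eN[of j] j i by (auto simp: J_def)
      hence "z ~: ball q (cL * rh)" using True dist_triangle[of p q z] by (auto simp: dist_commute)
      thus "\<phi> q z = 0" by (rule \<phi>(5))
     qed
    qed simp
    finally have "S i z = t z" .
    thus ?thesis using t0[of z] t't[of z] unfolding i(2) ete[OF i(1)] Sd by (simp add: i(2)[symmetric] min.commute)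
   next
    case False
    thus ?thesis using zero[OF pN False] \<phi>(5)[OF False] t't[of z] by simp
   qed
  qed
  note c = clip[OF tF(1), of 1] clip[OF tF(2), of 1]
  have F: "et p : F" unfolding eq by (intro EE.diff c) auto
  have "sqrt (En (et p)) <= sqrt (E t' t') + sqrt (E t t)" unfolding eq
   by (rule order_trans[OF EE.tri_diff]) (use c in "auto intro!: add_mono")
  also have "... <= 2 * (cQ * v)" using st by simp
  finally have "(sqrt (En (et p)))^2 <= (2 * (cQ * v))^2" using EE.B_nonneg[OF F] by (intro power_mono) auto
  hence "En (et p) <= 4 * cQ^2 * v^2" using EE.B_nonneg[OF F] by (simp add: power_mult_distrib)
  moreover have "v^2 = cC * cQ * vol p rh / Ps rh" using cut(2) cQ vol_pos[OF rh, of p] Psi_pos[OF rh] by (simp add: v_def)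
  ultimately show ?thesis using F by (simp add: cX_def mult.assoc)
 qed
 show ?thesis
 proof (rule that[of et])
  show "(SUM p:N. et p z) <= 1" for z unfolding sum by simp
 qed (use b zero one en cnt in blast)+
qed

end

lemma measure_overlap:
 assumes M: "finite_measure M" and I: "finite I" "!!i. i : I ==> A i : sets M" "!!i. i : I ==> A i <= B" "B : sets M"
  and c: "!!x. x : B ==> real (card {i:I. x : A i}) <= c" "0 <= c"
 shows "(SUM i:I. measure M (A i)) <= c * measure M B"
proof -
 interpret finite_measure M by fact
 have "ennreal (SUM i:I. measure M (A i)) = (SUM i:I. emeasure M (A i))" by (simp add: emeasure_eq_measure)
 also have "... <= ennreal c * emeasure M B" by (rule emeasure_overlap[OF I c(1)])
 also have "... = ennreal (c * measure M B)" using c(2) by (simp add: emeasure_eq_measure ennreal_mult)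
 finally show ?thesis using c(2) by (simp add: ennreal_le_iff)
qed

lemma le_by_eps: assumes "!!et. et > 0 ==> a <= b + c * et" "0 <= (c::real)" shows "a <= b"
proof (rule field_le_epsilon)
 fix e :: real assume e: "e > 0"
 have "c * (e / (c + 1)) <= e" using e assms(2) by (simp add: field_simps)
 thus "a <= b + e" using assms(1)[of "e / (c + 1)"] e assms(2) by simp
qed

context hk begin

definition "cZ K = (4 * cQ^4 * cX + 4 * cQ) * DD (4 * K + 1)"

lemma cZ: "cZ K >= 0" using cQ cX DD(1)[of "4*K+1"] by (auto simp: cZ_def intro!: mult_nonneg_nonneg add_nonneg_nonneg)

text \<open>Discrete convolution: averages over mesh balls are the coefficients of the partition of
  unity. On a mesh ball only differences of neighbouring averages enter, and these are bounded by
  the oscillation. The measure has a scaled and an unscaled part because the second will absorb a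
  tail of vanishing mass.\<close>

lemma mollify:
 assumes rh: "rh > 0" and g[measurable]: "g : borel_measurable borel" and k: "!!z. abs (g z) <= k"
  and g0: "!!z. z ~: ball o' R' ==> g z = 0"
  and N1: "finite_measure N1" "sets N1 = sets borel" and N2: "finite_measure N2" "sets N2 = sets borel" and H: "H >= 0" and K: "K >= 1"
  and nu: "!!A. nu A = H * measure N1 A + measure N2 A"
  and osc: "!!x. EX av. sqi (ball x (cM * rh)) (%y. g y - av) <= ennreal (Ps rh * nu (ball x (K * rh)))"
 obtains u where "u : F" "!!z. abs (u z) <= k" "E u u <= cZ K * nu UNIV" "Ns (%z. u z - g z) <= cZ K * Ps rh * nu UNIV"
  "!!A. A : sets borel ==> gm u A <= cZ K * nu (UN x:A. ball x ((K + 1) * rh))"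
proof -
 note L = cut(1)
 have nu0: "0 <= nu A" for A unfolding nu using H by simp
 have k0: "0 <= k" using k[of o'] by simp
 have Lr: "2 * rh <= cL * rh" "0 < cL * rh" using L rh by simp_all
 \<comment> \<open>The net reaches beyond the region where u can be nonzero, which ends at
   \<open>R3\<close>; hence the partition sums to 1 wherever that is used, and outside u has no
   energy.\<close>
 define R2 where "R2 = abs R' + (cL + 3) * rh"
 obtain N where N: "finite N" "N <= ball o' R2" "!!p q. p : N ==> q : N ==> p ~= q ==> rh <= dist p q" "ball o' R2 <= (UN p:N. ball p rh)"
  by (rule net[OF bounded_ball[of o' R2] rh]) (rule that, assumption+)
 obtain et where et: "!!p. p : N ==> et p : F" "!!p z. p : N ==> 0 <= et p z & et p z <= 1"
  "!!p z. p : N ==> z ~: ball p (cL * rh) ==> et p z = 0"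
  "!!z. z : (UN p:N. ball p rh) ==> (SUM p:N. et p z) = 1" "!!z. (SUM p:N. et p z) <= 1"
  "!!p. p : N ==> En (et p) <= cX * vol p rh / Ps rh"
  "!!z R'. R' <= 2 * cL * rh ==> real (card {p:N. dist z p <= R'}) <= cQ"
  by (rule partition[OF rh N(1,3)]) (assumption+, rule that, assumption+)
 define a where "a p = set_average m (ball p rh) g" for p
 define B where "B p = Ps rh * nu (ball p (K * rh))" for p
 have B0: "0 <= B p" for p using nu0 Psi_pos[OF rh] by (simp add: B_def)
 have vp: "vol p rh > 0" for p by (rule vol_pos[OF rh])
 have "EX av. ALL p. sqi (ball p (cM * rh)) (%y. g y - av p) <= ennreal (B p)" unfolding B_def using osc by metis
 then obtain av where av: "!!p. sqi (ball p (cM * rh)) (%y. g y - av p) <= ennreal (B p)" by blast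
 have sub: "sqi (ball q rh) (%y. g y - av p) <= ennreal (B p)" if "dist p q <= 2 * cL * rh" for p q
 proof -
  have "ball q rh <= ball p (cM * rh)"
  proof
   fix y assume "y : ball q rh"
   thus "y : ball p (cM * rh)" using that dist_triangle[of p y q] rh by (simp add: cM_def distrib_right)
  qed
  hence "sqi (ball q rh) (%y. g y - av p) <= (sqi (ball p (cM * rh)) (%y. g y - av p))"
   by (intro nn_integral_mono) (auto simp: indicator_def)
  thus ?thesis using av[of p] by (rule order_trans)
 qed
 have dv: "vol p rh <= cQ * vol q rh" if "dist p q <= 2 * cL * rh" for p q
 proof -
  have "2 * cL * rh <= 8 * cL * rh" using L rh by (intro mult_right_mono) auto
  hence "dist p q + rh <= (8 * cL + 1) * rh" using that unfolding distrib_right by linarith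
  thus ?thesis unfolding cQ_def by (rule DD(2)[OF rh])
 qed
 have diffav: "(a q - av p)^2 <= cQ * B p / vol p rh" if d: "dist p q <= 2 * cL * rh" for p q
 proof -
  have "(a q - av p)^2 <= B p / measure m (ball q rh)" unfolding a_def
   by (rule average_bound_real[OF _ _ _ borel_set_meas[OF g] sub[OF d] B0]) (use vp[of q] in "auto simp: vol_def")
  also have "... <= cQ * B p / vol p rh"
   using dv[OF d] vp[of p] vp[of q] B0[of p] mult_left_mono[OF dv[OF d] B0[of p]] by (simp add: vol_def field_simps)
  finally show ?thesis .
 qed
 have ak: "abs (a p) <= k" for p
 proof -
  have "sqi (ball p rh) (%y. g y - 0) <= (\<integral>\<^sup>+y. ennreal (k^2) * indicator (ball p rh) y \<partial>m)"
   using k k0 by (intro nn_integral_mono) (auto simp: indicator_def abs_le_square_iff[symmetric] intro!: ennreal_leI)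
  also have "... = ennreal (k^2 * vol p rh)"
   using emeasure_bounded[of "ball p rh"] by (simp add: nn_integral_cmult_indicator vol_def ennreal_mult)
  finally have "(a p - 0)^2 <= k^2 * vol p rh / measure m (ball p rh)" unfolding a_def
   by (intro average_bound_real[OF _ _ _ borel_set_meas[OF g]]) (use vp[of p] in "auto simp: vol_def")
  thus ?thesis using vp[of p] k0 by (simp add: vol_def abs_le_square_iff[symmetric])
 qed
 have a0: "a p = 0" if "dist o' p >= abs R' + rh" for p
 proof -
  have "indicator (ball p rh) y * g y = 0" for y
  proof (cases "y : ball p rh")
   case True
   hence "y ~: ball o' R'" using that dist_triangle[of o' p y] by (auto simp: dist_commute)
   thus ?thesis using g0 by simp
  qed simp
  hence *: "(%y. indicat_real (ball p rh) y *\<^sub>R g y) = (%_. 0)" by auto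
  show ?thesis by (simp add: a_def set_average_def set_lebesgue_integral_def * del: real_scaleR_def)
 qed
 define u where "u z = (SUM p:N. a p * et p z)" for z
 have aF: "(%z. c * et p z) : F" if "p : N" for p c using et(1)[OF that] by (rule EE.scale)
 have uF: "u : F" unfolding u_def using aF N(1) F_ne by (intro EE.sum) auto
 have ub: "abs (u z) <= k" for z
 proof -
  have "abs (u z) <= (SUM p:N. abs (a p) * et p z)" unfolding u_def using et(2) by (intro order_trans[OF sum_abs] sum_mono) (auto simp: abs_mult)
  also have "... <= (SUM p:N. k * et p z)" using ak et(2) by (intro sum_mono mult_right_mono) auto
  also have "... <= k * 1" unfolding sum_distrib_left[symmetric] using k0 et(5) by (intro mult_left_mono) auto
  finally show ?thesis by simp
 qed
 define R3 where "R3 = abs R' + (cL + 1) * rh"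
 have R32: "R3 < R2" using rh by (simp add: R3_def R2_def algebra_simps)
 have u0: "u z = 0" if "dist o' z > R3" for z
 proof -
  have "a p * et p z = 0" if p: "p : N" for p
  proof (cases "z : ball p (cL * rh)")
   case True
   hence "dist o' p >= abs R' + rh" using \<open>dist o' z > R3\<close> dist_triangle[of o' z p] by (simp add: R3_def algebra_simps)
   thus ?thesis by (simp add: a0)
  qed (use et(3)[OF p] in simp)
  thus ?thesis unfolding u_def by (intro sum.neutral) blast
 qed
 define J where "J p = {q:N. dist p q <= 2 * cL * rh}" for p
 have J: "finite (J p)" "J p <= N" "real (card (J p)) <= cQ" for p using N(1) et(7) by (auto simp: J_def)
 have loc: "(SUM q:N. c q * et q z) = (SUM q:J p. c q * et q z)" if z: "z : ball p rh" for z p c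
 proof (rule sum.mono_neutral_right)
  show "ALL q:N - J p. c q * et q z = 0"
  proof
   fix q assume q: "q : N - J p"
   hence "z ~: ball q (cL * rh)" using z dist_triangle[of p q z] Lr by (auto simp: J_def dist_commute)
   thus "c q * et q z = 0" using et(3) q by simp
  qed
 qed (use N J in auto)
 \<comment> \<open>Constants may be subtracted because the partition sums to 1 on a mesh ball
   centred in the net.\<close>
 have mid: "u z - c = (SUM q:J p. (a q - c) * et q z)" if p: "p : N" "z : ball p rh" for p z c
 proof -
  have "(SUM q:N. et q z) = 1" using p by (intro et(4)) auto
  hence "u z - c = (SUM q:N. (a q - c) * et q z)" by (simp add: u_def left_diff_distrib sum_subtractf sum_distrib_left[symmetric])
  thus ?thesis using loc[OF p(2), of "%q. a q - c"] by simp
 qed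
 have gmp: "gm u (ball p rh) <= 4 * cQ^4 * cX * nu (ball p (K * rh))" if p: "p : N" for p
 proof -
  define v where "v z = (SUM q:J p. (a q - a p) * et q z)" for z
  have tF: "(%z. (a q - a p) * et q z) : F" if "q : J p" for q by (rule aF) (use J(2) that in blast)
  have vF: "v : F" unfolding v_def using tF J(1) F_ne by (intro EE.sum) auto
  have "AE z in m. z : ball p rh --> u z = v z + a p" using mid[OF p, of _ "a p"] by (auto simp: v_def intro!: AE_I2) (smt (verit))
  from gm_local[OF uF vF open_ball this, of "ball p rh"] have "gm u (ball p rh) = gm v (ball p rh)" by simp
  define w where "w = 4 * cQ^2 * cX * nu (ball p (K * rh))"
  have w0: "0 <= w" using nu0 cX by (simp add: w_def)
  have t: "sqrt (gm (%z. (a q - a p) * et q z) (ball p rh)) <= sqrt w" if q: "q : J p" for q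
  proof (rule real_sqrt_le_mono)
   have dq: "dist p q <= 2 * cL * rh" and qN: "q : N" using q by (auto simp: J_def)
   have "(a q - a p)^2 <= 2 * (a q - av p)^2 + 2 * (a p - av p)^2"
    using sum_squares_bound[of "a q - av p" "- (a p - av p)"] by (simp add: power2_eq_square algebra_simps)
   also have "... <= 4 * cQ * B p / vol p rh" using diffav[OF dq] diffav[of p p] Lr rh by simp
   finally have 1: "(a q - a p)^2 <= 4 * cQ * B p / vol p rh" .
   have "vol q rh <= cQ * vol p rh" using dv[of q p] dq by (simp add: dist_commute)
   hence "cX * vol q rh / Ps rh <= cX * (cQ * vol p rh) / Ps rh"
    using cX Psi_pos[OF rh] by (intro divide_right_mono mult_left_mono) auto
   hence 2: "En (et q) <= cX * (cQ * vol p rh) / Ps rh" using et(6)[OF qN] by simp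
   have "gm (%z. (a q - a p) * et q z) (ball p rh) <= En (%z. (a q - a p) * et q z)" by (rule gm_le[OF tF[OF q]])
   also have "... = (a q - a p)^2 * En (et q)"
    using EE.B_scale[OF et(1)[OF qN] tF[OF q]] EE.B_scale_right[OF et(1)[OF qN] et(1)[OF qN]] by (simp add: power2_eq_square)
   also have "... <= 4 * cQ * B p / vol p rh * (cX * (cQ * vol p rh) / Ps rh)"
    using 1 2 EE.B_nonneg[OF et(1)[OF qN]] cQ B0[of p] vp[of p] by (intro mult_mono) auto
   also have "... = w" using vp[of p] Psi_pos[OF rh] by (simp add: w_def B_def power2_eq_square)
   finally show "gm (%z. (a q - a p) * et q z) (ball p rh) <= w" .
  qed
  have "sqrt (gm v (ball p rh)) <= (SUM q:J p. sqrt (gm (%z. (a q - a p) * et q z) (ball p rh)))"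
   unfolding v_def[abs_def] by (rule gm_sum[OF J(1) tF]) auto
  also have "... <= (SUM q:J p. sqrt w)" by (rule sum_mono[OF t])
  also have "... <= cQ * sqrt w" using J(3)[of p] w0 by (simp add: mult_right_mono)
  finally have "(sqrt (gm v (ball p rh)))^2 <= (cQ * sqrt w)^2" by (intro power_mono) auto
  hence "gm v (ball p rh) <= cQ^2 * w" using w0 by (simp add: power_mult_distrib)
  also have "cQ^2 * w = 4 * cQ^4 * cX * nu (ball p (K * rh))" by (simp add: w_def power2_eq_square power4_eq_xxxx)
  finally show ?thesis using \<open>gm u (ball p rh) = gm v (ball p rh)\<close> by simp
 qed
 have ov: "(SUM p:I. nu (ball p (K * rh))) <= DD (4 * K + 1) * nu S"
  if I: "I <= N" and S: "S : sets borel" "!!p. p : I ==> ball p (K * rh) <= S" for I S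
 proof -
  have c: "real (card {p:I. y : ball p (K * rh)}) <= DD (4 * K + 1)" for y
   by (rule count(2)[where sg = "rh/2" and c = "%p. p" and z = y and R' = "K * rh"])
    (use rh I N(3) half_balls in "auto simp: dist_commute algebra_simps subset_iff")
  have fI: "finite I" using I N(1) finite_subset by blast
  have D0: "0 <= DD (4 * K + 1)" using DD(1)[of "4 * K + 1"] by simp
  have "(SUM p:I. measure N1 (ball p (K * rh))) <= DD (4 * K + 1) * measure N1 S"
   by (rule measure_overlap[OF N1(1) fI _ S(2) _ c D0]) (use S N1 in auto)
  hence "H * (SUM p:I. measure N1 (ball p (K * rh))) <= H * (DD (4 * K + 1) * measure N1 S)" using H by (intro mult_left_mono)
  moreover have "(SUM p:I. measure N2 (ball p (K * rh))) <= DD (4 * K + 1) * measure N2 S"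
   by (rule measure_overlap[OF N2(1) fI _ S(2) _ c D0]) (use S N2 in auto)
  ultimately show ?thesis by (simp add: nu sum.distrib sum_distrib_left[symmetric] algebra_simps)
 qed
 have gmA: "gm u A <= cZ K * nu (UN x:A. ball x ((K + 1) * rh))" if A: "A : sets borel" for A
 proof -
  define I where "I = {p:N. ball p rh Int A ~= {}}"
  define Z where "Z = {z. R3 < dist o' z}"
  define S where "S = (UN x:A. ball x ((K + 1) * rh))"
  have Zo: "open Z" unfolding Z_def by (intro open_Collect_less continuous_intros)
  have I: "finite I" "I <= N" using N(1) by (auto simp: I_def)
  have cov: "A <= Z Un (UN p:I. ball p rh)"
  proof
   fix z assume z: "z : A"
   show "z : Z Un (UN p:I. ball p rh)"
   proof (cases "z : Z")
    case False
    hence "z : ball o' R2" using R32 by (auto simp: Z_def)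
    thus ?thesis using N(4) z by (force simp: I_def)
   qed simp
  qed
  have Ub: "(UN p:I. ball p rh) : sets borel" by (intro borel_open open_UN ballI open_ball)
  have "gm u A <= gm u (Z Un (UN p:I. ball p rh))" using cov Zo Ub by (intro gm_mono[OF uF] sets.Un borel_open) auto
  also have "... <= gm u Z + gm u (UN p:I. ball p rh)" using Zo Ub by (intro measure_Un_le) (simp_all add: sets_G[OF uF])
  also have "gm u Z = 0" by (rule gm_const[OF uF Zo, of 0]) (use u0 in "auto simp: Z_def")
  also have "gm u (UN p:I. ball p rh) <= (SUM p:I. gm u (ball p rh))" using I by (intro measure_UNION_le) (auto simp: sets_G[OF uF])
  also have "... <= (SUM p:I. 4 * cQ^4 * cX * nu (ball p (K * rh)))" using I by (intro sum_mono gmp) auto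
  also have "... = 4 * cQ^4 * cX * (SUM p:I. nu (ball p (K * rh)))" by (simp add: sum_distrib_left)
  also have "... <= 4 * cQ^4 * cX * (DD (4 * K + 1) * nu S)"
  proof (intro mult_left_mono ov I)
   show "S : sets borel" unfolding S_def by (intro borel_open) auto
   fix p assume "p : I"
   then obtain x where x: "x : A" "dist p x < rh" by (auto simp: I_def)
   show "ball p (K * rh) <= S"
   proof
    fix y assume "y : ball p (K * rh)"
    hence "dist x y < (K + 1) * rh" using x(2) dist_triangle[of x y p] by (simp add: dist_commute algebra_simps)
    thus "y : S" using x(1) by (auto simp: S_def)
   qed
  qed (use cX in auto)
  also have "... <= cZ K * nu S" using nu0[of S] DD(1)[of "4 * K + 1"] cQ by (simp add: cZ_def algebra_simps)
  finally show ?thesis by (simp add: S_def)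
 qed
 have "compact (cball o' R3)" by (intro compact_if_bounded) auto
 hence "E u u <= gm u UNIV" using uF ub u0 by (intro E_le_gm[of u "cball o' R3"]) (auto simp: ess_bounded_def)
 also have "... <= cZ K * nu UNIV"
 proof -
  have "x : ball x ((K + 1) * rh)" for x :: 'a using K rh by simp
  hence "(UN x:(UNIV::'a set). ball x ((K + 1) * rh)) = UNIV" by blast
  hence e: "nu (UN x:(UNIV::'a set). ball x ((K + 1) * rh)) = nu UNIV" by (rule arg_cong)
  show ?thesis using gmA[OF borel_open[OF open_UNIV]] unfolding e .
 qed
 finally have Eu: "E u u <= cZ K * nu UNIV" .
 have um[measurable]: "u : borel_measurable borel" by (rule F_meas[OF uF])
 have gL: "g : L2"
 proof (rule L2_bound[of "%z. k * indicator (ball o' (abs R')) z"])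
  show "(%z. k * indicator (ball o' (abs R')) z) : L2" by (intro L2_scale indicator_L2) auto
  show "abs (g x) <= abs (k * indicator (ball o' (abs R')) x)" for x using k[of x] g0[of x] by (auto simp: indicator_def)
 qed (rule g)
 have "ennreal (Ns (%z. u z - g z)) = (\<integral>\<^sup>+z. ennreal ((u z - g z)^2) \<partial>m)"
  using ip_nn[OF ip.diff[OF F_L2[OF uF] gL]] by simp
 also have "... = (sqi (ball o' R2) (%z. u z - g z))"
 proof (intro nn_integral_cong)
  fix z
  have "u z - g z = 0" if "z ~: ball o' R2"
  proof -
   have "0 <= (cL + 3) * rh" using L rh by simp
   hence "z ~: ball o' R'" using that by (auto simp: R2_def)
   thus ?thesis using u0[of z] g0[of z] that R32 by auto
  qed
  thus "ennreal ((u z - g z)^2) = ennreal ((u z - g z)^2) * indicator (ball o' R2) z" by (auto simp: indicator_def)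
 qed
 also have "... <= (SUM p:N. \<integral>\<^sup>+z\<in>ball p rh. ennreal ((u z - g z)^2) \<partial>m)"
  using N by (intro nn_integral_UN_le) auto
 also have "... <= (SUM p:N. ennreal (4 * cQ * B p))"
 proof (rule sum_mono)
  fix p assume p: "p : N"
  define s where "s = cQ * B p / vol p rh"
  have s0: "0 <= s" using cQ B0[of p] vp[of p] by (simp add: s_def)
  have us: "(u z - av p)^2 <= s" if z: "z : ball p rh" for z
  proof -
   have "abs (u z - av p) <= (SUM q:J p. sqrt s * et q z)" unfolding mid[OF p z]
   proof (intro order_trans[OF sum_abs] sum_mono)
    fix q assume q: "q : J p"
    hence "(a q - av p)^2 <= s" unfolding s_def by (intro diffav) (auto simp: J_def)
    hence "abs (a q - av p) <= sqrt s" by (metis real_sqrt_abs real_sqrt_le_mono)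
    thus "abs ((a q - av p) * et q z) <= sqrt s * et q z" using et(2)[of q z] q J(2)[of p] by (auto simp: abs_mult intro!: mult_right_mono)
   qed
   also have "... = sqrt s * (SUM q:N. 1 * et q z)" using loc[OF z, of "%_. 1"] by (simp add: sum_distrib_left)
   also have "... <= sqrt s * 1" using s0 et(5)[of z] by (intro mult_left_mono) auto
   finally have "abs (u z - av p)^2 <= (sqrt s)^2" by (intro power_mono) auto
   thus ?thesis using s0 by simp
  qed
  have "(sqi (ball p rh) (%z. u z - g z))
   <= (\<integral>\<^sup>+z. 2 * (ennreal ((g z - av p)^2) * indicator (ball p rh) z) + ennreal (2 * s) * indicator (ball p rh) z \<partial>m)"
  proof (rule nn_integral_mono)
   fix z
   have "(u z - g z)^2 <= 2 * (g z - av p)^2 + 2 * (u z - av p)^2"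
    using sum_squares_bound[of "u z - av p" "- (g z - av p)"] by (simp add: power2_eq_square algebra_simps)
   hence "ennreal ((u z - g z)^2) <= ennreal (2 * (g z - av p)^2 + 2 * s)" if "z : ball p rh" using us[OF that] by (intro ennreal_leI) linarith
   thus "ennreal ((u z - g z)^2) * indicator (ball p rh) z <= 2 * (ennreal ((g z - av p)^2) * indicator (ball p rh) z) + ennreal (2 * s) * indicator (ball p rh) z"
    using s0 by (auto simp: indicator_def ennreal_mult)
  qed
  also have "... = 2 * (sqi (ball p rh) (%z. g z - av p)) + ennreal (2 * s) * emeasure m (ball p rh)"
  proof -
   have [measurable]: "ball p rh : sets m" by simp
   show ?thesis by (subst nn_integral_add) (auto simp: nn_integral_cmult)
  qed
  also have "... <= 2 * ennreal (B p) + ennreal (2 * s) * ennreal (vol p rh)"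
   using sub[of p p] Lr rh emeasure_bounded[of "ball p rh"] by (intro add_mono mult_left_mono) (auto simp: vol_def)
  also have "... = ennreal (2 * B p + 2 * cQ * B p)"
  proof -
   have "2 * s * vol p rh = 2 * cQ * B p" using vp[of p] by (simp add: s_def)
   moreover have "ennreal (2 * s) * ennreal (vol p rh) = ennreal (2 * s * vol p rh)"
    by (rule ennreal_mult[symmetric]) (use s0 vp[of p] in auto)
   ultimately have "ennreal (2 * s) * ennreal (vol p rh) = ennreal (2 * cQ * B p)" by (simp only:)
   moreover have "2 * ennreal (B p) = ennreal (2 * B p)" using B0[of p] by (simp add: ennreal_mult)
   ultimately show ?thesis using B0[of p] cQ by (simp add: ennreal_plus)
  qed
  also have "... <= ennreal (4 * cQ * B p)" using mult_right_mono[OF cQ B0[of p]] by (intro ennreal_leI) (simp add: mult.commute)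
  finally show "sqi (ball p rh) (%z. u z - g z) <= ennreal (4 * cQ * B p)" .
 qed
 also have "... = ennreal (SUM p:N. 4 * cQ * B p)" using cQ B0 by (intro sum_ennreal) auto
 finally have "Ns (%z. u z - g z) <= (SUM p:N. 4 * cQ * B p)"
  using cQ B0 by (subst (asm) ennreal_le_iff) (auto intro!: sum_nonneg)
 also have "... = 4 * cQ * Ps rh * (SUM p:N. nu (ball p (K * rh)))" by (simp add: B_def sum_distrib_left mult.assoc)
 also have "... <= 4 * cQ * Ps rh * (DD (4 * K + 1) * nu UNIV)" using cQ Psi_pos[OF rh] by (intro mult_left_mono ov) auto
 also have "... <= cZ K * Ps rh * nu UNIV"
 proof -
  have "4 * cQ * DD (4 * K + 1) <= cZ K" using cQ cX DD(1)[of "4 * K + 1"] by (simp add: cZ_def algebra_simps)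
  hence "4 * cQ * DD (4 * K + 1) * (Ps rh * nu UNIV) <= cZ K * (Ps rh * nu UNIV)" using nu0 Psi_pos[OF rh] by (intro mult_right_mono) auto
  thus ?thesis by (simp add: mult_ac)
 qed
 finally have "Ns (%z. u z - g z) <= cZ K * Ps rh * nu UNIV" .
 with uF ub Eu gmA show ?thesis using that by blast
qed

end

context mmd begin

lemma prod_limit:
 assumes u: "!!n. u n : F" "!!n z. abs (u n z) <= k" "g : F" "!!n. En (u n) <= M"
  and l: "(%n. Ns (%x. u n x - g x)) ~~> 0" and w: "w : F" "!!z. abs (w z) <= k" and v: "v : F"
  and gk: "!!z. abs (g z) <= k"
 shows "(%n. E (%z. u n z * w z) v) ~~> E (%z. g z * w z) v"
proof -
 have k0: "0 <= k" using w(2)[of undefined] by (meson abs_ge_zero order_trans)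
 have b: "abs (u n z) <= k + 1" "abs (w z) <= k + 1" "abs (g z) <= k + 1" "0 < k + 1" for n z using u(2)[of n z] w(2)[of z] gk[of z] k0 by auto
 note P = F_prod0[OF u(1) b(1) w(1) b(2,4)] and Pg = F_prod0[OF u(3) b(3) w(1) b(2,4)]
 note L = F_L2[OF u(1)] F_L2[OF u(3)]
 have "(%n. Ns (%z. u n z * w z - g z * w z)) ~~> 0"
 proof (rule Lim_null_comparison[OF always_eventually])
  show "(%n. k^2 * Ns (%x. u n x - g x)) ~~> 0" using tendsto_mult[OF tendsto_const l, of "k^2"] by simp
  show "ALL n. norm (Ns (%z. u n z * w z - g z * w z)) <= k^2 * Ns (%x. u n x - g x)"
  proof
   fix n
   have d: "(%z. u n z * w z - g z * w z) : L2" by (intro ip.diff F_L2 P(1) Pg(1))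
   have "Ns (%z. u n z * w z - g z * w z) <= (\<integral>z. k^2 * ((u n z - g z) * (u n z - g z)) \<partial>m)"
    unfolding ip_def
   proof (rule integral_mono)
    fix z
    have "(u n z * w z - g z * w z) * (u n z * w z - g z * w z) = (w z)^2 * ((u n z - g z) * (u n z - g z))"
     by (simp add: power2_eq_square algebra_simps)
    also have "... <= k^2 * ((u n z - g z) * (u n z - g z))" using w(2)[of z] k0 by (intro mult_right_mono) (auto simp: abs_le_square_iff[symmetric])
    finally show "(u n z * w z - g z * w z) * (u n z * w z - g z * w z) <= k^2 * ((u n z - g z) * (u n z - g z))" .
   qed (intro integrable_mult_right L2_int d ip.diff L)+
   thus "norm (Ns (%z. u n z * w z - g z * w z)) <= k^2 * Ns (%x. u n x - g x)"
    using ip.B_nonneg[OF d] by (simp add: ip_def)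
  qed
 qed
 moreover have "En (%z. u n z * w z) <= 64 * (k + 1)^2 * (M + E w w)" for n
  by (rule order_trans[OF P(2)[of n]]) (use u(4)[of n] in "auto intro!: mult_left_mono")
 ultimately show ?thesis by (rule E_limit(3)[OF P(1) F_L2[OF Pg(1)] _ _ v])
qed

text \<open>Lower semicontinuity of the localised energy. The linear functional 2 Ib h (u n) g - Ib
  h g g lies below Ib h (u n) (u n) and converges to Ib h g g by weak convergence.\<close>

lemma GI_lsc:
 assumes u: "!!n. u n : F" "!!n z. abs (u n z) <= k" "g : F" "!!n. En (u n) <= M"
  and l: "(%n. Ns (%x. u n x - g x)) ~~> 0" and gk: "!!z. abs (g z) <= k"
  and h: "h : T U" and c: "!!n. GI (u n) h <= c"
 shows "GI g h <= c"
proof -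
 have FB: "u n : FB" "g : FB" for n using u gk unfolding ess_bounded_def by (auto intro!: exI[of _ k] AE_I2)
 have hF: "h : F" using TD(1)[OF h] by simp
 have hk: "abs (h z) <= max k 1" "abs (u n z) <= max k 1" "abs (g z) <= max k 1" for z n using TD(2,3)[OF h, of z] u(2)[of n z] gk[of z] by auto
 interpret h: psd FB "Ib h" by (rule Ib_psd[OF T_FB[OF h]]) (use TD[OF h] in auto)
 have GIb: "GI f h = Ib h f f" if "f : FB" for f using GI_FB[OF that TD(1)[OF h]] by (simp add: Ib_self)
 have gh: "(%z. g z * h z) : F" and uh: "(%z. u n z * h z) : F" and ug: "(%z. u n z * g z) : F" and gg: "(%z. g z * g z) : F" for n
  using FB_prod[OF FB(2) T_FB[OF h]] FB_prod[OF FB(1) T_FB[OF h], of n] FB_prod[OF FB, of n] FB_prod[OF FB(2,2)] by auto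
 have "(%n. Ib h (u n) g) ~~> 1/2 * (E g (%z. g z * h z) + E (%z. g z * h z) g - E (%z. g z * g z) h)"
  unfolding Ib_def EE.B_sym[OF u(3) uh]
  by (intro tendsto_intros E_limit(3)[OF u(1) F_L2[OF u(3)] l u(4) gh] prod_limit[OF u(1) hk(2) u(3,4) l _ _ _ hk(3)] hk hF u)
 hence lim: "(%n. 2 * Ib h (u n) g - Ib h g g) ~~> 2 * Ib h g g - Ib h g g"
  unfolding Ib_def[of h g g] EE.B_sym[OF gh u(3)] by (intro tendsto_intros)
 have "2 * Ib h (u n) g - Ib h g g <= c" for n
  using h.B_exp_diff[OF FB(1) FB(2), of n] h.B_nonneg[OF h.diff[OF FB(1) FB(2)], of n] c[of n] GIb[OF FB(1)] by simp
 hence "2 * Ib h g g - Ib h g g <= c" by (intro LIMSEQ_le_const2[OF lim]) auto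
 thus ?thesis using GIb[OF FB(2)] by simp
qed

lemma L2_tail: assumes g: "g : L2" and e: "e > 0"
 obtains R' where "R' > 0" "sqi (- ball o' R') g <= ennreal e"
proof -
 have [measurable]: "g : borel_measurable borel" by (rule L2_meas[OF g])
 define u where "u n z = g z * indicator (ball o' (real n)) z" for n z
 have um[measurable]: "u n : borel_measurable borel" for n
  unfolding u_def by (intro borel_measurable_times borel_measurable_indicator) auto
 have "(%n. Ns (%z. u n z - g z)) ~~> 0"
 proof (rule ip_dct[OF um _ g])
  show "abs (u n x - g x) <= abs (g x)" for n x by (auto simp: u_def indicator_def)
  show "(%n. u n x) ~~> g x" for x
  proof (rule tendsto_eventually)
   obtain n0 where "dist o' x < real n0" using reals_Archimedean2 by blast
   thus "\<forall>\<^sub>F n in sequentially. u n x = g x" by (auto simp: u_def eventually_sequentially intro!: exI[of _ n0])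
  qed
 qed simp
 from order_tendstoD(2)[OF this e] obtain n0 where n0: "!!n. n >= n0 ==> Ns (%z. u n z - g z) < e"
  by (auto simp: eventually_sequentially)
 define n where "n = Suc n0"
 have n: "n > 0" "Ns (%z. u n z - g z) < e" using n0[of n] by (auto simp: n_def)
 have uL: "u n : L2" by (rule L2_bound[OF g]) (auto simp: u_def indicator_def)
 have "sqi (- ball o' (real n)) g = (\<integral>\<^sup>+z. ennreal ((u n z - g z)^2) \<partial>m)"
  by (intro nn_integral_cong) (auto simp: u_def indicator_def)
 also have "... <= ennreal e" unfolding ip_nn[OF ip.diff[OF uL g]] using n by (intro ennreal_leI) simp
 finally show ?thesis using that[of "real n"] n by simp
qed

end

context hk begin

section \<open>Scale comparisons and the passage to zero mesh\<close>

lemma Psi_scale: assumes "K >= 1" shows "EX C>=1. ALL r>0. Ps (K * r) <= C * Ps r"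
proof -
 obtain C b1 b2 where C: "C > 1" "b1 > 1" "b2 > b1" and up: "!!r R. 0 < r ==> r <= R ==> Ps R / Ps r <= C * (R / r) powr b2"
  by (rule Psi_bounds) blast
 have "Ps (K * r) <= C * K powr b2 * Ps r" if "r > 0" for r
  using up[of r "K * r"] that assms Psi_pos[OF that] by (simp add: field_simps)
 moreover have "1 <= K powr b2" using assms C by (simp add: ge_one_powr_ge_zero)
 hence "1 <= C * K powr b2" using C mult_mono[of 1 C 1 "K powr b2"] by simp
 ultimately show ?thesis by blast
qed

definition "PK K = (SOME C. C \<ge> 1 & (ALL r>0. Ps (K * r) <= C * Ps r))"

lemma PK: assumes "K >= 1" shows "PK K >= 1" "r > 0 ==> Ps (K * r) <= PK K * Ps r"
 using someI_ex[OF Psi_scale[OF assms, unfolded Bex_def]] unfolding PK_def by blast+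

text \<open>The constant in the almost monotonicity of Psi(r)/r, a consequence of beta1 > 1. It also
  shows that Psi tends to 0 along the mesh sizes.\<close>

definition "PL = (SOME C. C > 0 & (ALL r R. 0 < r --> r <= R --> R * Ps r <= C * r * Ps R))"

lemma PL: "PL > 0" "0 < r ==> r <= q ==> q * Ps r <= PL * r * Ps q"
proof -
 obtain C b1 b2 where C: "C > 1" "b1 > 1" "b2 > b1" and lo: "!!r R. 0 < r ==> r <= R ==> inverse C * (R / r) powr b1 <= Ps R / Ps r"
  by (rule Psi_bounds) blast
 have "R * Ps r <= C * r * Ps R" if "0 < r" "r <= R" for r R
 proof -
  have "R / r <= (R / r) powr b1" using that C powr_mono[of 1 b1 "R / r"] by simp
  hence "inverse C * (R / r) <= inverse C * (R / r) powr b1" using C by (intro mult_left_mono) auto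
  hence "inverse C * (R / r) <= Ps R / Ps r" using lo[OF that] by linarith
  thus ?thesis using that C Psi_pos[OF that(1)] by (simp add: field_simps)
 qed
 hence "EX C. C > 0 & (ALL r R. 0 < r --> r <= R --> R * Ps r <= C * r * Ps R)" using C by (intro exI[of _ C]) auto
 from someI_ex[OF this] show "PL > 0" "0 < r ==> r <= q ==> q * Ps r <= PL * r * Ps q" unfolding PL_def by blast+
qed

definition "cW K = cZ (K * cM) * PK cM"

lemma cM: "cM >= 6" using cut(1) by (simp add: cM_def)
lemma cW: "cW K >= 0" using cZ[of "K * cM"] PK(1)[of cM] cM by (simp add: cW_def)

text \<open>Removes compact support from the hypotheses: g is cut off sharply far out. A ball that
  touches the cut sees only the tail of g, which is charged to an additional measure of mass at most
  rh.\<close>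

lemma mollify_step:
 assumes gL: "g : L2" and k: "!!z. abs (g z) <= k" and N: "finite_measure N" "sets N = sets borel" and H: "H >= 0" and K: "K >= 1"
  and osc: "!!x r. 0 < r ==> r <= r0 ==> EX av. sqi (ball x r) (%y. g y - av) <= ennreal (H * Ps r * measure N (ball x (K * r)))"
  and rh: "rh > 0" "cM * rh <= r0"
 obtains u where "u : F" "!!z. abs (u z) <= k" "E u u <= cZ (K * cM) * (H * PK cM * measure N UNIV + rh)"
  "Ns (%z. u z - g z) <= 2 * (cZ (K * cM) * Ps rh * (H * PK cM * measure N UNIV + rh)) + 2 * (Ps rh * rh)"
  "!!A. A : sets borel ==> gm u A <= cZ (K * cM) * (H * PK cM * measure N (UN x:A. ball x ((K * cM + 1) * rh)) + rh)"
proof -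
 fix o' :: 'a
 note [measurable] = L2_meas[OF gL]
 have Pp: "Ps rh > 0" by (rule Psi_pos[OF rh(1)])
 obtain R' where R': "R' > 0" "sqi (- ball o' R') g <= ennreal (Ps rh * rh)"
  using L2_tail[OF gL, of "Ps rh * rh" o'] Pp rh by auto
 \<comment> \<open>A ball of radius cM * rh that leaves the larger ball avoids the smaller
   one.\<close>
 define R2 where "R2 = R' + 2 * (cM * rh)"
 define q where "q z = g z * indicator (ball o' R2) z" for z
 have qm[measurable]: "q : borel_measurable borel" unfolding q_def by (intro borel_measurable_times borel_measurable_indicator) auto
 have [measurable]: "- ball o' R' : sets m" by (simp only: sets_m borel_comp borel_open open_ball)
 \<comment> \<open>The density is divided by Psi(rh), so that Psi(rh) times the new measure is the
   integral of g^2 over the tail.\<close>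
 define f where "f z = ennreal ((g z)^2 / Ps rh) * indicator (- ball o' R') z" for z
 have fm[measurable]: "f : borel_measurable m" unfolding f_def by measurable
 define N2 where "N2 = density m f"
 have sN2: "sets N2 = sets borel" by (simp add: N2_def)
 have eN2: "ennreal (Ps rh) * emeasure N2 A = (sqi (A Int - ball o' R') g)" if A: "A : sets borel" for A
 proof -
  have [measurable]: "A : sets m" using A by simp
  have "emeasure N2 A = (\<integral>\<^sup>+z. f z * indicator A z \<partial>m)" unfolding N2_def by (rule emeasure_density) (use A in auto)
  hence "ennreal (Ps rh) * emeasure N2 A = (\<integral>\<^sup>+z. ennreal (Ps rh) * (f z * indicator A z) \<partial>m)" by (simp add: nn_integral_cmult)
  also have "... = (sqi (A Int - ball o' R') g)"
   using Pp by (intro nn_integral_cong) (auto simp: f_def indicator_def simp flip: ennreal_mult)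
  finally show ?thesis .
 qed
 have N2le: "emeasure N2 UNIV <= ennreal rh"
 proof -
  have "ennreal (Ps rh) * emeasure N2 UNIV <= ennreal (Ps rh) * ennreal rh" using eN2[of UNIV] R'(2) Pp rh by (simp add: ennreal_mult)
  thus ?thesis using Pp by (simp add: ennreal_mult_le_mult_iff)
 qed
 have fN2: "finite_measure N2" using le_less_trans[OF N2le ennreal_less_top] by (intro finite_measureI) (auto simp: N2_def)
 have mN2: "measure N2 UNIV <= rh" using N2le finite_measure.emeasure_eq_measure[OF fN2, of UNIV] rh by simp
 define nu where "nu A = H * PK cM * measure N A + measure N2 A" for A
 have P1: "PK cM >= 1" using PK(1) cM by simp
 have HP: "H * PK cM >= 0" using H P1 by simp
 have K1: "K * cM >= 1" using K cM mult_mono[of 1 K 1 cM] by simp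
 have qk: "abs (q z) <= k" for z using k[of z] by (auto simp: q_def indicator_def)
 have q0: "q z = 0" if "z ~: ball o' R2" for z using that by (simp add: q_def)
 have oscq: "EX av. sqi (ball x (cM * rh)) (%y. q y - av) <= ennreal (Ps rh * nu (ball x (K * cM * rh)))" for x
 proof (cases "ball x (cM * rh) <= ball o' R2")
  case True
  obtain av where av: "sqi (ball x (cM * rh)) (%y. g y - av) <= ennreal (H * Ps (cM * rh) * measure N (ball x (K * (cM * rh))))"
   using osc[of "cM * rh" x] rh cM by auto
  have "sqi (ball x (cM * rh)) (%y. q y - av) = (sqi (ball x (cM * rh)) (%y. g y - av))"
   using True by (intro nn_integral_cong) (auto simp: q_def indicator_def)
  also note av
  also have "ennreal (H * Ps (cM * rh) * measure N (ball x (K * (cM * rh)))) <= ennreal (Ps rh * nu (ball x (K * cM * rh)))"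
  proof (rule ennreal_leI)
   have "H * Ps (cM * rh) * measure N (ball x (K * (cM * rh))) <= H * (PK cM * Ps rh) * measure N (ball x (K * (cM * rh)))"
    using PK(2)[of cM rh] cM rh H by (intro mult_right_mono mult_left_mono) auto
   also have "... <= Ps rh * nu (ball x (K * cM * rh))" using Pp by (simp add: nu_def mult_ac distrib_left)
   finally show "H * Ps (cM * rh) * measure N (ball x (K * (cM * rh))) <= Ps rh * nu (ball x (K * cM * rh))" .
  qed
  finally show ?thesis by blast
 next
  case False
  then obtain y where "y : ball x (cM * rh)" "y ~: ball o' R2" by blast
  hence y: "dist x y < cM * rh" "dist o' y >= R2" by auto
  have out: "z ~: ball o' R'" if "z : ball x (cM * rh)" for z
   using that y dist_triangle[of o' y z] dist_triangle3[of z y x] by (auto simp: R2_def)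
  have "sqi (ball x (cM * rh)) (%y. q y - 0) <= (sqi (ball x (cM * rh) Int - ball o' R') g)"
   using out by (intro nn_integral_mono) (auto simp: q_def indicator_def)
  also have "... = ennreal (Ps rh) * emeasure N2 (ball x (cM * rh))" by (rule eN2[symmetric]) simp
  also have "... <= ennreal (Ps rh) * emeasure N2 (ball x (K * cM * rh))"
  proof (intro mult_left_mono emeasure_mono)
   have "cM * rh <= K * cM * rh" using K cM rh mult_right_mono[of 1 K "cM * rh"] by (simp add: mult.assoc)
   thus "ball x (cM * rh) <= ball x (K * cM * rh)" by (rule subset_ball)
  qed (auto simp: sN2)
  also have "... = ennreal (Ps rh * measure N2 (ball x (K * cM * rh)))"
   using Pp finite_measure.emeasure_eq_measure[OF fN2] by (simp add: ennreal_mult)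
  also have "... <= ennreal (Ps rh * nu (ball x (K * cM * rh)))" using Pp HP by (intro ennreal_leI mult_left_mono) (auto simp: nu_def)
  finally show ?thesis by blast
 qed
 obtain u where u: "u : F" "!!z. abs (u z) <= k" "E u u <= cZ (K * cM) * nu UNIV" "Ns (%z. u z - q z) <= cZ (K * cM) * Ps rh * nu UNIV"
  "!!A. A : sets borel ==> gm u A <= cZ (K * cM) * nu (UN x:A. ball x ((K * cM + 1) * rh))"
  using mollify[OF rh(1) qm qk q0 N fN2 sN2 HP K1 nu_def oscq] by blast
 have nuU: "nu A <= H * PK cM * measure N A + rh" for A
 proof -
  have "measure N2 A <= measure N2 UNIV" using finite_measure.bounded_measure[OF fN2, of A] by (simp add: N2_def)
  thus ?thesis using mN2 by (simp add: nu_def)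
 qed
 have qL: "q : L2" by (rule L2_bound[OF gL qm]) (auto simp: q_def indicator_def)
 have qg: "Ns (%z. q z - g z) <= Ps rh * rh"
 proof -
  have "ennreal (Ns (%z. q z - g z)) = (\<integral>\<^sup>+z. ennreal ((q z - g z)^2) \<partial>m)" using ip_nn[OF ip.diff[OF qL gL]] by simp
  also have "... <= (sqi (- ball o' R') g)"
  proof (rule nn_integral_mono)
   fix z
   have "0 < cM * rh" using cM rh by simp
   hence "R' <= R2" by (simp add: R2_def)
   thus "ennreal ((q z - g z)^2) <= ennreal ((g z)^2) * indicator (- ball o' R') z" by (auto simp: q_def indicator_def)
  qed
  also note R'(2)
  finally show ?thesis using Pp rh by (simp add: ennreal_le_iff)
 qed
 show ?thesis
 proof (rule that[OF u(1,2)])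
  show "E u u <= cZ (K * cM) * (H * PK cM * measure N UNIV + rh)"
   using u(3) mult_left_mono[OF nuU[of UNIV] cZ[of "K * cM"]] by simp
  show "gm u A <= cZ (K * cM) * (H * PK cM * measure N (UN x:A. ball x ((K * cM + 1) * rh)) + rh)" if "A : sets borel" for A
   using u(5)[OF that] mult_left_mono[OF nuU[of "UN x:A. ball x ((K * cM + 1) * rh)"] cZ[of "K * cM"]] by simp
  have "cZ (K * cM) * Ps rh * nu UNIV <= cZ (K * cM) * Ps rh * (H * PK cM * measure N UNIV + rh)"
   using cZ[of "K * cM"] Pp by (intro mult_left_mono nuU) auto
  thus "Ns (%z. u z - g z) <= 2 * (cZ (K * cM) * Ps rh * (H * PK cM * measure N UNIV + rh)) + 2 * (Ps rh * rh)"
   using ip.add_le[OF ip.diff[OF F_L2[OF u(1)] qL] ip.diff[OF qL gL]] u(4) qg by simp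
 qed
qed

text \<open>The mesh tends to 0. The L^2 error carries the factor Psi(rh), so the mollifications
  converge to g with bounded energies; \<open>E_limit\<close> and \<open>GI_lsc\<close> transfer the
  bounds. For an open set the enlarged neighbourhoods eventually lie in the prescribed one.\<close>

lemma criterion_bdd:
 assumes gL: "g : L2" and k: "!!z. abs (g z) <= k" and N: "finite_measure N" "sets N = sets borel" and H: "H >= 0" and K: "K >= 1" and r0: "r0 > 0"
  and osc: "!!x r. 0 < r ==> r <= r0 ==> EX av. sqi (ball x r) (%y. g y - av) <= ennreal (H * Ps r * measure N (ball x (K * r)))"
 shows "g : F" "E g g <= cW K * H * measure N UNIV"
  "open A ==> \<epsilon> > 0 ==> gm g A <= cW K * H * measure N (UN x:A. ball x \<epsilon>)"
proof -
 define K' where "K' = K * cM"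
 have K1: "K' >= 1" using K cM mult_mono[of 1 K 1 cM] by (simp add: K'_def)
 define rh where "rh n = r0 / cM / real (Suc n)" for n
 have rh: "rh n > 0" "cM * rh n <= r0" for n
 proof -
  show "rh n > 0" using r0 cM by (simp add: rh_def)
  have "cM * rh n = r0 / real (Suc n)" using cM by (simp add: rh_def)
  moreover have "r0 / real (Suc n) <= r0 / 1" by (rule divide_left_mono) (use r0 in auto)
  ultimately show "cM * rh n <= r0" by simp
 qed
 have rh0: "rh ~~> 0" unfolding rh_def using LIMSEQ_Suc[OF lim_const_over_n[of "r0 / cM"]] by simp
 have rhev: "EX N. ALL n>=N. rh n < e" if "e > 0" for e using order_tendstoD(2)[OF rh0 that] by (simp add: eventually_sequentially)
 define b where "b S et = cZ K' * (H * PK cM * measure N S + et)" for S et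
 have ex: "EX u. u : F & (ALL z. abs (u z) <= k) & E u u <= b UNIV (rh n) &
  Ns (%z. u z - g z) <= Ps (rh n) * (2 * b UNIV (rh n) + 2 * rh n) &
  (ALL A. A : sets borel --> gm u A <= b (UN x:A. ball x ((K' + 1) * rh n)) (rh n))" for n
 proof (rule mollify_step[OF gL k N H K _ rh(1)[of n] rh(2)[of n]])
  show "EX av. sqi (ball x r) (%y. g y - av) <= ennreal (H * Ps r * measure N (ball x (K * r)))" if "0 < r" "r <= r0" for x r
   by (rule osc[OF that])
  fix u assume u: "u : F" "!!z. abs (u z) <= k" "E u u <= cZ (K * cM) * (H * PK cM * measure N UNIV + rh n)"
   "Ns (%z. u z - g z) <= 2 * (cZ (K * cM) * Ps (rh n) * (H * PK cM * measure N UNIV + rh n)) + 2 * (Ps (rh n) * rh n)"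
   "!!A. A : sets borel ==> gm u A <= cZ (K * cM) * (H * PK cM * measure N (UN x:A. ball x ((K * cM + 1) * rh n)) + rh n)"
  have "2 * (cZ (K * cM) * Ps (rh n) * (H * PK cM * measure N UNIV + rh n)) + 2 * (Ps (rh n) * rh n) = Ps (rh n) * (2 * b UNIV (rh n) + 2 * rh n)"
   by (simp add: b_def K'_def algebra_simps)
  thus ?thesis using u unfolding b_def K'_def by (intro exI[of _ u]) auto
 qed
 then obtain u where u: "!!n. u n : F" "!!n z. abs (u n z) <= k" "!!n. En (u n) <= b UNIV (rh n)"
  "!!n. Ns (%z. u n z - g z) <= Ps (rh n) * (2 * b UNIV (rh n) + 2 * rh n)"
  "!!n A. A : sets borel ==> gm (u n) A <= b (UN x:A. ball x ((K' + 1) * rh n)) (rh n)"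
 proof -
  from choice[OF allI[OF ex]] obtain u where "ALL n. u n : F & (ALL z. abs (u n z) <= k) & En (u n) <= b UNIV (rh n) &
   Ns (%z. u n z - g z) <= Ps (rh n) * (2 * b UNIV (rh n) + 2 * rh n) &
   (ALL A. A : sets borel --> gm (u n) A <= b (UN x:A. ball x ((K' + 1) * rh n)) (rh n))" ..
  thus ?thesis using that[of u] by simp
 qed
 have uL: "u n : L2" for n by (rule F_L2[OF u(1)])
 have lim: "(%n. Ns (%z. u n z - g z)) ~~> 0"
 proof (rule Lim_null_comparison[OF always_eventually])
  define c where "c = r0 / cM"
  have c: "c > 0" using r0 cM by (simp add: c_def)
  have "Ps (rh n) <= PL * Ps c / c * rh n" for n
  proof -
   have "rh n <= c" using c rh_def[of n] divide_left_mono[of 1 "real (Suc n)" c] by (simp add: c_def)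
   from PL(2)[OF rh(1) this] show ?thesis using c by (simp add: field_simps)
  qed
  hence "Ps (rh n) * (2 * b UNIV (rh n) + 2 * rh n) <= PL * Ps c / c * rh n * (2 * b UNIV (rh n) + 2 * rh n)" for n
   using rh(1)[of n] cZ[of K'] H PK(1)[of cM] cM unfolding b_def by (intro mult_right_mono add_nonneg_nonneg mult_nonneg_nonneg) auto
  thus "ALL n. norm (Ns (%z. u n z - g z)) <= PL * Ps c / c * rh n * (2 * b UNIV (rh n) + 2 * rh n)"
   using u(4) ip.B_nonneg[OF ip.diff[OF uL gL]] by (auto intro: order_trans)
  have "(%n. PL * Ps c / c * rh n * (2 * b UNIV (rh n) + 2 * rh n)) ~~> PL * Ps c / c * 0 * (2 * b UNIV 0 + 2 * 0)"
   unfolding b_def by (intro tendsto_intros rh0)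
  thus "(%n. PL * Ps c / c * rh n * (2 * b UNIV (rh n) + 2 * rh n)) ~~> 0" by simp
 qed
 have bm: "b S et <= b S et'" if "et <= et'" for S et et' unfolding b_def using that cZ[of K'] by (intro mult_left_mono) auto
 have be: "b S et = cW K * H * measure N S + cZ K' * et" for S et by (simp add: b_def cW_def K'_def algebra_simps)
 have tail: "g : F & E g g <= b UNIV et" if et: "et > 0" for et
 proof -
  obtain n0 where n0: "!!n. n >= n0 ==> rh n < et" using rhev[OF et] by blast
  have "En (u (n + n0)) <= b UNIV et" for n using u(3)[of "n + n0"] bm[of "rh (n + n0)" et UNIV] n0[of "n + n0"] by simp
  with E_limit(1,2)[OF u(1) gL LIMSEQ_ignore_initial_segment[OF lim]] show ?thesis by blast
 qed
 show gF: "g : F" using tail[of 1] by simp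
 show "E g g <= cW K * H * measure N UNIV" by (rule le_by_eps[OF _ cZ[of K']]) (use tail be in auto)
 assume A: "open A" and \<epsilon>: "\<epsilon> > 0"
 define S where "S = (UN x:A. ball x \<epsilon>)"
 have So: "open S" unfolding S_def by auto
 interpret N: finite_measure N by fact
 have "gm g A <= b S et" if et: "et > 0" for et
 proof (rule gm_open_le[OF gF A])
  show "0 <= b S et" unfolding be using cW[of K] H cZ[of K'] et by simp
  fix h assume h: "h : T A"
  have m0: "min et (\<epsilon> / (K' + 1)) > 0" using et \<epsilon> K1 by simp
  obtain n0 where n0: "!!n. n >= n0 ==> rh n < min et (\<epsilon> / (K' + 1))" using rhev[OF m0] by blast
  have c: "GI (u (n + n0)) h <= b S et" for n
  proof -
   let ?n = "n + n0"
   have r: "rh ?n < et" "(K' + 1) * rh ?n <= \<epsilon>" using n0[of ?n] K1 by (auto simp: field_simps)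
   have "GI (u ?n) h <= gm (u ?n) A" by (rule GI_le[OF u(1) A h])
   also have "... <= b (UN x:A. ball x ((K' + 1) * rh ?n)) (rh ?n)" using A by (intro u(5)) auto
   also have "... <= b S (rh ?n)"
   proof -
    have "(UN x:A. ball x ((K' + 1) * rh ?n)) <= S" unfolding S_def using subset_ball[OF r(2)] by blast
    hence "measure N (UN x:A. ball x ((K' + 1) * rh ?n)) <= measure N S" using So N(2) by (intro N.finite_measure_mono) auto
    thus ?thesis unfolding be using mult_left_mono[OF _ mult_nonneg_nonneg[OF cW H]] by auto
   qed
   also have "... <= b S et" using r by (intro bm) simp
   finally show ?thesis .
  qed
  have M: "En (u (n + n0)) <= b UNIV et" for n using u(3)[of "n + n0"] bm[of "rh (n + n0)" et UNIV] n0[of "n + n0"] by simp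
  show "GI g h <= b S et" by (rule GI_lsc[OF u(1,2) gF M LIMSEQ_ignore_initial_segment[OF lim] k h c])
 qed
 thus "gm g A <= cW K * H * measure N (UN x:A. ball x \<epsilon>)" unfolding be S_def by (rule le_by_eps[OF _ cZ[of K']])
qed

text \<open>Truncating g together with the reference value av does not increase the oscillation, so
  the bounded case applies at every level with the same constants.\<close>

theorem energy_criterion:
 assumes gL: "g : L2" and N: "finite_measure N" "sets N = sets borel" and H: "H >= 0" and K: "K >= 1" and r0: "r0 > 0"
  and osc: "!!x r. 0 < r ==> r <= r0 ==> EX av. sqi (ball x r) (%y. g y - av) <= ennreal (H * Ps r * measure N (ball x (K * r)))"
 shows "g : F" "E g g <= cW K * H * measure N UNIV"
  "open A ==> \<epsilon> > 0 ==> gm g A <= cW K * H * measure N (UN x:A. ball x \<epsilon>)"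
proof -
 note [measurable] = L2_meas[OF gL]
 have tm[measurable]: "trunc n g : borel_measurable borel" for n unfolding trunc_def by measurable
 have tL: "trunc n g : L2" for n by (rule L2_bound[OF gL tm]) (auto simp: trunc_def)
 have tk: "abs (trunc n g z) <= real n" for n z by (auto simp: trunc_def)
 have oscn: "EX av. sqi (ball x r) (%y. trunc n g y - av) <= ennreal (H * Ps r * measure N (ball x (K * r)))" if r: "0 < r" "r <= r0" for x r n
 proof -
  obtain av where av: "sqi (ball x r) (%y. g y - av) <= ennreal (H * Ps r * measure N (ball x (K * r)))" using osc[OF r] by blast
  define av' where "av' = max (- real n) (min av (real n))"
  have "(trunc n g y - av')^2 <= (g y - av)^2" for y unfolding abs_le_square_iff[symmetric] by (auto simp: trunc_def av'_def)
  hence "sqi (ball x r) (%y. trunc n g y - av') <= (sqi (ball x r) (%y. g y - av))"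
   by (intro nn_integral_mono mult_right_mono ennreal_leI) auto
  thus ?thesis using av order_trans by blast
 qed
 have C: "trunc n g : F" "En (trunc n g) <= cW K * H * measure N UNIV"
  "open A ==> \<epsilon> > 0 ==> gm (trunc n g) A <= cW K * H * measure N (UN x:A. ball x \<epsilon>)" for n A \<epsilon>
  by (rule criterion_bdd[OF tL tk N H K r0]; use oscn in blast)+
 have lim: "(%n. Ns (%z. trunc n g z - g z)) ~~> 0"
 proof (rule ip_dct[OF tm _ gL])
  show "(%n. trunc n g x) ~~> g x" for x
  proof (rule tendsto_eventually)
   obtain n0 where "abs (g x) < real n0" using reals_Archimedean2 by blast
   thus "\<forall>\<^sub>F n in sequentially. trunc n g x = g x" by (auto simp: trunc_def eventually_sequentially intro!: exI[of _ n0])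
  qed
 qed (auto simp: trunc_def)
 show gF: "g : F" and "E g g <= cW K * H * measure N UNIV" using E_limit(1,2)[OF C(1) gL lim C(2)] by auto
 assume A: "open A" "\<epsilon> > 0"
 show "gm g A <= cW K * H * measure N (UN x:A. ball x \<epsilon>)"
  using gm_limit[OF C(1) gF _ trunc(2)[OF gF], of A] A(1) C(3)[OF A] by (intro LIMSEQ_le_const2[of _ "gm g A"]) auto
qed

end

text \<open>Net points whose balls share a point of S form a graph; if it were disconnected, two
  unions of balls would separate S. A shortest path has at most as many edges as the graph, hence
  the square of the cardinality.\<close>

lemma connected_chain:
 fixes S :: "'a::metric_space set" and \<phi> :: "'a => real"
 assumes S: "connected S" and N: "finite N" "N <= S" "S <= (UN p:N. ball p sg)" and sg: "sg > 0" and t: "t >= 0"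
  and step: "!!p q. p : N ==> q : N ==> ball p sg Int ball q sg Int S ~= {} ==> abs (\<phi> p - \<phi> q) <= t"
  and pq: "p : N" "q : N"
 shows "abs (\<phi> p - \<phi> q) <= t * real (card N ^ 2)"
proof -
 define r where "r = {(p, q). p : N & q : N & ball p sg Int ball q sg Int S ~= {}}"
 have rN: "r <= N \<times> N" by (auto simp: r_def)
 have fr: "finite r" "card r <= card N ^ 2" using N(1) rN card_mono[OF _ rN] by (auto simp: finite_subset card_cartesian_product power2_eq_square)
 have "(p, q) : r\<^sup>*"
 proof (rule ccontr)
  assume nq: "(p, q) ~: r\<^sup>*"
  define C where "C = {x:N. (p, x) : r\<^sup>*}"
  let ?O1 = "UN x:C. ball x sg" and ?O2 = "UN x:N - C. ball x sg"
  have "?O1 Int S ~= {}" using pq(1) N(2) sg unfolding C_def by (intro ex_in_conv[THEN iffD1] exI[of _ p]) auto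
  moreover have "?O2 Int S ~= {}" using pq(2) N(2) sg nq unfolding C_def by (intro ex_in_conv[THEN iffD1] exI[of _ q]) (auto intro!: bexI[of _ q])
  moreover have "S <= ?O1 Un ?O2" using N(3) by (auto simp: C_def)
  moreover have "?O1 Int ?O2 Int S = {}"
  proof (rule ccontr)
   assume "?O1 Int ?O2 Int S ~= {}"
   then obtain z where "z : ?O1" "z : ?O2" "z : S" by blast
   then obtain x y where "x : C" "y : N - C" "z : ball x sg" "z : ball y sg" "z : S" by blast
   hence "(x, y) : r" by (auto simp: r_def C_def)
   hence "y : C" using \<open>x : C\<close> rN by (auto simp: C_def intro: rtrancl_into_rtrancl)
   thus False using \<open>y : N - C\<close> by simp
  qed
  moreover have "open ?O1" "open ?O2" by auto
  ultimately show False using S unfolding connected_def by meson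
 qed
 then obtain n where n: "(p, q) : r ^^ n" "n <= card r" using rtrancl_finite_eq_relpow[OF fr(1)] by auto
 have "(p, q) : r ^^ n ==> abs (\<phi> p - \<phi> q) <= t * real n" for p q n
 proof (induction n arbitrary: q)
  case (Suc n)
  then obtain z where z: "(p, z) : r ^^ n" "(z, q) : r" by auto
  hence "abs (\<phi> z - \<phi> q) <= t" by (intro step) (auto simp: r_def)
  thus ?case using Suc.IH[OF z(1)] by (simp add: algebra_simps)
 qed simp
 from this[OF n(1)] have "abs (\<phi> p - \<phi> q) <= t * real n" .
 also have "... <= t * real (card N ^ 2)" using n(2) fr(2) t by (intro mult_left_mono) auto
 finally show ?thesis .
qed

section \<open>Geometry of uniform domains\<close>

locale ext = hk m E F Ps for m :: "'a::metric_space measure" and E F Ps +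
 fixes U V :: "'a set" and A AP CP \<epsilon> :: real and RR SS :: "('a \<times> real) set"
  and Q :: "'a \<times> real => 'a \<times> real" and \<psi> :: "'a \<times> real => 'a => real"
 assumes U: "uniform_domain A U" and V: "V = interior (- U)" and PI: "poincare m E F Ps CP AP"
  and eps: "\<epsilon> > 0" "27 * AP * \<epsilon> < 1" and RR: "whitney_cover \<epsilon> U RR" and SS: "whitney_cover \<epsilon> V SS"
  and Q: "whitney_reflection \<epsilon> A U RR SS Q" and psi: "whitney_partition m E F Ps V SS \<psi>"
begin

text \<open>The radius of a Whitney ball is kp times the distance of its centre to the
  complement.\<close>

definition "kp = \<epsilon> / (1 + \<epsilon>)"

lemma cst: "A >= 1" "AP >= 1" "CP >= 1" "kp > 0" "kp < \<epsilon>" "27 * \<epsilon> < 1" "27 * kp < 1" "27 * (AP * kp) < 1"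
proof -
 show A: "A >= 1" "AP >= 1" "CP >= 1" using U PI by (auto simp: uniform_domain_def poincare_def)
 show k: "kp > 0" "kp < \<epsilon>" using eps by (auto simp: kp_def field_simps)
 show e: "27 * \<epsilon> < 1" proof -
  have "1 * \<epsilon> <= AP * \<epsilon>" using A(2) eps(1) by (intro mult_right_mono) auto
  thus ?thesis using eps(2) by linarith
 qed
 thus "27 * kp < 1" using k by simp
 show "27 * (AP * kp) < 1" proof -
  have "AP * kp <= AP * \<epsilon>" using A(2) k by (intro mult_left_mono) auto
  thus ?thesis using eps(2) by linarith
 qed
qed

lemma U_facts: "open U" "U ~= {}" "U ~= UNIV" "connected U" using U by (auto simp: uniform_domain_def)
lemma V_eq: "V = - closure U" by (simp add: V interior_complement)
lemma V_open: "open V" by (simp add: V)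

lemma infdist_open: fixes x :: 'a assumes "open W" "W ~= UNIV"
 shows "x : W \<longleftrightarrow> 0 < infdist x (- W)" "ball x (infdist x (- W)) <= W"
proof -
 have "x : - W \<longleftrightarrow> infdist x (- W) = 0" using assms by (intro in_closed_iff_infdist_zero) auto
 thus "x : W \<longleftrightarrow> 0 < infdist x (- W)" using infdist_nonneg[of x "- W"] by auto
 show "ball x (infdist x (- W)) <= W"
 proof
  fix y assume "y : ball x (infdist x (- W))"
  thus "y : W" using infdist_le[of y "- W" x] by fastforce
 qed
qed

abbreviation "dU x == infdist x (- U)"

lemmas dU_pos = infdist_open(1)[OF U_facts(1,3)] and dU_ball = infdist_open(2)[OF U_facts(1,3)]

lemma dU_lip: "dU x <= dU y + dist x y" by (rule infdist_triangle)

lemma ball_U: "r <= dU x ==> ball x r <= U" using dU_ball[of x] subset_ball by blast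

lemma uniform_path:
 assumes "x : U" "y : U"
 obtains \<gamma> where "path \<gamma>" "pathstart \<gamma> = x" "pathfinish \<gamma> = y" "path_image \<gamma> <= U"
  "!!z. z : path_image \<gamma> ==> dist x z <= A * dist x y" "!!z. z : path_image \<gamma> ==> min (dist x z) (dist y z) <= A * dU z"
proof -
 obtain \<gamma> where g: "path \<gamma>" "pathstart \<gamma> = x" "pathfinish \<gamma> = y" "path_image \<gamma> <= U"
  "diameter (path_image \<gamma>) <= A * dist x y" "ALL z:path_image \<gamma>. inverse A * min (dist x z) (dist y z) <= dU z"
  using U assms unfolding uniform_domain_def by metis
 have bd: "bounded (path_image \<gamma>)" using g(1) by (rule bounded_path_image)
 have "x : path_image \<gamma>" using g(2) pathstart_in_path_image by blast
 hence "dist x z <= A * dist x y" if "z : path_image \<gamma>" for z using diameter_bounded_bound[OF bd _ that, of x] g(5) by simp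
 moreover have "min (dist x z) (dist y z) <= A * dU z" if "z : path_image \<gamma>" for z
  using g(6) that cst(1) by (auto simp: field_simps)
 ultimately show ?thesis using that g by blast
qed

section \<open>Points deep inside U and the size of the frontier\<close>

lemma climb: assumes x: "x : U" and y: "y : U" "2 * s <= dist x y" and s: "s > 0"
 obtains z where "z : U" "dist x z = s" "s <= A * dU z"
proof -
 obtain \<gamma> where g: "path \<gamma>" "pathstart \<gamma> = x" "pathfinish \<gamma> = y" "path_image \<gamma> <= U"
  "!!z. z : path_image \<gamma> ==> min (dist x z) (dist y z) <= A * dU z" using uniform_path[OF x y(1)] by metis
 have "continuous_on {0..1} (%t. dist x (\<gamma> t))" using g(1) by (intro continuous_intros) (simp add: path_def)
 moreover have "dist x (\<gamma> 0) <= s" "s <= dist x (\<gamma> 1)" using g(2,3) y s by (auto simp: pathstart_def pathfinish_def)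
 ultimately obtain t where t: "0 <= t" "t <= 1" "dist x (\<gamma> t) = s" using IVT'[of "%t. dist x (\<gamma> t)" 0 s 1] by auto
 have z: "\<gamma> t : path_image \<gamma>" using t by (auto simp: path_image_def)
 have "s <= dist y (\<gamma> t)" using y(2) t(3) dist_triangle[of x y "\<gamma> t"] by (simp add: dist_commute)
 thus ?thesis using that[of "\<gamma> t"] g(4,5) z t(3) by force
qed

lemma far_point: assumes x: "x : U" and t: "ereal (2 * t) < ediam U" obtains y where "y : U" "t <= dist x y"
proof -
 have "EX y:U. t <= dist x y"
 proof (rule ccontr)
  assume "~ (EX y:U. t <= dist x y)"
  hence n: "!!y. y : U ==> dist x y < t" by force
  have "ereal (dist p q) <= ereal (2 * t)" if "p : U" "q : U" for p q
   using n[OF that(1)] n[OF that(2)] dist_triangle3[of p q x] by simp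
  hence "ediam U <= ereal (2 * t)" unfolding ediam_def by (intro SUP_least) auto
  thus False using t by simp
 qed
 thus ?thesis using that by blast
qed

lemma dU_frontier: assumes "\<xi> : frontier U" shows "dU x <= dist \<xi> x"
proof -
 have "\<xi> ~: U" using assms U_facts(1) by (simp add: frontier_def interior_open)
 thus ?thesis using infdist_le[of \<xi> "- U" x] by (simp add: dist_commute)
qed

lemma near_point: assumes "\<xi> : frontier U" "r > 0" obtains x where "x : U" "dist \<xi> x < r"
 using assms closure_approachable[of \<xi> U] by (auto simp: frontier_def dist_commute)

text \<open>A uniform curve that leaves a point near the boundary for distance r/4 has by then risen
  to height r/(4A), because its other end is far away.\<close>

lemma corkscrew: assumes "\<xi> : frontier U" "r > 0" "ereal (2 * r) < ediam U"
 obtains z where "ball z (r / (4 * A)) <= U" "ball z (r / (4 * A)) <= ball \<xi> r" "dist \<xi> z < r"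
proof -
 have A: "A >= 1" by (rule cst)
 obtain x where x: "x : U" "dist \<xi> x < r / 4" using near_point[OF assms(1), of "r/4"] assms(2) by auto
 obtain y where y: "y : U" "r <= dist x y" by (rule far_point[OF x(1) assms(3)])
 obtain z where z: "z : U" "dist x z = r / 4" "r / 4 <= A * dU z" using climb[OF x(1) y(1), of "r / 4"] y(2) assms(2) by auto
 have d: "dist \<xi> z < r / 2" using x z dist_triangle[of \<xi> z x] by simp
 have "r / (4 * A) <= dU z" using z(3) A by (simp add: field_simps)
 moreover have "r / (4 * A) <= r / 4" using A assms(2) by (simp add: field_simps)
 moreover have "ball z (r / (4 * A)) <= ball \<xi> r"
 proof
  fix w assume "w : ball z (r / (4 * A))"
  hence "dist z w < r / 4" using \<open>r / (4 * A) <= r / 4\<close> by simp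
  thus "w : ball \<xi> r" using d dist_triangle[of \<xi> w z] assms(2) by simp
 qed
 ultimately show ?thesis using that[of z] ball_U d assms(2) by auto
qed

lemma poincare_ball: assumes W: "open W" "f : FL W" and r: "r > 0" "ball x (AP * r) <= W"
 shows "sqi (ball x r) (%y. f y - set_average m (ball x r) f) <= ennreal (CP * Ps r) * LE W f (ball x (AP * r))"
proof -
 have "(sqi (ball x r) (%y. f y - set_average m (ball x r) f))
   <= ennreal (CP * Ps r) * LE (ball x (AP * r)) f (ball x (AP * r))"
  using PI r(1) FL_mono[OF W(2) r(2)] unfolding poincare_def by blast
 thus ?thesis unfolding LE_restrict[OF W open_ball r(2) borel_open[OF open_ball] subset_refl] .
qed

text \<open>If the dilated ball missed the frontier, the indicator of U would be locally in F on it
  with zero energy on either side. PI then makes it constant on the smaller ball, while both U and V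
  meet that ball in nonempty open sets, which have positive measure.\<close>

lemma meets_frontier:
 assumes rh: "rh > 0" and u: "u : ball x rh" "u : U" and v: "v : ball x rh" "v ~: U"
 shows "ball x (AP * rh) Int frontier U ~= {}"
proof
 assume n: "ball x (AP * rh) Int frontier U = {}"
 let ?W = "ball x (AP * rh)"
 have "rh <= AP * rh" using cst(2) rh by simp
 hence sub: "ball x rh <= ?W" by (rule subset_ball)
 have split: "y : U | y : V" if "y : ?W" for y using that n U_facts(1) by (auto simp: V_eq frontier_def interior_open)
 have VU: "y : V ==> y ~: U" for y using closure_subset[of U] by (auto simp: V_eq)
 have vV: "v : V" using v sub split by blast
 define g :: "'a => real" where "g = indicator U"
 have gm[measurable]: "g : borel_measurable borel" unfolding g_def using U_facts(1) by (intro borel_measurable_indicator) auto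
 have g: "g : FL ?W" unfolding F_loc_def
 proof (safe)
  show "g : borel_measurable (restrict_space borel ?W)" by (rule measurable_restrict_space1[OF gm])
  fix O' assume O': "open O'" "rel_compact_in ?W O'"
  \<comment> \<open>As the dilated ball misses the frontier, this compact set lies inside U, and a
    test function that is 1 near it represents the indicator on O'.\<close>
  have K: "compact (closure O' Int closure U)" using O'(2) by (auto simp: rel_compact_in_def compact_Int_closed)
  have "closure O' Int closure U <= U" using O'(2) split unfolding rel_compact_in_def V_eq by blast
  then obtain h G' where h: "h : T U" "closure O' Int closure U <= G'" "!!x. x : G' ==> h x = 1" using urysohn[OF K U_facts(1)] by metis
  have "g y = h y" if "y : O'" for y using h that closure_subset T_zero[OF h(1), of y] by (cases "y : U") (auto simp: g_def subset_iff)
  thus "EX f':F. AE y in m. y : O' --> g y = f' y" using TD(1)[OF h(1)] by (intro bexI[of _ h]) auto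
 qed
 have Z: "gm (%_. 0) B = 0" for B :: "'a set" using gm_le[OF F0, of B] EE.B_scale[OF F0 F0, of 0] by (simp add: order_antisym)
 have "LE ?W g (?W Int U) = ennreal (gm (%_. 0) (?W Int U))"
  by (rule LE_loc_F[OF open_ball g F0, of "?W Int U" 1]) (use U_facts(1) in "auto simp: g_def")
 moreover have "LE ?W g (?W Int V) = ennreal (gm (%_. 0) (?W Int V))"
  by (rule LE_loc_F[OF open_ball g F0, of "?W Int V" 0]) (use V_open VU in "auto simp: g_def")
 moreover have "?W = (?W Int U) Un (?W Int V)" using split by blast
 moreover have "LE ?W g ((?W Int U) Un (?W Int V)) <= LE ?W g (?W Int U) + LE ?W g (?W Int V)"
  using U_facts(1) V_open g by (intro emeasure_subadditive) (auto simp: sets_LE)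
 ultimately have LE0: "LE ?W g ?W = 0" by (simp add: Z)
 define a where "a = set_average m (ball x rh) g"
 have "sqi (ball x rh) (%y. g y - a) = 0"
  using poincare_ball[OF open_ball g rh subset_refl] LE0 by (simp add: a_def)
 moreover have [measurable]: "ball x rh : sets m" by simp
 ultimately have "AE y in m. ennreal ((g y - a)^2) * indicator (ball x rh) y = 0" by (subst (asm) nn_integral_0_iff_AE) measurable
 hence ae: "AE y in m. y : ball x rh --> g y = a" by eventually_elim (auto simp: indicator_def split: if_splits)
 have *: "a = c" if "open O'" "O' ~= {}" "O' <= ball x rh" "!!y. y : O' ==> g y = c" for O' c
 proof (rule ccontr)
  assume "a ~= c"
  from ae have "AE y in m. y ~: O'" by (rule AE_mp, intro AE_I2) (use that \<open>a ~= c\<close> in auto)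
  moreover have "O' : sets m" using that by simp
  ultimately have "emeasure m O' = 0" using AE_iff_measurable[of O' m "%y. y ~: O'"] by simp
  thus False using F_facts(6) that by (auto simp: metric_measure_space_def)
 qed
 have "a = 1" by (rule *[of "ball x rh Int U"]) (use u U_facts in "auto simp: g_def")
 moreover have "a = 0" by (rule *[of "ball x rh Int V"]) (use v vV V_open VU in "auto simp: g_def")
 ultimately show False by simp
qed

text \<open>A one-point U would be closed as well as open and so have empty frontier, against
  \<open>meets_frontier\<close> for a ball that reaches the complement.\<close>

lemma ediam_pos: "EX t>0. ereal t < ediam U"
proof -
 obtain x where x: "x : U" using U_facts by blast
 have "EX y:U. x ~= y"
 proof (rule ccontr)
  assume "~ (EX y:U. x ~= y)"
  hence *: "!!y. y : U ==> y = x" by metis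
  have "{x} <= U" using x by (rule insert_subsetI) (rule empty_subsetI)
  moreover have "U <= {x}" by (rule subsetI, drule *) (rule singleton_iff[THEN iffD2])
  ultimately have Ux: "U = {x}" by (rule equalityI[rotated])
  have p: "dU x > 0" using x dU_pos by simp
  obtain y where "y ~: U" using U_facts by blast
  hence yx: "dU x <= dist x y" using infdist_le[of y "- U" x] by simp
  have "closure U = {x}" using Ux by simp
  hence fr: "frontier U = {}" using Ux U_facts(1) by (simp add: frontier_def interior_open)
  have "ball x (AP * (dist x y + 1)) Int frontier U ~= {}"
  proof (rule meets_frontier[OF _ _ x _ \<open>y ~: U\<close>])
   show "0 < dist x y + 1" using zero_le_dist[of x y] by linarith
   thus "x : ball x (dist x y + 1)" by simp
   show "y : ball x (dist x y + 1)" by simp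
  qed
  thus False unfolding fr by blast
 qed
 then obtain y where y: "y : U" "x ~= y" by blast
 have "ereal (dist x y) <= ediam U" unfolding ediam_def using x y by (intro SUP_upper2[of "(x, y)"]) auto
 moreover have "ereal (dist x y / 2) < ereal (dist x y)" using y by simp
 ultimately have "ereal (dist x y / 2) < ediam U" by (rule less_le_trans[rotated])
 thus ?thesis using y by (intro exI[of _ "dist x y / 2"]) auto
qed

text \<open>Porosity. Around a compact part K of the frontier, corkscrew balls fill a fixed fraction
  c of m(K) inside arbitrarily thin neighbourhoods, whose measures tend to m(K); thus (1 + c) m(K)
  <= m(K). Inner regularity extends this to the whole frontier.\<close>

lemma frontier_null: "emeasure m (frontier U) = 0"
proof -
 have A: "A >= 1" by (rule cst)
 have "emeasure m K = 0" if K: "compact K" "K <= frontier U" for K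
 proof -
  define c where "c = 1 / DD (16 * A)"
  have c: "c > 0" using DD(1)[of "16 * A"] by (simp add: c_def)
  define B where "B n = (UN x:K. ball x (1 / real (Suc n)))" for n
  have Kb: "bounded K" by (rule compact_imp_bounded[OF K(1)])
  have Bb: "bounded (B n)" for n
  proof -
   obtain z e where e: "!!y. y : K ==> dist z y <= e" using Kb by (auto simp: bounded_def)
   have "dist z y <= e + 1" if "y : B n" for y
   proof -
    obtain x where x: "x : K" "dist x y < 1 / real (Suc n)" using \<open>y : B n\<close> by (auto simp: B_def)
    have "1 / real (Suc n) <= 1" by simp
    thus ?thesis using x e[OF x(1)] dist_triangle[of z y x] by linarith
   qed
   thus ?thesis by (auto simp: bounded_def)
  qed
  have Bo: "open (B n)" for n by (auto simp: B_def)
  have Ks: "K : sets borel" using K(1) by (simp add: compact_imp_closed)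
  obtain t where t: "t > 0" "ereal t < ediam U" using ediam_pos by blast
  obtain n0 where n0: "1 / real (Suc n0) < t / 2" using nat_approx_posE[of "t / 2"] t(1) by (metis half_gt_zero)
  \<comment> \<open>A maximal separated set of K at the scale of the neighbourhood carries disjoint
    corkscrew balls, each comparable in volume to the mesh ball around its centre.\<close>
  have key: "(1 + c) * measure m K <= measure m (B n)" if n: "n >= n0" for n
  proof -
   define rh where "rh = 1 / real (Suc n)"
   have rh: "rh > 0" by (simp add: rh_def)
   have "rh <= 1 / real (Suc n0)" using n by (simp add: rh_def frac_le)
   hence r2: "ereal (2 * (rh / 2)) < ediam U" using n0 t by (auto intro!: less_trans[OF _ t(2)])
   obtain N where N: "finite N" "N <= K" "!!p q. p : N ==> q : N ==> p ~= q ==> rh <= dist p q" "K <= (UN p:N. ball p rh)"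
    by (rule net[OF Kb rh]) (rule that, assumption+)
   have "ALL p:N. EX z. ball z (rh / 2 / (4 * A)) <= U & ball z (rh / 2 / (4 * A)) <= ball p (rh / 2) & dist p z < rh / 2"
   proof
    fix p assume "p : N"
    hence "p : frontier U" using N K by blast
    from corkscrew[OF this _ r2] rh show "EX z. ball z (rh / 2 / (4 * A)) <= U & ball z (rh / 2 / (4 * A)) <= ball p (rh / 2) & dist p z < rh / 2" by (metis half_gt_zero)
   qed
   from bchoice[OF this] obtain z where z: "!!p. p : N ==> ball (z p) (rh / 2 / (4 * A)) <= U"
    "!!p. p : N ==> ball (z p) (rh / 2 / (4 * A)) <= ball p (rh / 2)" "!!p. p : N ==> dist p (z p) < rh / 2" by blast
   define s where "s = rh / 2 / (4 * A)"
   have s: "s > 0" "16 * A * s = 2 * rh" using rh A by (auto simp: s_def)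
   define Z where "Z = (UN p:N. ball (z p) s)"
   have "measure m K <= measure m (UN p:N. ball p rh)" using N Ks by (intro measure_mono_b) auto
   also have "... <= (SUM p:N. vol p rh)" unfolding vol_def using N(1) by (intro measure_UNION_le) auto
   also have "... <= (SUM p:N. DD (16 * A) * vol (z p) s)"
   proof (intro sum_mono DD(2) s(1))
    fix p assume "p : N"
    thus "dist p (z p) + rh <= 16 * A * s" using z(3)[of p] rh by (simp add: s(2))
   qed
   also have "... = DD (16 * A) * measure m Z" unfolding Z_def sum_distrib_left[symmetric]
   proof (subst measure_finite_Union)
    show "disjoint_family_on (%p. ball (z p) s) N" using half_balls[OF N(3)] z(2) unfolding disjoint_family_on_def s_def by blast
    show "emeasure m (ball (z p) s) ~= \<infinity>" for p using bounded_fin[of "ball (z p) s"] by auto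
   qed (use N in "auto simp: vol_def")
   finally have "c * measure m K <= measure m Z" using DD(1)[of "16 * A"] by (simp add: c_def field_simps)
   moreover have "measure m K + measure m Z = measure m (K Un Z)"
   proof (rule measure_Union[symmetric])
    show "K Int Z = {}" using z(1) K(2) U_facts(1) unfolding Z_def s_def by (auto simp: frontier_def interior_open)
    show "emeasure m K ~= \<infinity>" using bounded_fin[OF Kb] by auto
    have "bounded Z" unfolding Z_def using N(1) by auto
    thus "emeasure m Z ~= \<infinity>" using bounded_fin[of Z] by auto
   qed (use Ks in "auto simp: Z_def intro!: borel_open open_UN")
   moreover have "measure m (K Un Z) <= measure m (B n)"
   proof (rule measure_mono_b)
    have "ball p rh <= B n" if "p : N" for p using that N(2) by (auto simp: B_def rh_def)
    moreover have "ball p (rh / 2) <= ball p rh" for p using rh by auto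
    ultimately have "Z <= B n" unfolding Z_def s_def using z(2) by blast
    thus "K Un Z <= B n" by (auto simp: B_def)
    have "Z : sets borel" unfolding Z_def by (intro borel_open open_UN) auto
    thus "K Un Z : sets borel" using Ks by auto
   qed (use Bo Bb in auto)
   ultimately show ?thesis by (simp add: algebra_simps)
  qed
  have "(%n. emeasure m (B n)) ~~> emeasure m (\<Inter>n. B n)"
  proof (rule Lim_emeasure_decseq)
   show "decseq B" unfolding B_def by (intro decseq_SucI UN_mono subset_ball) (auto simp: frac_le)
   show "emeasure m (B n) ~= \<infinity>" for n using bounded_fin[OF Bb, of n] by auto
  qed (use Bo in auto)
  moreover have "(\<Inter>n. B n) = K"
  proof
   show "(\<Inter>n. B n) <= K"
   proof
    fix y assume y: "y : (\<Inter>n. B n)"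
    have "EX x:K. dist x y < e" if "e > 0" for e
    proof -
     obtain n where n: "1 / real (Suc n) < e" using nat_approx_posE[OF \<open>e > 0\<close>] by blast
     have "y : B n" using y by blast
     thus ?thesis using n by (auto simp: B_def intro: less_trans)
    qed
    hence "y : closure K" by (simp add: closure_approachable)
    thus "y : K" using closure_closed[OF compact_imp_closed[OF K(1)]] by simp
   qed
  qed (auto simp: B_def)
  ultimately have "(%n. ennreal (measure m (B n))) ~~> ennreal (measure m K)"
   using emeasure_bounded[OF Bb] emeasure_bounded[OF Kb] by simp
  hence "(%n. measure m (B n)) ~~> measure m K" by (rule tendsto_ennrealD) auto
  hence "(1 + c) * measure m K <= measure m K" using key by (intro LIMSEQ_le_const) auto
  hence "c * measure m K <= 0" by (simp add: algebra_simps)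
  hence "measure m K = 0" using c measure_nonneg[of m K] by (simp add: mult_le_0_iff)
  thus ?thesis using emeasure_bounded[OF Kb] by simp
 qed
 hence "(SUP K\<in>{K. compact K \<and> K <= frontier U}. emeasure m K) <= 0" by (intro SUP_least) auto
 moreover have "emeasure m (frontier U) = (SUP K\<in>{K. compact K \<and> K <= frontier U}. emeasure m K)"
  using F_facts(6) by (auto simp: metric_measure_space_def radon_measure_def)
 ultimately show ?thesis by simp
qed

section \<open>Oscillation along chains\<close>

text \<open>A Whitney ball is determined by its centre, so covers are handled through their centres.\<close>

abbreviation "XU == fst ` RR"
abbreviation "XV == fst ` SS"

lemma whitney_centres:
 fixes W :: "'a set" assumes W: "whitney_cover \<epsilon> W \<RR>"
 shows "(x, r) : \<RR> ==> x : W & r = kp * infdist x (- W)" "x : fst ` \<RR> ==> x : W & (x, kp * infdist x (- W)) : \<RR>"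
  "x : fst ` \<RR> ==> y : fst ` \<RR> ==> x ~= y ==> ball x (kp * infdist x (- W)) Int ball y (kp * infdist y (- W)) = {}"
  "z : W ==> EX x:fst ` \<RR>. dist x z < 2 * (1 + \<epsilon>) * (kp * infdist x (- W))"
proof -
 have w: "open W" "W ~= (UNIV :: 'a set)" and c: "!!x r. (x, r) : \<RR> ==> x : W & r = kp * infdist x (- W)"
  and d: "pairwise (%B B'. rball W 1 B \<inter> rball W 1 B' = {}) \<RR>" and u: "(UN B:\<RR>. rball W (2 * (1 + \<epsilon>)) B) = W"
  using W unfolding whitney_cover_def kp_def by auto
 show "(x, r) : \<RR> ==> x : W & r = kp * infdist x (- W)" by (rule c)
 show c2: "x : fst ` \<RR> ==> x : W & (x, kp * infdist x (- W)) : \<RR>" for x using c by force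
 have "rball W 1 (x, kp * infdist x (- W)) = ball x (kp * infdist x (- W))" for x
 proof -
  have "kp * infdist x (- W) <= 1 * infdist x (- W)" using cst(7) infdist_nonneg by (intro mult_right_mono) auto
  hence "ball x (kp * infdist x (- W)) <= W" using infdist_open(2)[OF w, of x] subset_ball by fastforce
  thus ?thesis by (auto simp: rball_def)
 qed
 thus "x : fst ` \<RR> ==> y : fst ` \<RR> ==> x ~= y ==> ball x (kp * infdist x (- W)) Int ball y (kp * infdist y (- W)) = {}"
  using pairwiseD[OF d, of "(x, kp * infdist x (- W))" "(y, kp * infdist y (- W))"] c2[of x] c2[of y] by simp
 show "z : W ==> EX x:fst ` \<RR>. dist x z < 2 * (1 + \<epsilon>) * (kp * infdist x (- W))"
  using u c by (force simp: rball_def)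
qed

lemma XU: "x : XU ==> x : U" "x : XU ==> y : XU ==> x ~= y ==> ball x (kp * dU x) Int ball y (kp * dU y) = {}"
 "z : U ==> EX x:XU. dist x z < 3 * kp * dU x"
proof -
 show "x : XU ==> x : U" "x : XU ==> y : XU ==> x ~= y ==> ball x (kp * dU x) Int ball y (kp * dU y) = {}"
  using whitney_centres(2,3)[OF RR] by blast+
 assume "z : U"
 from whitney_centres(4)[OF RR this] obtain x where x: "x : XU" "dist x z < 2 * (1 + \<epsilon>) * (kp * dU x)" by blast
 have "2 * (1 + \<epsilon>) * (kp * dU x) <= 3 * (kp * dU x)" using cst infdist_nonneg[of x "- U"] by (intro mult_right_mono) auto
 thus "EX x:XU. dist x z < 3 * kp * dU x" using x by (intro bexI[of _ x]) auto
qed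

lemma XU_count: assumes "s > 0" "a > 0" and Y: "Y <= XU" "!!x. x : Y ==> dist z x <= L * s & a * s <= dU x"
 shows "finite Y" "real (card Y) <= DD (2 * L / (kp * a) + 1)"
proof -
 have k: "kp > 0" by (rule cst)
 have p: "kp * (a * s) > 0" using k assms by simp
 have d: "ball x (kp * (a * s)) Int ball y (kp * (a * s)) = {}" if "x : Y" "y : Y" "x ~= y" for x y
 proof -
  have "kp * (a * s) <= kp * dU x" "kp * (a * s) <= kp * dU y" using Y(2) that k by (auto intro!: mult_left_mono)
  thus ?thesis using XU(2)[of x y] that Y(1) subset_ball by blast
 qed
 have n: "dist z x <= L * s" if "x : Y" for x using Y(2)[OF that] by simp
 have K: "2 * (L * s) + kp * (a * s) <= (2 * L / (kp * a) + 1) * (kp * (a * s))" using k assms by (simp add: field_simps)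
 show "finite Y" "real (card Y) <= DD (2 * L / (kp * a) + 1)"
  using count[where c = "%x. x", OF p d n K] by auto
qed

text \<open>Climbing to distance 4A dU x reaches height 4 dU x; the Whitney centre nearby loses at
  most a small part of it, which keeps the height at least doubled.\<close>

lemma parent: assumes x: "x : U" and far: "y : U" "8 * A * dU x <= dist x y"
 obtains n where "n : XU" "2 * dU x <= dU n" "dU n <= 6 * A * dU x" "dist x n <= 6 * A * dU x"
proof -
 have A: "A >= 1" and k: "27 * kp < 1" "kp > 0" by (rule cst)+
 have d: "dU x > 0" using x dU_pos by simp
 have Ad: "dU x <= A * dU x" using A d by simp
 obtain z where z: "z : U" "dist x z = 4 * A * dU x" "4 * A * dU x <= A * dU z"
  using climb[OF x far(1), of "4 * A * dU x"] far(2) A d by auto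
 obtain n where n: "n : XU" "dist n z < 3 * kp * dU n" using XU(3)[OF z(1)] by blast
 have "3 * kp * dU n <= 1 / 9 * dU n" using k infdist_nonneg[of n "- U"] by (intro mult_right_mono) auto
 hence nz: "dist n z <= 1 / 9 * dU n" using n by linarith
 have z4: "4 * dU x <= dU z" using z(3) A by (simp add: mult.assoc)
 have 1: "dU z <= dU n + dist n z" "dU n <= dU z + dist n z" using dU_lip[of z n] dU_lip[of n z] by (simp_all add: dist_commute)
 have 2: "dU z <= dU x + 4 * A * dU x" using dU_lip[of z x] z(2) by (simp add: dist_commute)
 have 3: "dist x n <= 4 * A * dU x + dist n z" using dist_triangle[of x n z] z(2) by (simp add: dist_commute)
 show ?thesis using nz z4 1 2 3 Ad n(1) d by (intro that[of n]) linarith+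
qed

definition "cS = 4 * CP * DD (2 / kp)"

text \<open>A curve-free region containing the half-height balls along any uniform curve that starts
  at x, has length scale L rh and ends at height at least a rh. Overlaps of such regions can be
  counted, those of curves cannot.\<close>

definition "tube a L x rh = {z : U. dist x z <= 2 * A * L * rh & a / (4 * A) * rh <= dU z}"

lemma tube_borel: "tube a L x rh : sets borel" "tube a L x rh <= U"
proof -
 have "tube a L x rh = U Int {z. dist x z <= 2 * A * L * rh} Int {z. a / (4 * A) * rh <= dU z}" by (auto simp: tube_def)
 also have "... : sets borel" using U_facts(1) by (intro sets.Int borel_open borel_closed closed_Collect_le continuous_intros) auto
 finally show "tube a L x rh : sets borel" .
qed (auto simp: tube_def)

text \<open>The net along the curve has boundedly many points; \<open>chM\<close> bounds their number.\<close>
definition "chM a L = DD (8 * A^2 * L / (kp * a) + 1)"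
text \<open>The first factor is the squared number of steps of the chain, two for its ends and two
  for each edge; the rest is the cost of one step with volume and scale transferred to the starting
  point.\<close>

definition "chC a L = (2 + 2 * (chM a L)^2)^2 * (cS * PK (2 * A * L) * DD (2 * A * (A * L + 1) / a))"

lemma chC: "chC a L >= 0" if "2 * A * L >= 1"
 using cst(3) DD(1)[of "2/kp"] DD(1)[of "2 * A * (A * L + 1) / a"] PK(1)[OF that] by (simp add: chC_def cS_def)

context
 fixes f assumes fU: "f : FL U" and fm: "f : borel_measurable borel" and ffin: "LE U f U < \<infinity>"
begin

definition "eU S = measure (local_energy_measure m E F U f) S"

lemma LE_fin: "finite_measure (local_energy_measure m E F U f)"
proof (rule finite_measureI)
 have "space (local_energy_measure m E F U f) = U"
  using sets_eq_imp_space_eq[of "local_energy_measure m E F U f" "restrict_space borel U"] LE_spec[OF U_facts(1) fU]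
  by (simp add: LEspec_def space_restrict_space)
 thus "emeasure (local_energy_measure m E F U f) (space (local_energy_measure m E F U f)) ~= \<infinity>" using ffin by simp
qed

lemma LE_eU: "LE U f S = ennreal (eU S)" unfolding eU_def by (rule finite_measure.emeasure_eq_measure[OF LE_fin])
lemma eU_nonneg: "0 <= eU S" by (simp add: eU_def)
lemma eU_mono: "S <= S' ==> S' : sets borel ==> S' <= U ==> eU S <= eU S'"
 unfolding eU_def by (rule finite_measure.finite_measure_mono[OF LE_fin]) (auto simp: sets_LE[OF U_facts(1) fU])

text \<open>The average over the tripled Whitney ball, but defined at every point of U, so that
  chains need not run through centres.\<close>

definition "bx x = set_average m (ball x (3 * kp * dU x)) f"

lemma poincare_U: assumes "r > 0" "AP * r <= dU x"
 shows "sqi (ball x r) (%y. f y - set_average m (ball x r) f) <= ennreal (CP * Ps r * eU (ball x (AP * r)))"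
 using poincare_ball[OF U_facts(1) fU assms(1) ball_U[OF assms(2)]] cst(3) Psi_pos[OF assms(1)]
 by (simp add: LE_eU ennreal_mult eU_nonneg)

text \<open>Both averages are compared with that over one larger ball around x. Its
  \<open>AP\<close>-dilate stays within half the distance to the boundary, which is where the bound
  on AP*eps enters.\<close>

lemma bx_step: assumes x: "x : U" and xy: "dist x y <= kp * dU x"
 shows "(bx x - bx y)^2 <= cS * Ps (dU x) / vol x (dU x) * eU (ball x (dU x / 2))"
proof -
 define d where "d = dU x"
 have k: "kp > 0" "27 * kp < 1" "27 * (AP * kp) < 1" and CP: "CP >= 1" by (rule cst)+
 have d: "d > 0" using x dU_pos by (simp add: d_def)
 have kd: "27 * (kp * d) < d" "kp * d > 0" using k d mult_strict_right_mono[OF k(2) d] by auto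
 have dy: "d - kp * d <= dU y" "dU y <= d + kp * d" using dU_lip[of x y] dU_lip[of y x] xy by (auto simp: d_def dist_commute)
 have kdy: "kp * dU y <= kp * (2 * d)" "kp * (d / 2) <= kp * dU y" using dy kd k by (auto intro!: mult_left_mono)
 \<comment> \<open>The tripled Whitney ball at y has radius at most 6 kp d, and y is at most kp d
   away.\<close>
 define r where "r = 5 * kp * d + kp * d + kp * d"
 have r: "r > 0" "r <= d" "AP * r <= d / 2"
 proof -
  show "r > 0" "r <= d" using kd unfolding r_def mult.assoc by linarith+
  have "AP * r = 7 * (AP * kp) * d" by (simp add: r_def algebra_simps)
  also have "... <= 1 / 2 * d" using k(3) d by (intro mult_right_mono) auto
  finally show "AP * r <= d / 2" by simp
 qed
 define a where "a = set_average m (ball x r) f"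
 define c where "c = CP * Ps d * eU (ball x (d / 2))"
 have c0: "0 <= c" using CP Psi_pos[OF d] eU_nonneg by (simp add: c_def)
 have "sqi (ball x r) (%y. f y - a) <= ennreal (CP * Ps r * eU (ball x (AP * r)))"
  unfolding a_def by (rule poincare_U) (use r d in "auto simp: d_def")
 also have "... <= ennreal c" unfolding c_def
  using CP Psi_mono[OF r(1,2)] Psi_pos[OF r(1)] r(3) d eU_nonneg ball_U[of "d / 2" x]
  by (intro ennreal_leI mult_mono eU_mono subset_ball) (auto simp: d_def)
 finally have B: "sqi (ball x r) (%y. f y - a) <= ennreal c" .
 have key: "(set_average m (ball z s) f - a)^2 <= DD (2 / kp) * c / vol x d" if s: "s > 0" "dist z x + d <= 2 / kp * s" "dist x z + s <= r" for z s
 proof -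
  have "ball z s <= ball x r"
  proof
   fix w assume "w : ball z s" thus "w : ball x r" using s(3) dist_triangle[of x w z] by simp
  qed
  hence "sqi (ball z s) (%y. f y - a) <= (sqi (ball x r) (%y. f y - a))"
   by (intro nn_integral_mono) (auto simp: indicator_def)
  hence "(set_average m (ball z s) f - a)^2 <= c / measure m (ball z s)"
   using B vol_pos[OF s(1), of z] c0 by (intro average_bound_real[OF _ _ _ borel_set_meas[OF fm]]) (auto simp: vol_def)
  also have "... <= DD (2 / kp) * c / vol x d"
  proof -
   have "vol x d <= DD (2 / kp) * vol z s" by (rule DD(2)[OF s(1)]) (use s in "auto simp: dist_commute")
   hence "c * vol x d <= c * (DD (2 / kp) * vol z s)" using c0 by (rule mult_left_mono)
   thus ?thesis using vol_pos[OF s(1), of z] vol_pos[OF d, of x] by (simp add: vol_def field_simps)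
  qed
  finally show ?thesis .
 qed
 have **: "2 / kp * (3 * kp * d) = 6 * d" using k by (simp add: field_simps)
 have 1: "(bx x - a)^2 <= DD (2 / kp) * c / vol x d" unfolding bx_def d_def[symmetric]
 proof (rule key)
  show "0 < 3 * kp * d" using kd unfolding mult.assoc by linarith
  show "dist x x + d <= 2 / kp * (3 * kp * d)" unfolding ** using d by simp
  show "dist x x + 3 * kp * d <= r" using kd unfolding r_def mult.assoc dist_self by linarith
 qed
 have *: "2 / kp * (3 * kp * dU y) = 6 * dU y" using k by (simp add: field_simps)
 have 2: "(bx y - a)^2 <= DD (2 / kp) * c / vol x d" unfolding bx_def
 proof (rule key)
  show "0 < 3 * kp * dU y" using kd kdy unfolding mult.assoc by linarith
  show "dist y x + d <= 2 / kp * (3 * kp * dU y)" unfolding *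
   using xy kd dy d unfolding d_def[symmetric] dist_commute[of y x] by linarith
  have "3 * kp * dU y <= 6 * kp * d" using kdy unfolding mult.assoc by linarith
  thus "dist x y + 3 * kp * dU y <= r" using xy unfolding r_def d_def[symmetric] mult.assoc by linarith
 qed
 have "(bx x - bx y)^2 <= 2 * (bx x - a)^2 + 2 * (bx y - a)^2"
  using sum_squares_bound[of "bx x - a" "- (bx y - a)"] by (simp add: power2_eq_square algebra_simps)
 also have "... <= 2 * (DD (2 / kp) * c / vol x d) + 2 * (DD (2 / kp) * c / vol x d)" using 1 2 by (intro add_mono mult_left_mono) auto
 also have "... = cS * Ps d / vol x d * eU (ball x (d / 2))" by (simp add: cS_def c_def algebra_simps)
 finally show ?thesis by (simp add: d_def)
qed

text \<open>Along a uniform curve heights stay comparable to rh, so a net of mesh comparable to rh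
  has boundedly many points, and consecutive averages differ by one application of
  \<open>bx_step\<close>.\<close>

lemma bx_chain:
 assumes x: "x : U" "y : U" and rh: "rh > 0" and a: "0 < a" and L: "L >= 1"
  and d: "a * rh <= dU x" "a * rh <= dU y" "dist x y <= L * rh" "dU x <= L * rh"
 shows "(bx x - bx y)^2 <= chC a L * Ps rh / vol x rh * eU (tube a L x rh)"
proof -
 have A: "A >= 1" and k: "kp > 0" "27 * kp < 1" by (rule cst)+
 obtain \<gamma> where g: "path \<gamma>" "pathstart \<gamma> = x" "pathfinish \<gamma> = y" "path_image \<gamma> <= U"
  "!!z. z : path_image \<gamma> ==> dist x z <= A * dist x y" "!!z. z : path_image \<gamma> ==> min (dist x z) (dist y z) <= A * dU z"
  by (rule uniform_path[OF x]) (rule that, assumption+)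
 define S where "S = path_image \<gamma>"
 define b where "b = a / (2 * A)"
 have b: "b > 0" using a A by (simp add: b_def)
 have AL: "0 < A * L * rh" "1 <= A * L" using A L rh mult_mono[of 1 A 1 L] by auto
 have Sx: "dist x z <= A * L * rh" if "z : S" for z
 proof -
  have "A * dist x y <= A * (L * rh)" using d(3) A by (intro mult_left_mono) auto
  thus ?thesis using g(5)[of z] that by (simp add: S_def mult.assoc)
 qed
 \<comment> \<open>A point of the curve with small height would be close to one of the ends by
   uniformity, and so inherit half of that end's height.\<close>
 have Sb: "b * rh <= dU z" if z: "z : S" for z
 proof (rule ccontr)
  assume n: "~ b * rh <= dU z"
  have "A * dU z < a * rh / 2" using n A by (simp add: b_def field_simps)
  hence "min (dist x z) (dist y z) < a * rh / 2" using g(6)[of z] z by (simp add: S_def)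
  moreover have "b * rh <= a * rh / 2" using A a rh by (simp add: b_def field_simps)
  ultimately show False using n d(1,2) dU_lip[of x z] dU_lip[of y z] by (auto simp: min_def dist_commute split: if_splits)
 qed
 have Sd: "dU z <= 2 * A * L * rh" if "z : S" for z
 proof -
  have "L * rh <= A * L * rh" using A L rh by (simp add: mult_le_cancel_right1)
  thus ?thesis using Sx[OF that] dU_lip[of z x] d(4) by (simp add: dist_commute)
 qed
 have SU: "S <= U" and xS: "x : S" and yS: "y : S" using g by (auto simp: S_def)
 \<comment> \<open>Fine enough that each net ball is within Whitney range of its centre.\<close>
 define sg where "sg = kp * b * rh"
 have sg: "sg > 0" using k b rh by (simp add: sg_def)
 have bS: "bounded S" unfolding S_def by (rule bounded_path_image[OF g(1)])
 obtain N where N: "finite N" "N <= S" "!!p q. p : N ==> q : N ==> p ~= q ==> sg <= dist p q" "S <= (UN p:N. ball p sg)"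
  by (rule net[OF bS sg]) (rule that, assumption+)
 have cN: "real (card N) <= chM a L" unfolding chM_def
 proof (rule count(2)[where c = "%p. p" and sg = "sg / 2" and z = x and R' = "A * L * rh"])
  show "2 * (A * L * rh) + sg / 2 <= (8 * A^2 * L / (kp * a) + 1) * (sg / 2)"
   using k a A rh by (simp add: sg_def b_def field_simps power2_eq_square)
 qed (use sg N half_balls Sx in auto)
 define w where "w = cS * PK (2 * A * L) * DD (2 * A * (A * L + 1) / a) * Ps rh / vol x rh * eU (tube a L x rh)"
 have cS0: "cS >= 0" using cst(3) DD(1)[of "2/kp"] by (simp add: cS_def)
 have PKb: "PK (2 * A * L) >= 1" "Ps (2 * A * L * rh) <= PK (2 * A * L) * Ps rh" using PK[of "2 * A * L"] AL rh by auto
 have w0: "w >= 0" using cS0 PKb DD(1)[of "2 * A * (A * L + 1) / a"] Psi_pos[OF rh] vol_pos[OF rh, of x] eU_nonneg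
  unfolding w_def by (intro mult_nonneg_nonneg divide_nonneg_nonneg) auto
 have st: "abs (bx p - bx z) <= sqrt w" if p: "p : S" "dist p z <= sg" for p z
 proof -
  have pU: "p : U" using p SU by blast
  have dp: "dU p > 0" using pU dU_pos by simp
  have "sg <= kp * dU p" using Sb[OF p(1)] k by (simp add: sg_def mult.assoc)
  hence "(bx p - bx z)^2 <= cS * Ps (dU p) / vol p (dU p) * eU (ball p (dU p / 2))" using p by (intro bx_step pU) simp
  also have "... <= cS * (PK (2 * A * L) * Ps rh) * (DD (2 * A * (A * L + 1) / a) / vol x rh) * eU (tube a L x rh)"
  proof (intro mult_mono)
   show "cS * Ps (dU p) / vol p (dU p) <= cS * (PK (2 * A * L) * Ps rh) * (DD (2 * A * (A * L + 1) / a) / vol x rh)"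
   proof -
    have 1: "Ps (dU p) <= PK (2 * A * L) * Ps rh" using Psi_mono[OF dp Sd[OF p(1)]] PKb by simp
    have "vol x rh <= DD (2 * A * (A * L + 1) / a) * vol p (dU p)"
    proof (rule DD(2)[OF dp])
     have "dist x p + rh <= (A * L + 1) * rh" using Sx[OF p(1)] by (simp add: algebra_simps)
     also have "... = 2 * A * (A * L + 1) / a * (b * rh)" using A a by (simp add: b_def)
     also have "... <= 2 * A * (A * L + 1) / a * dU p" using Sb[OF p(1)] AL A a by (intro mult_left_mono) auto
     finally show "dist x p + rh <= 2 * A * (A * L + 1) / a * dU p" .
    qed
    hence 2: "1 / vol p (dU p) <= DD (2 * A * (A * L + 1) / a) / vol x rh"
     using vol_pos[OF dp, of p] vol_pos[OF rh, of x] by (simp add: field_simps)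
    have "cS * Ps (dU p) * (1 / vol p (dU p)) <= cS * (PK (2 * A * L) * Ps rh) * (DD (2 * A * (A * L + 1) / a) / vol x rh)"
     using 1 2 cS0 Psi_pos[OF dp] vol_pos[OF dp, of p] PKb Psi_pos[OF rh] by (intro mult_mono) auto
    thus ?thesis by simp
   qed
   show "eU (ball p (dU p / 2)) <= eU (tube a L x rh)"
   proof (rule eU_mono[OF _ tube_borel])
    show "ball p (dU p / 2) <= tube a L x rh"
    proof
     fix v assume v: "v : ball p (dU p / 2)"
     have vU: "v : U" using v ball_U[of "dU p / 2" p] dp by auto
     have "dist x v <= A * L * rh + dU p / 2" using v Sx[OF p(1)] dist_triangle[of x v p] by simp
     moreover have "dU p / 2 <= dU v" using v dU_lip[of p v] by simp
     moreover have "a / (4 * A) * rh = b * rh / 2" by (simp add: b_def)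
     ultimately show "v : tube a L x rh" using vU Sd[OF p(1)] Sb[OF p(1)] unfolding tube_def mem_Collect_eq mult.assoc by (intro conjI) linarith+
    qed
   qed
  qed (use cS0 PKb DD(1)[of "2 * A * (A * L + 1) / a"] Psi_pos[OF rh] vol_pos[OF rh, of x] eU_nonneg in auto)
  also have "... = w" by (simp add: w_def)
  finally show ?thesis by (metis real_sqrt_abs real_sqrt_le_mono)
 qed
 have chain: "abs (bx p - bx q) <= 2 * sqrt w * real (card N ^ 2)" if "p : N" "q : N" for p q
 proof (rule connected_chain[OF _ N(1,2,4) sg _ _ that])
  show "connected S" unfolding S_def by (rule connected_path_image[OF g(1)])
  fix p q assume p: "p : N" "q : N" "ball p sg Int ball q sg Int S ~= {}"
  then obtain z where z: "dist p z < sg" "dist q z < sg" by auto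
  show "abs (bx p - bx q) <= 2 * sqrt w" using st[OF subsetD[OF N(2) p(1)], of z] st[OF subsetD[OF N(2) p(2)], of z] z by simp
 qed (use w0 in auto)
 obtain p where p: "p : N" "dist p x < sg" using N(4) xS by auto
 obtain q where q: "q : N" "dist q y < sg" using N(4) yS by auto
 have "abs (bx x - bx y) <= 2 * sqrt w + 2 * sqrt w * real (card N ^ 2)"
  using st[OF subsetD[OF N(2) p(1)], of x] st[OF subsetD[OF N(2) q(1)], of y] chain[OF p(1) q(1)] p(2) q(2) by simp
 also have "... <= 2 * sqrt w + 2 * sqrt w * (chM a L)^2"
  using cN w0 by (intro add_left_mono mult_left_mono) (auto intro!: power_mono)
 also have "... = (2 + 2 * (chM a L)^2) * sqrt w" by (simp add: algebra_simps)
 finally have "abs (bx x - bx y)^2 <= ((2 + 2 * (chM a L)^2) * sqrt w)^2" by (intro power_mono) auto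
 also have "... = (2 + 2 * (chM a L)^2)^2 * w" using w0 by (simp add: power_mult_distrib)
 also have "... = chC a L * Ps rh / vol x rh * eU (tube a L x rh)" by (simp add: w_def chC_def)
 finally show ?thesis by simp
qed

end

end

text \<open>With this and the next two lemmas, bounds on open sets are checked on compact subsets
  only, where finitely many Whitney balls suffice.\<close>

lemma (in hk) emeasure_exhaust:
 assumes M: "sets M = sets borel" and W: "open (W :: 'a set)" and c: "!!K. compact K ==> K <= W ==> emeasure M K <= c"
 shows "emeasure M W <= c"
proof -
 obtain K where K: "!!n::nat. compact (K n)" "!!n. K n <= W" "incseq (%n. interior (K n))" "(\<Union>n. interior (K n)) = W"
  by (rule exhaust_incr[OF W]) (rule that, assumption+)
 have "range (%n. interior (K n)) <= sets M" by (simp add: M image_subset_iff)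
 from SUP_emeasure_incseq[OF this K(3)] have "emeasure M W = (SUP n. emeasure M (interior (K n)))" by (simp only: K(4))
 also have "... <= c"
 proof (intro SUP_least)
  fix n
  have "K n : sets M" using K(1) M by (simp add: compact_imp_closed)
  hence "emeasure M (interior (K n)) <= emeasure M (K n)" by (intro emeasure_mono interior_subset)
  thus "emeasure M (interior (K n)) <= c" using c[OF K(1,2), of n] by (rule order_trans)
 qed
 finally show ?thesis .
qed

lemma (in hk) nn_integral_exhaust:
 assumes g: "g : borel_measurable borel" and W: "open (W :: 'a set)" and c: "!!K. compact K ==> K <= W ==> (\<integral>\<^sup>+x\<in>K. g x \<partial>m) <= c"
 shows "(\<integral>\<^sup>+x\<in>W. g x \<partial>m) <= c"
proof -
 have gm: "g : borel_measurable m" using g by (simp add: measurable_def)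
 have e: "emeasure (density m g) S = (\<integral>\<^sup>+x\<in>S. g x \<partial>m)" if "S : sets borel" for S using gm that by (intro emeasure_density) auto
 have "emeasure (density m g) W <= c"
  by (rule emeasure_exhaust) (use W c in "auto simp: e compact_imp_closed")
 thus ?thesis using W by (simp add: e)
qed

lemma (in hk) LE_exhaust:
 assumes V: "open V" "f : FL V" and W: "open W" "W <= V" and c: "!!K. compact K ==> K <= W ==> LE V f K <= c"
 shows "LE V f W <= c"
proof -
 obtain K where K: "!!n::nat. compact (K n)" "!!n. K n <= W" "incseq (%n. interior (K n))" "(\<Union>n. interior (K n)) = W"
  by (rule exhaust_incr[OF W(1)]) (rule that, assumption+)
 have "LE V f W = (SUP n. LE V f (W Int interior (K n)))"
  by (rule LE_SUP[OF V K(3) _ K(4) W(2)]) (use W in auto)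
 also have "... <= c"
 proof (intro SUP_least)
  fix n
  have "LE V f (W Int interior (K n)) <= LE V f (K n)"
   by (rule LE_mono[OF V]) (use K(1)[of n] K(2)[of n] W interior_subset[of "K n"] in "auto simp: compact_imp_closed")
  also have "... <= c" by (rule c[OF K(1,2)])
  finally show "LE V f (W Int interior (K n)) <= c" .
 qed
 finally show ?thesis .
qed

lemma (in hk) nn_shift: assumes [measurable]: "f : borel_measurable borel" "S : sets borel"
 shows "sqi S (%x. f x - av) <= 2 * (sqi S (%x. f x - \<beta>)) + ennreal (2 * (\<beta> - av)^2) * emeasure m S"
proof -
 have f: "f : borel_measurable m" and S: "S : sets m" using assms by (simp_all add: measurable_def)
 have p: "(f x - av)^2 <= 2 * (f x - \<beta>)^2 + 2 * (\<beta> - av)^2" for x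
  using sum_squares_bound[of "f x - \<beta>" "\<beta> - av"] by (simp add: power2_eq_square algebra_simps)
 have "sqi S (%x. f x - av) <= (\<integral>\<^sup>+x. 2 * (ennreal ((f x - \<beta>)^2) * indicator S x) + ennreal (2 * (\<beta> - av)^2) * indicator S x \<partial>m)"
 proof (rule nn_integral_mono)
  fix x
  have "ennreal ((f x - av)^2) <= ennreal (2 * (f x - \<beta>)^2 + 2 * (\<beta> - av)^2)" by (rule ennreal_leI[OF p])
  also have "... = 2 * ennreal ((f x - \<beta>)^2) + ennreal (2 * (\<beta> - av)^2)" by (simp add: ennreal_plus ennreal_mult)
  finally show "ennreal ((f x - av)^2) * indicator S x <= 2 * (ennreal ((f x - \<beta>)^2) * indicator S x) + ennreal (2 * (\<beta> - av)^2) * indicator S x"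
   by (auto simp: indicator_def)
 qed
 also have "... = 2 * (sqi S (%x. f x - \<beta>)) + ennreal (2 * (\<beta> - av)^2) * emeasure m S"
  using f S by (subst nn_integral_add) (auto simp: nn_integral_cmult nn_integral_cmult_indicator)
 finally show ?thesis .
qed

context ext
begin

text \<open>The balls of Whitney radius are disjoint and have comparable volume to the balls of full
  height, and all lie in one ball around z.\<close>

lemma vol_sum:
 assumes rh: "rh > 0" and Y: "finite Y" "Y <= XU" "!!x. x : Y ==> dist z x <= L * rh & dU x <= L * rh"
 shows "(SUM x:Y. vol x (dU x)) <= DD (1 / kp) * DD (2 * L) * vol z rh"
proof -
 have k: "kp > 0" "27 * kp < 1" by (rule cst)+
 have d: "dU x > 0" "kp * dU x <= dU x" if "x : Y" for x
 proof -
  show "dU x > 0" using that Y(2) XU(1)[of x] dU_pos[of x] by blast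
  thus "kp * dU x <= dU x" using k by simp
 qed
 have "(SUM x:Y. vol x (dU x)) <= (SUM x:Y. DD (1 / kp) * vol x (kp * dU x))"
  using d k by (intro sum_mono DD(2)) auto
 also have "... = DD (1 / kp) * measure m (UN x:Y. ball x (kp * dU x))" unfolding sum_distrib_left[symmetric]
 proof (subst measure_finite_Union)
  show "disjoint_family_on (%x. ball x (kp * dU x)) Y" using XU(2) Y(2) unfolding disjoint_family_on_def by blast
  show "emeasure m (ball x (kp * dU x)) ~= \<infinity>" for x using bounded_fin[of "ball x (kp * dU x)"] by auto
 qed (use Y in "auto simp: vol_def")
 also have "... <= DD (1 / kp) * vol z (2 * L * rh)" unfolding vol_def
 proof (intro mult_left_mono measure_mono_b)
  show "(UN x:Y. ball x (kp * dU x)) <= ball z (2 * L * rh)"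
  proof
   fix w assume "w : (UN x:Y. ball x (kp * dU x))"
   then obtain x where x: "x : Y" "dist x w < kp * dU x" by auto
   hence "dist z w < 2 * L * rh" using Y(3)[OF x(1)] d[OF x(1)] dist_triangle[of z w x] unfolding mult.assoc by linarith
   thus "w : ball z (2 * L * rh)" by simp
  qed
 qed (use DD(1)[of "1 / kp"] in "auto intro!: borel_open open_UN")
 also have "... <= DD (1 / kp) * (DD (2 * L) * vol z rh)" using DD(1)[of "1 / kp"] by (intro mult_left_mono DD(2) rh) auto
 finally show ?thesis by simp
qed

text \<open>\<open>tC\<close> is the overlap of tubes attached to Whitney centres. In
  \<open>cR\<close> the first summand is the cost of the climbs and the second that of joining their
  tops to one reference point; \<open>cU\<close> adds the PI on each Whitney ball.\<close>

definition "tC a L = DD (2 * (8 * A^2 * L / a) / (kp * (1 / (1 + 2 * A * L))) + 1)"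
definition "cR = DD (1 / kp) * DD (14 * A) * chC 1 (6 * A) * PL * 4 * tC 1 (6 * A) + 2 * DD (1 / kp) * DD (8 * A) * chC 1 (39 * A^2)"
definition "cU = 2 * CP * tC 1 1 + 2 * cR"

lemma tC: "tC a L >= 1" by (simp add: tC_def DD)

lemma chC1: "1 <= L ==> 0 <= chC a L" 
 using cst(1) mult_mono[of 1 A 1 L] by (intro chC) simp

lemma cU: "cR >= 0" "cU >= 0"
proof -
 have "1 <= 6 * A" "1 <= 39 * A^2" using cst(1) one_le_power[OF cst(1), of 2] by linarith+
 from this[THEN chC1] have "chC 1 (6 * A) >= 0" "chC 1 (39 * A^2) >= 0" .
 thus "cR >= 0" unfolding cR_def using DD(1) PL(1) tC
  by (intro add_nonneg_nonneg mult_nonneg_nonneg) (auto intro: order_trans[OF zero_le_one] less_imp_le)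
 thus "cU >= 0" unfolding cU_def using cst(3) tC[of 1 1] by (intro add_nonneg_nonneg mult_nonneg_nonneg) auto
qed

context
 fixes f assumes fU: "f : FL U" and fm: "f : borel_measurable borel" and ffin: "LE U f U < \<infinity>"
begin

abbreviation "eu == eU f"
abbreviation "bb == bx f"
lemmas eu_nonneg = eU_nonneg[OF fU fm ffin] and eu_mono = eU_mono[OF fU fm ffin] and LE_eu = LE_eU[OF fU fm ffin]
 and bb_chain = bx_chain[OF fU fm ffin]

text \<open>If z lies in the tube of x, then height of x and distance to x are comparable to the
  height of z, so few Whitney centres qualify.\<close>

lemma tube_sum:
 assumes Y: "finite Y" "Y <= XU" "!!x. x : Y ==> tube a L x (dU x) <= S" and S: "S : sets borel" "S <= U" and a: "0 < a" "L >= 1"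
 shows "(SUM x:Y. eu (tube a L x (dU x))) <= tC a L * eu S"
 unfolding eU_def[OF fU fm ffin]
proof (rule measure_overlap[OF LE_fin[OF fU fm ffin] Y(1)])
 have A: "A >= 1" by (rule cst)
 have AL: "A * L > 0" using A a by simp
 fix z assume z: "z : S"
 have zp: "dU z > 0" using z S(2) dU_pos by blast
 show "real (card {x:Y. z : tube a L x (dU x)}) <= tC a L" unfolding tC_def
 proof (rule XU_count(2)[OF zp, where z = z])
  show "0 < 1 / (1 + 2 * A * L)" using AL by (simp add: add_pos_pos)
  fix x assume "x : {x:Y. z : tube a L x (dU x)}"
  hence t: "dist x z <= 2 * A * L * dU x" "a / (4 * A) * dU x <= dU z" by (auto simp: tube_def)
  have "dU x <= 4 * A / a * dU z" using t(2) a A by (simp add: field_simps)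
  hence "2 * A * L * dU x <= 2 * A * L * (4 * A / a * dU z)" using AL by (intro mult_left_mono) auto
  hence 1: "dist z x <= 8 * A^2 * L / a * dU z" using t(1) by (simp add: dist_commute power2_eq_square algebra_simps)
  have "dU z <= (1 + 2 * A * L) * dU x" using dU_lip[of z x] t(1) by (simp add: dist_commute algebra_simps)
  hence "1 / (1 + 2 * A * L) * dU z <= dU x" using AL by (simp add: field_simps add_pos_pos)
  with 1 show "dist z x <= 8 * A^2 * L / a * dU z & 1 / (1 + 2 * A * L) * dU z <= dU x" ..
 qed (use Y(2) in auto)
qed (use Y S tube_borel tC[of a L] in "auto simp: sets_LE[OF U_facts(1) fU]")

text \<open>The bound of \<open>bx_chain\<close> for the squared jump of the averages between e and
  its parent.\<close>

definition "DE e = chC 1 (6 * A) * Ps (dU e) / vol e (dU e) * eu (tube 1 (6 * A) e (dU e))"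

lemma DE_nonneg: "e : XU ==> 0 <= DE e"
 using chC1[of "6 * A" 1] cst(1) Psi_pos[of "dU e"] vol_pos[of "dU e" e] eu_nonneg dU_pos[of e] XU(1)[of e] unfolding DE_def
 by (intro mult_nonneg_nonneg divide_nonneg_nonneg) (auto simp: less_imp_le)

text \<open>Climbing away from the boundary, the distances at least double, so the weights along the climb sum up geometrically.\<close>

lemma tree:
 assumes q: "q > 0" "ereal (16 * A * q) < ediam U"
 shows "x : XU ==> dU x <= 6 * A * q ==> q < 2^n * dU x ==>
  EX S t. finite S & S <= XU & t : XU & q < dU t & dU t <= 6 * A * q & dist x t <= 6 * A * (dU t - dU x) &
   (ALL e:S. dU e <= q & dU x <= dU e & dist x e <= 6 * A * (dU e - dU x)) &
   (SUM e:S. dU e) <= (if dU x <= q then 2 * q - dU x else 0) & abs (bb x - bb t) <= (SUM e:S. sqrt (DE e))"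
proof (induction n arbitrary: x)
 case 0
 thus ?case by (intro exI[of _ "{}"] exI[of _ x]) auto
next
 case (Suc n)
 have A: "A >= 1" by (rule cst)
 show ?case
 proof (cases "dU x <= q")
  case False
  thus ?thesis using Suc.prems by (intro exI[of _ "{}"] exI[of _ x]) auto
 next
  case True
  have xU: "x : U" and xp: "dU x > 0" using Suc.prems(1) XU(1) dU_pos by blast+
  have "ereal (2 * (8 * A * q)) < ediam U" using q(2) by (rule subst[rotated, where P = "%t. ereal t < ediam U"]) simp
  then obtain w where w: "w : U" "8 * A * q <= dist x w" by (rule far_point[OF xU])
  have AR: "A * dU x <= A * q" using True A by simp
  obtain y where y: "y : XU" "2 * dU x <= dU y" "dU y <= 6 * A * dU x" "dist x y <= 6 * A * dU x"
   by (rule parent[OF xU w(1)]) (use w(2) AR in "auto simp: mult.assoc intro: that")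
  have y6: "dU y <= 6 * A * q" using y(3) AR by (simp add: mult.assoc)
  have "q < 2^n * dU y" using Suc.prems(3) mult_left_mono[OF y(2), of "2^n"] zero_le_power[of "2::real" n] unfolding power_Suc by linarith
  from Suc.IH[OF y(1) y6 this] obtain S t where S: "finite S" "S <= XU" "t : XU" "q < dU t" "dU t <= 6 * A * q" "dist y t <= 6 * A * (dU t - dU y)"
   "ALL e:S. dU e <= q & dU y <= dU e & dist y e <= 6 * A * (dU e - dU y)"
   "(SUM e:S. dU e) <= (if dU y <= q then 2 * q - dU y else 0)" "abs (bb y - bb t) <= (SUM e:S. sqrt (DE e))" by blast
  have xS: "x ~: S" using S(7) y(2) xp by auto
  have c: "dist x e <= 6 * A * (dU e - dU x)" if "dist y e <= 6 * A * (dU e - dU y)" for e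
  proof -
   have "6 * A * (2 * dU x) <= 6 * A * dU y" using y(2) A by (intro mult_left_mono) auto
   thus ?thesis using dist_triangle[of x e y] y(4) that by (simp add: algebra_simps)
  qed
  have yU: "y : U" using y(1) XU(1) by blast
  have "(bb x - bb y)^2 <= DE x" unfolding DE_def
   by (rule bb_chain[OF xU yU xp]) (use y A xp in "auto simp: mult_le_cancel_right1")
  hence "abs (bb x - bb y) <= sqrt (DE x)" by (metis real_sqrt_abs real_sqrt_le_mono)
  hence d: "abs (bb x - bb t) <= (SUM e:insert x S. sqrt (DE e))" using S(1,9) xS by simp
  have s: "(SUM e:insert x S. dU e) <= 2 * q - dU x" using S(1,8) xS y(2) True by (auto split: if_splits)
  show ?thesis
   by (intro exI[of _ "insert x S"] exI[of _ t] conjI)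
    (use S Suc.prems(1) c d s True y(2) xp in auto)
 qed
qed

text \<open>Cauchy-Schwarz with the heights as weights: their sum along the climb is at most 2q
  because they at least double. What remains is a sum of jumps divided by heights, which can be
  summed over all starting points.\<close>

lemma tree_sq:
 assumes q: "q > 0" "ereal (16 * A * q) < ediam U" and x: "x : XU" "dU x <= q"
 shows "EX S. finite S & S <= XU & (ALL e:S. dU e <= q & dU x <= dU e & dist x e <= 6 * A * dU e) &
  (EX t:XU. q < dU t & dU t <= 6 * A * q & dist x t <= 36 * A^2 * q & (bb x - bb t)^2 <= 2 * q * (SUM e:S. DE e / dU e))"
proof -
 have A: "A >= 1" by (rule cst)
 have xp: "dU x > 0" using x XU(1) dU_pos by blast
 obtain n where "q / dU x < 2^n" using ex_pow2_gt by blast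
 hence n: "q < 2^n * dU x" using xp by (simp add: field_simps)
 have "1 * q <= 6 * A * q" using A q by (intro mult_right_mono) auto
 hence x6: "dU x <= 6 * A * q" using x by linarith
 from tree[OF q x(1) x6 n] x(2) obtain S t where S: "finite S" "S <= XU" "t : XU" "q < dU t" "dU t <= 6 * A * q" "dist x t <= 6 * A * (dU t - dU x)"
  "ALL e:S. dU e <= q & dU x <= dU e & dist x e <= 6 * A * (dU e - dU x)" "(SUM e:S. dU e) <= 2 * q - dU x" "abs (bb x - bb t) <= (SUM e:S. sqrt (DE e))" by auto
 have ep: "dU e > 0" "0 <= DE e" if "e : S" for e using that S(2) XU(1) dU_pos DE_nonneg by blast+
 have "(bb x - bb t)^2 <= (SUM e:S. sqrt (dU e) * sqrt (DE e / dU e))^2"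
 proof -
  have "(SUM e:S. sqrt (DE e)) = (SUM e:S. sqrt (dU e) * sqrt (DE e / dU e))"
   using ep by (intro sum.cong refl) (simp add: real_sqrt_mult[symmetric] less_imp_neq[symmetric])
  thus ?thesis using power_mono[OF S(9), of 2] by simp
 qed
 also have "... <= (SUM e:S. (sqrt (dU e))^2) * (SUM e:S. (sqrt (DE e / dU e))^2)" by (rule Cauchy_Schwarz_ineq_sum)
 also have "... = (SUM e:S. dU e) * (SUM e:S. DE e / dU e)"
  using ep by (intro arg_cong2[of _ _ _ _ "(*)"] sum.cong refl) (simp_all add: less_imp_le)
 also have "... <= 2 * q * (SUM e:S. DE e / dU e)" using S(8) xp ep by (intro mult_right_mono sum_nonneg) (auto simp: less_imp_le)
 finally have sq: "(bb x - bb t)^2 <= 2 * q * (SUM e:S. DE e / dU e)" .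
 have "dist x e <= 6 * A * dU e" if "dist x e <= 6 * A * (dU e - dU x)" for e using that mult_pos_pos[of A "dU x"] A xp unfolding right_diff_distrib mult.assoc by linarith
 moreover have "6 * A * dU t <= 6 * A * (6 * A * q)" using S(5) A by (intro mult_left_mono) auto
 hence "dist x t <= 36 * A^2 * q" using calculation[OF S(6)] by (simp add: power2_eq_square algebra_simps)
 ultimately show ?thesis using S sq by blast
qed

text \<open>The reference value is the average at one point z of height about q near the boundary
  point. Every Whitney centre climbs to height q, and all tops are joined to z by single chains.
  Both the value and the bound are uniform over finite sets of centres.\<close>

lemma near_average:
 assumes \<xi>: "\<xi> : frontier U" and q: "q > 0" "ereal (16 * A * q) < ediam U"
 obtains av where "!!Y. finite Y ==> Y <= XU ==> (!!x. x : Y ==> dist \<xi> x <= q) ==>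
  (SUM x:Y. vol x (dU x) * (bb x - av)^2) <= cR * Ps q * eu (U Int ball \<xi> (100 * A^3 * q))"
proof -
 have A: "A >= 1" by (rule cst)
 define W where "W = U Int ball \<xi> (100 * A^3 * q)"
 have W: "W : sets borel" "W <= U" using U_facts(1) by (auto simp: W_def)
 have AR: "q <= A * q" "A * q <= A^2 * q" "A^2 * q <= A^3 * q" using A q(1) power_increasing[of 1 2 A] power_increasing[of 2 3 A] by (auto intro!: mult_right_mono simp: mult_le_cancel_right1)
 have PR: "Ps q > 0" by (rule Psi_pos[OF q(1)])
 obtain x0 where x0: "x0 : U" "dist \<xi> x0 < q" by (rule near_point[OF \<xi> q(1)])
 have "ereal (2 * (8 * A * q)) < ediam U" using q(2) by (rule subst[rotated, where P = "%t. ereal t < ediam U"]) simp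
 then obtain y0 where y0: "y0 : U" "8 * A * q <= dist x0 y0" by (rule far_point[OF x0(1)])
 have y2: "2 * (A * q) <= dist x0 y0" using y0(2) AR q(1) unfolding mult.assoc by linarith
 have Aq: "A * q > 0" using AR q(1) by linarith
 obtain z where z: "z : U" "dist x0 z = A * q" "A * q <= A * dU z"
  by (rule climb[OF x0(1) y0(1) y2 Aq])
 \<comment> \<open>The climb of length A q guarantees height q at z, the scale at which the other
   climbs end.\<close>
 have zR: "q <= dU z" using z(3) A by simp
 have xz: "dist \<xi> z <= 2 * A * q" using dist_triangle[of \<xi> z x0] x0(2) z(2) AR unfolding mult.assoc by linarith
 have z2: "dU z <= 2 * A * q" using dU_frontier[OF \<xi>, of z] xz by simp
 define \<tau> where "\<tau> = chC 1 (39 * A^2) * Ps q / vol z q * eu (tube 1 (39 * A^2) z q)"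
 have L: "39 * A^2 >= 1" using one_le_power[OF A, of 2] by simp
 have v: "vol z q > 0" by (rule vol_pos[OF q(1)])
 have c0: "chC 1 (6 * A) >= 0" "chC 1 (39 * A^2) >= 0" using A L by (auto intro!: chC1)
 have \<tau>0: "\<tau> >= 0" using c0 PR v eu_nonneg by (auto simp: \<tau>_def)
 have \<tau>W: "vol z q * \<tau> <= chC 1 (39 * A^2) * Ps q * eu W"
 proof -
  have "tube 1 (39 * A^2) z q <= W"
  proof
   fix w assume w: "w : tube 1 (39 * A^2) z q"
   hence "dist z w <= 78 * A^3 * q" by (simp add: tube_def power2_eq_square power3_eq_cube)
   hence "dist \<xi> w < 100 * A^3 * q" using xz AR dist_triangle[of \<xi> w z] q(1) unfolding mult.assoc by linarith
   thus "w : W" using w by (simp add: tube_def W_def)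
  qed
  hence "chC 1 (39 * A^2) * Ps q * eu (tube 1 (39 * A^2) z q) <= chC 1 (39 * A^2) * Ps q * eu W"
   using W c0 PR by (intro mult_left_mono eu_mono) auto
  thus ?thesis using v by (simp add: \<tau>_def)
 qed
 show ?thesis
 proof (rule that)
  fix Y assume Y: "finite Y" "Y <= XU" "!!x. x : Y ==> dist \<xi> x <= q"
  have yR: "dU x <= q" if "x : Y" for x using Y(3)[OF that] dU_frontier[OF \<xi>, of x] by simp
  have yp: "vol x (dU x) > 0" if "x : Y" for x using that Y(2) XU(1) dU_pos by (intro vol_pos) blast
  have "ALL x:Y. EX S. finite S & S <= XU & (ALL e:S. dU e <= q & dU x <= dU e & dist x e <= 6 * A * dU e) &
   (EX t:XU. q < dU t & dU t <= 6 * A * q & dist x t <= 36 * A^2 * q & (bb x - bb t)^2 <= 2 * q * (SUM e:S. DE e / dU e))"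
  proof
   fix x assume "x : Y"
   thus "EX S. finite S & S <= XU & (ALL e:S. dU e <= q & dU x <= dU e & dist x e <= 6 * A * dU e) &
    (EX t:XU. q < dU t & dU t <= 6 * A * q & dist x t <= 36 * A^2 * q & (bb x - bb t)^2 <= 2 * q * (SUM e:S. DE e / dU e))"
    by (intro tree_sq[OF q] subsetD[OF Y(2)] yR)
  qed
  from bchoice[OF this] obtain S where S0: "ALL x:Y. finite (S x) & S x <= XU & (ALL e:S x. dU e <= q & dU x <= dU e & dist x e <= 6 * A * dU e) &
   (EX t:XU. q < dU t & dU t <= 6 * A * q & dist x t <= 36 * A^2 * q & (bb x - bb t)^2 <= 2 * q * (SUM e:S x. DE e / dU e))" ..
  have S: "finite (S x)" "S x <= XU" "ALL e:S x. dU e <= q & dU x <= dU e & dist x e <= 6 * A * dU e"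
   "EX t:XU. q < dU t & dU t <= 6 * A * q & dist x t <= 36 * A^2 * q & (bb x - bb t)^2 <= 2 * q * (SUM e:S x. DE e / dU e)" if "x : Y" for x
   by (rule bspec[OF S0 that, THEN conjunct1], rule bspec[OF S0 that, THEN conjunct2, THEN conjunct1],
    rule bspec[OF S0 that, THEN conjunct2, THEN conjunct2, THEN conjunct1], rule bspec[OF S0 that, THEN conjunct2, THEN conjunct2, THEN conjunct2])
  define H where "H = (UN x:Y. S x)"
  have H: "finite H" "H <= XU" using Y(1) S(1,2) by (auto simp: H_def)
  have Hp: "dU e > 0" "0 <= DE e" if "e : H" for e using that H(2) XU(1) dU_pos DE_nonneg by blast+
  have one: "(bb x - bb z)^2 <= 4 * q * (SUM e:S x. DE e / dU e) + 2 * \<tau>" if x: "x : Y" for x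
  proof -
   obtain t where t: "t : XU" "q < dU t" "dU t <= 6 * A * q" "dist x t <= 36 * A^2 * q" "(bb x - bb t)^2 <= 2 * q * (SUM e:S x. DE e / dU e)"
    using S(4)[OF x] by blast
   have tU: "t : U" using t(1) XU(1) by blast
   have "dist z t <= 39 * A^2 * q"
    using dist_triangle[of z t \<xi>] dist_triangle[of \<xi> t x] xz t(4) Y(3)[OF x] AR unfolding dist_commute[of z \<xi>] mult.assoc by linarith
   hence "(bb z - bb t)^2 <= \<tau>" unfolding \<tau>_def
    proof (intro bb_chain[OF z(1) tU q(1) _ L])
    show "dU z <= 39 * A^2 * q" using z2 AR q(1) unfolding mult.assoc by linarith
   qed (use zR t(2) in auto)
   moreover have "(bb x - bb z)^2 <= 2 * (bb x - bb t)^2 + 2 * (bb z - bb t)^2"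
    using sum_squares_bound[of "bb x - bb t" "- (bb z - bb t)"] by (simp add: power2_eq_square algebra_simps)
   ultimately show ?thesis using t(5) by linarith
  qed
  have "(SUM x:Y. vol x (dU x) * (bb x - bb z)^2) <= (SUM x:Y. vol x (dU x) * (4 * q * (SUM e:S x. DE e / dU e) + 2 * \<tau>))"
   using one yp by (intro sum_mono mult_left_mono) (auto simp: less_imp_le)
  also have "... = 4 * q * (SUM x:Y. SUM e:S x. vol x (dU x) * (DE e / dU e)) + 2 * \<tau> * (SUM x:Y. vol x (dU x))"
   by (simp add: distrib_left sum.distrib sum_distrib_left mult_ac)
  \<comment> \<open>Summation is reversed: each jump is counted once for all starting points whose
    climb passes through e.\<close>
  also have "(SUM x:Y. SUM e:S x. vol x (dU x) * (DE e / dU e)) = (SUM e:H. SUM x:{x:Y. e : S x}. vol x (dU x) * (DE e / dU e))"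
  proof -
   have "(SUM x:Y. SUM e:S x. vol x (dU x) * (DE e / dU e)) = (SUM x:Y. SUM e:{e:H. e : S x}. vol x (dU x) * (DE e / dU e))"
    by (intro sum.cong refl) (auto simp: H_def)
   also have "... = (SUM e:H. SUM x:{x:Y. e : S x}. vol x (dU x) * (DE e / dU e))" by (rule sum.swap_restrict[OF Y(1) H(1)])
   finally show ?thesis .
  qed
  also have "4 * q * ... <= 4 * (DD (1 / kp) * DD (14 * A) * chC 1 (6 * A) * PL * Ps q * (tC 1 (6 * A) * eu W))"
  proof -
   \<comment> \<open>Those starting points are lower than e and close to it, so their total volume
     is at most a multiple of the volume at e and cancels the one in \<open>DE\<close>. The
     remaining factor q Psi(dU e) / dU e is bounded by PL Psi(q).\<close>
   have 1: "q * (SUM x:{x:Y. e : S x}. vol x (dU x) * (DE e / dU e)) <= DD (1 / kp) * DD (14 * A) * chC 1 (6 * A) * PL * Ps q * eu (tube 1 (6 * A) e (dU e))"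
    if e: "e : H" for e
   proof -
    note ep = Hp[OF e]
    have "dU e <= A * dU e" using A ep by simp
    hence "(SUM x:{x:Y. e : S x}. vol x (dU x)) <= DD (1 / kp) * DD (2 * (7 * A)) * vol e (dU e)"
     proof (intro vol_sum[OF ep(1)])
      fix x assume "x : {x:Y. e : S x}"
      hence "dU x <= dU e" "dist x e <= 6 * A * dU e" using S(3) by auto
      thus "dist e x <= 7 * A * dU e & dU x <= 7 * A * dU e" using \<open>dU e <= A * dU e\<close> ep unfolding dist_commute[of e x] mult.assoc by linarith
     qed (use Y in auto)
    hence "(SUM x:{x:Y. e : S x}. vol x (dU x)) * (q * DE e / dU e) <= DD (1 / kp) * DD (14 * A) * vol e (dU e) * (q * DE e / dU e)"
     using ep q by (intro mult_right_mono) auto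
    also have "... = DD (1 / kp) * DD (14 * A) * chC 1 (6 * A) * (q * Ps (dU e) / dU e) * eu (tube 1 (6 * A) e (dU e))"
     using vol_pos[OF ep(1), of e] by (simp add: DE_def)
    also have "... <= DD (1 / kp) * DD (14 * A) * chC 1 (6 * A) * (PL * Ps q) * eu (tube 1 (6 * A) e (dU e))"
    proof (intro mult_right_mono mult_left_mono eu_nonneg)
     obtain x where "x : Y" "e : S x" using e by (auto simp: H_def)
     hence "q * Ps (dU e) <= PL * dU e * Ps q" using bspec[OF S(3)] by (intro PL(2) ep) blast
     thus "q * Ps (dU e) / dU e <= PL * Ps q" using ep by (simp add: field_simps)
    qed (use DD(1)[of "1/kp"] DD(1)[of "14 * A"] c0 in "auto intro!: mult_nonneg_nonneg")
    finally show ?thesis by (simp add: sum_distrib_left sum_distrib_right mult_ac)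
   qed
   have "q * (SUM e:H. SUM x:{x:Y. e : S x}. vol x (dU x) * (DE e / dU e)) <= (SUM e:H. DD (1 / kp) * DD (14 * A) * chC 1 (6 * A) * PL * Ps q * eu (tube 1 (6 * A) e (dU e)))"
    unfolding sum_distrib_left[of q] using 1 by (intro sum_mono) (simp add: sum_distrib_left)
   also have "... = DD (1 / kp) * DD (14 * A) * chC 1 (6 * A) * PL * Ps q * (SUM e:H. eu (tube 1 (6 * A) e (dU e)))" by (simp add: sum_distrib_left)
   also have "... <= DD (1 / kp) * DD (14 * A) * chC 1 (6 * A) * PL * Ps q * (tC 1 (6 * A) * eu W)"
   proof (intro mult_left_mono tube_sum H W)
    fix e assume "e : H"
    then obtain x where x: "x : Y" "e : S x" by (auto simp: H_def)
    have e: "dU e <= q" "dist x e <= 6 * A * dU e" using bspec[OF S(3)[OF x(1)] x(2)] by auto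
    have eA: "A * dU e <= A * q" "A^2 * dU e <= A^2 * q" using e A by (auto intro!: mult_left_mono)
    show "tube 1 (6 * A) e (dU e) <= W"
    proof
     fix w assume w: "w : tube 1 (6 * A) e (dU e)"
     hence "dist e w <= 12 * (A^2 * dU e)" by (simp add: tube_def power2_eq_square algebra_simps)
     moreover have "dist \<xi> w <= dist \<xi> x + dist x e + dist e w" using dist_triangle[of \<xi> w x] dist_triangle[of x w e] by simp
     ultimately have "dist \<xi> w < 100 * A^3 * q" using Y(3)[OF x(1)] e(2) eA AR q unfolding mult.assoc by linarith
     thus "w : W" using w by (simp add: W_def tube_def)
    qed
   qed (use A DD(1)[of "1/kp"] DD(1)[of "14 * A"] c0 PL(1) PR in "auto intro!: mult_nonneg_nonneg simp: less_imp_le")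
   finally show ?thesis by simp
  qed
  also have "2 * \<tau> * (SUM x:Y. vol x (dU x)) <= 2 * \<tau> * (DD (1 / kp) * DD (2 * (4 * A)) * vol z q)"
  proof (intro mult_left_mono vol_sum[OF q(1) Y(1,2)])
   fix x assume x: "x : Y"
   show "dist z x <= 4 * A * q & dU x <= 4 * A * q" using yR[OF x] Y(3)[OF x] dist_triangle[of z x \<xi>] xz AR q(1) unfolding dist_commute[of z \<xi>] mult.assoc by (intro conjI) linarith+
  qed (use \<tau>0 in auto)
  also have "... = 2 * DD (1 / kp) * DD (8 * A) * (vol z q * \<tau>)" by simp
  also have "... <= 2 * DD (1 / kp) * DD (8 * A) * (chC 1 (39 * A^2) * Ps q * eu W)"
   using DD(1)[of "1/kp"] DD(1)[of "8 * A"] by (intro mult_left_mono \<tau>W) auto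
  finally show "(SUM x:Y. vol x (dU x) * (bb x - bb z)^2) <= cR * Ps q * eu (U Int ball \<xi> (100 * A^3 * q))"
   unfolding cR_def W_def[symmetric] by (simp only: algebra_simps)
 qed
qed

text \<open>PI on each tripled Whitney ball reduces the oscillation to that of the averages. The
  radius q/2 ensures that centres of balls meeting the region are within q of the boundary
  point.\<close>

lemma near_U:
 assumes \<xi>: "\<xi> : frontier U" and q: "q > 0"
  and av: "!!Y. finite Y ==> Y <= XU ==> (!!x. x : Y ==> dist \<xi> x <= q) ==>
   (SUM x:Y. vol x (dU x) * (bb x - av)^2) <= cR * Ps q * eu (U Int ball \<xi> (100 * A^3 * q))"
 shows "sqi (U Int ball \<xi> (q / 2)) (%x. f x - av) <= ennreal (cU * Ps q * eu (U Int ball \<xi> (100 * A^3 * q)))"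
proof (rule nn_integral_exhaust)
 note [measurable] = fm
 show "(%x. ennreal ((f x - av)^2)) : borel_measurable borel" by measurable
 show "open (U Int ball \<xi> (q / 2))" using U_facts(1) by auto
 have A: "A >= 1" and k: "kp > 0" "27 * kp < 1" "27 * (AP * kp) < 1" and P: "AP >= 1" "CP >= 1" by (rule cst)+
 have AR: "q <= A * q" "A * q <= A^2 * q" "A^2 * q <= A^3 * q" using A q(1) power_increasing[of 1 2 A] power_increasing[of 2 3 A] by (auto intro!: mult_right_mono simp: mult_le_cancel_right1)
 define W where "W = U Int ball \<xi> (100 * A^3 * q)"
 have W: "W : sets borel" "W <= U" using U_facts(1) by (auto simp: W_def)
 have PR: "Ps q > 0" by (rule Psi_pos[OF q(1)])
 fix K assume K: "compact K" "K <= U Int ball \<xi> (q / 2)"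
 have cov: "K <= (UN x:XU. ball x (3 * kp * dU x))"
 proof
  fix w assume "w : K"
  then obtain x where "x : XU" "dist x w < 3 * kp * dU x" using XU(3)[of w] K(2) by blast
  thus "w : (UN x:XU. ball x (3 * kp * dU x))" by (intro UN_I[of x]) auto
 qed
 obtain C where C: "C <= XU" "finite C" "K <= (UN x:C. ball x (3 * kp * dU x))"
  by (rule compactE_image[OF K(1) open_ball cov]) (rule that)
 define Y where "Y = {x:C. ball x (3 * kp * dU x) Int K ~= {}}"
 have Y: "finite Y" "Y <= XU" using C by (auto simp: Y_def)
 have KY: "K <= (UN x:Y. ball x (3 * kp * dU x))"
 proof
  fix w assume w: "w : K"
  with C(3) obtain x where "x : C" "w : ball x (3 * kp * dU x)" by blast
  with w show "w : (UN x:Y. ball x (3 * kp * dU x))" by (intro UN_I[of x]) (auto simp: Y_def)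
 qed
 have yd: "dU x > 0" "3 * kp * dU x <= dU x / 9" if "x : Y" for x
 proof -
  show p: "dU x > 0" using that Y(2) XU(1) dU_pos by blast
  have "27 * kp * dU x <= 1 * dU x" using k p by (intro mult_right_mono) auto
  thus "3 * kp * dU x <= dU x / 9" by simp
 qed
 have yR: "dist \<xi> x <= q" if x: "x : Y" for x
 proof -
  obtain w where w: "dist x w < 3 * kp * dU x" "w : K" using x by (auto simp: Y_def)
  hence "dist \<xi> w < q / 2" using K(2) by auto
  thus ?thesis using w(1) yd[OF x] dU_frontier[OF \<xi>, of x] dist_triangle[of \<xi> x w] unfolding dist_commute[of w x] by linarith
 qed
 have one: "(sqi (ball x (3 * kp * dU x)) (%y. f y - av))
   <= ennreal (2 * (CP * Ps q * eu (tube 1 1 x (dU x))) + 2 * (vol x (dU x) * (bb x - av)^2))" if x: "x : Y" for x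
 proof -
  let ?r = "3 * kp * dU x"
  note d = yd[OF x]
  have r: "?r > 0" using k d by simp
  have rq: "?r <= q" using d yR[OF x] dU_frontier[OF \<xi>, of x] by linarith
  have "27 * (AP * kp) * dU x <= 1 * dU x" using k d by (intro mult_right_mono) auto
  hence ar: "AP * ?r <= dU x / 9" by simp
  have "ball x (AP * ?r) <= tube 1 1 x (dU x)"
  proof
   fix w assume "w : ball x (AP * ?r)"
   hence w: "dist x w < dU x / 9" using ar by simp
   hence "w : U" using ball_U[of "dU x / 9" x] d by auto
   moreover have "dU x * 1 <= dU x * A" using A d by (intro mult_left_mono) auto
   hence "dist x w <= 2 * A * 1 * dU x" using w d unfolding mult.assoc mult_1_left mult_1_right mult.commute[of "dU x" A] by linarith
   moreover have "1 / (4 * A) * dU x <= 1 / 4 * dU x" using A d by (intro mult_right_mono) (auto simp: field_simps)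
   hence "1 / (4 * A) * dU x <= dU w" using dU_lip[of x w] w d(1) by (elim order_trans) linarith
   ultimately show "w : tube 1 1 x (dU x)" by (simp add: tube_def)
  qed
  hence "CP * Ps ?r * eu (ball x (AP * ?r)) <= CP * Ps q * eu (tube 1 1 x (dU x))"
   using P Psi_mono[OF r rq] PR tube_borel eu_nonneg Psi_pos[OF r] by (intro mult_mono eu_mono) auto
  from order_trans[OF poincare_U[OF fU fm ffin r] ennreal_leI[OF this]] ar d
  have "sqi (ball x ?r) (%y. f y - bb x) <= ennreal (CP * Ps q * eu (tube 1 1 x (dU x)))"
   unfolding bx_def[OF fU fm ffin] by linarith
  hence "sqi (ball x ?r) (%y. f y - av) <= 2 * ennreal (CP * Ps q * eu (tube 1 1 x (dU x))) + ennreal (2 * (bb x - av)^2) * emeasure m (ball x ?r)"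
   by (intro order_trans[OF nn_shift[OF fm, of _ av "bb x"]] add_mono mult_left_mono) auto
  also have "... <= 2 * ennreal (CP * Ps q * eu (tube 1 1 x (dU x))) + ennreal (2 * (bb x - av)^2) * ennreal (vol x (dU x))"
   using vol_mono_dist[of x x ?r "dU x"] d by (intro add_left_mono mult_left_mono) (auto simp: emeasure_bounded vol_def)
  also have "... = ennreal (2 * (CP * Ps q * eu (tube 1 1 x (dU x))) + 2 * (vol x (dU x) * (bb x - av)^2))"
   using P PR eu_nonneg by (simp add: ennreal_plus ennreal_mult[symmetric] vol_def mult_ac flip: ennreal_numeral)
  finally show ?thesis .
 qed
 have "sqi K (%x. f x - av) <= (SUM x:Y. \<integral>\<^sup>+y\<in>ball x (3 * kp * dU x). ennreal ((f y - av)^2) \<partial>m)"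
  by (rule nn_integral_UN_le[OF Y(1) _ _ _ KY]) (use K fm in "auto simp: compact_imp_closed")
 also have "... <= (SUM x:Y. ennreal (2 * (CP * Ps q * eu (tube 1 1 x (dU x))) + 2 * (vol x (dU x) * (bb x - av)^2)))"
  by (rule sum_mono[OF one])
 also have "... = ennreal (SUM x:Y. 2 * (CP * Ps q * eu (tube 1 1 x (dU x))) + 2 * (vol x (dU x) * (bb x - av)^2))"
  using P PR eu_nonneg by (intro sum_ennreal) (auto simp: vol_def)
 also have "... <= ennreal (cU * Ps q * eu W)"
 proof (rule ennreal_leI)
  have "(SUM x:Y. eu (tube 1 1 x (dU x))) <= tC 1 1 * eu W"
  proof (rule tube_sum[OF Y _ W])
   fix x assume x: "x : Y"
   have "A * dU x <= A * q" using yR[OF x] dU_frontier[OF \<xi>, of x] A by simp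
   show "tube 1 1 x (dU x) <= W"
   proof
    fix w assume w: "w : tube 1 1 x (dU x)"
    hence "dist x w <= 2 * (A * q)" using \<open>A * dU x <= A * q\<close> by (simp add: tube_def mult.assoc)
    hence "dist \<xi> w < 100 * A^3 * q" using yR[OF x] AR q dist_triangle[of \<xi> w x] unfolding mult.assoc by linarith
    thus "w : W" using w by (simp add: W_def tube_def)
   qed
  qed auto
  hence "2 * (CP * Ps q * (SUM x:Y. eu (tube 1 1 x (dU x)))) <= 2 * (CP * Ps q * (tC 1 1 * eu W))"
   using P PR by (intro mult_left_mono) auto
  moreover have "(SUM x:Y. vol x (dU x) * (bb x - av)^2) <= cR * Ps q * eu W" unfolding W_def by (rule av[OF Y yR])
  moreover have "(SUM x:Y. 2 * (CP * Ps q * eu (tube 1 1 x (dU x))) + 2 * (vol x (dU x) * (bb x - av)^2))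
   = 2 * (CP * Ps q * (SUM x:Y. eu (tube 1 1 x (dU x)))) + 2 * (SUM x:Y. vol x (dU x) * (bb x - av)^2)"
   by (simp only: sum.distrib sum_distrib_left)
  moreover have "2 * (CP * Ps q * (tC 1 1 * eu W)) + 2 * (cR * Ps q * eu W) = cU * Ps q * eu W" by (simp add: cU_def algebra_simps)
  ultimately show "(SUM x:Y. 2 * (CP * Ps q * eu (tube 1 1 x (dU x))) + 2 * (vol x (dU x) * (bb x - av)^2)) <= cU * Ps q * eu W"
   by linarith
 qed
 finally show "sqi K (%x. f x - av) <= ennreal (cU * Ps q * eu (U Int ball \<xi> (100 * A^3 * q)))" by (simp add: W_def)
qed

end

end

section \<open>The extension on the complement\<close>

context ext
begin

abbreviation "dV x == infdist x (- V)"
abbreviation "SM == small_balls \<epsilon> A U SS"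
abbreviation "xt == whitney_extension m \<epsilon> A U SS Q \<psi>"
abbreviation "ob B == ball (fst B) (3 * snd B)"

lemma V_U: "y : V ==> y ~: U" using closure_subset[of U] by (auto simp: V_eq)
lemma V_ne: "V ~= UNIV" using U_facts(2) V_U by blast

lemma SSf: assumes "B : SS"
 shows "fst B : V" "snd B = kp * dV (fst B)" "0 < dV (fst B)" "0 < snd B" "27 * snd B < dV (fst B)"
proof -
 show y: "fst B : V" and s: "snd B = kp * dV (fst B)" using whitney_centres(1)[OF SS, of "fst B" "snd B"] assms by auto
 show v: "0 < dV (fst B)" using y infdist_open(1)[OF V_open V_ne] by blast
 thus "0 < snd B" using s cst(4) by simp
 show "27 * snd B < dV (fst B)" using mult_strict_right_mono[OF cst(7) v] s by simp
qed

lemma ob_V: "B : SS ==> ob B <= V"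
 using SSf(4,5)[of B] infdist_open(2)[OF V_open V_ne, of "fst B"] subset_ball[of "3 * snd B" "dV (fst B)"] by force

lemma ob_cover: assumes "z : V" shows "EX B:SS. z : ob B"
proof -
 obtain y where y: "y : XV" "dist y z < 2 * (1 + \<epsilon>) * (kp * dV y)" using whitney_centres(4)[OF SS assms] by blast
 then obtain B where B: "B : SS" "y = fst B" by blast
 have "2 * (1 + \<epsilon>) * snd B <= 3 * snd B" using cst(6) SSf(4)[OF B(1)] by (intro mult_right_mono) auto
 thus ?thesis using y(2) B SSf(2)[OF B(1)] by (intro bexI[of _ B]) auto
qed

definition "cpsi = (SOME C. C > 0 & (ALL B:SS. (ALL x. x ~: rball V 6 B --> \<psi> B x = 0) & En (\<psi> B) <= C * vol (fst B) (snd B) / Ps (snd B)))"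

lemma cpsi: "cpsi > 0 & (ALL B:SS. (ALL x. x ~: rball V 6 B --> \<psi> B x = 0) & En (\<psi> B) <= cpsi * vol (fst B) (snd B) / Ps (snd B))"
proof -
 from psi obtain C where "C > 0" "ALL B:SS. (ALL x. x ~: rball V 6 B --> \<psi> B x = 0) & En (\<psi> B) <= C * measure m (ball (fst B) (snd B)) / Ps (snd B)"
  unfolding whitney_partition_def by meson
 thus ?thesis unfolding cpsi_def vol_def by (intro someI_ex[where P = "%C. C > 0 & _ C"]) blast
qed

lemma psiD: assumes "B : SS"
 shows "\<psi> B : F" "continuous_on UNIV (\<psi> B)" "0 <= \<psi> B x" "\<psi> B x <= 1" "x ~: V ==> \<psi> B x = 0"
  "6 * snd B <= dist (fst B) x ==> \<psi> B x = 0"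
 using psi cpsi assms by (auto simp: whitney_partition_def Cc_def rball_def)

text \<open>The members of the cover whose partition function can be nonzero on the tripled ball of
  B.\<close>

definition "nb B = {B':SS. ball (fst B') (6 * snd B') Int ob B ~= {}}"

lemma nb: assumes B: "B : SS" "B' : nb B"
 shows "B' : SS" "dV (fst B') <= 2 * dV (fst B)" "dV (fst B) <= 2 * dV (fst B')" "dist (fst B) (fst B') <= dV (fst B)"
proof -
 obtain z where z: "dist (fst B') z < 6 * snd B'" "dist (fst B) z < 3 * snd B" using B(2) by (auto simp: nb_def)
 show B': "B' : SS" using B by (auto simp: nb_def)
 have d: "dist (fst B) (fst B') < 3 * snd B + 6 * snd B'" using z dist_triangle2[of "fst B" "fst B'" z] by linarith
 have t: "dV (fst B) <= dV (fst B') + dist (fst B) (fst B')" "dV (fst B') <= dV (fst B) + dist (fst B) (fst B')"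
  using infdist_triangle[of "fst B" "- V" "fst B'"] infdist_triangle[of "fst B'" "- V" "fst B"] by (auto simp: dist_commute)
 note s = SSf(3,4,5)[OF B(1)] SSf(3,4,5)[OF B']
 show "dV (fst B') <= 2 * dV (fst B)" "dV (fst B) <= 2 * dV (fst B')" "dist (fst B) (fst B') <= dV (fst B)" using d t s by linarith+
qed

lemma nb_self: assumes "B : SS" shows "B : nb B"
proof -
 have "fst B : ball (fst B) (6 * snd B)" "fst B : ob B" using SSf(4)[OF assms] by simp_all
 thus ?thesis using assms unfolding nb_def by blast
qed

lemma SS_count: assumes sg: "sg > 0" and Y: "Y <= SS" "!!B. B : Y ==> sg <= snd B & dist z (fst B) <= r" and K: "2 * r + sg <= K * sg"
 shows "finite Y" "real (card Y) <= DD K"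
proof -
 have d: "ball (fst B) sg Int ball (fst B') sg = {}" if B: "B : Y" "B' : Y" "B ~= B'" for B B'
 proof -
  have S: "B : SS" "B' : SS" using B Y(1) by auto
  have "fst B ~= fst B'" using B(3) SSf(2)[OF S(1)] SSf(2)[OF S(2)] by (auto simp: prod_eq_iff)
  hence "ball (fst B) (snd B) Int ball (fst B') (snd B') = {}"
   using whitney_centres(3)[OF SS, of "fst B" "fst B'"] S SSf(2)[OF S(1)] SSf(2)[OF S(2)] by simp
  moreover have "ball (fst B) sg <= ball (fst B) (snd B)" "ball (fst B') sg <= ball (fst B') (snd B')" using Y(2)[OF B(1)] Y(2)[OF B(2)] by (simp_all add: subset_ball)
  ultimately show ?thesis by blast
 qed
 show "finite Y" "real (card Y) <= DD K" using count[where c = fst, OF sg d _ K] Y(2) by blast+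
qed

definition "cN = DD (4 / kp + 1)"

lemma nb_fin: assumes "B : SS" shows "finite (nb B)" "real (card (nb B)) <= cN" "nb B <= SS"
proof -
 show s: "nb B <= SS" by (auto simp: nb_def)
 note v = SSf[OF assms]
 have k: "kp > 0" by (rule cst)
 have Y: "snd B / 2 <= snd B' & dist (fst B) (fst B') <= dV (fst B)" if "B' : nb B" for B'
  using nb[OF assms that] SSf(2)[OF nb(1)[OF assms that]] v(2) k by (simp add: mult_left_mono)
 have K: "2 * dV (fst B) + snd B / 2 <= (4 / kp + 1) * (snd B / 2)" using k by (simp add: v(2) field_simps)
 have p: "snd B / 2 > 0" using v by simp
 show "finite (nb B)" "real (card (nb B)) <= cN" using SS_count[OF p s Y K] by (auto simp: cN_def)
qed

text \<open>Large balls get coefficient 0, so that the extension becomes a sum over the whole cover,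
  where the partition functions add up to 1.\<close>

definition "aQ f B = (if B : SM then set_average m (rball U 3 (Q B)) f else 0)"

text \<open>A finite index set that contains the neighbours of B captures the infinite sums on its
  tripled ball. Larger index sets are allowed so that one set can serve several balls.\<close>

lemma EQ_V:
 assumes B: "B : SS" "z : ob B" and Y: "finite Y" "nb B <= Y" "Y <= SS"
 shows "xt f z = (SUM B':Y. aQ f B' * \<psi> B' z)" "(SUM B':Y. \<psi> B' z) = 1"
proof -
 have z0: "\<psi> B' z = 0" if "B' : SS" "B' ~: Y" for B'
 proof -
  have "B' ~: nb B" using that Y by blast
  hence "z ~: ball (fst B') (6 * snd B')" using B(2) that(1) by (auto simp: nb_def)
  thus ?thesis using psiD(6)[OF that(1), of z] by simp
 qed
 have zV: "z : V" using ob_V[OF B(1)] B(2) by blast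
 have SM: "SM <= SS" by (auto simp: small_balls_def)
 have "xt f z = (\<Sum>\<^sub>\<infinity>B'\<in>SM. \<psi> B' z * set_average m (rball U 3 (Q B')) f)" using V_U[OF zV] by (simp add: whitney_extension_def)
 also have "... = (\<Sum>\<^sub>\<infinity>B'\<in>Y. aQ f B' * \<psi> B' z)" by (rule infsum_cong_neutral) (use z0 SM in "auto simp: aQ_def")
 finally show "xt f z = (SUM B':Y. aQ f B' * \<psi> B' z)" using Y(1) by simp
 have "((%B. \<psi> B z) has_sum 1) SS" using psi zV unfolding whitney_partition_def by (metis indicator_simps(1))
 hence "(\<Sum>\<^sub>\<infinity>B'\<in>SS. \<psi> B' z) = 1" by (rule infsumI)
 moreover have "(\<Sum>\<^sub>\<infinity>B'\<in>SS. \<psi> B' z) = (\<Sum>\<^sub>\<infinity>B'\<in>Y. \<psi> B' z)" by (rule infsum_cong_neutral) (use z0 Y in auto)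
 ultimately show "(SUM B':Y. \<psi> B' z) = 1" using Y(1) by simp
qed

lemma V_cover: assumes "compact K" "K <= V"
 obtains Y where "finite Y" "Y <= SS" "K <= (UN B:Y. ob B)" "!!B. B : Y ==> ob B Int K ~= {}"
proof -
 have cov: "K <= (UN B:SS. ob B)" using assms(2) ob_cover by blast
 obtain C where C: "C <= SS" "finite C" "K <= (UN B:C. ob B)" by (rule compactE_image[OF assms(1) open_ball cov]) (rule that)
 show ?thesis
 proof (rule that[of "{B:C. ob B Int K ~= {}}"])
  show "K <= (UN B:{B:C. ob B Int K ~= {}}. ob B)"
  proof
   fix w assume w: "w : K"
   with C(3) obtain B where "B : C" "w : ob B" by blast
   with w show "w : (UN B:{B:C. ob B Int K ~= {}}. ob B)" by (intro UN_I[of B]) auto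
  qed
 qed (use C in auto)
qed

text \<open>Near a compact subset of V the extension is one finite combination of partition
  functions, which lie in F. No integrability of f enters, only that the averages are numbers; on
  the frontier the extension is 0.\<close>

lemma EQ_FL: "xt f : FL V" "xt f : borel_measurable borel" if fm: "f : borel_measurable (restrict_space borel U)"
proof -
 have "continuous_on (UN B:SS. ob B) (xt f)"
 proof (rule continuous_on_open_UN)
  fix B assume B: "B : SS"
  have "continuous_on (ob B) (%z. SUM B':nb B. aQ f B' * \<psi> B' z)"
   by (intro continuous_on_sum continuous_on_mult_left continuous_on_subset[OF psiD(2)[OF nb(1)[OF B]] subset_UNIV])
  thus "continuous_on (ob B) (xt f)"
   by (rule continuous_on_eq) (rule EQ_V(1)[OF B _ nb_fin(1)[OF B] order_refl nb_fin(3)[OF B], symmetric])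
 qed auto
 moreover have "(UN B:SS. ob B) = V" using ob_V ob_cover by blast
 ultimately have V: "xt f : borel_measurable (restrict_space borel V)" by (simp add: borel_measurable_continuous_on_restrict)
 show "xt f : FL V" unfolding F_loc_def
 proof (safe, rule V)
  fix O' assume O': "open O'" "rel_compact_in V O'"
  obtain Y where Y: "finite Y" "Y <= SS" "closure O' <= (UN B:Y. ob B)"
   using V_cover[of "closure O'"] O'(2) unfolding rel_compact_in_def by metis
  define Z where "Z = (UN B:Y. nb B)"
  have Z: "finite Z" "Z <= SS" unfolding Z_def
   by (rule finite_UN_I[OF Y(1) nb_fin(1)[OF subsetD[OF Y(2)]]], assumption, rule UN_least, rule nb_fin(3)[OF subsetD[OF Y(2)]])
  have "(%z. SUM B':Z. aQ f B' * \<psi> B' z) : F"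
   by (intro EE.sum[OF Z(1) F_ne] EE.scale psiD(1) subsetD[OF Z(2)])
  moreover have "xt f z = (SUM B':Z. aQ f B' * \<psi> B' z)" if z: "z : O'" for z
  proof -
   obtain B where B: "B : Y" "z : ob B" using z closure_subset[of O'] Y(3) by blast
   have "nb B <= Z" using B(1) by (auto simp: Z_def)
   thus ?thesis using EQ_V(1)[OF _ B(2) Z(1) _ Z(2)] B(1) Y(2) by blast
  qed
  ultimately show "EX f':F. AE x in m. x : O' --> xt f x = f' x" by (intro bexI[of _ "%z. SUM B':Z. aQ f B' * \<psi> B' z"] AE_I2) auto
 qed
 have z: "xt f x = 0" if "x ~: U" "x ~: V" for x
 proof -
  have "(\<Sum>\<^sub>\<infinity>B'\<in>SM. \<psi> B' x * set_average m (rball U 3 (Q B')) f) = 0"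
  proof (rule infsum_0)
   fix B' assume "B' : SM"
   hence "B' : SS" by (simp add: small_balls_def)
   thus "\<psi> B' x * set_average m (rball U 3 (Q B')) f = 0" using psiD(5)[of B' x] that by simp
  qed
  thus ?thesis using that by (simp add: whitney_extension_def)
 qed
 have "xt f = (%x. indicator U x * f x + indicator V x * xt f x)"
  using z V_U by (auto simp: fun_eq_iff indicator_def whitney_extension_def)
 moreover have "(%x. indicator U x * f x + indicator V x * xt f x) : borel_measurable borel"
  using fm V U_facts(1) V_open by (intro borel_measurable_add) (simp_all add: borel_measurable_restrict_space_iff mult.commute)
 ultimately show "xt f : borel_measurable borel" by simp
qed

definition "cE = cN^2 * (cpsi * DD (1 / kp + 2) * PK 2)"

lemma cE: "cE >= 0"
 using cpsi DD(1)[of "1 / kp + 2"] PK(1)[of 2] unfolding cE_def by (intro mult_nonneg_nonneg) auto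

text \<open>Subtracting a constant changes no energy, and the partition functions sum to 1, so only
  the deviations of the neighbouring coefficients from c contribute; at most cN of them, hence the
  square of \<open>cN\<close> in \<open>cE\<close>.\<close>

lemma loc_energy:
 assumes B: "B : SS" and fm: "f : borel_measurable (restrict_space borel U)" and M: "!!B'. B' : nb B ==> (aQ f B' - c)^2 <= M"
 shows "LE V (xt f) (ob B) <= ennreal (cE * (vol (fst B) (snd B) / Ps (snd B)) * M)"
proof -
 define h where "h = (%B' z. (aQ f B' - c) * \<psi> B' z)"
 note fin = nb_fin[OF B]
 have M0: "0 <= M" using M[OF nb_self[OF B]] by (rule order_trans[OF zero_le_power2])
 have hF: "h B' : F" if "B' : nb B" for B' unfolding h_def using psiD(1)[OF nb(1)[OF B that]] by (rule EE.scale)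
 have sF: "(%z. SUM B':nb B. h B' z) : F" by (rule EE.sum[OF fin(1) F_ne hF])
 have eq: "xt f z = (SUM B':nb B. h B' z) + c" if "z : ob B" for z
  using EQ_V(1)[OF B that fin(1) order_refl fin(3), of f] EQ_V(2)[OF B that fin(1) order_refl fin(3)]
  by (simp add: h_def left_diff_distrib sum_subtractf sum_distrib_left[symmetric])
 define w where "w = cpsi * DD (1 / kp + 2) * PK 2 * (vol (fst B) (snd B) / Ps (snd B)) * M"
 note s = SSf[OF B]
 have w0: "0 <= w" using cpsi DD(1)[of "1 / kp + 2"] PK(1)[of 2] vol_pos[OF s(4)] Psi_pos[OF s(4)] M0 unfolding w_def
  by (intro mult_nonneg_nonneg divide_nonneg_nonneg) (auto simp: less_imp_le)
 have g1: "gm (h B') (ob B) <= w" if B': "B' : nb B" for B'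
 proof -
  note n = nb[OF B B'] and s' = SSf[OF nb(1)[OF B B']]
  have k: "kp > 0" by (rule cst)
  have ss: "snd B' <= 2 * snd B" "snd B <= 2 * snd B'" using n(2,3) k by (simp_all add: s(2) s'(2) mult.left_commute)
  have "dist (fst B) (fst B') + snd B' <= (1 / kp + 2) * snd B" using n(4) ss(1) k by (simp add: s(2) distrib_right)
  hence v: "vol (fst B') (snd B') <= DD (1 / kp + 2) * vol (fst B) (snd B)"
   by (intro DD(2)[OF s(4)]) (simp add: dist_commute)
  have "Ps (snd B) <= Ps (2 * snd B')" by (rule Psi_mono[OF s(4) ss(2)])
  also have "... <= PK 2 * Ps (snd B')" by (rule PK(2)[OF _ s'(4)]) simp
  finally have p: "1 / Ps (snd B') <= PK 2 / Ps (snd B)" using Psi_pos[OF s(4)] Psi_pos[OF s'(4)] by (simp add: field_simps)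
  have "gm (h B') (ob B) <= En (h B')" by (rule gm_le[OF hF[OF B']])
  also have "... = (aQ f B' - c)^2 * En (\<psi> B')" unfolding h_def using psiD(1)[OF n(1)] by (simp add: EE.B_simps EE.scale power2_eq_square)
  also have "... <= M * (cpsi * vol (fst B') (snd B') / Ps (snd B'))"
   using M[OF B'] cpsi n(1) M0 EE.B_nonneg[OF psiD(1)[OF n(1)]] by (intro mult_mono) auto
  also have "... <= M * (cpsi * (DD (1 / kp + 2) * vol (fst B) (snd B)) * (PK 2 / Ps (snd B)))"
  proof (intro mult_left_mono M0)
   have "cpsi * vol (fst B') (snd B') * (1 / Ps (snd B')) <= cpsi * (DD (1 / kp + 2) * vol (fst B) (snd B)) * (PK 2 / Ps (snd B))"
    using cpsi v p vol_pos[OF s'(4), of "fst B'"] Psi_pos[OF s'(4)] by (intro mult_mono) auto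
   thus "cpsi * vol (fst B') (snd B') / Ps (snd B') <= cpsi * (DD (1 / kp + 2) * vol (fst B) (snd B)) * (PK 2 / Ps (snd B))" by simp
  qed
  finally show ?thesis by (simp add: w_def mult_ac)
 qed
 have "sqrt (gm (%z. SUM B':nb B. h B' z) (ob B)) <= (SUM B':nb B. sqrt (gm (h B') (ob B)))" by (rule gm_sum[OF fin(1) hF]) auto
 also have "... <= (SUM B':nb B. sqrt w)" using g1 by (intro sum_mono) simp
 also have "... <= cN * sqrt w" using fin(2) w0 by (simp add: mult_right_mono)
 finally have "gm (%z. SUM B':nb B. h B' z) (ob B) <= (cN * sqrt w)^2" by (rule sqrt_le_D)
 also have "... = cE * (vol (fst B) (snd B) / Ps (snd B)) * M" using w0 by (simp add: power_mult_distrib cE_def w_def)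
 finally have "gm (%z. SUM B':nb B. h B' z) (ob B) <= cE * (vol (fst B) (snd B) / Ps (snd B)) * M" .
 moreover have "LE V (xt f) (ob B) = ennreal (gm (%z. SUM B':nb B. h B' z) (ob B))"
  by (rule LE_loc_F[OF V_open EQ_FL(1)[OF fm] sF open_ball ob_V[OF B] AE_I2]) (use eq in auto)
 ultimately show ?thesis by (simp add: ennreal_leI)
qed

section \<open>Reflected balls and their energies\<close>

definition "xq B = fst (Q B)"
definition "nQ = (SOME N::nat. ALL D:RR. finite {B:SM. Q B = D} & card {B:SM. Q B = D} <= N)"

lemma nQ: "W : RR ==> card {B:SM. Q B = W} <= nQ" "W : RR ==> finite {B:SM. Q B = W}"
proof -
 have "EX N::nat. ALL D:RR. finite {B:SM. Q B = D} & card {B:SM. Q B = D} <= N" using Q unfolding whitney_reflection_def by blast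
 from someI_ex[OF this] show "W : RR ==> card {B:SM. Q B = W} <= nQ" "W : RR ==> finite {B:SM. Q B = W}" unfolding nQ_def by blast+
qed

text \<open>The radius is kp times the distance to the complement of V, so the threshold on radii
  becomes one on distances.\<close>

lemma SMd: "B : SM \<longleftrightarrow> B : SS & ereal (6 * A * dV (fst B)) < ediam U"
proof (cases "B : SS")
 case B: True
 have k: "kp > 0" "A >= 1" by (rule cst)+
 have e: "\<epsilon> / (6 * A * (1 + \<epsilon>)) = kp / (6 * A)" by (simp add: kp_def)
 obtain t where "t > 0" "ereal t < ediam U" using ediam_pos by blast
 thus ?thesis using B SSf(2)[OF B] k unfolding small_balls_def e
  by (cases "ediam U") (auto simp: field_simps)
qed (auto simp: small_balls_def)

lemma xq: assumes B: "B : SM"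
 shows "xq B : XU" "Q B = (xq B, kp * dU (xq B))" "dV (fst B) <= 2 * dU (xq B)" "dU (xq B) <= 2 * dV (fst B)"
  "dist (xq B) (fst B) <= 4 * A * dV (fst B)" "xq B : U" "0 < dU (xq B)"
proof -
 have BS: "B : SS" using B by (simp add: SMd)
 have k: "kp > 0" "A >= 1" "27 * \<epsilon> < 1" by (rule cst)+
 have q: "Q B : RR" using Q B unfolding whitney_reflection_def by blast
 show x: "xq B : XU" using q by (auto simp: xq_def)
 show "xq B : U" by (rule XU(1)[OF x])
 thus "0 < dU (xq B)" using dU_pos by blast
 show e: "Q B = (xq B, kp * dU (xq B))"
  using whitney_centres(1)[OF RR, of "fst (Q B)" "snd (Q B)"] q by (simp add: xq_def prod_eq_iff)
 have "case B of (y, s) \<Rightarrow> ALL x r. Q (y, s) = (x, r) -->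
    (1 + \<epsilon>) / (1 + 4 * \<epsilon>) * s < r \<and> r < (1 + \<epsilon>) / (1 - 2 * \<epsilon>) * s \<and> dist x y \<le> (2 + 3 * A / 2) * ((1 + \<epsilon>) / \<epsilon>) * s"
  using Q B unfolding whitney_reflection_def by blast
 hence h: "(1 + \<epsilon>) / (1 + 4 * \<epsilon>) * snd B < kp * dU (xq B)" "kp * dU (xq B) < (1 + \<epsilon>) / (1 - 2 * \<epsilon>) * snd B"
  "dist (xq B) (fst B) <= (2 + 3 * A / 2) * ((1 + \<epsilon>) / \<epsilon>) * snd B" using e by (auto split: prod.splits)
 note s = SSf[OF BS]
 have "1 / 2 * snd B <= (1 + \<epsilon>) / (1 + 4 * \<epsilon>) * snd B" using eps(1) s(4) k by (intro mult_right_mono) (auto simp: field_simps)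
 hence "kp * dV (fst B) < kp * (2 * dU (xq B))" using h(1) unfolding s(2) by linarith
 thus "dV (fst B) <= 2 * dU (xq B)" using k by simp
 have "(1 + \<epsilon>) / (1 - 2 * \<epsilon>) * snd B <= 2 * snd B" using eps(1) s(4) k by (intro mult_right_mono) (auto simp: field_simps)
 hence "kp * dU (xq B) < kp * (2 * dV (fst B))" using h(2) unfolding s(2) by linarith
 thus "dU (xq B) <= 2 * dV (fst B)" using k by simp
 have "(2 + 3 * A / 2) * ((1 + \<epsilon>) / \<epsilon>) * snd B = (2 + 3 * A / 2) * dV (fst B)" using eps(1) by (simp add: s(2) kp_def)
 also have "... <= 4 * A * dV (fst B)" using s(3) k by (intro mult_right_mono) auto
 finally show "dist (xq B) (fst B) <= 4 * A * dV (fst B)" using h(3) by linarith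
qed

text \<open>The reflection is at most nQ-to-one, and a ball of the cover of U is determined by its
  centre.\<close>

lemma Q_sum: assumes Y: "finite Y" "Y <= SM" and h: "!!x. 0 <= h x"
 shows "(SUM B:Y. h (xq B)) <= real nQ * (SUM x:xq ` Y. h x)"
proof -
 have "(SUM B:Y. h (xq B)) = (SUM x:xq ` Y. SUM B:{B:Y. xq B = x}. h (xq B))" by (rule sum.image_gen[OF Y(1)])
 also have "... = (SUM x:xq ` Y. real (card {B:Y. xq B = x}) * h x)" by (intro sum.cong) auto
 also have "... <= (SUM x:xq ` Y. real nQ * h x)"
 proof (intro sum_mono mult_right_mono h)
  fix x assume "x : xq ` Y"
  then obtain B0 where B0: "B0 : Y" "x = xq B0" by blast
  have D: "Q B0 : RR" using B0 Y(2) Q unfolding whitney_reflection_def by blast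
  have "{B:Y. xq B = x} <= {B:SM. Q B = Q B0}" 
  proof
   fix B assume "B : {B:Y. xq B = x}"
   hence "B : SM" "xq B = xq B0" "B0 : SM" using Y(2) B0 by auto
   thus "B : {B:SM. Q B = Q B0}" using xq(2)[of B] xq(2)[of B0] by simp
  qed
  from card_mono[OF nQ(2)[OF D] this] nQ(1)[OF D] show "real (card {B:Y. xq B = x}) <= real nQ" by linarith
 qed
 finally show ?thesis by (simp add: sum_distrib_left)
qed

context
 fixes f assumes fU: "f : FL U" and fm: "f : borel_measurable borel" and ffin: "LE U f U < \<infinity>"
begin

lemmas fmU = measurable_restrict_space1[OF fm, of U]
lemmas en = eu_nonneg[OF fU fm ffin] and bxd = bx_def[OF fU fm ffin]

lemma aQ_bx: assumes "B : SM" shows "aQ f B = bb f (xq B)"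
proof -
 have "3 * kp * dU (xq B) <= dU (xq B)" using cst(7) xq(7)[OF assms] by simp
 hence "rball U 3 (Q B) = ball (xq B) (3 * kp * dU (xq B))" using ball_U[of "3 * kp * dU (xq B)" "xq B"] by (auto simp: rball_def xq(2)[OF assms] mult.assoc)
 thus ?thesis using assms by (simp add: aQ_def bxd)
qed

abbreviation "tb x == tube (1 / 8) (26 * A) x (dU x)"
abbreviation "cC' == chC (1 / 8) (26 * A)"

lemma cC'_nonneg: "0 <= cC'" using cst(1) by (intro chC1) simp

text \<open>Reflections of neighbouring balls are joined by one chain in U. The factor 1/8 comes
  from three comparisons of distances by a factor 2, and 26 A from the two reflections and the step
  between the balls.\<close>

lemma near_avg: assumes B: "B : SS" "nb B <= SM" "B' : nb B"
 shows "(aQ f B' - bb f (xq B))^2 <= cC' * Ps (dU (xq B)) / vol (xq B) (dU (xq B)) * eu f (tb (xq B))"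
proof -
 have S: "B : SM" "B' : SM" using B nb_self[OF B(1)] by auto
 note n = nb[OF B(1,3)] and x = xq[OF S(1)] and x' = xq[OF S(2)]
 have A: "A >= 1" by (rule cst)
 have AA: "dV (fst B) <= A * dV (fst B)" "A * dV (fst B') <= A * (2 * dV (fst B))" "A * dV (fst B) <= A * (2 * dU (xq B))"
  "dU (xq B) <= A * dU (xq B)" using A n x by (auto simp: SSf(3)[OF B(1)] mult_le_cancel_right1)
 have "dist (xq B) (xq B') <= dist (xq B) (fst B) + dist (fst B) (fst B') + dist (xq B') (fst B')"
  using dist_triangle[of "xq B" "xq B'" "fst B"] dist_triangle[of "fst B" "xq B'" "fst B'"] by (simp add: dist_commute)
 hence d: "dist (xq B) (xq B') <= 26 * A * dU (xq B)" using n(4) x(5) x'(5) AA unfolding mult.assoc by linarith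
 have "(bb f (xq B) - bb f (xq B'))^2 <= cC' * Ps (dU (xq B)) / vol (xq B) (dU (xq B)) * eu f (tb (xq B))"
 proof (rule bb_chain[OF fU fm ffin x(6) x'(6) x(7) _ _ _ _ d])
  show "1 / 8 * dU (xq B) <= dU (xq B')" using x(4) n(3) x'(3) by linarith
  show "dU (xq B) <= 26 * A * dU (xq B)" using AA(4) x(7) unfolding mult.assoc by linarith
 qed (use A x(7) in auto)
 thus ?thesis using aQ_bx[OF S(2)] by (simp add: power2_commute)
qed

definition "cG = cE * (DD (10 * A) * PK (2 / kp) * cC')"

text \<open>When all neighbours are small, every coefficient is an average in U within one chain of
  that at the centre of the reflected ball. The same bound controls both the energy and the
  oscillation, and both are charged to the tube of that centre.\<close>

lemma good: assumes B: "B : SS" "nb B <= SM"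
 shows "LE V (xt f) (ob B) <= ennreal (cG * eu f (tb (xq B)))"
  "sqi (ob B) (%z. xt f z - bb f (xq B)) <= ennreal (DD (10 * A) * cC' * Ps (dU (xq B)) * eu f (tb (xq B)))"
  "vol (fst B) (3 * snd B) <= DD (10 * A) * vol (xq B) (dU (xq B))"
proof -
 define x where "x = xq B"
 define M where "M = cC' * Ps (dU x) / vol x (dU x) * eu f (tb x)"
 have S: "B : SM" using B nb_self[OF B(1)] by auto
 note X = xq[OF S, folded x_def] and s = SSf[OF B(1)]
 have A: "A >= 1" and k: "kp > 0" by (rule cst)+
 have v: "vol x (dU x) > 0" by (rule vol_pos[OF X(7)])
 have M: "(aQ f B' - bb f x)^2 <= M" if "B' : nb B" for B' unfolding M_def x_def by (rule near_avg[OF B that])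
 have M0: "0 <= M" using cC'_nonneg Psi_pos[OF X(7)] v en by (simp add: M_def)
 have AA: "A * dV (fst B) <= A * (2 * dU x)" "dV (fst B) <= A * dV (fst B)" using A X s by (auto simp: mult_le_cancel_right1)
 show v3: "vol (fst B) (3 * snd B) <= DD (10 * A) * vol (xq B) (dU (xq B))" unfolding x_def[symmetric]
  by (rule DD(2)[OF X(7)]) (use AA X(5) s(3,5) in \<open>unfold mult.assoc dist_commute[of "fst B"], linarith\<close>)
 have "vol (fst B) (snd B) <= vol (fst B) (3 * snd B)" using s by (intro vol_mono_dist) auto
 hence v1: "vol (fst B) (snd B) <= DD (10 * A) * vol x (dU x)" using v3 by (simp add: x_def)
 have "dU x <= 2 / kp * snd B" using X(4) k by (simp add: s(2))
 hence "Ps (dU x) <= Ps (2 / kp * snd B)" by (rule Psi_mono[OF X(7)])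
 also have "... <= PK (2 / kp) * Ps (snd B)" by (rule PK(2)[OF _ s(4)]) (use k cst(7) in "simp add: field_simps")
 finally have p: "Ps (dU x) / Ps (snd B) <= PK (2 / kp)" using Psi_pos[OF s(4)] by (simp add: field_simps)
 have "LE V (xt f) (ob B) <= ennreal (cE * (vol (fst B) (snd B) / Ps (snd B)) * M)" by (rule loc_energy[OF B(1) fmU M])
 also have "... <= ennreal (cG * eu f (tb x))"
 proof (rule ennreal_leI)
  have "cE * (vol (fst B) (snd B) / Ps (snd B)) * M = cE * (cC' * eu f (tb x)) * (vol (fst B) (snd B) / vol x (dU x) * (Ps (dU x) / Ps (snd B)))" by (simp add: M_def mult_ac)
  also have "... <= cE * (cC' * eu f (tb x)) * (DD (10 * A) * PK (2 / kp))"
  proof (intro mult_left_mono mult_mono p)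
   show "vol (fst B) (snd B) / vol x (dU x) <= DD (10 * A)" using v1 v by (simp add: field_simps)
  qed (use DD(1)[of "10 * A"] Psi_pos[OF s(4)] Psi_pos[OF X(7)] cE cC'_nonneg en in auto)
  finally show "cE * (vol (fst B) (snd B) / Ps (snd B)) * M <= cG * eu f (tb x)" by (simp add: cG_def mult_ac)
 qed
 finally show "LE V (xt f) (ob B) <= ennreal (cG * eu f (tb (xq B)))" by (simp add: x_def)
 have pt: "(xt f z - bb f x)^2 <= M" if z: "z : ob B" for z
 proof -
  note e = EQ_V(1)[OF B(1) z nb_fin(1)[OF B(1)] order_refl nb_fin(3)[OF B(1)], of f] EQ_V(2)[OF B(1) z nb_fin(1)[OF B(1)] order_refl nb_fin(3)[OF B(1)]]
  have "xt f z - bb f x = (SUM B':nb B. (aQ f B' - bb f x) * \<psi> B' z)"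
   using e by (simp add: left_diff_distrib sum_subtractf sum_distrib_left[symmetric])
  hence "abs (xt f z - bb f x) <= (SUM B':nb B. abs ((aQ f B' - bb f x) * \<psi> B' z))" by (simp only: sum_abs)
  also have "... <= (SUM B':nb B. sqrt M * \<psi> B' z)"
  proof (rule sum_mono)
   fix B' assume B': "B' : nb B"
   have "abs (aQ f B' - bb f x) <= sqrt M" using real_sqrt_le_mono[OF M[OF B']] by simp
   thus "abs ((aQ f B' - bb f x) * \<psi> B' z) <= sqrt M * \<psi> B' z" using psiD(3)[OF nb(1)[OF B(1) B'], of z] by (simp add: abs_mult mult_right_mono)
  qed
  also have "... = sqrt M" using e(2) by (simp add: sum_distrib_left[symmetric])
  finally have "abs (xt f z - bb f x)^2 <= (sqrt M)^2" by (intro power_mono) auto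
  thus ?thesis using M0 by simp
 qed
 have "sqi (ob B) (%z. xt f z - bb f x) <= (\<integral>\<^sup>+z\<in>ob B. ennreal M \<partial>m)"
  using pt by (intro nn_integral_mono) (auto simp: indicator_def intro!: ennreal_leI)
 also have "... = ennreal (M * vol (fst B) (3 * snd B))" using M0 by (simp add: nn_integral_cmult_indicator emeasure_bounded vol_def ennreal_mult)
 also have "... <= ennreal (M * (DD (10 * A) * vol x (dU x)))" using v3 M0 by (intro ennreal_leI mult_left_mono) (auto simp: x_def)
 also have "M * (DD (10 * A) * vol x (dU x)) = DD (10 * A) * cC' * Ps (dU x) * eu f (tb x)" using v by (simp add: M_def)
 finally show "sqi (ob B) (%z. xt f z - bb f (xq B)) <= ennreal (DD (10 * A) * cC' * Ps (dU (xq B)) * eu f (tb (xq B)))" by (simp add: x_def)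
qed

lemma tb_sum: assumes "finite Y" "Y <= SM" "!!B. B : Y ==> tb (xq B) <= S" "S : sets borel" "S <= U"
 shows "(SUM B:Y. eu f (tb (xq B))) <= real nQ * tC (1 / 8) (26 * A) * eu f S"
proof -
 have "(SUM B:Y. eu f (tb (xq B))) <= real nQ * (SUM x:xq ` Y. eu f (tb x))" by (rule Q_sum[OF assms(1,2) en])
 also have "... <= real nQ * (tC (1 / 8) (26 * A) * eu f S)"
  by (intro mult_left_mono tube_sum[OF fU fm ffin]) (use assms xq(1) cst(1) in auto)
 finally show ?thesis by simp
qed

text \<open>A ball of V that meets a small ball centred on the frontier has radius and distance
  controlled by r; the diameter condition makes its neighbours small too, and its reflection and
  tube stay near.\<close>

lemma near_B: assumes \<xi>: "\<xi> : frontier U" and r: "ereal (16 * A * r) < ediam U" and B: "B : SS" "ob B Int ball \<xi> r ~= {}"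
 shows "nb B <= SM" "dist \<xi> (xq B) <= 6 * A * r" "dU (xq B) <= 3 * r" "tb (xq B) <= U Int ball \<xi> (600 * A^4 * r)"
proof -
 obtain z where z: "dist (fst B) z < 3 * snd B" "dist \<xi> z < r" using B(2) by auto
 have A: "A >= 1" by (rule cst)
 note s = SSf[OF B(1)]
 have "\<xi> ~: V" using \<xi> by (simp add: frontier_def V_eq)
 hence "dV (fst B) <= dist \<xi> (fst B)" using infdist_le[of \<xi> "- V" "fst B"] by (simp add: dist_commute)
 moreover have xy: "dist \<xi> (fst B) < r + 3 * snd B" using z dist_triangle2[of \<xi> "fst B" z] by linarith
 ultimately have v: "dV (fst B) <= 9 / 8 * r" "dist \<xi> (fst B) <= 9 / 8 * r" using s(5) by linarith+
 have r0: "r > 0" using v s by linarith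
 show nS: "nb B <= SM"
 proof
  fix B' assume B': "B' : nb B"
  have "A * dV (fst B') <= A * (9 / 4 * r)" using nb(2)[OF B(1) B'] v A by (intro mult_left_mono) auto
  hence "6 * A * dV (fst B') <= 16 * A * r" using mult_pos_pos[of A r] A r0 unfolding mult.assoc by linarith
  thus "B' : SM" using nb(1)[OF B(1) B'] r using le_less_trans[of "ereal (6 * A * dV (fst B'))" "ereal (16 * A * r)"] by (simp add: SMd)
 qed
 hence S: "B : SM" using nb_self[OF B(1)] by blast
 note x = xq[OF S]
 have Av: "A * dV (fst B) <= A * (9 / 8 * r)" "r <= A * r" using v A r0 by (auto intro!: mult_left_mono)
 show xd: "dist \<xi> (xq B) <= 6 * A * r"
  using dist_triangle[of \<xi> "xq B" "fst B"] x(5) v Av r0 unfolding dist_commute[of "fst B"] mult.assoc by linarith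
 show xr: "dU (xq B) <= 3 * r" using x(4) v r0 by linarith
 show "tb (xq B) <= U Int ball \<xi> (600 * A^4 * r)"
 proof
  fix w assume w: "w : tb (xq B)"
  hence "dist (xq B) w <= 52 * (A^2 * dU (xq B))" by (simp add: tube_def power2_eq_square)
  also have "... <= 52 * (A^2 * (3 * r))" using xr by (intro mult_left_mono) auto
  finally have "dist \<xi> w <= 6 * (A * r) + 156 * (A^2 * r)" using xd dist_triangle[of \<xi> w "xq B"] unfolding mult.assoc by linarith
  moreover have "A^1 * r <= A^4 * r" "A^2 * r <= A^4 * r" using A r0 by (intro mult_right_mono power_increasing; simp)+
  moreover have "0 < A^4 * r" using A r0 by simp
  ultimately have "dist \<xi> w < 600 * A^4 * r" unfolding mult.assoc power_one_right by linarith
  thus "w : U Int ball \<xi> (600 * A^4 * r)" using w by (simp add: tube_def)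
 qed
qed

definition "cB = cG * (real nQ * tC (1 / 8) (26 * A))"

lemma cG: "cG >= 0" "cB >= 0"
proof -
 have "2 / kp >= 1" using cst(4,7) by (simp add: field_simps)
 thus "cG >= 0" using cE DD(1)[of "10 * A"] PK(1)[of "2 / kp"] cC'_nonneg unfolding cG_def by (intro mult_nonneg_nonneg) auto
 thus "cB >= 0" using tC[of "1/8" "26 * A"] unfolding cB_def by (intro mult_nonneg_nonneg) auto
qed

lemma LE_cover: assumes K: "compact K" and Y: "finite Y" "Y <= SS" "K <= (UN B:Y. ob B)"
 shows "LE V (xt f) K <= (SUM B:Y. LE V (xt f) (ob B))"
proof -
 note g = EQ_FL(1)[OF fmU]
 have s: "ob B : sets (local_energy_measure m E F V (xt f))" if "B : Y" for B using ob_V[OF subsetD[OF Y(2) that]] by (simp add: sets_LE[OF V_open g])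
 have "LE V (xt f) K <= LE V (xt f) (UN B:Y. ob B)"
  by (rule LE_mono[OF V_open g Y(3)]) (rule borel_open, rule open_UN, simp, rule UN_least, rule ob_V[OF subsetD[OF Y(2)]])
 also have "... <= (SUM B:Y. LE V (xt f) (ob B))" by (rule emeasure_subadditive_finite[OF Y(1)]) (use s in auto)
 finally show ?thesis .
qed

lemma V_energy_local: assumes \<xi>: "\<xi> : frontier U" and r: "ereal (16 * A * r) < ediam U"
 shows "LE V (xt f) (V Int ball \<xi> r) <= ennreal (cB * eu f (U Int ball \<xi> (600 * A^4 * r)))"
proof (rule LE_exhaust[OF V_open EQ_FL(1)[OF fmU]])
 define S where "S = U Int ball \<xi> (600 * A^4 * r)"
 show "open (V Int ball \<xi> r)" "V Int ball \<xi> r <= V" using V_open by auto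
 fix K assume K: "compact K" "K <= V Int ball \<xi> r"
 obtain Y where Y: "finite Y" "Y <= SS" "K <= (UN B:Y. ob B)" "!!B. B : Y ==> ob B Int K ~= {}"
  by (rule V_cover[OF K(1)]) (use K(2) in "auto intro: that")
 have nB: "nb B <= SM" "tb (xq B) <= S" "B : SS" if "B : Y" for B
 proof -
  show BS: "B : SS" using that Y(2) by blast
  have "ob B Int ball \<xi> r ~= {}" using Y(4)[OF that] K(2) by blast
  from near_B[OF \<xi> r BS this] show "nb B <= SM" "tb (xq B) <= S" by (auto simp: S_def)
 qed
 have "LE V (xt f) K <= (SUM B:Y. LE V (xt f) (ob B))" by (rule LE_cover[OF K(1) Y(1-3)])
 also have "... <= (SUM B:Y. ennreal (cG * eu f (tb (xq B))))" using nB by (intro sum_mono good(1)) auto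
 also have "... = ennreal (cG * (SUM B:Y. eu f (tb (xq B))))" using cG en by (simp add: sum_ennreal sum_distrib_left)
 also have "... <= ennreal (cG * (real nQ * tC (1 / 8) (26 * A) * eu f S))"
 proof (intro ennreal_leI mult_left_mono cG tb_sum Y)
  show "Y <= SM" using nB nb_self by blast
 qed (use nB U_facts(1) in "auto simp: S_def")
 finally show "LE V (xt f) K <= ennreal (cB * eu f (U Int ball \<xi> (600 * A^4 * r)))" by (simp add: cB_def S_def mult.assoc)
qed

definition "cD = DD (48 * A / kp + 1) * (cE * DD (15 * A / kp) * PK (12 * A / kp))"

text \<open>The cover splits by the neighbours of its balls. If all are small, \<open>good\<close>
  applies; if none is, the extension vanishes there. The mixed balls have size comparable to the
  diameter, which is then finite, so they are boundedly many and are paid for by the L^2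
  norm.\<close>

lemma V_energy:
 assumes I2: "sqi U f = ennreal I2" "0 <= I2"
 shows "LE V (xt f) V <= ennreal (cB * eu f U + cD * (inv_scale_diam Ps U * I2))"
proof (rule LE_exhaust[OF V_open EQ_FL(1)[OF fmU] V_open order_refl])
 have A: "A >= 1" and k: "kp > 0" "27 * kp < 1" by (rule cst)+
 have K1: "12 * A / kp >= 1" using A k by (simp add: field_simps)
 define J where "J = inv_scale_diam Ps U * I2"
 define c where "c = cE * DD (15 * A / kp) * PK (12 * A / kp)"
 have c0: "c >= 0" unfolding c_def using cE DD(1)[of "15 * A / kp"] PK(1)[OF K1] by (intro mult_nonneg_nonneg) auto
 fix K assume K: "compact K" "K <= V"
 obtain Y where Y: "finite Y" "Y <= SS" "K <= (UN B:Y. ob B)"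
  by (rule V_cover[OF K]) (rule that)
 define Y1 where "Y1 = {B:Y. nb B <= SM}"
 define Y2 where "Y2 = {B:Y. ~ nb B <= SM & nb B Int SM ~= {}}"
 define Y3 where "Y3 = {B:Y. ~ nb B <= SM & nb B Int SM = {}}"
 have fin: "finite Y1" "finite Y2" "finite Y3" using Y(1) by (auto simp: Y1_def Y2_def Y3_def)
 have Ys: "Y = Y1 Un (Y2 Un Y3)" unfolding Y1_def Y2_def Y3_def by blast
 have dj: "Y1 Int (Y2 Un Y3) = {}" "Y2 Int Y3 = {}" unfolding Y1_def Y2_def Y3_def by blast+
 have split: "(SUM B:Y. h B) = (SUM B:Y1. h B) + ((SUM B:Y2. h B) + (SUM B:Y3. h B))" for h :: "_ => ennreal"
  unfolding Ys sum.union_disjoint[OF fin(1) finite_UnI[OF fin(2,3)] dj(1)] sum.union_disjoint[OF fin(2,3) dj(2)] ..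
 have "(SUM B:Y1. LE V (xt f) (ob B)) <= (SUM B:Y1. ennreal (cG * eu f (tb (xq B))))"
  using Y(2) by (intro sum_mono good(1)) (auto simp: Y1_def)
 also have "... = ennreal (cG * (SUM B:Y1. eu f (tb (xq B))))" using cG en by (simp add: sum_ennreal sum_distrib_left)
 also have "... <= ennreal (cG * (real nQ * tC (1 / 8) (26 * A) * eu f U))"
 proof (intro ennreal_leI mult_left_mono cG tb_sum fin)
  show "Y1 <= SM" using Y(2) nb_self by (auto simp: Y1_def)
 qed (use U_facts(1) tube_borel in auto)
 also have "cG * (real nQ * tC (1 / 8) (26 * A) * eu f U) = cB * eu f U" by (simp add: cB_def)
 finally have 1: "(SUM B:Y1. LE V (xt f) (ob B)) <= ennreal (cB * eu f U)" .
 have "LE V (xt f) (ob B) <= 0" if "B : Y3" for B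
 proof -
  have B: "B : SS" "nb B Int SM = {}" using that Y(2) by (auto simp: Y3_def)
  have "(aQ f B' - 0)^2 <= 0" if "B' : nb B" for B' using that B(2) by (auto simp: aQ_def)
  from loc_energy[OF B(1) fmU this] show ?thesis by simp
 qed
 hence 3: "(SUM B:Y3. LE V (xt f) (ob B)) <= 0" by (intro sum_nonpos) auto
 have 2: "(SUM B:Y2. LE V (xt f) (ob B)) <= ennreal (cD * J)"
 proof (cases "Y2 = {}")
  case False
  then obtain B0 where Bz: "B0 : Y2" by blast
  then obtain B0' where "B0' : nb B0" "B0' ~: SM" unfolding Y2_def by blast
  with Bz have B0: "~ ereal (6 * A * dV (fst B0')) < ediam U" using nb(1)[of B0 B0'] Y(2) by (auto simp: SMd Y2_def)
  obtain d where d: "ediam U = ereal d" "d > 0" using ediam_pos B0 by (cases "ediam U") auto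
  have J: "J = I2 / Ps d" using d by (simp add: J_def inv_scale_diam_def)
  have diam: "dist p q <= d" if "p : U" "q : U" for p q
  proof -
   have "ereal (dist p q) <= ediam U" unfolding ediam_def using that by (intro SUP_upper2[of "(p, q)"]) auto
   thus ?thesis using d by simp
  qed
  obtain u0 where u0: "u0 : U" using U_facts by blast
  \<comment> \<open>A neighbour that is not small bounds the size from below, one that is small
    bounds the distance to U from above. Averages are estimated against the value 0, which leaves
    the L^2 norm of f.\<close>
  have Yb: "kp * d / (12 * A) <= snd B & dist u0 (fst B) <= 2 * d & LE V (xt f) (ob B) <= ennreal (c * J)" if B: "B : Y2" for B
  proof -
   have BS: "B : SS" using B Y(2) by (auto simp: Y2_def)
   note s = SSf[OF BS]
   obtain B1 where B1: "B1 : nb B" "B1 ~: SM" using B by (auto simp: Y2_def)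
   obtain B2 where B2: "B2 : nb B" "B2 : SM" using B by (auto simp: Y2_def)
   have "d <= 6 * A * dV (fst B1)" using B1 nb(1)[OF BS B1(1)] d by (simp add: SMd)
   moreover have "A * dV (fst B1) <= A * (2 * dV (fst B))" using nb(2)[OF BS B1(1)] A by simp
   ultimately have dv: "d <= 12 * A * dV (fst B)" unfolding mult.assoc by linarith
   hence ds: "d <= 12 * A / kp * snd B" using k by (simp add: s(2))
   have lo: "kp * d / (12 * A) <= snd B" using ds A k by (simp add: field_simps)
   have "6 * A * dV (fst B2) < d" using B2 d by (simp add: SMd)
   moreover have "A * dV (fst B) <= A * (2 * dV (fst B2))" "dV (fst B) <= A * dV (fst B)" using nb(3)[OF BS B2(1)] A s by (auto simp: mult_le_cancel_right1)
   moreover have "dist u0 (fst B) <= d + dist (xq B2) (fst B2) + dist (fst B) (fst B2)"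
    using diam[OF u0 xq(6)[OF B2(2)]] dist_triangle[of u0 "fst B" "xq B2"] dist_triangle[of "xq B2" "fst B" "fst B2"] by (simp add: dist_commute)
   ultimately have hi: "dist u0 (fst B) <= 2 * d" using xq(5)[OF B2(2)] nb(4)[OF BS B2(1)] unfolding mult.assoc by linarith
   define M where "M = DD (15 * A / kp) * I2 / vol (fst B) (snd B)"
   have vB: "vol (fst B) (snd B) > 0" by (rule vol_pos[OF s(4)])
   have "(aQ f B' - 0)^2 <= M" if B': "B' : nb B" for B'
   proof (cases "B' : SM")
    case True
    note x = xq[OF True] and n = nb[OF BS B']
    let ?r = "3 * kp * dU (xq B')"
    have r: "?r > 0" "?r <= dU (xq B')" using k x(7) by auto
    have "sqi (ball (xq B') ?r) (%y. f y - 0) <= (sqi U f)"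
     using ball_U[OF r(2)] by (intro nn_integral_mono) (auto simp: indicator_def)
    hence "(aQ f B' - 0)^2 <= I2 / vol (xq B') ?r" unfolding aQ_bx[OF True] bxd vol_def I2(1)
     using vol_pos[OF r(1), of "xq B'"] I2(2) by (intro average_bound_real borel_set_meas[OF fm]) (auto simp: vol_def)
    also have "... <= M"
    proof -
     have "vol (fst B) (snd B) <= DD (15 * A / kp) * vol (xq B') ?r"
     proof (rule DD(2)[OF r(1)])
      have "A * dV (fst B') <= A * (2 * dV (fst B))" "dV (fst B) <= A * dV (fst B)" using n(2) A s by (auto simp: mult_le_cancel_right1)
      hence "dist (xq B') (fst B) + snd B <= 10 * (A * dV (fst B)) - dV (fst B) / 2"
       using dist_triangle[of "xq B'" "fst B" "fst B'"] x(5) n(4) s unfolding dist_commute[of "fst B'"] mult.assoc by linarith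
      moreover have "A * dV (fst B) <= A * (4 * dU (xq B'))" using n(3) x(3) A by (intro mult_left_mono) auto
      moreover have "15 * A / kp * ?r = 45 * (A * dU (xq B'))" using k by simp
      ultimately show "dist (fst B) (xq B') + snd B <= 15 * A / kp * ?r" using s A x(7) mult_pos_pos[of A "dU (xq B')"] unfolding dist_commute[of "fst B"] by linarith
     qed
     hence "I2 * vol (fst B) (snd B) <= I2 * (DD (15 * A / kp) * vol (xq B') ?r)" using I2(2) by (rule mult_left_mono)
     thus ?thesis using vB vol_pos[OF r(1), of "xq B'"] by (simp add: M_def field_simps)
    qed
    finally show ?thesis .
   qed (use I2(2) DD(1)[of "15 * A / kp"] vB in "auto simp: aQ_def M_def")
   from loc_energy[OF BS fmU this] have "LE V (xt f) (ob B) <= ennreal (cE * (vol (fst B) (snd B) / Ps (snd B)) * M)" .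
   also have "... <= ennreal (c * J)"
   proof (rule ennreal_leI)
    have "Ps d <= Ps (12 * A / kp * snd B)" by (rule Psi_mono[OF d(2) ds])
    also have "... <= PK (12 * A / kp) * Ps (snd B)" by (rule PK(2)[OF K1 s(4)])
    finally have "1 / Ps (snd B) <= PK (12 * A / kp) / Ps d" using Psi_pos[OF s(4)] Psi_pos[OF d(2)] by (simp add: field_simps)
    hence "cE * DD (15 * A / kp) * I2 * (1 / Ps (snd B)) <= cE * DD (15 * A / kp) * I2 * (PK (12 * A / kp) / Ps d)"
     using cE DD(1)[of "15 * A / kp"] I2(2) by (intro mult_left_mono mult_nonneg_nonneg) auto
    thus "cE * (vol (fst B) (snd B) / Ps (snd B)) * M <= c * J" using vB by (simp add: M_def c_def J mult_ac)
   qed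
   finally show ?thesis using lo hi by blast
  qed
  have J0: "J >= 0" using I2(2) Psi_pos[OF d(2)] by (simp add: J)
  have "(SUM B:Y2. LE V (xt f) (ob B)) <= (SUM B:Y2. ennreal (c * J))" using Yb by (intro sum_mono) blast
  also have "... = ennreal (real (card Y2) * (c * J))" using c0 J0 by (simp add: ennreal_mult ennreal_of_nat_eq_real_of_nat)
  also have "... <= ennreal (DD (48 * A / kp + 1) * (c * J))"
  proof (intro ennreal_leI mult_right_mono mult_nonneg_nonneg c0 J0)
   show "real (card Y2) <= DD (48 * A / kp + 1)"
    by (rule SS_count(2)[of "kp * d / (12 * A)" Y2 u0 "2 * d"]) (use Yb Y(2) k A d in "auto simp: Y2_def field_simps")
  qed
  finally show ?thesis by (simp add: cD_def c_def mult.assoc)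
 qed simp
 have J0: "0 <= cD * J"
 proof -
  obtain t where "t > 0" "ereal t < ediam U" using ediam_pos by blast
  hence "0 <= inv_scale_diam Ps U" using Psi_pos by (cases "ediam U") (auto simp: inv_scale_diam_def less_imp_le)
  thus ?thesis using I2(2) c0 DD(1)[of "48 * A / kp + 1"] unfolding cD_def c_def[symmetric] J_def by (intro mult_nonneg_nonneg) auto
 qed
 have "LE V (xt f) K <= (SUM B:Y. LE V (xt f) (ob B))" by (rule LE_cover[OF K(1) Y])
 also have "... <= ennreal (cB * eu f U) + (ennreal (cD * J) + 0)" unfolding split by (intro add_mono 1 2 3)
 also have "... = ennreal (cB * eu f U + cD * J)" using cG en J0 by (simp add: ennreal_plus)
 finally show "LE V (xt f) K <= ennreal (cB * eu f U + cD * (inv_scale_diam Ps U * I2))" by (simp add: J_def)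
qed

end

end

section \<open>Energy across the boundary\<close>

context ext
begin

lemma scale_diam: assumes "ereal r < ereal (1 / t) * ediam U" "t > 0" shows "ereal (t * r) < ediam U"
 using assms by (cases "ediam U") (auto simp: field_simps)

definition "cV = 2 * DD (10 * A) * real nQ * (chC (1 / 8) (26 * A) * tC (1 / 8) (26 * A) + cR)"
definition "cA = (cU + cV) * PK (6 * A)"

lemma cA: "cV >= 0" "cA >= 0"
proof -
 have "chC (1 / 8) (26 * A) >= 0" using cst(1) by (intro chC1) simp
 thus v: "cV >= 0" unfolding cV_def using DD(1)[of "10 * A"] tC[of "1 / 8" "26 * A"] cU
  by (intro mult_nonneg_nonneg add_nonneg_nonneg) auto
 show "cA >= 0" unfolding cA_def using v cU PK(1)[of "6 * A"] cst(1) by (intro mult_nonneg_nonneg add_nonneg_nonneg) auto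
qed

context
 fixes f assumes fU: "f : FL U" and fm: "f : borel_measurable borel" and ffin: "LE U f U < \<infinity>"
  and f2: "(sqi U f) < \<infinity>"
begin

abbreviation "g == xt f"
abbreviation "tt x == tube (1 / 8) (26 * A) x (dU x)"
lemmas f_hyps = fU fm ffin
lemmas fmr = fmU[OF f_hyps] and eun = eu_nonneg[OF f_hyps] and eum = eu_mono[OF f_hyps] and LEu = LE_eu[OF f_hyps]
lemmas gV = EQ_FL(1)[OF fmr] and gm = EQ_FL(2)[OF fmr]

text \<open>The reference value is that of the U side: each tripled ball oscillates little around
  the average at its reflected centre, and the deviations of these averages from av are summed by
  the hypothesis, after accounting for the multiplicity of the reflection.\<close>

lemma osc_V:
 assumes \<xi>: "\<xi> : frontier U" and r: "r > 0" "ereal (96 * A^2 * r) < ediam U"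
  and av: "!!Y. finite Y ==> Y <= XU ==> (!!x. x : Y ==> dist \<xi> x <= 6 * A * r) ==>
   (SUM x:Y. vol x (dU x) * (bb f x - av)^2) <= cR * Ps (6 * A * r) * eu f (U Int ball \<xi> (600 * A^4 * r))"
 shows "sqi (V Int ball \<xi> r) (%x. g x - av) <= ennreal (cV * Ps (6 * A * r) * eu f (U Int ball \<xi> (600 * A^4 * r)))"
proof (rule nn_integral_exhaust)
 show "open (V Int ball \<xi> r)" using V_open by auto
 note [measurable] = gm
 show "(%x. ennreal ((g x - av)^2)) : borel_measurable borel" by measurable
 define S where "S = U Int ball \<xi> (600 * A^4 * r)"
 define d where "d = DD (10 * A)"
 define c where "c = chC (1 / 8) (26 * A)"
 have A: "A >= 1" by (rule cst)
 have dc: "d >= 1" "c >= 0" using DD(1) chC1[of "26 * A"] A by (auto simp: d_def c_def)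
 have "A * r <= A^2 * r" using A r by (simp add: power2_eq_square)
 hence "16 * A * r <= 96 * A^2 * r" using A r unfolding mult.assoc by (smt (verit) mult_pos_pos)
 hence r16: "ereal (16 * A * r) < ediam U" using r(2) le_less_trans[of "ereal (16 * A * r)" "ereal (96 * A^2 * r)"] by simp
 have q: "6 * A * r > 0" "3 * r <= 6 * A * r" using A r by auto
 note Pq = Psi_pos[OF q(1)]
 fix K assume K: "compact K" "K <= V Int ball \<xi> r"
 obtain Y where Y: "finite Y" "Y <= SS" "K <= (UN B:Y. ob B)" "!!B. B : Y ==> ob B Int K ~= {}"
  by (rule V_cover[OF K(1)]) (use K(2) in "auto intro: that")
 have nB: "nb B <= SM" "tt (xq B) <= S" "B : SS" "dist \<xi> (xq B) <= 6 * A * r" "dU (xq B) <= 6 * A * r" if "B : Y" for B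
 proof -
  show BS: "B : SS" using that Y(2) by blast
  have "ob B Int ball \<xi> r ~= {}" using Y(4)[OF that] K(2) by blast
  from near_B[OF f_hyps \<xi> r16 BS this] q(2) show "nb B <= SM" "tt (xq B) <= S" "dist \<xi> (xq B) <= 6 * A * r" "dU (xq B) <= 6 * A * r" by (auto simp: S_def)
 qed
 have SM: "Y <= SM" using nB(1,3) nb_self by blast
 have one: "(sqi (ob B) (%z. g z - av))
   <= ennreal (2 * d * c * Ps (6 * A * r) * eu f (tt (xq B)) + 2 * d * (vol (xq B) (dU (xq B)) * (bb f (xq B) - av)^2))" if B: "B : Y" for B
 proof -
  define x where "x = xq B"
  have xp: "dU x > 0" unfolding x_def by (rule xq(7)) (use B SM in blast)
  note G = good(2,3)[OF f_hyps nB(3,1)[OF B], folded x_def d_def c_def]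
  have "sqi (ob B) (%z. g z - av) <= 2 * (sqi (ob B) (%z. g z - bb f x)) + ennreal (2 * (bb f x - av)^2) * emeasure m (ob B)"
   by (rule nn_shift[OF gm]) simp
  also have "... <= 2 * ennreal (d * c * Ps (dU x) * eu f (tt x)) + ennreal (2 * (bb f x - av)^2) * ennreal (d * vol x (dU x))"
   using G by (intro add_mono mult_left_mono) (auto simp: emeasure_bounded vol_def ennreal_leI)
  also have "... = ennreal (2 * (d * c * Ps (dU x) * eu f (tt x)) + 2 * (bb f x - av)^2 * (d * vol x (dU x)))"
   using dc Psi_pos[OF xp] eun by (simp add: ennreal_plus ennreal_mult vol_def)
  also have "... <= ennreal (2 * (d * c * Ps (6 * A * r) * eu f (tt x)) + 2 * (bb f x - av)^2 * (d * vol x (dU x)))"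
   using Psi_mono[OF xp, of "6 * A * r"] nB(5)[OF B] dc eun by (intro ennreal_leI add_right_mono mult_left_mono mult_right_mono) (auto simp: x_def)
  finally show ?thesis by (simp add: x_def mult_ac)
 qed
 have "sqi K (%x. g x - av) <= (SUM B:Y. \<integral>\<^sup>+z\<in>ob B. ennreal ((g z - av)^2) \<partial>m)"
  by (rule nn_integral_UN_le[OF Y(1) _ _ _ Y(3)]) (use K in "auto simp: compact_imp_closed")
 also have "... <= (SUM B:Y. ennreal (2 * d * c * Ps (6 * A * r) * eu f (tt (xq B)) + 2 * d * (vol (xq B) (dU (xq B)) * (bb f (xq B) - av)^2)))"
  by (rule sum_mono[OF one])
 also have "... = ennreal (SUM B:Y. 2 * d * c * Ps (6 * A * r) * eu f (tt (xq B)) + 2 * d * (vol (xq B) (dU (xq B)) * (bb f (xq B) - av)^2))"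
  using dc Pq eun by (intro sum_ennreal) (auto simp: vol_def)
 also have "... <= ennreal (cV * Ps (6 * A * r) * eu f S)"
 proof (rule ennreal_leI)
  have "(SUM B:Y. eu f (tt (xq B))) <= real nQ * tC (1 / 8) (26 * A) * eu f S"
   by (rule tb_sum[OF f_hyps Y(1) SM nB(2)]) (use U_facts(1) in "auto simp: S_def")
  hence 1: "2 * d * c * Ps (6 * A * r) * (SUM B:Y. eu f (tt (xq B))) <= 2 * d * c * Ps (6 * A * r) * (real nQ * tC (1 / 8) (26 * A) * eu f S)"
   using dc Pq by (intro mult_left_mono) auto
  have "(SUM B:Y. vol (xq B) (dU (xq B)) * (bb f (xq B) - av)^2) <= real nQ * (SUM x:xq ` Y. vol x (dU x) * (bb f x - av)^2)"
   by (rule Q_sum[OF Y(1) SM]) (simp add: vol_def)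
  also have "... <= real nQ * (cR * Ps (6 * A * r) * eu f S)" unfolding S_def
   by (intro mult_left_mono av) (use Y(1) SM xq(1) nB(4) in auto)
  finally have 2: "2 * d * (SUM B:Y. vol (xq B) (dU (xq B)) * (bb f (xq B) - av)^2) <= 2 * d * (real nQ * (cR * Ps (6 * A * r) * eu f S))"
   using dc by (intro mult_left_mono) auto
  have "(SUM B:Y. 2 * d * c * Ps (6 * A * r) * eu f (tt (xq B)) + 2 * d * (vol (xq B) (dU (xq B)) * (bb f (xq B) - av)^2))
   = 2 * d * c * Ps (6 * A * r) * (SUM B:Y. eu f (tt (xq B))) + 2 * d * (SUM B:Y. vol (xq B) (dU (xq B)) * (bb f (xq B) - av)^2)"
   by (simp only: sum.distrib sum_distrib_left)
  also have "... <= cV * Ps (6 * A * r) * eu f S"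
   by (rule order_trans[OF add_mono[OF 1 2]]) (simp add: cV_def d_def c_def algebra_simps)
  finally show "(SUM B:Y. 2 * d * c * Ps (6 * A * r) * eu f (tt (xq B)) + 2 * d * (vol (xq B) (dU (xq B)) * (bb f (xq B) - av)^2)) <= cV * Ps (6 * A * r) * eu f S" .
 qed
 finally show "sqi K (%x. g x - av) <= ennreal (cV * Ps (6 * A * r) * eu f (U Int ball \<xi> (600 * A^4 * r)))" by (simp add: S_def)
qed

text \<open>Valid because the frontier is a null set.\<close>

lemma split_UV: assumes h: "h : borel_measurable borel" and S: "S : sets borel"
 shows "(\<integral>\<^sup>+x\<in>S. h x \<partial>m) <= (\<integral>\<^sup>+x\<in>U Int S. h x \<partial>m) + (\<integral>\<^sup>+x\<in>V Int S. h x \<partial>m)"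
proof -
 have [measurable]: "h : borel_measurable m" "S : sets m" "U : sets m" "V : sets m" using h S U_facts(1) V_open by (simp_all add: measurable_def)
 have "AE x in m. x ~: frontier U" using frontier_null by (intro AE_not_in) (simp add: null_sets_def)
 hence "AE x in m. h x * indicator S x <= h x * indicator (U Int S) x + h x * indicator (V Int S) x"
  by (rule AE_mp, intro AE_I2) (auto simp: frontier_def V_eq indicator_def U_facts(1) interior_open)
 hence "(\<integral>\<^sup>+x\<in>S. h x \<partial>m) <= (\<integral>\<^sup>+x. h x * indicator (U Int S) x + h x * indicator (V Int S) x \<partial>m)" by (rule nn_integral_mono_AE)
 also have "... = (\<integral>\<^sup>+x\<in>U Int S. h x \<partial>m) + (\<integral>\<^sup>+x\<in>V Int S. h x \<partial>m)" by (rule nn_integral_add) measurable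
 finally show ?thesis .
qed

lemma gU: "x : U ==> g x = f x" by (simp add: whitney_extension_def)

text \<open>One reference value serves both sides; it is taken at scale 6 A r because reflections of
  balls within r of the boundary point may be that far away.\<close>

lemma frontier_osc:
 assumes \<xi>: "\<xi> : frontier U" and r: "r > 0" "ereal (96 * A^2 * r) < ediam U"
 shows "EX av. sqi (ball \<xi> r) (%x. g x - av) <= ennreal (cA * Ps r * eu f (U Int ball \<xi> (600 * A^4 * r)))"
proof -
 have A: "A >= 1" by (rule cst)
 have q: "6 * A * r > 0" "ereal (16 * A * (6 * A * r)) < ediam U" using A r by (simp_all add: power2_eq_square mult_ac)
 define c where "c = Ps (6 * A * r) * eu f (U Int ball \<xi> (600 * A^4 * r))"
 have e: "100 * A^3 * (6 * A * r) = 600 * A^4 * r" by (simp add: power3_eq_cube power4_eq_xxxx)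
 obtain av where av: "!!Y. finite Y ==> Y <= XU ==> (!!x. x : Y ==> dist \<xi> x <= 6 * A * r) ==>
  (SUM x:Y. vol x (dU x) * (bb f x - av)^2) <= cR * Ps (6 * A * r) * eu f (U Int ball \<xi> (100 * A^3 * (6 * A * r)))"
  by (rule near_average[OF f_hyps \<xi> q]) (rule that, blast)
 note gm[measurable]
 have 1: "sqi (U Int ball \<xi> r) (%x. g x - av) <= ennreal (cU * c)"
 proof -
  have "ball \<xi> r <= ball \<xi> (6 * A * r / 2)" using A r by (intro subset_ball) simp
  hence "sqi (U Int ball \<xi> r) (%x. g x - av) <= (sqi (U Int ball \<xi> (6 * A * r / 2)) (%x. f x - av))"
   by (intro nn_integral_mono) (auto simp: indicator_def gU)
  also have "... <= ennreal (cU * c)" using near_U[OF f_hyps \<xi> q(1) av] unfolding e c_def by (simp add: mult.assoc)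
  finally show ?thesis .
 qed
 have 2: "sqi (V Int ball \<xi> r) (%x. g x - av) <= ennreal (cV * c)"
  using osc_V[OF \<xi> r av[unfolded e]] unfolding c_def by (simp add: mult.assoc)
 have "sqi (ball \<xi> r) (%x. g x - av) <= ennreal (cU * c) + ennreal (cV * c)"
  by (rule order_trans[OF split_UV add_mono[OF 1 2]]) auto
 also have "... = ennreal ((cU + cV) * c)" unfolding distrib_right
  using cU cA eun Psi_pos[OF q(1)] by (intro ennreal_plus[symmetric] mult_nonneg_nonneg) (auto simp: c_def)
 also have "... <= ennreal (cA * Ps r * eu f (U Int ball \<xi> (600 * A^4 * r)))"
 proof (rule ennreal_leI)
  have "Ps (6 * A * r) <= PK (6 * A) * Ps r" by (rule PK(2)) (use A r in auto)
  hence "(cU + cV) * c <= (cU + cV) * (PK (6 * A) * Ps r * eu f (U Int ball \<xi> (600 * A^4 * r)))"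
   unfolding c_def using cU cA eun by (intro mult_left_mono mult_right_mono) auto
  thus "(cU + cV) * c <= cA * Ps r * eu f (U Int ball \<xi> (600 * A^4 * r))" by (simp add: cA_def mult.assoc)
 qed
 finally show ?thesis by blast
qed

text \<open>On V the square of the extension is at most the weighted mean of the squared
  coefficients, by convexity. Each squared coefficient times the volume of its ball is at most an
  integral of f^2 over a reflected ball, and these have bounded overlap.\<close>

lemma g_L2: "g : L2"
proof -
 note gm[measurable] fm[measurable]
 define C where "C = ennreal (DD (4 * A / kp) * real nQ * DD (8 / kp + 1)) * (sqi U f)"
 have k: "kp > 0" "27 * kp < 1" and A: "A >= 1" by (rule cst)+
 have "sqi V g <= C"
 proof (rule nn_integral_exhaust[OF _ V_open])
  show "(%x. ennreal ((g x)^2)) : borel_measurable borel" by measurable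
  fix K assume K: "compact K" "K <= V"
  obtain Y where Y: "finite Y" "Y <= SS" "K <= (UN B:Y. ob B)" by (rule V_cover[OF K]) (rule that)
  define Z where "Z = (UN B:Y. nb B)"
  have Z: "finite Z" "Z <= SS" unfolding Z_def
   by (rule finite_UN_I[OF Y(1) nb_fin(1)[OF subsetD[OF Y(2)]]], assumption, rule UN_least, rule nb_fin(3)[OF subsetD[OF Y(2)]])
  define W where "W = Z Int SM"
  have W: "finite W" "W <= SM" "W <= SS" using Z by (auto simp: W_def)
  let ?b = "%x. ball x (3 * kp * dU x)"
  have kd: "3 * kp * t <= t / 9" if "t > 0" for t using mult_strict_right_mono[OF k(2) that] by simp
  have pt: "(g z)^2 <= (SUM B:W. (aQ f B)^2 * indicator (ball (fst B) (6 * snd B)) z)" if z: "z : K" for z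
  proof -
   obtain B where B: "B : Y" "z : ob B" using z Y(3) by blast
   have BS: "B : SS" using B Y by blast
   have nZ: "nb B <= Z" using B(1) by (auto simp: Z_def)
   note e = EQ_V(1)[OF BS B(2) Z(1) nZ Z(2), of f] EQ_V(2)[OF BS B(2) Z(1) nZ Z(2)]
   have "0 <= (SUM B:Z. \<psi> B z * (aQ f B - g z)^2)" using psiD(3) Z(2) by (intro sum_nonneg mult_nonneg_nonneg) auto
   also have "... = (SUM B:Z. \<psi> B z * (aQ f B)^2) - 2 * g z * (SUM B:Z. aQ f B * \<psi> B z) + (g z)^2 * (SUM B:Z. \<psi> B z)"
    by (simp add: power2_eq_square algebra_simps sum.distrib sum_subtractf sum_distrib_left sum_distrib_right)
   finally have "(g z)^2 <= (SUM B:Z. \<psi> B z * (aQ f B)^2)" by (simp add: e(1)[symmetric] e(2) power2_eq_square)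
   also have "... = (SUM B:W. \<psi> B z * (aQ f B)^2)" using Z(1) by (intro sum.mono_neutral_right) (auto simp: W_def aQ_def)
   also have "... <= (SUM B:W. (aQ f B)^2 * indicator (ball (fst B) (6 * snd B)) z)"
   proof (rule sum_mono)
    fix B assume "B : W"
    hence B: "B : SS" using W by blast
    have "\<psi> B z <= indicator (ball (fst B) (6 * snd B)) z" using psiD(4,6)[OF B, of z] by (auto simp: indicator_def)
    from mult_right_mono[OF this zero_le_power2[of "aQ f B"]]
    show "\<psi> B z * (aQ f B)^2 <= (aQ f B)^2 * indicator (ball (fst B) (6 * snd B)) z" by (simp only: mult.commute)
   qed
   finally show ?thesis .
  qed
  have "sqi K g <= (\<integral>\<^sup>+x. (SUM B:W. ennreal ((aQ f B)^2) * indicator (ball (fst B) (6 * snd B)) x) \<partial>m)"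
  proof (rule nn_integral_mono)
   fix x
   have "(SUM B:W. ennreal ((aQ f B)^2) * indicator (ball (fst B) (6 * snd B)) x) = ennreal (SUM B:W. (aQ f B)^2 * indicator (ball (fst B) (6 * snd B)) x)"
    by (subst sum_ennreal[symmetric]) (auto simp: ennreal_mult intro!: sum.cong split: split_indicator)
   thus "ennreal ((g x)^2) * indicator K x <= (SUM B:W. ennreal ((aQ f B)^2) * indicator (ball (fst B) (6 * snd B)) x)"
    using pt[of x] by (cases "x : K") (auto intro: ennreal_leI)
  qed
  also have "... = (SUM B:W. ennreal ((aQ f B)^2 * vol (fst B) (6 * snd B)))"
   by (subst nn_integral_sum) (auto simp: nn_integral_cmult_indicator emeasure_bounded vol_def ennreal_mult
    intro!: borel_measurable_times_ennreal borel_measurable_const borel_measurable_indicator)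
  also have "... <= (SUM B:W. ennreal (DD (4 * A / kp)) * (sqi (?b (xq B)) f))"
  proof (rule sum_mono)
   fix B assume "B : W"
   hence B: "B : SM" "B : SS" using W by auto
   note x = xq[OF B(1)] and s = SSf[OF B(2)]
   have r: "3 * kp * dU (xq B) > 0" using k x by simp
   have "vol (fst B) (6 * snd B) <= DD (4 * A / kp) * vol (xq B) (3 * kp * dU (xq B))"
   proof (rule DD(2)[OF r])
    have "4 * A / kp * (3 * kp * dU (xq B)) = 12 * (A * dU (xq B))" using k by simp
    moreover have "A * dV (fst B) <= A * (2 * dU (xq B))" "dV (fst B) <= A * dV (fst B)" using x(3) A s by (auto simp: mult_le_cancel_right1)
    ultimately show "dist (fst B) (xq B) + 6 * snd B <= 4 * A / kp * (3 * kp * dU (xq B))"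
     using x(5) s(3,5) unfolding dist_commute[of "fst B"] mult.assoc[of 4] by linarith
   qed
   hence "ennreal ((aQ f B)^2 * vol (fst B) (6 * snd B)) <= ennreal ((aQ f B)^2 * (DD (4 * A / kp) * vol (xq B) (3 * kp * dU (xq B))))"
    by (intro ennreal_leI mult_left_mono) auto
   also have "... = ennreal (DD (4 * A / kp)) * ennreal (measure m (?b (xq B)) * (set_average m (?b (xq B)) f - 0)^2)"
    using DD(1)[of "4 * A / kp"] by (simp add: ennreal_mult[symmetric] aQ_bx[OF f_hyps B(1)] bx_def[OF f_hyps] vol_def mult_ac)
   also have "... <= ennreal (DD (4 * A / kp)) * (sqi (?b (xq B)) (%x. f x - 0))"
    using vol_pos[OF r, of "xq B"] by (intro mult_left_mono average_bound borel_set_meas[OF fm]) (auto simp: vol_def)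
   finally show "ennreal ((aQ f B)^2 * vol (fst B) (6 * snd B)) <= ennreal (DD (4 * A / kp)) * (sqi (?b (xq B)) f)" by simp
  qed
  also have "... = ennreal (DD (4 * A / kp)) * (SUM B:W. \<integral>\<^sup>+x\<in>?b (xq B). ennreal ((f x)^2) \<partial>m)" by (simp add: sum_distrib_left)
  also have "... <= ennreal (DD (4 * A / kp)) * (ennreal (real nQ * DD (8 / kp + 1)) * (sqi U f))"
  proof (intro mult_left_mono nn_integral_overlap W(1))
   fix B assume "B : W"
   hence x: "xq B : U" "dU (xq B) > 0" using xq(6,7)[OF subsetD[OF W(2)]] by auto
   show "?b (xq B) <= U" using kd[OF x(2)] x(2) by (intro ball_U) simp
   show "?b (xq B) : sets m" by simp
  next
   fix z assume z: "z : U"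
   hence zp: "dU z > 0" using dU_pos by blast
   define h where "h x = (if z : ?b x then 1 else 0 :: real)" for x
   have "real (card {B:W. z : ?b (xq B)}) = (SUM B:W. h (xq B))" using W(1) by (simp add: h_def sum.If_cases Int_def)
   also have "... <= real nQ * (SUM x:xq ` W. h x)" by (rule Q_sum[OF W(1,2)]) (simp add: h_def)
   also have "(SUM x:xq ` W. h x) = real (card {x:xq ` W. z : ?b x})" using W(1) by (simp add: h_def sum.If_cases Int_def)
   also have "... <= DD (8 / kp + 1)"
   proof -
    have *: "dist z x <= 2 * dU z & 1 / 2 * dU z <= dU x" if x: "x : {x:xq ` W. z : ?b x}" for x
    proof -
     have xp: "dU x > 0" using x xq(7) W(2) by blast
     have "dist x z < dU x / 9" using x kd[OF xp] by simp
     thus ?thesis using dU_lip[of x z] dU_lip[of z x] xp unfolding dist_commute[of z x] by linarith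
    qed
    have "{x:xq ` W. z : ?b x} <= XU" using xq(1) W(2) by blast
    from XU_count(2)[OF zp _ this *] show ?thesis by simp
   qed
   finally show "real (card {B:W. z : ?b (xq B)}) <= real nQ * DD (8 / kp + 1)" by (simp add: mult_left_mono)
  qed (use U_facts(1) in auto)
  also have "... = C" unfolding C_def using DD(1)[of "4 * A / kp"] DD(1)[of "8 / kp + 1"]
   by (subst mult.assoc[symmetric], subst ennreal_mult[symmetric]) (auto simp: mult.assoc)
  finally show "sqi K g <= C" .
 qed
 moreover have "sqi U g = (sqi U f)" by (intro nn_integral_cong) (auto simp: indicator_def gU)
 moreover have "C < \<infinity>" using f2 by (simp add: C_def ennreal_mult_less_top)
 moreover have "sqi UNIV g <= (sqi (U Int UNIV) g) + (sqi (V Int UNIV) g)" by (rule split_UV) auto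
 ultimately have "(\<integral>\<^sup>+x. ennreal ((g x)^2) \<partial>m) < \<infinity>" using f2 by (auto intro: le_less_trans simp: ennreal_add_eq_top less_top[symmetric] top_unique)
 hence "integrable m (%x. (g x)^2)" by (intro integrableI_nonneg) (use gm in "auto intro!: borel_measurable_power simp: measurable_cong_sets[OF sets_m refl]")
 thus ?thesis using gm by (simp add: L2_iff)
qed

text \<open>The sum of the two local energy measures, pushed to the whole space. It is available
  before the extension is known to be in F.\<close>

definition "nu = measure_of UNIV (sets borel) (%S. LE U f (S Int U) + LE V g (S Int V))"

lemma sets_nu[simp]: "sets nu = sets (borel :: 'a measure)" using sets.sigma_sets_eq[of "borel :: 'a measure"] by (simp add: nu_def)

lemma emeasure_nu: assumes "S : sets borel" shows "emeasure nu S = LE U f (S Int U) + LE V g (S Int V)"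
proof (rule emeasure_measure_of[OF nu_def])
 show "positive (sets nu) (%S. LE U f (S Int U) + LE V g (S Int V))" by (simp add: positive_def)
 show "countably_additive (sets nu) (%S. LE U f (S Int U) + LE V g (S Int V))"
 proof (rule countably_additiveI)
  fix S :: "nat => 'a set" assume S: "range S <= sets nu" "disjoint_family S"
  have d: "disjoint_family (%i. S i Int W)" for W using S(2) by (auto simp: disjoint_family_on_def)
  have m: "range (%i. S i Int U) <= sets (local_energy_measure m E F U f)" "range (%i. S i Int V) <= sets (local_energy_measure m E F V g)"
   using S(1) U_facts(1) V_open by (auto simp: sets_LE[OF U_facts(1) fU] sets_LE[OF V_open gV] image_subset_iff)
  show "(\<Sum>i. LE U f (S i Int U) + LE V g (S i Int V)) = LE U f ((\<Union>i. S i) Int U) + LE V g ((\<Union>i. S i) Int V)"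
   using suminf_emeasure[OF m(1) d] suminf_emeasure[OF m(2) d] by (simp add: suminf_add[symmetric] Int_UN_distrib2)
 qed
qed (use assms in auto)

definition "I2 = enn2real (sqi U f)"

lemma I2: "sqi U f = ennreal I2" "0 <= I2"
 using f2 by (simp_all add: I2_def)

lemma nu_fin: "finite_measure nu" "emeasure nu S = ennreal (measure nu S)"
proof -
 have "LE V g V < \<infinity>" using V_energy[OF f_hyps I2] by (rule le_less_trans) simp
 moreover have "space nu = UNIV" by (simp add: nu_def)
 ultimately show fin: "finite_measure nu" using ffin by (intro finite_measureI) (auto simp: emeasure_nu ennreal_add_eq_top less_top)
 show "emeasure nu S = ennreal (measure nu S)" by (rule finite_measure.emeasure_eq_measure[OF fin])
qed

lemma nu_ge: assumes "S : sets borel" shows "LE U f (S Int U) <= ennreal (measure nu S)" "LE V g (S Int V) <= ennreal (measure nu S)"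
 unfolding nu_fin(2)[symmetric] emeasure_nu[OF assms] by (simp_all add: le_iff_add add.commute)
lemma eu_nu: "S : sets borel ==> eu f (U Int S) <= measure nu S"
 using nu_ge(1)[of S] by (simp add: LEu Int_commute)
lemma nu_mono: "S <= T' ==> T' : sets borel ==> measure nu S <= measure nu T'"
 by (rule finite_measure.finite_measure_mono[OF nu_fin(1)]) simp_all

lemma hits_frontier: assumes "r > 0" "u : ball x r" "u : U" "v : ball x r" "v ~: U"
 obtains \<xi> where "\<xi> : frontier U" "ball x r <= ball \<xi> (2 * AP * r)" "dist x \<xi> < AP * r"
proof -
 obtain \<xi> where \<xi>: "\<xi> : frontier U" "dist x \<xi> < AP * r" using meets_frontier[OF assms] by auto
 have "r <= AP * r" using cst(2) assms(1) by simp
 hence "ball x r <= ball \<xi> (2 * AP * r)" using \<xi>(2) dist_triangle3[of \<xi> _ x] by (auto simp: subset_iff mult.assoc) (smt (verit))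
 thus ?thesis using that \<xi> by blast
qed

text \<open>The two summands belong to the two cases of the oscillation estimate, PI inside one of
  the open sides and the estimate at the frontier.\<close>

definition "cH = CP + cA * PK (2 * AP^2)"
definition "cK = 1300 * A^4 * AP^2"

lemma cK: "1 <= cK" "0 <= cH" "1 <= A^4" "1 <= AP^2" "AP <= AP^2" "1 <= 2 * AP^2" "1 < cK"
proof -
 show a: "1 <= A^4" "1 <= AP^2" "AP <= AP^2" using cst(1,2) one_le_power[of A 4] one_le_power[of "AP" 2] power_increasing[of 1 2 "AP"] by auto
 show p: "1 <= 2 * AP^2" using a by linarith
 show "1 < cK" unfolding cK_def using mult_mono[of 1 "A^4" 1 "AP^2"] a by simp
 thus "1 <= cK" by simp
 show "0 <= cH" unfolding cH_def using cst(3) cA PK(1)[OF p] by (intro add_nonneg_nonneg mult_nonneg_nonneg) auto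
qed

text \<open>PI inside U and inside V gives the bound with the energy of the respective side; a ball
  whose dilate lies in neither is contained in a comparable ball centred on the frontier.\<close>

lemma osc_nu:
 assumes r: "r > 0" "ereal (96 * A^2 * (2 * AP^2 * r)) < ediam U"
 shows "EX av. sqi (ball x r) (%y. g y - av) <= ennreal (cH * Ps r * measure nu (ball x (cK * r)))"
proof -
 let ?B = "ball x (AP * r)"
 note Pr = Psi_pos[OF r(1)]
 have PP: "AP * r <= AP^2 * r" "AP^2 * r <= A^4 * AP^2 * r" "AP * r > 0" using cK r(1) cst(2) by (auto intro!: mult_right_mono simp: mult_le_cancel_right1)
 have "AP * r <= cK * r" using PP unfolding cK_def mult.assoc by linarith
 hence BK: "measure nu ?B <= measure nu (ball x (cK * r))" by (intro nu_mono subset_ball) auto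
 have pi: "EX av. sqi (ball x r) (%y. g y - av) <= ennreal (cH * Ps r * measure nu (ball x (cK * r)))"
  if W: "open W" "h : FL W" "?B <= W" "!!y. y : W ==> g y = h y" "LE W h ?B <= ennreal (measure nu ?B)" for W h
 proof -
  have "ball x r <= ?B" using cst(2) r(1) by (intro subset_ball) simp
  hence "ball x r <= W" using W(3) by blast
  hence "sqi (ball x r) (%y. g y - set_average m (ball x r) h) = (sqi (ball x r) (%y. h y - set_average m (ball x r) h))"
   using W(4) by (intro nn_integral_cong) (auto simp: indicator_def subset_iff)
  also have "... <= ennreal (CP * Ps r) * LE W h ?B" by (rule poincare_ball[OF W(1,2) r(1) W(3)])
  also have "... <= ennreal (CP * Ps r) * ennreal (measure nu (ball x (cK * r)))"
   using BK by (intro mult_left_mono order_trans[OF W(5)] ennreal_leI) auto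
  also have "... <= ennreal (cH * Ps r * measure nu (ball x (cK * r)))"
   using cst(3) Pr cA PK(1)[OF cK(6)] by (auto simp: ennreal_mult[symmetric] cH_def intro!: ennreal_leI mult_right_mono)
  finally show ?thesis by blast
 qed
 show ?thesis
 proof (cases "?B <= U | ?B <= V")
  case True
  thus ?thesis
  proof
   assume B: "?B <= U"
   show ?thesis by (rule pi[OF U_facts(1) fU B gU]) (use nu_ge(1)[of ?B] B in "auto simp: Int_absorb2")
  next
   assume B: "?B <= V"
   show ?thesis by (rule pi[OF V_open gV B refl]) (use nu_ge(2)[of ?B] B in "auto simp: Int_absorb2")
  qed
 next
  case False
  \<comment> \<open>The dilated ball may meet both sides without meeting the frontier. Then the
    frontier point comes from its own dilate, which explains the square of
    \<open>AP\<close>.\<close>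
  have "EX \<xi>:frontier U. dist x \<xi> < AP^2 * r"
  proof (cases "?B Int frontier U = {}")
   case True
   hence "y : U | y : V" if "y : ?B" for y using that U_facts(1) unfolding V_eq frontier_def interior_open[OF U_facts(1)] by blast
   then obtain u v where "u : ?B" "u : U" "v : ?B" "v ~: U" using False V_U by blast
   from meets_frontier[OF PP(3) this] show ?thesis by (auto simp: power2_eq_square mult.assoc)
  next
   case False
   thus ?thesis using PP(1) by force
  qed
  then obtain \<xi> where \<xi>: "\<xi> : frontier U" "dist x \<xi> < AP^2 * r" by blast
  let ?r = "2 * AP^2 * r"
  have "1 * r <= AP^2 * r" using cK(4) r(1) by (intro mult_right_mono) auto
  hence r2: "?r > 0" "r <= AP^2 * r" using r(1) unfolding mult.assoc by linarith+
  obtain av where av: "sqi (ball \<xi> ?r) (%y. g y - av) <= ennreal (cA * Ps ?r * eu f (U Int ball \<xi> (600 * A^4 * ?r)))"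
   using frontier_osc[OF \<xi>(1) r2(1)] r(2) by blast
  have "ball x r <= ball \<xi> ?r"
  proof
   fix y assume "y : ball x r"
   thus "y : ball \<xi> ?r" using \<xi>(2) r2 dist_triangle3[of \<xi> y x] unfolding mem_ball mult.assoc by linarith
  qed
  hence "sqi (ball x r) (%y. g y - av) <= (sqi (ball \<xi> ?r) (%y. g y - av))"
   by (intro nn_integral_mono) (auto simp: indicator_def)
  also note av
  also have "ennreal (cA * Ps ?r * eu f (U Int ball \<xi> (600 * A^4 * ?r))) <= ennreal (cH * Ps r * measure nu (ball x (cK * r)))"
  proof (rule ennreal_leI, rule mult_mono)
   have "cA * Ps ?r <= cA * (PK (2 * AP^2) * Ps r)" using cA PK(2)[OF cK(6) r(1)] by (intro mult_left_mono) auto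
   also have "... <= cH * Ps r" using cst(3) Pr by (simp add: cH_def distrib_right)
   finally show "cA * Ps ?r <= cH * Ps r" .
   have "ball \<xi> (600 * A^4 * ?r) <= ball x (cK * r)"
   proof
    fix y assume "y : ball \<xi> (600 * A^4 * ?r)"
    hence "dist \<xi> y < 1200 * (A^4 * (AP^2 * r))" by (simp add: mult_ac)
    thus "y : ball x (cK * r)" using \<xi>(2) PP dist_triangle[of x y \<xi>] unfolding mem_ball cK_def mult.assoc by linarith
   qed
   thus "eu f (U Int ball \<xi> (600 * A^4 * ?r)) <= measure nu (ball x (cK * r))"
    by (intro order_trans[OF eu_nu nu_mono]) auto
  qed (use cK Pr eun in auto)
  finally show ?thesis by blast
 qed
qed

lemma EQ_F: "g : F" "E g g <= cW cK * cH * measure nu UNIV"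
  "open S ==> e > 0 ==> gm g S <= cW cK * cH * measure nu (UN x:S. ball x e)"
proof -
 obtain t where t: "t > 0" "ereal t < ediam U" using ediam_pos by blast
 define w where "w = 96 * A^2 * (2 * AP^2)"
 define r0 where "r0 = t / w"
 have c: "w > 0" unfolding w_def using cst(1,2) by simp
 hence r0: "r0 > 0" using t by (simp add: r0_def)
 have osc: "EX av. sqi (ball x r) (%y. g y - av) <= ennreal (cH * Ps r * measure nu (ball x (cK * r)))" if r: "0 < r" "r <= r0" for x r
 proof (rule osc_nu[OF r(1)])
  have "w * r <= t" using r(2) c by (simp add: r0_def field_simps)
  thus "ereal (96 * A^2 * (2 * AP^2 * r)) < ediam U" using t(2) le_less_trans[of "ereal (96 * A^2 * (2 * AP^2 * r))" "ereal t"] by (simp add: w_def mult.assoc)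
 qed
 note crit = energy_criterion[OF g_L2 nu_fin(1) sets_nu cK(2) cK(1) r0 osc]
 show "g : F" "E g g <= cW cK * cH * measure nu UNIV" "open S ==> e > 0 ==> gm g S <= cW cK * cH * measure nu (UN x:S. ball x e)"
  by (rule crit(1), assumption+, rule crit(2), assumption+, rule crit(3))
qed

lemma nu_UNIV: "measure nu UNIV <= (1 + cB) * eu f U + cD * (inv_scale_diam Ps U * I2)"
proof -
 obtain t where "t > 0" "ereal t < ediam U" using ediam_pos by blast
 hence i: "0 <= inv_scale_diam Ps U" using Psi_pos by (cases "ediam U") (auto simp: inv_scale_diam_def less_imp_le)
 have "12 * A / kp >= 1" using cst(1,4,7) by (simp add: field_simps)
 hence "cD >= 0" unfolding cD_def[OF f_hyps] using DD(1)[of "48 * A / kp + 1"] DD(1)[of "15 * A / kp"] cE PK(1)[of "12 * A / kp"] by (intro mult_nonneg_nonneg) auto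
 hence nn: "0 <= cB * eu f U + cD * (inv_scale_diam Ps U * I2)" using cG(2)[OF f_hyps] eun i I2(2) by (intro add_nonneg_nonneg mult_nonneg_nonneg) auto
 have "ennreal (measure nu UNIV) = LE U f U + LE V g V" by (simp add: nu_fin(2)[symmetric] emeasure_nu)
 also have "... <= ennreal (eu f U) + ennreal (cB * eu f U + cD * (inv_scale_diam Ps U * I2))"
  unfolding LEu by (rule add_left_mono[OF V_energy[OF f_hyps I2]])
 also have "... = ennreal ((1 + cB) * eu f U + cD * (inv_scale_diam Ps U * I2))" using nn eun by (subst ennreal_plus[symmetric]) (auto simp: algebra_simps)
 finally have "ennreal (measure nu UNIV) <= ennreal ((1 + cB) * eu f U + cD * (inv_scale_diam Ps U * I2))" .
 moreover have "0 <= (1 + cB) * eu f U + cD * (inv_scale_diam Ps U * I2)" using nn eun[of U] by (simp add: algebra_simps)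
 ultimately show ?thesis by (simp only: ennreal_le_iff)
qed

lemma gm_U: "S : sets borel ==> S <= U ==> gm g S = eu f S"
 using LE_loc_F[OF U_facts(1) fU EQ_F(1) U_facts(1) order_refl, of 0 S] eun[of S] by (simp add: LEu gU)
lemma gm_V: "S : sets borel ==> S <= V ==> ennreal (gm g S) = LE V g S"
 using LE_F[OF V_open EQ_F(1)] by simp

text \<open>The local bound of the criterion, applied to shrinking neighbourhoods of the frontier,
  passes to the limit because \<open>nu\<close> is finite and the frontier is closed.\<close>

lemma frontier_energy: "gm g (frontier U) = 0"
proof -
 define O' where "O' e = (UN x:frontier U. ball x e)" for e
 have Ob: "open (O' e)" for e by (auto simp: O'_def)
 define c where "c = cW cK * cH"
 have c: "c >= 0" using cW cK by (simp add: c_def)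
 have "gm g (frontier U) <= c * measure nu (O' (1 / real (Suc n)))" for n
 proof -
  define k where "k = 1 / real (Suc n)"
  define e where "e = k / 2"
  have e: "e > 0" by (simp add: e_def k_def)
  have e2: "2 * e = k" by (simp add: e_def)
  have "frontier U <= O' e" using e by (auto simp: O'_def)
  hence "gm g (frontier U) <= gm g (O' e)" using Ob by (intro gm_mono[OF EQ_F(1)]) auto
  also have "... <= c * measure nu (UN x:O' e. ball x e)" unfolding c_def by (rule EQ_F(3)[OF Ob e])
  also have "... <= c * measure nu (O' (2 * e))"
  proof (intro mult_left_mono c nu_mono)
   show "(UN x:O' e. ball x e) <= O' (2 * e)"
   proof
    fix y assume "y : (UN x:O' e. ball x e)"
    then obtain x z where "z : frontier U" "dist z x < e" "dist x y < e" by (auto simp: O'_def)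
    thus "y : O' (2 * e)" using dist_triangle[of z y x] by (auto simp: O'_def intro!: bexI[of _ z])
   qed
  qed (use Ob in auto)
  finally show ?thesis unfolding e2 k_def .
 qed
 moreover have "(%n. c * measure nu (O' (1 / real (Suc n)))) ~~> c * measure nu (\<Inter>n. O' (1 / real (Suc n)))"
 proof (intro tendsto_mult tendsto_const finite_measure.finite_Lim_measure_decseq[OF nu_fin(1)])
  show "decseq (%n. O' (1 / real (Suc n)))" unfolding O'_def by (intro decseq_SucI UN_mono subset_ball) (auto simp: frac_le)
 qed (use Ob in auto)
 moreover have "(\<Inter>n. O' (1 / real (Suc n))) = frontier U"
 proof
  show "(\<Inter>n. O' (1 / real (Suc n))) <= frontier U"
  proof
   fix y assume y: "y : (\<Inter>n. O' (1 / real (Suc n)))"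
   have "EX x:frontier U. dist x y < e" if "e > 0" for e
   proof -
    obtain n where n: "1 / real (Suc n) < e" using nat_approx_posE[OF \<open>e > 0\<close>] by blast
    have "y : O' (1 / real (Suc n))" using y by blast
    thus ?thesis using n by (auto simp: O'_def intro: less_trans)
   qed
   hence "y : closure (frontier U)" unfolding closure_approachable by blast
   thus "y : frontier U" unfolding closure_closed[OF frontier_closed[of U]] .
  qed
 qed (auto simp: O'_def)
 moreover have "measure nu (frontier U) = 0"
 proof -
  have "frontier U Int U = {}" "frontier U Int V = {}" using U_facts(1) by (auto simp: frontier_def V_eq interior_open)
  hence "emeasure nu (frontier U) = 0" by (simp add: emeasure_nu frontier_closed)
  thus ?thesis by (simp add: measure_def)
 qed
 ultimately have "gm g (frontier U) <= 0" by (intro LIMSEQ_le_const) auto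
 thus ?thesis by (simp add: order_antisym)
qed

text \<open>A ball around a point of the closure either lies in U, or meets both U and its
  complement and then lies in a ball centred on the frontier. Its energy is that of the U part,
  which is exact, plus that of the V part, bounded by \<open>V_energy_local\<close>; the frontier
  adds nothing.\<close>

lemma boundary_energy:
 assumes x: "x : closure U" and r: "r > 0" "ereal (32 * A * AP * r) < ediam U"
 shows "gm g (ball x r) <= (1 + cB) * eu f (U Int ball x (cK * r))"
proof -
 have PP: "AP * r <= AP^2 * r" "AP^2 * r <= A^4 * AP^2 * r" "AP * r > 0" "r <= AP * r" "A^4 * (AP * r) <= A^4 * (AP^2 * r)" "AP * r <= A^4 * (AP * r)"
 proof -
  have *: "t <= A^4 * t" if "t >= 0" for t using mult_right_mono[OF cK(3) that] by simp
  show 1: "AP * r <= AP^2 * r" using cK(5) r(1) by (intro mult_right_mono) auto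
  show "AP * r > 0" "r <= AP * r" using cst(2) r(1) by auto
  thus "AP^2 * r <= A^4 * AP^2 * r" "AP * r <= A^4 * (AP * r)" using *[of "AP^2 * r"] *[of "AP * r"] r(1) by (auto simp: mult.assoc)
  show "A^4 * (AP * r) <= A^4 * (AP^2 * r)" using 1 by (intro mult_left_mono) auto
 qed
 have rK: "r <= cK * r" using mult_right_mono[OF cK(1), of r] r(1) by simp
 have cB: "cB >= 0" by (rule cG(2)[OF f_hyps])
 define S where "S = U Int ball x (cK * r)"
 have S: "S : sets borel" "S <= U" using U_facts(1) by (auto simp: S_def)
 have SB: "eu f S <= (1 + cB) * eu f S" using cB eun[of S] by (simp add: distrib_right)
 show ?thesis
 proof (cases "ball x r <= U")
  case True
  have "eu f (ball x r) <= eu f S" using True rK by (intro eum S) (auto simp: S_def intro: less_le_trans)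
  thus ?thesis using SB gm_U[OF _ True] by (simp add: S_def)
 next
  case False
  then obtain v where v: "v : ball x r" "v ~: U" by blast
  obtain u where u: "u : U" "dist u x < r" using x r(1) closure_approachable[of x U] by blast
  have u': "u : ball x r" using u(2) by (simp add: dist_commute)
  obtain \<xi> where \<xi>: "\<xi> : frontier U" "ball x r <= ball \<xi> (2 * AP * r)" "dist x \<xi> < AP * r"
   by (rule hits_frontier[OF r(1) u' u(1) v])
  have sub: "ball \<xi> (600 * A^4 * (2 * AP * r)) <= ball x (cK * r)"
  proof
   fix y assume "y : ball \<xi> (600 * A^4 * (2 * AP * r))"
   hence "dist \<xi> y < 1200 * (A^4 * (AP * r))" by (simp add: mult_ac)
   thus "y : ball x (cK * r)" using \<xi>(3) PP dist_triangle[of x y \<xi>] unfolding mem_ball cK_def mult.assoc by linarith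
  qed
  have eS: "eu f (U Int ball \<xi> (600 * A^4 * (2 * AP * r))) <= eu f S" using sub by (intro eum S) (auto simp: S_def)
  have "ereal (16 * A * (2 * AP * r)) < ediam U" using r(2) by (rule subst[rotated, where P = "%t. ereal t < ediam U"]) simp
  from V_energy_local[OF f_hyps \<xi>(1) this]
  have "ennreal (gm g (V Int ball \<xi> (2 * AP * r))) <= ennreal (cB * eu f (U Int ball \<xi> (600 * A^4 * (2 * AP * r))))"
   using V_open by (subst gm_V) auto
  hence v1: "gm g (V Int ball \<xi> (2 * AP * r)) <= cB * eu f S"
   using cB eun mult_left_mono[OF eS cB] by (simp add: ennreal_le_iff)
  have v2: "gm g (V Int ball x r) <= gm g (V Int ball \<xi> (2 * AP * r))" using \<xi>(2) V_open by (intro gm_mono[OF EQ_F(1)]) auto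
  have "gm g (U Int ball x r) = eu f (U Int ball x r)" using U_facts(1) by (intro gm_U) auto
  also have "... <= eu f S" using rK by (intro eum S) (auto simp: S_def intro: less_le_trans)
  finally have u1: "gm g (U Int ball x r) <= eu f S" .
  have sG: "sets (G g) = sets borel" by (rule sets_G[OF EQ_F(1)])
  have "gm g (ball x r) <= gm g ((U Int ball x r) Un ((V Int ball x r) Un frontier U))"
   by (rule gm_mono[OF EQ_F(1)]) (use U_facts(1) V_open in "auto simp: frontier_def V_eq interior_open frontier_closed")
  also have "... <= gm g (U Int ball x r) + gm g ((V Int ball x r) Un frontier U)"
   by (rule measure_Un_le) (use U_facts(1) V_open in "auto simp: sG frontier_closed")
  also have "... <= gm g (U Int ball x r) + (gm g (V Int ball x r) + gm g (frontier U))"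
   by (intro add_left_mono measure_Un_le) (use U_facts(1) V_open in "auto simp: sG frontier_closed")
  finally show ?thesis using u1 v1 v2 frontier_energy by (simp add: S_def distrib_right)
 qed
qed

end

text \<open>Members of the local domain are Borel on U only. Setting the function to 0 off U gives a
  Borel function on the whole space without changing averages over subsets of U, local energies or
  the extension.\<close>

lemma F_refl_repr:
 assumes f: "f : F_refl m E F U"
 obtains h where "h : FL U" "h : borel_measurable borel" "LE U h U < \<infinity>" "(sqi U h) < \<infinity>"
  "xt f = xt h" "!!S. S : sets borel ==> S <= U ==> LE U f S = LE U h S"
  "sqi U f = (sqi U h)"
proof -
 define h where "h x = f x * indicator U x" for x
 have hU: "h x = f x" if "x : U" for x using that by (simp add: h_def)
 have fL: "f : FL U" and fin: "(sqi U f) + LE U f U < \<infinity>" using f by (auto simp: F_refl_def)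
 have "f : borel_measurable (restrict_space borel U)" using fL by (simp add: F_loc_def)
 hence hm: "h : borel_measurable borel" unfolding h_def using U_facts(1) by (simp add: borel_measurable_restrict_space_iff mult.commute)
 have hL: "h : FL U" unfolding F_loc_def
 proof (safe)
  show "h : borel_measurable (restrict_space borel U)" by (rule measurable_restrict_space1[OF hm])
  fix O' assume O': "open O'" "rel_compact_in U O'"
  then obtain f' where f': "f' : F" "AE x in m. x : O' --> f x = f' x" using fL unfolding F_loc_def by blast
  have "O' <= U" using O'(2) closure_subset[of O'] by (auto simp: rel_compact_in_def)
  hence "AE x in m. x : O' --> h x = f' x" by (intro AE_mp[OF f'(2) AE_I2]) (auto simp: hU subset_iff)
  thus "EX f':F. AE x in m. x : O' --> h x = f' x" using f'(1) by blast
 qed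
 have LE: "LE U f S = LE U h S" if "S : sets borel" "S <= U" for S
  by (rule LE_loc[OF U_facts(1) fL U_facts(1) hL U_facts(1) order_refl order_refl _ that, of 0]) (simp add: hU)
 have i: "sqi U f = (sqi U h)" by (intro nn_integral_cong) (auto simp: indicator_def hU)
 have "set_average m (rball U 3 B) f = set_average m (rball U 3 B) h" for B
  unfolding set_average_def set_lebesgue_integral_def by (intro arg_cong2[of _ _ _ _ "(/)"] Bochner_Integration.integral_cong refl) (auto simp: rball_def hU indicator_def)
 hence "xt f = xt h" by (simp add: whitney_extension_def fun_eq_iff hU)
 moreover have "LE U f U < \<infinity>" "(sqi U f) < \<infinity>" using fin by (auto simp: ennreal_add_eq_top less_top)
 ultimately show ?thesis using that[OF hL hm] LE U_facts(1) i by simp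
qed

end

theorem proposition5p8:
  fixes m :: "'a::metric_space measure"
    and \<E> :: "('a \<Rightarrow> real) \<Rightarrow> ('a \<Rightarrow> real) \<Rightarrow> real"
    and \<F> :: "('a \<Rightarrow> real) set"
    and \<Psi> :: "real \<Rightarrow> real"
    and U V :: "'a set"
    and A A\<^sub>P \<epsilon> :: real
    and \<RR> \<SS> :: "('a \<times> real) set"
    and Q :: "'a \<times> real \<Rightarrow> 'a \<times> real"
    and \<psi> :: "'a \<times> real \<Rightarrow> 'a \<Rightarrow> real"
    and EQ :: "('a \<Rightarrow> real) \<Rightarrow> 'a \<Rightarrow> real"
  assumes MMD: "MMD_space m \<E> \<F>"
    and scale: "scale_function \<Psi>"
    and HKE: "HKE m \<E> \<F> \<Psi>"
    and doubling: "doubling_measure m"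
    and U: "uniform_domain A U"
    and V: "V = interior (- U)"
    and PI: "\<exists>C\<^sub>P. poincare m \<E> \<F> \<Psi> C\<^sub>P A\<^sub>P"
    and eps: "\<epsilon> > 0" "27 * A\<^sub>P * \<epsilon> < 1"
    and RR: "whitney_cover \<epsilon> U \<RR>"
    and SS: "whitney_cover \<epsilon> V \<SS>"
    and Q: "whitney_reflection \<epsilon> A U \<RR> \<SS> Q"
    and psi: "whitney_partition m \<E> \<F> \<Psi> V \<SS> \<psi>"
    and EQ: "EQ = whitney_extension m \<epsilon> A U \<SS> Q \<psi>"
  shows
    "(\<exists>c0 K0 C1. 0 < c0 \<and> c0 < 1 \<and> 1 < K0 \<and> 1 < C1 \<and>
        (\<forall>\<xi>\<in>frontier U. \<forall>r>0. ereal r < ereal c0 * ediam U \<longrightarrow>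
          (\<forall>f\<in>F_refl m \<E> \<F> U.
             (INF \<alpha>::real. \<integral>\<^sup>+x\<in>ball \<xi> r. ennreal (\<bar>EQ f x - \<alpha>\<bar>\<^sup>2) \<partial>m)
               \<le> ennreal (C1 * \<Psi> r) *
                  emeasure (local_energy_measure m \<E> \<F> U f) (ball \<xi> (K0 * r) \<inter> U))))
     \<and>
     (\<forall>f\<in>L2_on m U. EQ f \<in> F_loc m \<F> V)
     \<and>
     (\<exists>c1 C1 C2 K1. 0 < c1 \<and> c1 < 1 \<and> 1 < C1 \<and> 1 < C2 \<and> 1 < K1 \<and>
        (\<forall>f\<in>F_refl m \<E> \<F> U.
          (\<forall>\<xi>\<in>frontier U. \<forall>r>0. ereal r < ereal c1 * ediam U \<longrightarrow>
             emeasure (local_energy_measure m \<E> \<F> V (EQ f)) (V \<inter> ball \<xi> r)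
               \<le> ennreal C1 * emeasure (local_energy_measure m \<E> \<F> U f) (U \<inter> ball \<xi> (K1 * r))) \<and>
          emeasure (local_energy_measure m \<E> \<F> V (EQ f)) V
            \<le> ennreal C2 * (E_refl m \<E> \<F> U f +
                 ennreal (inv_scale_diam \<Psi> U) * (\<integral>\<^sup>+x\<in>U. ennreal ((f x)\<^sup>2) \<partial>m))))
     \<and>
     (\<exists>C3>1. \<forall>f\<in>F_refl m \<E> \<F> U.
        EQ f \<in> \<F> \<and>
        ennreal (\<E> (EQ f) (EQ f))
          \<le> ennreal C3 * (E_refl m \<E> \<F> U f +
               ennreal (inv_scale_diam \<Psi> U) * (\<integral>\<^sup>+x\<in>U. ennreal ((f x)\<^sup>2) \<partial>m)))
     \<and>
     (\<forall>f\<in>F_refl m \<E> \<F> U. emeasure (energy_measure m \<E> \<F> (EQ f)) (frontier U) = 0)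
     \<and>
     (\<exists>C4 K2 c2. 1 < C4 \<and> 1 < K2 \<and> 0 < c2 \<and> c2 < 1 \<and>
        (\<forall>f\<in>F_refl m \<E> \<F> U. \<forall>x\<in>closure U. \<forall>r>0. ereal r < ereal c2 * ediam U \<longrightarrow>
           emeasure (energy_measure m \<E> \<F> (EQ f)) (ball x r)
             \<le> ennreal C4 * emeasure (local_energy_measure m \<E> \<F> U f) (U \<inter> ball x (K2 * r))))"
proof -
 obtain CP where P: "poincare m \<E> \<F> \<Psi> CP A\<^sub>P" using PI by blast
 interpret ext m \<E> \<F> \<Psi> U V A A\<^sub>P CP \<epsilon> \<RR> \<SS> Q \<psi>
  by unfold_locales (use assms P in "auto simp: MMD_space_def dirichlet_form_def")
 have A: "A >= 1" and AP: "A\<^sub>P >= 1" by (rule cst)+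
 have A2: "1 <= A^2" "1 <= A^4" using A one_le_power[of A 2] one_le_power[of A 4] by auto
 have big: "1 < 96 * A^2" "1 < 600 * A^4" "1 < 16 * A" using A A2 by linarith+
 have i: "0 < 1 / t" "1 / t < 1" if "1 < t" for t :: real using that by simp_all
 have AA: "1 <= A * A\<^sub>P" using mult_mono[of 1 A 1 "A\<^sub>P"] A AP by simp
 have en: "ennreal a * LE U f S = ennreal (a * eu h S)" if h: "h : FL U" "h : borel_measurable borel" "LE U h U < \<infinity>"
  and "LE U f S = LE U h S" "0 <= a" for a f h S
  using that(4,5) LE_eu[OF h, of S] eu_nonneg[OF h, of S] by (simp add: ennreal_mult)
 have ball: "U \<inter> ball \<xi> r : sets borel" "U \<inter> ball \<xi> r <= U" for \<xi> r using U_facts(1) by auto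
 \<comment> \<open>Turns a real bound in terms of the globally Borel representative h into the
   extended nonnegative one in terms of f, with one constant for both summands; the factor for
   infinite diameter is 0.\<close>
 have tot: "ennreal t <= ennreal c * (E_refl m \<E> \<F> U f + ennreal (inv_scale_diam \<Psi> U) * (\<integral>\<^sup>+x\<in>U. ennreal ((f x)\<^sup>2) \<partial>m))"
  if h: "h : FL U" "h : borel_measurable borel" "LE U h U < \<infinity>" "(\<integral>\<^sup>+x\<in>U. ennreal ((h x)^2) \<partial>m) < \<infinity>"
   and f: "!!S. S : sets borel ==> S <= U ==> LE U f S = LE U h S" "(\<integral>\<^sup>+x\<in>U. ennreal ((f x)^2) \<partial>m) = (\<integral>\<^sup>+x\<in>U. ennreal ((h x)^2) \<partial>m)"
   and t: "t <= a * eu h U + b * (inv_scale_diam \<Psi> U * I2 h)" and c: "a <= c" "b <= c" "0 <= c" for t a b c f h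
 proof -
  obtain s where "s > 0" "ereal s < ediam U" using ediam_pos by blast
  hence i: "0 <= inv_scale_diam \<Psi> U" using Psi_pos by (cases "ediam U") (auto simp: inv_scale_diam_def less_imp_le)
  note I = I2[OF h] and e = eu_nonneg[OF h(1-3), of U]
  have "t <= c * (eu h U + inv_scale_diam \<Psi> U * I2 h)"
   using t mult_right_mono[OF c(1) e] mult_right_mono[OF c(2) mult_nonneg_nonneg[OF i I(2)]] by (simp add: distrib_left)
  hence "ennreal t <= ennreal (c * (eu h U + inv_scale_diam \<Psi> U * I2 h))" by (rule ennreal_leI)
  also have "... = ennreal c * (ennreal (eu h U) + ennreal (inv_scale_diam \<Psi> U) * ennreal (I2 h))"
   using c i I(2) e by (simp add: ennreal_mult ennreal_plus)
  finally show ?thesis using f U_facts(1) I(1) LE_eu[OF h(1-3), of U] by (simp add: E_refl_def)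
 qed
 define k where "k = cW cK * cH"
 show ?thesis
 proof (intro conjI, goal_cases)
  case 1
  show ?case
 proof (rule exI[of _ "1 / (96 * A^2)"], rule exI[of _ "600 * A^4"], rule exI[of _ "cA + 2"], intro conjI ballI allI impI)
  show "0 < 1 / (96 * A^2)" "1 / (96 * A^2) < 1" "1 < 600 * A^4" "1 < cA + 2" by (rule i(1)[OF big(1)], rule i(2)[OF big(1)], rule big(2)) (use cA in simp)
  fix \<xi> r f assume \<xi>: "\<xi> : frontier U" and r: "0 < r" "ereal r < ereal (1 / (96 * A^2)) * ediam U" and f: "f : F_refl m \<E> \<F> U"
  obtain h where h: "h : FL U" "h : borel_measurable borel" "LE U h U < \<infinity>" "(\<integral>\<^sup>+x\<in>U. ennreal ((h x)^2) \<partial>m) < \<infinity>"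
   and fh: "xt f = xt h" "!!S. S : sets borel ==> S <= U ==> LE U f S = LE U h S"
   by (rule F_refl_repr[OF f]) (rule that, assumption+)
  have "ereal (96 * A^2 * r) < ediam U" by (rule scale_diam[OF r(2)]) (use A2 in auto)
  from frontier_osc[OF h \<xi> r(1) this] obtain \<alpha> where
   "(\<integral>\<^sup>+x\<in>ball \<xi> r. ennreal ((xt h x - \<alpha>)^2) \<partial>m) <= ennreal (cA * \<Psi> r * eu h (U \<inter> ball \<xi> (600 * A^4 * r)))" by blast
  note this
  also have "ennreal (cA * \<Psi> r * eu h (U \<inter> ball \<xi> (600 * A^4 * r))) <= ennreal ((cA + 2) * \<Psi> r * eu h (U \<inter> ball \<xi> (600 * A^4 * r)))"
   using Psi_pos[OF r(1)] eu_nonneg[OF h(1-3)] by (intro ennreal_leI mult_right_mono) auto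
  finally have "(\<integral>\<^sup>+x\<in>ball \<xi> r. ennreal (\<bar>EQ f x - \<alpha>\<bar>^2) \<partial>m) <= ennreal ((cA + 2) * \<Psi> r) * LE U f (U \<inter> ball \<xi> (600 * A^4 * r))"
   unfolding EQ fh(1) power2_abs using Psi_pos[OF r(1)] cA by (subst en[OF h(1-3) fh(2)[OF ball]]) auto
  thus "(INF \<alpha>::real. \<integral>\<^sup>+x\<in>ball \<xi> r. ennreal (\<bar>EQ f x - \<alpha>\<bar>\<^sup>2) \<partial>m)
   \<le> ennreal ((cA + 2) * \<Psi> r) * emeasure (local_energy_measure m \<E> \<F> U f) (ball \<xi> (600 * A^4 * r) \<inter> U)"
   unfolding Int_commute[of _ U] by (rule INF_lower2[OF UNIV_I])
 qed
 next
  case 2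
  show ?case using EQ_FL(1) by (simp add: EQ L2_on_def)
 next
  case 3
  show ?case
 \<comment> \<open>The constants do not involve f, but their signs are established for data of
   finite energy only; absolute values with 2 added exceed 1 before any f is fixed.\<close>
 proof (rule exI[of _ "1 / (16 * A)"], rule exI[of _ "\<bar>cB\<bar> + 2"], rule exI[of _ "\<bar>cB\<bar> + \<bar>cD\<bar> + 2"], rule exI[of _ "600 * A^4"], intro conjI ballI allI impI)
  show "0 < 1 / (16 * A)" "1 / (16 * A) < 1" "1 < 600 * A^4" "1 < \<bar>cB\<bar> + 2" "1 < \<bar>cB\<bar> + \<bar>cD\<bar> + 2" by (rule i(1)[OF big(3)], rule i(2)[OF big(3)], rule big(2)) simp_all
  fix f assume f: "f : F_refl m \<E> \<F> U"
  obtain h where h: "h : FL U" "h : borel_measurable borel" "LE U h U < \<infinity>" "(\<integral>\<^sup>+x\<in>U. ennreal ((h x)^2) \<partial>m) < \<infinity>"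
   and fh: "xt f = xt h" "!!S. S : sets borel ==> S <= U ==> LE U f S = LE U h S" "(\<integral>\<^sup>+x\<in>U. ennreal ((f x)^2) \<partial>m) = (\<integral>\<^sup>+x\<in>U. ennreal ((h x)^2) \<partial>m)"
   by (rule F_refl_repr[OF f]) (rule that, assumption+)
  show "LE V (EQ f) V \<le> ennreal (\<bar>cB\<bar> + \<bar>cD\<bar> + 2) * (E_refl m \<E> \<F> U f + ennreal (inv_scale_diam \<Psi> U) * (\<integral>\<^sup>+x\<in>U. ennreal ((f x)\<^sup>2) \<partial>m))"
   unfolding EQ fh(1) by (rule order_trans[OF V_energy[OF h(1-3) I2[OF h]] tot[OF h fh(2,3) order_refl]]) auto
  fix \<xi> r assume \<xi>: "\<xi> : frontier U" and r: "0 < r" "ereal r < ereal (1 / (16 * A)) * ediam U"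
  have "ereal (16 * A * r) < ediam U" by (rule scale_diam[OF r(2)]) (use A in auto)
  from V_energy_local[OF h(1-3) \<xi> this]
  have "LE V (EQ f) (V \<inter> ball \<xi> r) <= ennreal (cB * eu h (U \<inter> ball \<xi> (600 * A^4 * r)))" by (simp only: EQ fh(1))
  also have "... <= ennreal ((\<bar>cB\<bar> + 2) * eu h (U \<inter> ball \<xi> (600 * A^4 * r)))" using eu_nonneg[OF h(1-3)] by (intro ennreal_leI mult_right_mono) auto
  also have "... = ennreal (\<bar>cB\<bar> + 2) * LE U f (U \<inter> ball \<xi> (600 * A^4 * r))" by (rule en[OF h(1-3) fh(2)[OF ball], symmetric]) simp
  finally show "LE V (EQ f) (V \<inter> ball \<xi> r) <= ennreal (\<bar>cB\<bar> + 2) * LE U f (U \<inter> ball \<xi> (600 * A^4 * r))" .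
 qed
 next
  case 4
  show ?case
 proof (rule exI[of _ "\<bar>k * (1 + cB)\<bar> + \<bar>k * cD\<bar> + 2"], intro conjI ballI)
  fix f assume f: "f : F_refl m \<E> \<F> U"
  obtain h where h: "h : FL U" "h : borel_measurable borel" "LE U h U < \<infinity>" "(\<integral>\<^sup>+x\<in>U. ennreal ((h x)^2) \<partial>m) < \<infinity>"
   and fh: "xt f = xt h" "!!S. S : sets borel ==> S <= U ==> LE U f S = LE U h S" "(\<integral>\<^sup>+x\<in>U. ennreal ((f x)^2) \<partial>m) = (\<integral>\<^sup>+x\<in>U. ennreal ((h x)^2) \<partial>m)"
   by (rule F_refl_repr[OF f]) (rule that, assumption+)
  show "EQ f : \<F>" unfolding EQ fh(1) by (rule EQ_F(1)[OF h])
  have k: "0 <= k" using cW cK(2)[OF h] by (simp add: k_def)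
  have "\<E> (xt h) (xt h) <= k * measure (nu h) UNIV" unfolding k_def by (rule EQ_F(2)[OF h])
  also have "... <= k * ((1 + cB) * eu h U + cD * (inv_scale_diam \<Psi> U * I2 h))" by (intro mult_left_mono nu_UNIV[OF h] k)
  finally have "\<E> (xt h) (xt h) <= k * (1 + cB) * eu h U + k * cD * (inv_scale_diam \<Psi> U * I2 h)" unfolding distrib_left[of k "(1 + cB) * eu h U"] mult.assoc .
  from tot[OF h fh(2,3) this, of "\<bar>k * (1 + cB)\<bar> + \<bar>k * cD\<bar> + 2"] show "ennreal (\<E> (EQ f) (EQ f)) \<le> ennreal (\<bar>k * (1 + cB)\<bar> + \<bar>k * cD\<bar> + 2) * (E_refl m \<E> \<F> U f + ennreal (inv_scale_diam \<Psi> U) * (\<integral>\<^sup>+x\<in>U. ennreal ((f x)\<^sup>2) \<partial>m))"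
   unfolding EQ fh(1) by simp
 qed auto
 next
  case 5
  show ?case
 proof
  fix f assume f: "f : F_refl m \<E> \<F> U"
  obtain h where h: "h : FL U" "h : borel_measurable borel" "LE U h U < \<infinity>" "(\<integral>\<^sup>+x\<in>U. ennreal ((h x)^2) \<partial>m) < \<infinity>" and fh: "xt f = xt h"
   by (rule F_refl_repr[OF f]) (rule that, assumption+)
  show "emeasure (energy_measure m \<E> \<F> (EQ f)) (frontier U) = 0"
   by (simp add: EQ fh energy_measure_G[OF EQ_F(1)[OF h]] emeasure_G[OF EQ_F(1)[OF h]] frontier_energy[OF h])
 qed
 next
  case 6
  show ?case
 proof (rule exI[of _ "\<bar>1 + cB\<bar> + 2"], rule exI[of _ "1300 * A^4 * A\<^sub>P^2"], rule exI[of _ "1 / (32 * A * A\<^sub>P)"], intro conjI ballI allI impI)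
  have "1 <= A^4 * A\<^sub>P^2" using mult_mono[of 1 "A^4" 1 "A\<^sub>P^2"] A2 one_le_power[OF AP, of 2] by simp
  thus "1 < 1300 * A^4 * A\<^sub>P^2" "1 < \<bar>1 + cB\<bar> + 2" "0 < 1 / (32 * A * A\<^sub>P)" "1 / (32 * A * A\<^sub>P) < 1" using A AP AA by (auto simp: field_simps)
  fix f x r assume f: "f : F_refl m \<E> \<F> U" and x: "x : closure U" and r: "0 < r" "ereal r < ereal (1 / (32 * A * A\<^sub>P)) * ediam U"
  obtain h where h: "h : FL U" "h : borel_measurable borel" "LE U h U < \<infinity>" "(\<integral>\<^sup>+x\<in>U. ennreal ((h x)^2) \<partial>m) < \<infinity>"
   and fh: "xt f = xt h" "!!S. S : sets borel ==> S <= U ==> LE U f S = LE U h S"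
   by (rule F_refl_repr[OF f]) (rule that, assumption+)
  have "ereal (32 * A * A\<^sub>P * r) < ediam U" by (rule scale_diam[OF r(2)]) (use A AP in auto)
  from boundary_energy[OF h x r(1) this]
  have "gm (xt h) (ball x r) <= (1 + cB) * eu h (U \<inter> ball x (1300 * A^4 * A\<^sub>P^2 * r))" by (simp only: cK_def[OF h])
  also have "... <= (\<bar>1 + cB\<bar> + 2) * eu h (U \<inter> ball x (1300 * A^4 * A\<^sub>P^2 * r))" using eu_nonneg[OF h(1-3)] by (intro mult_right_mono) auto
  finally have "emeasure (energy_measure m \<E> \<F> (EQ f)) (ball x r) <= ennreal ((\<bar>1 + cB\<bar> + 2) * eu h (U \<inter> ball x (1300 * A^4 * A\<^sub>P^2 * r)))"
   unfolding EQ fh(1) energy_measure_G[OF EQ_F(1)[OF h]] emeasure_G[OF EQ_F(1)[OF h]] by (rule ennreal_leI)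
  also have "... = ennreal (\<bar>1 + cB\<bar> + 2) * LE U f (U \<inter> ball x (1300 * A^4 * A\<^sub>P^2 * r))" by (rule en[OF h(1-3) fh(2)[OF ball], symmetric]) simp
  finally show "emeasure (energy_measure m \<E> \<F> (EQ f)) (ball x r) <= ennreal (\<bar>1 + cB\<bar> + 2) * LE U f (U \<inter> ball x (1300 * A^4 * A\<^sub>P^2 * r))" .
 qed
 qed
qed

end
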